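(* Let $n\ge 1$ and let $K$ be a triangulation of the sphere $S^{2n}$, with dual cell complex $K^*$. Let $K^{(n)}$ denote the $n$-skeleton of $K$ and $K^{*(n)}$ the $n$-skeleton of $K^*$. Then $$T_{K^{(n)}}(X,Y)=T_{K^{*(n)}}(Y,X),$$ where both polynomials are taken with respect to the dimension $n$.
   Context: All homology groups have real coefficients, and $|H_i(L)|$ denotes $\dim_{\mathbb R} H_i(L;\mathbb R)$. For a finite CW (or simplicial) complex $K$ of dimension $\ge n$, a spanning $n$-subcomplex of $K$ is an $n$-dimensional subcomplex $L$ of $K$ whose $(n-1)$-skeleton equals that of $K$, i.e. $L^{(n-1)}=K^{(n-1)}$ (so $L$ is determined by a subset of the $n$-cells of $K$). Define $$T_K(X,Y)=\sum_{L} X^{|H_{n-1}(L)|-|H_{n-1}(K)|}\,Y^{|H_n(L)|},$$ the sum over all spanning $n$-subcomplexes $L$ of $K$. Dual complex: if $K$ triangulates a closed $m$-manifold, for each $k$-simplex $\sigma$ of $K$ its dual cell $D\sigma$ is the $(m-k)$-cell formed by the union of all simplices of the barycentric subdivision of $K$ that contain the barycenter of $\sigma$ as a vertex and are transverse to $\sigma$; the collection of all $D\sigma$ forms a CW complex $K^*$ (the dual cell complex) whose $k$-cells correspond bijectively to the $(m-k)$-simplices of $K$. *)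

theory Defs
  imports "HOL-Analysis.Analysis" "HOL-Analysis.Finite_Function_Topology" "HOL-Homology.Homology"
begin

subsection \<open>Singular homology with real coefficients\<close>

text \<open>
  The library's singular chains have integer coefficients. The definitions below repeat
  its construction, on the same singular simplices and faces, over the reals.
\<close>

type_synonym 'a real_chain = "((nat \<Rightarrow> real) \<Rightarrow> 'a) \<Rightarrow>\<^sub>0 real"

definition real_chains :: "nat \<Rightarrow> 'a topology \<Rightarrow> 'a real_chain set" where
  "real_chains p X = {c. Poly_Mapping.keys c \<subseteq> singular_simplex_set p X}"

definition real_boundary :: "nat \<Rightarrow> 'a real_chain \<Rightarrow> 'a real_chain" where
  "real_boundary p c =
     (if p = 0 then 0
      else \<Sum>f\<in>Poly_Mapping.keys c. Poly_Mapping.lookup c f *\<^sub>R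
             (\<Sum>k\<le>p. Poly_Mapping.single (singular_face p k f) ((-1) ^ k)))"

definition real_cycles :: "nat \<Rightarrow> 'a topology \<Rightarrow> 'a real_chain set" where
  "real_cycles p X = {c \<in> real_chains p X. real_boundary p c = 0}"

definition real_boundaries :: "nat \<Rightarrow> 'a topology \<Rightarrow> 'a real_chain set" where
  "real_boundaries p X = real_boundary (Suc p) ` real_chains (Suc p) X"

text \<open>
  \<open>S\<close> is a finite set of representatives of a basis of the quotient space \<open>V / W\<close>
  of a subspace \<open>V\<close> by a subspace \<open>W \<subseteq> V\<close>.
\<close>

definition quotient_basis :: "'v::real_vector set \<Rightarrow> 'v set \<Rightarrow> 'v set \<Rightarrow> bool" where
  "quotient_basis V W S \<longleftrightarrow>
     finite S \<and> S \<subseteq> V \<and>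
     (\<forall>u. (\<Sum>s\<in>S. u s *\<^sub>R s) \<in> W \<longrightarrow> (\<forall>s\<in>S. u s = 0)) \<and>
     (\<forall>v\<in>V. \<exists>u. v - (\<Sum>s\<in>S. u s *\<^sub>R s) \<in> W)"

definition quotient_dim :: "'v::real_vector set \<Rightarrow> 'v set \<Rightarrow> nat" where
  "quotient_dim V W = (THE d. \<exists>S. quotient_basis V W S \<and> card S = d)"

definition betti :: "nat \<Rightarrow> 'a topology \<Rightarrow> nat" where
  "betti p X = quotient_dim (real_cycles p X) (real_boundaries p X)"


subsection \<open>Cell complexes, spanning subcomplexes and the polynomial\<close>

text \<open>
  A finite cell complex is given by its closed cells, each tagged with its dimension.
  In the complexes considered here the boundary of a closed cell is a union of cells, so
  that a set of cells is a subcomplex iff it contains all cells lying in one of its members.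
\<close>

type_synonym 'a cell_complex = "(nat \<times> 'a set) set"

definition space_of :: "'a::topological_space cell_complex \<Rightarrow> 'a topology" where
  "space_of C = top_of_set (\<Union>(k, e)\<in>C. e)"

definition skeleton :: "nat \<Rightarrow> 'a cell_complex \<Rightarrow> 'a cell_complex" where
  "skeleton n C = {(k, e) \<in> C. k \<le> n}"

definition subcomplex :: "'a cell_complex \<Rightarrow> 'a cell_complex \<Rightarrow> bool" where
  "subcomplex L C \<longleftrightarrow>
     L \<subseteq> C \<and> (\<forall>(k, e)\<in>L. \<forall>(j, f)\<in>C. f \<subseteq> e \<longrightarrow> (j, f) \<in> L)"

text \<open>
  Every subset of the \<open>n\<close>-cells is allowed, including the empty one. Used for \<open>n \<ge> 1\<close> only.
\<close>

definition spanning_subcomplex :: "nat \<Rightarrow> 'a cell_complex \<Rightarrow> 'a cell_complex \<Rightarrow> bool" where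
  "spanning_subcomplex n C L \<longleftrightarrow>
     subcomplex L C \<and> (\<forall>(k, e)\<in>L. k \<le> n) \<and> skeleton (n - 1) L = skeleton (n - 1) C"

text \<open>
  The polynomial is given through its values at two elements of an arbitrary commutative
  ring; the generic case is that of two indeterminates. The difference of Betti numbers in
  the exponent is never truncated: \<open>H\<^sub>n\<^sub>-\<^sub>1(L)\<close> maps onto \<open>H\<^sub>n\<^sub>-\<^sub>1(C)\<close>, because \<open>C\<close> arises from
  \<open>L\<close> by attaching cells of dimension at least \<open>n\<close>.
\<close>

definition T_poly :: "nat \<Rightarrow> 'a::topological_space cell_complex \<Rightarrow> 'r::comm_ring_1 \<Rightarrow> 'r \<Rightarrow> 'r" where
  "T_poly n C X Y =
     (\<Sum>L | spanning_subcomplex n C L.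
        X ^ (betti (n - 1) (space_of L) - betti (n - 1) (space_of C)) *
        Y ^ betti n (space_of L))"


subsection \<open>Simplicial complexes and their dual cell complexes\<close>

text \<open>
  A library \<^const>\<open>simplicial_complex\<close> also contains the empty simplex, of dimension \<open>-1\<close>,
  which is not a cell.
\<close>

definition simplicial_cells :: "'a::euclidean_space set set \<Rightarrow> 'a cell_complex" where
  "simplicial_cells K = {(k, \<sigma>). \<sigma> \<in> K \<and> int k simplex \<sigma>}"

definition barycenter :: "'a::euclidean_space set \<Rightarrow> 'a" where
  "barycenter \<sigma> = (let V = {v. v extreme_point_of \<sigma>} in (1 / real (card V)) *\<^sub>R \<Sum>V)"

definition barycentric_subdivision :: "'a::euclidean_space set set \<Rightarrow> 'a set set" where
  "barycentric_subdivision K =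
     {convex hull (barycenter ` F) | F.
        F \<subseteq> K - {{}} \<and> (\<forall>\<rho>\<in>F. \<forall>\<tau>\<in>F. \<rho> \<subseteq> \<tau> \<or> \<tau> \<subseteq> \<rho>)}"

text \<open>
  Transversality of \<open>\<tau>\<close> to \<open>\<sigma>\<close> means that they meet in the barycenter of \<open>\<sigma>\<close> only,
  i.e. that \<open>\<sigma>\<close> is the least element of the flag spanning \<open>\<tau>\<close>.
\<close>

definition dual_cell :: "'a::euclidean_space set set \<Rightarrow> 'a set \<Rightarrow> 'a set" where
  "dual_cell K \<sigma> =
     \<Union>{\<tau> \<in> barycentric_subdivision K.
          barycenter \<sigma> extreme_point_of \<tau> \<and> \<tau> \<inter> \<sigma> = {barycenter \<sigma>}}"

definition dual_complex :: "nat \<Rightarrow> 'a::euclidean_space set set \<Rightarrow> 'a cell_complex" where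
  "dual_complex m K =
     {(j, dual_cell K \<sigma>) | j k \<sigma>. \<sigma> \<in> K \<and> int k simplex \<sigma> \<and> j + k = m}"

definition triangulates :: "'a::euclidean_space set set \<Rightarrow> 'b topology \<Rightarrow> bool" where
  "triangulates K M \<longleftrightarrow> simplicial_complex K \<and> top_of_set (\<Union>K) homeomorphic_space M"

end

theory Submission
  imports Defs "HOL-Library.Function_Algebras"
begin

text \<open>
  Let \<open>L\<close> consist of all simplices of dimension less than \<open>n\<close> and a set \<open>E\<close> of \<open>n\<close>-simplices. The dual
  cells of the simplices outside \<open>L\<close> form a spanning \<open>n\<close>-subcomplex \<open>L*\<close> of the dual complex; its
  \<open>n\<close>-cells are dual to the \<open>n\<close>-simplices not in \<open>E\<close>. The polyhedron of \<open>L*\<close> is a deformation retract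
  of the complement of that of \<open>L\<close>, hence Alexander duality in the \<open>2n\<close>-sphere identifies the reduced
  homology of \<open>L\<close> in degrees \<open>n\<close> and \<open>n - 1\<close> with that of \<open>L*\<close> in degrees \<open>n - 1\<close> and \<open>n\<close>. So
  \<open>L \<mapsto> L*\<close> exchanges the two exponents; the normalisation by the homology of the \<open>n\<close>-skeleton only
  accounts for the difference between \<open>H\<^sub>0\<close> and reduced \<open>H\<^sub>0\<close>.

  Alexander duality is a perfect pairing between simplicial cycles of \<open>L\<close> and singular cycles of \<open>L*\<close>.
  It is given by functionals on singular chains, one for each simplex \<open>\<sigma>\<close>, that behave like intersection
  numbers with \<open>\<sigma>\<close>; they are chosen by induction on \<open>dim \<sigma>\<close>, starting from the fundamental cycle, which
  is possible because the complement of a simplex in a sphere is acyclic. That the pairing is perfect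
  follows by Mayer--Vietoris induction over subcomplexes, as acyclicity of a mapping cone.

  Integral singular homology is transferred to real coefficients by expanding the coefficients of a
  real chain in a basis of the rational vector space they span.
\<close>

subsection \<open>Quotients of real vector spaces\<close>

text \<open>A triangulation of a sphere need not be piecewise linear: links may fail to be spheres
  and dual cells may fail to be balls. Hence no cellular homology of the dual complex is used. Dual
  cells enter only as closed sets, and the topology of the dual side comes from the acyclicity of
  complements of simplices.

  Both sides are read off from barycentric coordinates. The support of a point decides which
  subcomplexes contain it, and the set of vertices with largest coordinate decides the same for dual
  subcomplexes; this symmetry makes the deformations explicit.

  Only equality of dimensions is required. A basis is chosen once, in simplicial homology, where
  everything is finite; every singular homology space is reached from it by a map or a pairing with
  known kernels. A cycle of the dual polyhedron is represented by a chain of the sphere that it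
  bounds, so the pairing is a linking number.\<close>

lemma exists_linear_with_kernel:
  fixes W :: "'v::real_vector set"
  assumes "subspace W"
  obtains \<pi> :: "'v \<Rightarrow> 'v" where "linear \<pi>" "\<And>v. \<pi> v = 0 \<longleftrightarrow> v \<in> W"
proof -
  obtain B where B: "B \<subseteq> W" "independent B" "W \<subseteq> span B"
    using maximal_independent_subset by blast
  have spB: "span B = W"
    using B assms by (simp add: span_subspace)
  obtain C where C: "B \<subseteq> C" "independent C" "UNIV \<subseteq> span C"
    using maximal_independent_subset_extend[of B UNIV] B by auto
  obtain \<pi> :: "'v \<Rightarrow> 'v" where \<pi>: "linear \<pi>" "\<And>x. x \<in> C \<Longrightarrow> \<pi> x = (if x \<in> B then 0 else x)"
    using linear_independent_extend[OF C(2), of "\<lambda>x. if x \<in> B then 0 else x"] by blast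
  have 0: "\<pi> x = 0" if "x \<in> span B" for x
    by (rule linear_eq_0_on_span[OF \<pi>(1) _ that]) (use \<pi>(2) C(1) in auto)
  have 1: "\<pi> y = y" if "y \<in> span (C - B)" for y
    using linear_eq_on_span[OF \<pi>(1) linear_id, of "C - B" y] \<pi>(2) that by auto
  show thesis
  proof
    show "linear \<pi>" by fact
    fix v
    have "v \<in> span (B \<union> (C - B))"
      using C by (simp add: Un_absorb1 subset_iff)
    then obtain x y where xy: "v = x + y" "x \<in> span B" "y \<in> span (C - B)"
      unfolding span_Un by auto
    have "\<pi> v = y" using xy 0 1 \<pi>(1) by (simp add: linear_add)
    then show "\<pi> v = 0 \<longleftrightarrow> v \<in> W"
      using xy spB 0 by (metis add.right_neutral)
  qed
qed

lemma functional_separating: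
  fixes W :: "'v::real_vector set"
  assumes "subspace W" "x \<notin> W"
  obtains \<mu> :: "'v \<Rightarrow> real" where "linear \<mu>" "\<And>w. w \<in> W \<Longrightarrow> \<mu> w = 0" "\<mu> x = 1"
proof -
  obtain \<pi> :: "'v \<Rightarrow> 'v" where \<pi>: "linear \<pi>" "\<And>v. \<pi> v = 0 \<longleftrightarrow> v \<in> W"
    using exists_linear_with_kernel[OF assms(1)] by blast
  have "independent {\<pi> x}" using \<pi> assms(2) by simp
  then obtain f :: "'v \<Rightarrow> real" where f: "linear f" "f (\<pi> x) = 1"
    using linear_independent_extend[of "{\<pi> x}" "\<lambda>_. 1::real"] by auto
  show thesis
  proof (rule that)
    show "linear (f \<circ> \<pi>)" by (rule linear_compose) fact+
    show "(f \<circ> \<pi>) w = 0" if "w \<in> W" for w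
      using \<pi>(2)[of w] that \<open>linear f\<close> by (simp add: linear_0)
    show "(f \<circ> \<pi>) x = 1" using \<open>f (\<pi> x) = 1\<close> by simp
  qed
qed

text \<open>\<open>ker\<close> makes the assignment of \<open>l c\<close> to \<open>T c\<close> well
  defined modulo \<open>W\<close>; a linear right inverse of the projected map turns it into a
  functional on the whole space. It supplies the functionals that are prescribed on boundaries when
  intersection numbers are constructed.\<close>

lemma functional_factor:
  fixes T :: "'v::real_vector \<Rightarrow> 'w::real_vector" and l :: "'v \<Rightarrow> real"
  assumes V: "subspace V" and W: "subspace W" and T: "linear T" and l: "linear l"
    and ker: "\<And>c. c \<in> V \<Longrightarrow> T c \<in> W \<Longrightarrow> l c = 0"
  obtains \<mu> :: "'w \<Rightarrow> real" where "linear \<mu>" "\<And>c. c \<in> V \<Longrightarrow> \<mu> (T c) = l c"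
    "\<And>w. w \<in> W \<Longrightarrow> \<mu> w = 0"
proof -
  obtain \<pi> :: "'w \<Rightarrow> 'w" where \<pi>: "linear \<pi>" "\<And>v. \<pi> v = 0 \<longleftrightarrow> v \<in> W"
    using exists_linear_with_kernel[OF W] by blast
  define R where "R = \<pi> \<circ> T"
  have R: "linear R" unfolding R_def by (rule linear_compose[OF T \<pi>(1)])
  obtain g where g: "g ` UNIV \<subseteq> V" "linear g" "\<forall>v\<in>R ` V. R (g v) = v"
    using linear_exists_right_inverse_on[OF R V] by blast
  show thesis
  proof
    show "linear (l \<circ> g \<circ> \<pi>)"
      by (intro linear_compose \<pi> g l)
    show "(l \<circ> g \<circ> \<pi>) w = 0" if "w \<in> W" for w
      using \<pi>(2)[of w] that g(2) l by (simp add: linear_0)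
    show "(l \<circ> g \<circ> \<pi>) (T c) = l c" if "c \<in> V" for c
    proof -
      define d where "d = c - g (R c)"
      have "g (R c) \<in> V" using g(1) by auto
      then have "d \<in> V" using V that by (simp add: d_def subspace_diff)
      moreover have "R d = 0"
        using g(3) that R by (simp add: d_def linear_diff)
      ultimately have "l d = 0" using ker \<pi>(2) by (simp add: R_def)
      then show ?thesis using l by (simp add: d_def linear_diff R_def)
    qed
  qed
qed

text \<open>A map with kernel \<open>W\<close> serves as the projection to the quotient by
  \<open>W\<close> within the same type; representatives of a basis of the quotient become an
  ordinary basis of the image of \<open>V\<close>.\<close>

lemma quotient_basis_iff_kernel:
  fixes \<pi> :: "'v::real_vector \<Rightarrow> 'v"
  assumes \<pi>: "linear \<pi>" "\<And>v. \<pi> v = 0 \<longleftrightarrow> v \<in> W" and V: "subspace V"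
    and S: "quotient_basis V W S"
  shows "inj_on \<pi> S" "independent (\<pi> ` S)" "span (\<pi> ` S) = \<pi> ` V"
proof -
  have fin: "finite S" and sub: "S \<subseteq> V"
    and ind: "\<And>u. (\<Sum>s\<in>S. u s *\<^sub>R s) \<in> W \<Longrightarrow> \<forall>s\<in>S. u s = 0"
    and spn: "\<And>v. v \<in> V \<Longrightarrow> \<exists>u. v - (\<Sum>s\<in>S. u s *\<^sub>R s) \<in> W"
    using S by (auto simp: quotient_basis_def)
  have \<pi>sum: "\<pi> (\<Sum>s\<in>S. u s *\<^sub>R s) = (\<Sum>s\<in>S. u s *\<^sub>R \<pi> s)" for u
    using \<pi>(1) by (simp add: linear_sum linear_scale)
  show inj: "inj_on \<pi> S"
  proof
    fix a b assume ab: "a \<in> S" "b \<in> S" "\<pi> a = \<pi> b"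
    show "a = b"
    proof (rule ccontr)
      assume ne: "a \<noteq> b"
      define u where "u s = (if s = a then 1 else if s = b then -1 else (0::real))" for s
      have "(\<Sum>s\<in>S. u s *\<^sub>R \<pi> s) = (\<Sum>s\<in>{a,b}. u s *\<^sub>R \<pi> s)"
        using ab fin by (intro sum.mono_neutral_right) (auto simp: u_def)
      also have "\<dots> = 0" using ne ab(3) by (simp add: u_def)
      finally have "(\<Sum>s\<in>S. u s *\<^sub>R s) \<in> W" using \<pi>sum \<pi>(2) by metis
      then have "u a = 0" using ind ab by blast
      then show False by (simp add: u_def)
    qed
  qed
  show "independent (\<pi> ` S)"
  proof (rule independent_if_scalars_zero)
    show "finite (\<pi> ` S)" using fin by simp
    fix f x assume f: "(\<Sum>x\<in>\<pi> ` S. f x *\<^sub>R x) = 0" and x: "x \<in> \<pi> ` S"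
    have "(\<Sum>s\<in>S. f (\<pi> s) *\<^sub>R \<pi> s) = 0" using f by (simp add: sum.reindex[OF inj])
    then have "(\<Sum>s\<in>S. f (\<pi> s) *\<^sub>R s) \<in> W" using \<pi>sum[of "\<lambda>s. f (\<pi> s)"] \<pi>(2) by metis
    then show "f x = 0" using ind[of "\<lambda>s. f (\<pi> s)"] x by auto
  qed
  have "\<pi> v \<in> span (\<pi> ` S)" if v: "v \<in> V" for v
  proof -
    obtain u where "v - (\<Sum>s\<in>S. u s *\<^sub>R s) \<in> W" using spn[OF v] by blast
    then have "\<pi> v = (\<Sum>s\<in>S. u s *\<^sub>R \<pi> s)"
      using \<pi> \<pi>sum by (metis linear_diff right_minus_eq)
    then show ?thesis by (simp add: span_sum span_scale span_base)
  qed
  moreover have "\<pi> ` S \<subseteq> \<pi> ` V" using sub by auto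
  ultimately show "span (\<pi> ` S) = \<pi> ` V"
    by (intro span_subspace linear_subspace_image[OF \<pi>(1) V]) auto
qed

text \<open>The definite description in \<open>quotient_dim\<close> is justified because every
  admissible set has as its cardinality the dimension of one fixed image space.\<close>

lemma quotient_dim_eq_card:
  fixes V :: "'v::real_vector set"
  assumes V: "subspace V" and W: "subspace W" and S: "quotient_basis V W S"
  shows "quotient_dim V W = card S"
proof -
  obtain \<pi> :: "'v \<Rightarrow> 'v" where \<pi>: "linear \<pi>" "\<And>v. \<pi> v = 0 \<longleftrightarrow> v \<in> W"
    using exists_linear_with_kernel[OF W] by blast
  have card: "card S' = dim (\<pi> ` V)" if "quotient_basis V W S'" for S'
    using quotient_basis_iff_kernel[OF \<pi> V that]
    by (metis card_image dim_eq_card_independent dim_span)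
  show ?thesis unfolding quotient_dim_def
    by (rule the_equality) (use S card in auto)
qed

text \<open>Finiteness is asked of \<open>V\<close> itself, so this is applied to simplicial chains;
  bases of singular homology are obtained from simplicial ones by transport.\<close>

lemma quotient_basis_exists:
  fixes V :: "'v::real_vector set"
  assumes V: "subspace V" and W: "subspace W" and F: "finite F" "V \<subseteq> span F"
  obtains S where "quotient_basis V W S"
proof -
  obtain \<pi> :: "'v \<Rightarrow> 'v" where \<pi>: "linear \<pi>" "\<And>v. \<pi> v = 0 \<longleftrightarrow> v \<in> W"
    using exists_linear_with_kernel[OF W] by blast
  obtain B where B: "B \<subseteq> \<pi> ` V" "independent B" "\<pi> ` V \<subseteq> span B"
    using maximal_independent_subset by blast
  have "B \<subseteq> span (\<pi> ` F)"
    using B(1) F(2) linear_span_image[OF \<pi>(1), of F] by auto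
  then have finB: "finite B"
    using independent_span_bound[of "\<pi> ` F" B] B(2) F(1) by auto
  obtain S where S: "S \<subseteq> V" "inj_on \<pi> S" "\<pi> ` S = B"
    using B(1) by (metis subset_image_inj)
  have finS: "finite S" using finB S finite_image_iff by metis
  have \<pi>sum: "\<pi> (\<Sum>s\<in>S. u s *\<^sub>R s) = (\<Sum>s\<in>S. u s *\<^sub>R \<pi> s)" for u
    using \<pi>(1) by (simp add: linear_sum linear_scale)
  have "quotient_basis V W S"
    unfolding quotient_basis_def
  proof (intro conjI allI impI ballI)
    fix u s assume u: "(\<Sum>s\<in>S. u s *\<^sub>R s) \<in> W" and s: "s \<in> S"
    have "(\<Sum>s\<in>S. u s *\<^sub>R \<pi> s) = 0" using u \<pi>(2) \<pi>sum by metis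
    then have "(\<Sum>b\<in>B. u (the_inv_into S \<pi> b) *\<^sub>R b) = 0"
      unfolding S(3)[symmetric] sum.reindex[OF S(2)]
      by (simp add: the_inv_into_f_f[OF S(2)])
    then have "u (the_inv_into S \<pi> (\<pi> s)) = 0"
      using independentD[OF B(2) finB order_refl, of "\<lambda>b. u (the_inv_into S \<pi> b)" "\<pi> s"] s S(3) by blast
    then show "u s = 0" using S s by (simp add: the_inv_into_f_f)
  next
    fix v assume "v \<in> V"
    then have "\<pi> v \<in> span B" using B(3) by auto
    then obtain w where "\<pi> v = (\<Sum>b\<in>B. w b *\<^sub>R b)"
      using span_finite[OF finB] by auto
    then have "\<pi> v = (\<Sum>s\<in>S. w (\<pi> s) *\<^sub>R \<pi> s)"
      unfolding S(3)[symmetric] sum.reindex[OF S(2)] by simp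
    then have "\<pi> (v - (\<Sum>s\<in>S. w (\<pi> s) *\<^sub>R s)) = 0"
      using \<pi>sum[of "\<lambda>s. w (\<pi> s)"] \<pi>(1) by (simp add: linear_diff)
    then have "v - (\<Sum>s\<in>S. w (\<pi> s) *\<^sub>R s) \<in> W" using \<pi>(2) by simp
    then show "\<exists>u. v - (\<Sum>s\<in>S. u s *\<^sub>R s) \<in> W" by (rule exI[where x = "\<lambda>s. w (\<pi> s)"])
  qed (use finS S in auto)
  then show thesis by (rule that)
qed

text \<open>\<open>inj\<close> and \<open>sur\<close> say that \<open>T\<close> induces an
  isomorphism of the quotients, although \<open>T\<close> may be neither injective nor onto.\<close>

lemma quotient_basis_image:
  fixes T :: "'v::real_vector \<Rightarrow> 'w::real_vector"
  assumes T: "linear T" and V: "subspace V"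
    and TV: "\<And>v. v \<in> V \<Longrightarrow> T v \<in> V'"
    and inj: "\<And>v. v \<in> V \<Longrightarrow> T v \<in> W' \<longleftrightarrow> v \<in> W"
    and sur: "\<And>v'. v' \<in> V' \<Longrightarrow> \<exists>v\<in>V. v' - T v \<in> W'"
    and W': "subspace W'"
    and S: "quotient_basis V W S"
  shows "quotient_basis V' W' (T ` S)" "card (T ` S) = card S"
proof -
  have fin: "finite S" and sub: "S \<subseteq> V"
    and ind: "\<And>u. (\<Sum>s\<in>S. u s *\<^sub>R s) \<in> W \<Longrightarrow> \<forall>s\<in>S. u s = 0"
    and spn: "\<And>v. v \<in> V \<Longrightarrow> \<exists>u. v - (\<Sum>s\<in>S. u s *\<^sub>R s) \<in> W"
    using S by (auto simp: quotient_basis_def)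
  have Tsum: "T (\<Sum>s\<in>S. u s *\<^sub>R s) = (\<Sum>s\<in>S. u s *\<^sub>R T s)" for u
    using T by (simp add: linear_sum linear_scale)
  have sumV: "(\<Sum>s\<in>S. u s *\<^sub>R s) \<in> V" for u
    using sub V by (intro subspace_sum subspace_scale) auto
  have ind': "\<forall>s\<in>S. u s = 0" if "(\<Sum>s\<in>S. u s *\<^sub>R T s) \<in> W'" for u
    using that ind[of u] inj[OF sumV[of u]] Tsum[of u] by metis
  have injT: "inj_on T S"
  proof
    fix a b assume ab: "a \<in> S" "b \<in> S" "T a = T b"
    show "a = b"
    proof (rule ccontr)
      assume ne: "a \<noteq> b"
      define u where "u s = (if s = a then 1 else if s = b then -1 else (0::real))" for s
      have "(\<Sum>s\<in>S. u s *\<^sub>R T s) = (\<Sum>s\<in>{a,b}. u s *\<^sub>R T s)"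
        using ab fin by (intro sum.mono_neutral_right) (auto simp: u_def)
      also have "\<dots> = 0" using ne ab(3) by (simp add: u_def)
      finally have "u a = 0" using ind'[of u] ab W' by (simp add: subspace_0)
      then show False by (simp add: u_def)
    qed
  qed
  then show "card (T ` S) = card S" by (rule card_image)
  show "quotient_basis V' W' (T ` S)"
    unfolding quotient_basis_def
  proof (intro conjI allI impI ballI)
    fix u s' assume u: "(\<Sum>s\<in>T ` S. u s *\<^sub>R s) \<in> W'" and s': "s' \<in> T ` S"
    then show "u s' = 0" using ind'[of "\<lambda>s. u (T s)"] by (auto simp: sum.reindex[OF injT])
  next
    fix v' assume "v' \<in> V'"
    then obtain v where v: "v \<in> V" "v' - T v \<in> W'" using sur by blast
    obtain u where u: "v - (\<Sum>s\<in>S. u s *\<^sub>R s) \<in> W" using spn v(1) by blast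
    have "v - (\<Sum>s\<in>S. u s *\<^sub>R s) \<in> V" using v(1) sumV V by (simp add: subspace_diff)
    then have "T (v - (\<Sum>s\<in>S. u s *\<^sub>R s)) \<in> W'" using inj u by blast
    then have "T v - (\<Sum>s\<in>S. u s *\<^sub>R T s) \<in> W'" using Tsum T by (simp add: linear_diff)
    then have "(v' - T v) + (T v - (\<Sum>s\<in>S. u s *\<^sub>R T s)) \<in> W'"
      by (rule subspace_add[OF W' v(2)])
    then have "v' - (\<Sum>s\<in>T ` S. u (the_inv_into S T s) *\<^sub>R s) \<in> W'"
      by (simp add: sum.reindex[OF injT] the_inv_into_f_f[OF injT])
    then show "\<exists>u. v' - (\<Sum>s\<in>T ` S. u s *\<^sub>R s) \<in> W'"
      by (rule exI[where x = "\<lambda>s. u (the_inv_into S T s)"])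
  qed (use fin sub TV in auto)
qed

text \<open>With \<open>e\<close> the coefficient sum, this is the passage from reduced to ordinary
  homology in degree 0: one more class, represented by a point.\<close>

lemma quotient_basis_add_functional:
  fixes e :: "'v::real_vector \<Rightarrow> real"
  assumes V: "subspace V" and W: "subspace W" and e: "linear e"
    and We: "\<And>w. w \<in> W \<Longrightarrow> e w = 0" and v0: "v0 \<in> V" "e v0 = 1"
    and S: "quotient_basis {v \<in> V. e v = 0} W S"
  shows "quotient_basis V W (insert v0 S)" "card (insert v0 S) = Suc (card S)"
proof -
  have fin: "finite S" and sub: "S \<subseteq> V" "\<And>s. s \<in> S \<Longrightarrow> e s = 0"
    and ind: "\<And>u. (\<Sum>s\<in>S. u s *\<^sub>R s) \<in> W \<Longrightarrow> \<forall>s\<in>S. u s = 0"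
    and spn: "\<And>v. v \<in> V \<Longrightarrow> e v = 0 \<Longrightarrow> \<exists>u. v - (\<Sum>s\<in>S. u s *\<^sub>R s) \<in> W"
    using S by (auto simp: quotient_basis_def)
  have nin: "v0 \<notin> S" using sub v0 by auto
  then show "card (insert v0 S) = Suc (card S)" using fin by simp
  have esum: "e (\<Sum>s\<in>S. u s *\<^sub>R s) = 0" for u
    using e sub(2) by (simp add: linear_sum linear_scale)
  show "quotient_basis V W (insert v0 S)"
    unfolding quotient_basis_def
  proof (intro conjI allI impI)
    fix u assume u: "(\<Sum>s\<in>insert v0 S. u s *\<^sub>R s) \<in> W"
    have *: "(\<Sum>s\<in>insert v0 S. u s *\<^sub>R s) = u v0 *\<^sub>R v0 + (\<Sum>s\<in>S. u s *\<^sub>R s)"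
      using nin fin by simp
    have "u v0 = 0" using We[OF u] esum v0 e unfolding * by (simp add: linear_add linear_scale)
    then show "\<forall>s\<in>insert v0 S. u s = 0" using ind[of u] u * by simp
  next
    show "\<forall>v\<in>V. \<exists>u. v - (\<Sum>s\<in>insert v0 S. u s *\<^sub>R s) \<in> W"
    proof
      fix v assume v: "v \<in> V"
      have "v - e v *\<^sub>R v0 \<in> V" using v v0 V by (simp add: subspace_diff subspace_scale)
      moreover have "e (v - e v *\<^sub>R v0) = 0" using e v0 by (simp add: linear_diff linear_scale)
      ultimately obtain u where u: "v - e v *\<^sub>R v0 - (\<Sum>s\<in>S. u s *\<^sub>R s) \<in> W" using spn by blast
      have "(\<Sum>s\<in>insert v0 S. (u(v0 := e v)) s *\<^sub>R s) = e v *\<^sub>R v0 + (\<Sum>s\<in>S. (u(v0 := e v)) s *\<^sub>R s)"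
        using nin fin by simp
      also have "(\<Sum>s\<in>S. (u(v0 := e v)) s *\<^sub>R s) = (\<Sum>s\<in>S. u s *\<^sub>R s)"
        using nin by (intro sum.cong) auto
      finally show "\<exists>u. v - (\<Sum>s\<in>insert v0 S. u s *\<^sub>R s) \<in> W"
        using u by (intro exI[where x = "u(v0 := e v)"]) (simp add: diff_diff_eq)
    qed
  qed (use fin sub v0 in auto)
qed

section \<open>Real-valued functions as vectors, for simplicial chains and cochains\<close>

instantiation "fun" :: (type, real_vector) real_vector
begin
definition scaleR_fun_def: "r *\<^sub>R f = (\<lambda>x. r *\<^sub>R f x)"
instance
  by standard (auto simp: scaleR_fun_def fun_eq_iff scaleR_add_left scaleR_add_right)
end

lemma scaleR_fun_apply [simp]: "(r *\<^sub>R f) x = r *\<^sub>R f x"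
  by (simp add: scaleR_fun_def)

lemma sum_fun_apply: "(\<Sum>i\<in>I. f i) x = (\<Sum>i\<in>I. f i x)"
  for f :: "'i \<Rightarrow> 'x \<Rightarrow> 'b::real_vector"
  by (induction I rule: infinite_finite_induct) auto

lemma function_expansion:
  fixes x :: "'s \<Rightarrow> real"
  assumes "finite F" "\<And>s. s \<notin> F \<Longrightarrow> x s = 0"
  shows "x = (\<Sum>s\<in>F. x s *\<^sub>R indicator {s})"
proof
  fix t
  have "(\<Sum>s\<in>F. x s *\<^sub>R indicator {s}) t = (\<Sum>s\<in>F. if s = t then x s else 0)"
    by (auto simp: sum_fun_apply indicator_def intro!: sum.cong)
  also have "\<dots> = x t" using assms by (cases "t \<in> F") (simp_all add: sum.delta)
  finally show "x t = (\<Sum>s\<in>F. x s *\<^sub>R indicator {s}) t" by simp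
qed

text \<open>\<open>W\<close> and \<open>W'\<close> are the exact annihilators, and the first
  quotient is finite-dimensional; hence the basis \<open>S\<close> has a dual basis on the other
  side. \<open>V'\<close> may be infinite-dimensional, as it will consist of singular
  chains.\<close>

lemma perfect_pairing_quotient_basis:
  fixes P :: "'v::real_vector \<Rightarrow> 'w::real_vector \<Rightarrow> real"
  assumes V: "subspace V" and V': "subspace V'" and W': "subspace W'"
    and lin1: "\<And>w. linear (\<lambda>v. P v w)" and lin2: "\<And>v. linear (P v)"
    and ker1: "\<And>v. v \<in> V \<Longrightarrow> (\<forall>w\<in>V'. P v w = 0) \<longleftrightarrow> v \<in> W"
    and ker2: "\<And>w. w \<in> V' \<Longrightarrow> (\<forall>v\<in>V. P v w = 0) \<longleftrightarrow> w \<in> W'"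
    and S: "quotient_basis V W S"
  obtains S' where "quotient_basis V' W' S'" "card S' = card S"
proof -
  have fin: "finite S" and sub: "S \<subseteq> V"
    and ind: "\<And>u. (\<Sum>s\<in>S. u s *\<^sub>R s) \<in> W \<Longrightarrow> \<forall>s\<in>S. u s = 0"
    and spn: "\<And>v. v \<in> V \<Longrightarrow> \<exists>u. v - (\<Sum>s\<in>S. u s *\<^sub>R s) \<in> W"
    using S by (auto simp: quotient_basis_def)
  have sumV: "(\<Sum>s\<in>S. u s *\<^sub>R s) \<in> V" for u
    using sub V by (intro subspace_sum subspace_scale) auto
  \<comment> \<open>Evaluation on the basis \<open>S\<close>: a linear map into functions on a
    finite set whose kernel in \<open>V'\<close> is \<open>W'\<close>.\<close>
  define T :: "'w \<Rightarrow> 'v \<Rightarrow> real" where "T w = (\<lambda>s. if s \<in> S then P s w else 0)" for w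
  have T: "linear T"
    by (rule linearI) (auto simp: T_def fun_eq_iff linear_add[OF lin2] linear_scale[OF lin2])
  have kerT: "w \<in> W'" if w: "w \<in> V'" "T w = 0" for w
  proof -
    have z: "P s w = 0" if "s \<in> S" for s
      using w(2) that by (auto simp: T_def fun_eq_iff split: if_splits)
    have "P v w = 0" if "v \<in> V" for v
    proof -
      obtain u where u: "v - (\<Sum>s\<in>S. u s *\<^sub>R s) \<in> W" using spn \<open>v \<in> V\<close> by blast
      have "v - (\<Sum>s\<in>S. u s *\<^sub>R s) \<in> V" using that sumV V by (simp add: subspace_diff)
      then have "P (v - (\<Sum>s\<in>S. u s *\<^sub>R s)) w = 0" using ker1 u w(1) by blast
      then have "P v w = (\<Sum>s\<in>S. u s *\<^sub>R P s w)"
        by (simp add: linear_diff[OF lin1] linear_sum[OF lin1] linear_scale[OF lin1])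
      then show ?thesis using z by simp
    qed
    then show ?thesis using ker2 w(1) by blast
  qed
  \<comment> \<open>A functional vanishing on all values of \<open>T\<close> but not on this
    indicator would give a combination of \<open>S\<close>, with nonzero coefficient at
    \<open>s\<close>, that annihilates \<open>V'\<close> and so lies in \<open>W\<close>.\<close>
  have "\<exists>w\<in>V'. T w = indicator {s}" if s: "s \<in> S" for s
  proof (rule ccontr)
    assume "\<not> ?thesis"
    then have "indicator {s} \<notin> T ` V'" by auto
    then obtain \<mu> :: "('v \<Rightarrow> real) \<Rightarrow> real" where \<mu>: "linear \<mu>" "\<And>x. x \<in> T ` V' \<Longrightarrow> \<mu> x = 0"
        "\<mu> (indicator {s}) = 1"
      using functional_separating[OF linear_subspace_image[OF T V']] by metis
    have "(\<Sum>t\<in>S. \<mu> (indicator {t}) *\<^sub>R t) \<in> W"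
    proof -
      have "P (\<Sum>t\<in>S. \<mu> (indicator {t}) *\<^sub>R t) w = 0" if "w \<in> V'" for w
      proof -
        have "P (\<Sum>t\<in>S. \<mu> (indicator {t}) *\<^sub>R t) w = (\<Sum>t\<in>S. T w t * \<mu> (indicator {t}))"
          by (simp add: linear_sum[OF lin1] linear_scale[OF lin1] T_def mult.commute)
        also have "\<dots> = \<mu> (\<Sum>t\<in>S. T w t *\<^sub>R indicator {t})"
          using \<mu>(1) by (simp add: linear_sum linear_scale)
        also have "\<dots> = \<mu> (T w)"
          by (rule arg_cong[where f = \<mu>], rule function_expansion[OF fin, symmetric]) (simp add: T_def)
        finally show ?thesis using \<mu>(2) that by simp
      qed
      then show ?thesis using ker1[OF sumV, of "\<lambda>t. \<mu> (indicator {t})"] by blast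
    qed
    then have "\<mu> (indicator {s}) = 0" using ind[of "\<lambda>t. \<mu> (indicator {t})"] s by blast
    then show False using \<mu>(3) by simp
  qed
  then obtain g where g: "\<And>s. s \<in> S \<Longrightarrow> g s \<in> V' \<and> T (g s) = indicator {s}" by metis
  have Pg: "P s (g t) = (if s = t then 1 else 0)" if "s \<in> S" "t \<in> S" for s t
    using g[OF that(2)] that by (auto simp: T_def fun_eq_iff indicator_def split: if_splits)
  have injg: "inj_on g S"
  proof
    fix a b assume ab: "a \<in> S" "b \<in> S" "g a = g b"
    show "a = b"
      using Pg[OF ab(1) ab(1)] Pg[OF ab(1) ab(2)] ab(3) by (auto split: if_splits)
  qed
  have "quotient_basis V' W' (g ` S)"
    unfolding quotient_basis_def
  proof (intro conjI allI impI ballI)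
    fix u s' assume u: "(\<Sum>s\<in>g ` S. u s *\<^sub>R s) \<in> W'" and s': "s' \<in> g ` S"
    obtain t where t: "t \<in> S" "s' = g t" using s' by blast
    have u': "(\<Sum>s\<in>S. u (g s) *\<^sub>R g s) \<in> W'" using u by (simp add: sum.reindex[OF injg])
    have "(\<Sum>s\<in>S. u (g s) *\<^sub>R g s) \<in> V'"
      using g V' by (intro subspace_sum subspace_scale) auto
    then have "P t (\<Sum>s\<in>S. u (g s) *\<^sub>R g s) = 0" using ker2 u' t sub by blast
    then have "(\<Sum>s\<in>S. u (g s) * P t (g s)) = 0"
      by (simp add: linear_sum[OF lin2] linear_scale[OF lin2])
    moreover have "(\<Sum>s\<in>S. u (g s) * P t (g s)) = (\<Sum>s\<in>S. if s = t then u (g s) else 0)"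
      using Pg t by (intro sum.cong) auto
    ultimately show "u s' = 0" using t fin by (simp add: sum.delta)
  next
    fix w assume w: "w \<in> V'"
    \<comment> \<open>What remains of \<open>w\<close> after its expansion in the dual basis; it
      pairs to zero with \<open>S\<close>, hence lies in \<open>W'\<close>.\<close>
    define d where "d = w - (\<Sum>s\<in>S. P s w *\<^sub>R g s)"
    have dV: "d \<in> V'" unfolding d_def
      using g V' w by (intro subspace_diff subspace_sum subspace_scale) auto
    have "P t d = 0" if t: "t \<in> S" for t
    proof -
      have "P t d = P t w - (\<Sum>s\<in>S. P s w * P t (g s))"
        by (simp add: d_def linear_diff[OF lin2] linear_sum[OF lin2] linear_scale[OF lin2])
      also have "(\<Sum>s\<in>S. P s w * P t (g s)) = (\<Sum>s\<in>S. if s = t then P s w else 0)"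
        using Pg t by (intro sum.cong) auto
      finally show ?thesis using t fin by (simp add: sum.delta)
    qed
    then have "T d = 0" by (auto simp: T_def fun_eq_iff)
    then have "d \<in> W'" using kerT dV by blast
    then have "w - (\<Sum>s\<in>g ` S. P (the_inv_into S g s) w *\<^sub>R s) \<in> W'"
      by (simp add: d_def sum.reindex[OF injg] the_inv_into_f_f[OF injg])
    then show "\<exists>u. w - (\<Sum>s\<in>g ` S. u s *\<^sub>R s) \<in> W'"
      by (rule exI[where x = "\<lambda>s. P (the_inv_into S g s) w"])
  qed (use fin g in auto)
  then show thesis using that card_image[OF injg] by blast
qed

subsection \<open>Real chains\<close>

abbreviation "lookup \<equiv> Poly_Mapping.lookup"
abbreviation "keys \<equiv> Poly_Mapping.keys"

lemma lookup_scaleR [simp]: "lookup (r *\<^sub>R c) i = r *\<^sub>R lookup c i"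
  by (simp add: scaleR_poly_mapping_def)

lemma lookup_sum_apply: "lookup (\<Sum>i\<in>I. f i) x = (\<Sum>i\<in>I. lookup (f i) x)"
  by (induction I rule: infinite_finite_induct) (auto simp: lookup_add)

lemma keys_scaleR: "keys (r *\<^sub>R c) \<subseteq> keys c"
  by (auto simp: in_keys_iff)

lemma sum_keys_eq:
  fixes g :: "'b \<Rightarrow> 'v::real_vector" and c :: "'b \<Rightarrow>\<^sub>0 real"
  assumes "finite F" "keys c \<subseteq> F"
  shows "(\<Sum>f\<in>keys c. lookup c f *\<^sub>R g f) = (\<Sum>f\<in>F. lookup c f *\<^sub>R g f)"
  using assms by (intro sum.mono_neutral_left) (auto simp: in_keys_iff)

lemma linear_extension:
  fixes g :: "'b \<Rightarrow> 'v::real_vector"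
  shows "linear (\<lambda>c :: 'b \<Rightarrow>\<^sub>0 real. \<Sum>f\<in>keys c. lookup c f *\<^sub>R g f)"
proof (rule linearI)
  fix a b :: "'b \<Rightarrow>\<^sub>0 real"
  have f: "finite (keys a \<union> keys b)" by simp
  show "(\<Sum>f\<in>keys (a + b). lookup (a + b) f *\<^sub>R g f)
      = (\<Sum>f\<in>keys a. lookup a f *\<^sub>R g f) + (\<Sum>f\<in>keys b. lookup b f *\<^sub>R g f)"
    using sum_keys_eq[OF f, of a g] sum_keys_eq[OF f, of b g] sum_keys_eq[OF f keys_add, of g]
    by (simp add: lookup_add scaleR_add_left sum.distrib)
next
  fix r and b :: "'b \<Rightarrow>\<^sub>0 real"
  show "(\<Sum>f\<in>keys (r *\<^sub>R b). lookup (r *\<^sub>R b) f *\<^sub>R g f) = r *\<^sub>R (\<Sum>f\<in>keys b. lookup b f *\<^sub>R g f)"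
    using sum_keys_eq[of "keys b" "r *\<^sub>R b" g] keys_scaleR[of r b] by (simp add: scaleR_sum_right)
qed

lemma linear_real_boundary: "linear (real_boundary p)"
proof (cases "p = 0")
  case True
  then show ?thesis by (simp add: real_boundary_def[abs_def] linear_zero)
next
  case False
  then show ?thesis
    using linear_extension[of "\<lambda>f. \<Sum>k\<le>p. Poly_Mapping.single (singular_face p k f) ((-1) ^ k)"]
    by (simp add: real_boundary_def[abs_def])
qed

lemmas real_boundary_add = linear_add[OF linear_real_boundary]
  and real_boundary_diff = linear_diff[OF linear_real_boundary]
  and real_boundary_neg = linear_neg[OF linear_real_boundary]
  and real_boundary_scale = linear_scale[OF linear_real_boundary]
  and real_boundary_sum = linear_sum[OF linear_real_boundary]
  and real_boundary_zero [simp] = linear_0[OF linear_real_boundary]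

lemma real_boundary_0 [simp]: "real_boundary 0 c = 0"
  by (simp add: real_boundary_def)

lemma subspace_keys: "subspace {c :: 'b \<Rightarrow>\<^sub>0 real. keys c \<subseteq> P}"
proof (rule subspaceI)
  show "0 \<in> {c :: 'b \<Rightarrow>\<^sub>0 real. keys c \<subseteq> P}" by simp
  show "x + y \<in> {c :: 'b \<Rightarrow>\<^sub>0 real. keys c \<subseteq> P}"
    if "x \<in> {c :: 'b \<Rightarrow>\<^sub>0 real. keys c \<subseteq> P}" "y \<in> {c :: 'b \<Rightarrow>\<^sub>0 real. keys c \<subseteq> P}" for x y
    using that keys_add[of x y] by auto
  show "r *\<^sub>R x \<in> {c :: 'b \<Rightarrow>\<^sub>0 real. keys c \<subseteq> P}"
    if "x \<in> {c :: 'b \<Rightarrow>\<^sub>0 real. keys c \<subseteq> P}" for x r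
    using that keys_scaleR[of r x] by auto
qed

lemma subspace_real_chains: "subspace (real_chains p X)"
  unfolding real_chains_def by (rule subspace_keys)

lemma keys_subset_split:
  fixes c :: "'b \<Rightarrow>\<^sub>0 real"
  assumes "keys c \<subseteq> A \<union> B"
  obtains a b where "c = a + b" "keys a \<subseteq> A" "keys b \<subseteq> B"
proof
  define a where "a = Abs_poly_mapping (\<lambda>i. if i \<in> A then lookup c i else 0)"
  have "finite {i. (if i \<in> A then lookup c i else 0) \<noteq> 0}"
    by (rule finite_subset[OF _ finite_keys[of c]]) (auto simp: in_keys_iff)
  then have a: "lookup a i = (if i \<in> A then lookup c i else 0)" for i
    by (simp add: a_def)
  show "c = a + (c - a)" by simp
  show "keys a \<subseteq> A" by (auto simp: in_keys_iff a split: if_splits)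
  show "keys (c - a) \<subseteq> B" using assms by (auto simp: in_keys_iff lookup_minus a split: if_splits)
qed

section \<open>Integral chains inside real chains\<close>

definition real_frag :: "('b \<Rightarrow>\<^sub>0 int) \<Rightarrow> ('b \<Rightarrow>\<^sub>0 real)" where
  "real_frag c = Poly_Mapping.map real_of_int c"

lemma lookup_real_frag [simp]: "lookup (real_frag c) i = real_of_int (lookup c i)"
  by (simp add: real_frag_def map.rep_eq when_def)

lemma keys_real_frag [simp]: "keys (real_frag c) = keys c"
  by (auto simp: in_keys_iff)

lemma real_frag_0 [simp]: "real_frag 0 = 0"
  by (rule poly_mapping_eqI) simp

lemma real_frag_add: "real_frag (a + b) = real_frag a + real_frag b"
  by (rule poly_mapping_eqI) (simp add: lookup_add)

lemma real_frag_diff: "real_frag (a - b) = real_frag a - real_frag b"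
  by (rule poly_mapping_eqI) (simp add: lookup_minus)

lemma real_frag_cmul: "real_frag (frag_cmul k a) = real_of_int k *\<^sub>R real_frag a"
  by (rule poly_mapping_eqI) simp

lemma real_frag_sum: "real_frag (\<Sum>i\<in>I. f i) = (\<Sum>i\<in>I. real_frag (f i))"
  by (rule poly_mapping_eqI) (simp add: lookup_sum_apply)

lemma real_frag_of: "real_frag (frag_of f) = Poly_Mapping.single f 1"
  by (rule poly_mapping_eqI) (simp add: lookup_single when_def)

lemma real_frag_boundary: "real_frag (chain_boundary p c) = real_boundary p (real_frag c)"
proof (cases "p = 0")
  case False
  have s: "(-1) ^ k *\<^sub>R Poly_Mapping.single (f :: (nat \<Rightarrow> real) \<Rightarrow> 'a) (1::real) = Poly_Mapping.single f ((-1) ^ k)"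
    for f and k :: nat
    by (rule poly_mapping_eqI) (simp add: lookup_single when_def)
  show ?thesis using False
    by (simp add: chain_boundary_def real_boundary_def frag_extend_def real_frag_sum real_frag_cmul real_frag_of s)
qed (simp add: chain_boundary_def)

lemma singular_chain_real_frag: "singular_chain p X c \<longleftrightarrow> real_frag c \<in> real_chains p X"
  by (simp add: singular_chain_def real_chains_def)

lemma real_chain_expansion:
  fixes c :: "'b \<Rightarrow>\<^sub>0 real"
  shows "c = (\<Sum>f\<in>keys c. lookup c f *\<^sub>R Poly_Mapping.single f 1)"
proof (rule poly_mapping_eqI)
  fix i
  have "lookup (\<Sum>f\<in>keys c. lookup c f *\<^sub>R Poly_Mapping.single f 1) i = (\<Sum>f\<in>keys c. if f = i then lookup c f else 0)"
    unfolding lookup_sum_apply by (intro sum.cong) (auto simp: lookup_single when_def)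
  also have "\<dots> = lookup c i" by (simp add: sum.delta in_keys_iff)
  finally show "lookup c i = lookup (\<Sum>f\<in>keys c. lookup c f *\<^sub>R Poly_Mapping.single f 1) i" by simp
qed

text \<open>Linearity reduces this to a single simplex, which is an integral chain, where the
  integral theorem applies. \<open>real_boundary_boundary\<close> is obtained in the same
  way.\<close>

lemma real_boundary_in_chains:
  assumes "c \<in> real_chains p X"
  shows "real_boundary p c \<in> real_chains (p - 1) X"
proof -
  have "real_boundary p (Poly_Mapping.single f 1) \<in> real_chains (p - 1) X" if "f \<in> keys c" for f
  proof -
    have "singular_chain p X (frag_of f)"
      using assms that by (auto simp: real_chains_def singular_chain_of)
    then show ?thesis
      using singular_chain_boundary[of p X "frag_of f"]
      by (simp add: singular_chain_real_frag real_frag_boundary real_frag_of)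
  qed
  then have "(\<Sum>f\<in>keys c. lookup c f *\<^sub>R real_boundary p (Poly_Mapping.single f 1)) \<in> real_chains (p - 1) X"
    by (intro subspace_sum subspace_scale subspace_real_chains) auto
  then show ?thesis
    by (subst real_chain_expansion) (simp add: real_boundary_sum real_boundary_scale)
qed

lemma real_boundary_in_chains_Suc:
  "c \<in> real_chains (Suc p) X \<Longrightarrow> real_boundary (Suc p) c \<in> real_chains p X"
  using real_boundary_in_chains[of c "Suc p" X] by simp

lemma real_boundary_boundary:
  assumes "c \<in> real_chains (Suc p) X"
  shows "real_boundary p (real_boundary (Suc p) c) = 0"
proof -
  have "real_boundary p (real_boundary (Suc p) (Poly_Mapping.single f 1)) = 0" if "f \<in> keys c" for f
  proof -
    have "singular_chain (Suc p) X (frag_of f)"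
      using assms that by (auto simp: real_chains_def singular_chain_of)
    then show ?thesis
      using chain_boundary_boundary_alt[of p X "frag_of f"]
      by (simp flip: real_frag_of real_frag_boundary)
  qed
  then show ?thesis
    by (subst real_chain_expansion) (simp add: real_boundary_sum real_boundary_scale)
qed

subsection \<open>Passing from integral to real coefficients\<close>

lemma rat_common_denominator:
  fixes A :: "rat set"
  assumes "finite A"
  shows "\<exists>N::int. N > 0 \<and> (\<forall>q\<in>A. \<exists>k::int. of_int N * q = of_int k)"
  using assms
proof (induction A rule: finite_induct)
  case empty
  show ?case by (intro exI[of _ 1]) auto
next
  case (insert q A)
  then obtain N :: int where N: "N > 0" "\<And>r. r \<in> A \<Longrightarrow> \<exists>k::int. of_int N * r = of_int k" by blast
  obtain a b where ab: "quotient_of q = (a, b)" by fastforce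
  have b: "b > 0" and q: "q = of_int a / of_int b"
    using ab quotient_of_denom_pos quotient_of_div by blast+
  have "\<exists>k::int. of_int (N * b) * r = of_int k" if r: "r \<in> insert q A" for r
  proof (cases "r = q")
    case True
    then have "of_int (N * b) * r = of_int (N * a)" using q b by simp
    then show ?thesis by blast
  next
    case False
    then obtain k :: int where "of_int N * r = of_int k" using N(2) r by blast
    then have "of_int (N * b) * r = of_int (b * k)" by simp
    then show ?thesis by blast
  qed
  then show ?case using N(1) b by (intro exI[of _ "N * b"]) auto
qed

text \<open>The basis \<open>J\<close> of a rational vector space of reals contains \<open>1\<close>, so that an integral chain
  is recognised by its component at \<open>1\<close>.\<close>

lemma real_chain_decomposition:
  fixes c :: "'b \<Rightarrow>\<^sub>0 real"
  obtains J :: "real set" and N :: int and g :: "real \<Rightarrow> ('b \<Rightarrow>\<^sub>0 int)"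
  where "finite J" "1 \<in> J" "N > 0" "real_of_int N *\<^sub>R c = (\<Sum>b\<in>J. b *\<^sub>R real_frag (g b))"
    "\<And>b. keys (g b) \<subseteq> keys c"
    "\<And>k :: real \<Rightarrow> int. (\<Sum>b\<in>J. b * real_of_int (k b)) = 0 \<Longrightarrow> \<forall>b\<in>J. k b = 0"
proof -
  \<comment> \<open>The reals as a rational vector space. Only the span of 1 and the finitely many
    coefficients of \<open>c\<close> matters, which is why \<open>J\<close> can be finite.\<close>
  interpret rv: vector_space "\<lambda>(q::rat) (r::real). of_rat q * r"
    by unfold_locales (auto simp: algebra_simps of_rat_add of_rat_mult)
  define F where "F = lookup c ` keys c"
  have "rv.independent {1}" by simp
  then obtain J where J: "{1} \<subseteq> J" "J \<subseteq> insert 1 F" "rv.independent J" "insert 1 F \<subseteq> rv.span J"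
    using rv.maximal_independent_subset_extend[of "{1}" "insert 1 F"] by auto
  have finJ: "finite J" using J(2) by (rule finite_subset) (simp add: F_def)
  have "\<exists>q. r = (\<Sum>b\<in>J. of_rat (q b) * b)" if "r \<in> F" for r
    using that J(4) rv.span_finite[OF finJ] by auto
  then obtain q where q: "\<And>r. r \<in> F \<Longrightarrow> r = (\<Sum>b\<in>J. of_rat (q r b) * b)" by metis
  have "finite ((\<lambda>(r,b). q r b) ` (F \<times> J))" using finJ by (simp add: F_def)
  from rat_common_denominator[OF this]
  obtain N :: int where N: "N > 0" "\<forall>x\<in>(\<lambda>(r,b). q r b) ` (F \<times> J). \<exists>k::int. of_int N * x = of_int k"
    by (elim exE conjE)
  have "\<exists>k::int. of_int N * q r b = of_int k" if "r \<in> F" "b \<in> J" for r b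
    using N(2) that by force
  then obtain kk :: "real \<Rightarrow> real \<Rightarrow> int"
    where kk: "\<And>r b. r \<in> F \<Longrightarrow> b \<in> J \<Longrightarrow> of_int N * q r b = of_int (kk r b)" by metis
  define g where "g b = Poly_Mapping.map (\<lambda>r. kk r b) c" for b
  have lg: "lookup (g b) i = (if i \<in> keys c then kk (lookup c i) b else 0)" for b i
    by (simp add: g_def map.rep_eq when_def in_keys_iff)
  show thesis
  proof
    show "finite J" "1 \<in> J" "N > 0" using finJ J N by auto
    show "keys (g b) \<subseteq> keys c" for b
      by (auto simp: in_keys_iff lg split: if_splits)
    show "real_of_int N *\<^sub>R c = (\<Sum>b\<in>J. b *\<^sub>R real_frag (g b))"
    proof (rule poly_mapping_eqI)
      fix i
      show "lookup (real_of_int N *\<^sub>R c) i = lookup (\<Sum>b\<in>J. b *\<^sub>R real_frag (g b)) i"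
      proof (cases "i \<in> keys c")
        case True
        then have iF: "lookup c i \<in> F" by (simp add: F_def)
        have "real_of_int N * lookup c i = (\<Sum>b\<in>J. real_of_int N * (of_rat (q (lookup c i) b) * b))"
          by (subst q[OF iF]) (simp add: sum_distrib_left)
        also have "\<dots> = (\<Sum>b\<in>J. b * real_of_int (kk (lookup c i) b))"
        proof (rule sum.cong[OF refl])
          fix b assume b: "b \<in> J"
          have "real_of_int N * of_rat (q (lookup c i) b) = of_rat (of_int N * q (lookup c i) b)"
            by (simp add: of_rat_mult)
          also have "\<dots> = real_of_int (kk (lookup c i) b)" using kk[OF iF b] by simp
          finally show "real_of_int N * (of_rat (q (lookup c i) b) * b) = b * real_of_int (kk (lookup c i) b)"
            by (metis mult.assoc mult.commute)
        qed
        finally show ?thesis using True by (simp add: lookup_sum_apply lg)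
      qed (simp add: lookup_sum_apply lg in_keys_iff)
    qed
    fix k :: "real \<Rightarrow> int" assume k: "(\<Sum>b\<in>J. b * real_of_int (k b)) = 0"
    have "(\<Sum>b\<in>J. of_rat (of_int (k b)) * b) = 0" using k by (simp add: mult.commute)
    then have "\<forall>b\<in>J. (of_int (k b) :: rat) = 0"
      using rv.independentD[OF J(3) finJ order_refl, of "\<lambda>b. of_int (k b)"] by blast
    then show "\<forall>b\<in>J. k b = 0" by simp
  qed
qed

text \<open>Support conditions on the boundary pass to the integral summands: a simplex outside
  \<open>Q\<close> yields an integral relation between the elements of \<open>J\<close>, and these
  are independent. With \<open>Q\<close> empty, a real cycle becomes a combination of integral
  cycles.\<close>

lemma real_chain_integral_combination:
  assumes c: "c \<in> real_chains p X" "keys (real_boundary p c) \<subseteq> Q"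
  obtains J :: "real set" and r :: "real \<Rightarrow> real" and g where "finite J" "c = (\<Sum>b\<in>J. r b *\<^sub>R real_frag (g b))"
    "\<And>b. b \<in> J \<Longrightarrow> singular_chain p X (g b)" "\<And>b. b \<in> J \<Longrightarrow> keys (chain_boundary p (g b)) \<subseteq> Q"
proof -
  obtain J N g where J: "finite J" "1 \<in> J" and N: "N > 0"
    and Nc: "real_of_int N *\<^sub>R c = (\<Sum>b\<in>J. b *\<^sub>R real_frag (g b))"
    and g: "\<And>b. keys (g b) \<subseteq> keys c"
    and ind: "\<And>k :: real \<Rightarrow> int. (\<Sum>b\<in>J. b * real_of_int (k b)) = 0 \<Longrightarrow> \<forall>b\<in>J. k b = 0"
    using real_chain_decomposition[of c] by blast
  have gc: "singular_chain p X (g b)" for b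
    using g[of b] c(1) by (auto simp: singular_chain_def real_chains_def)
  have gQ: "keys (chain_boundary p (g b)) \<subseteq> Q" if b: "b \<in> J" for b
  proof
    fix s assume s: "s \<in> keys (chain_boundary p (g b))"
    show "s \<in> Q"
    proof (rule ccontr)
      assume "s \<notin> Q"
      then have "lookup (real_boundary p c) s = 0" using c(2) by (auto simp: in_keys_iff)
      then have "lookup (real_boundary p (real_of_int N *\<^sub>R c)) s = 0"
        by (simp add: real_boundary_scale)
      then have "(\<Sum>b\<in>J. b * real_of_int (lookup (chain_boundary p (g b)) s)) = 0"
        unfolding Nc by (simp add: real_boundary_sum real_boundary_scale lookup_sum_apply
            real_frag_boundary[symmetric])
      then have "lookup (chain_boundary p (g b)) s = 0"
        using ind[of "\<lambda>b. lookup (chain_boundary p (g b)) s"] b by blast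
      then show False using s by (simp add: in_keys_iff)
    qed
  qed
  have "c = (1 / real_of_int N) *\<^sub>R (\<Sum>b\<in>J. b *\<^sub>R real_frag (g b))"
    unfolding Nc[symmetric] using N by simp
  then have "c = (\<Sum>b\<in>J. (b / real_of_int N) *\<^sub>R real_frag (g b))"
    by (simp add: scaleR_sum_right)
  from that[OF J(1) this gc gQ] show thesis .
qed

text \<open>Exactness up to supports is inherited by real coefficients. The sets \<open>P\<close>
  and \<open>Q\<close> let one statement serve absolute cycles, chains subordinate to a cover, and
  chains relative to a subspace.\<close>

lemma real_chain_transfer:
  assumes int: "\<And>c. singular_chain p X c \<Longrightarrow> keys (chain_boundary p c) \<subseteq> Q \<Longrightarrow>
      \<exists>y. singular_chain (Suc p) X y \<and> keys (c - chain_boundary (Suc p) y) \<subseteq> P"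
    and c: "c \<in> real_chains p X" "keys (real_boundary p c) \<subseteq> Q"
  obtains y where "y \<in> real_chains (Suc p) X" "keys (c - real_boundary (Suc p) y) \<subseteq> P"
proof -
  obtain J :: "real set" and r g where J: "finite J" "c = (\<Sum>b\<in>J. r b *\<^sub>R real_frag (g b))"
    and gc: "\<And>b. b \<in> J \<Longrightarrow> singular_chain p X (g b)"
    and gQ: "\<And>b. b \<in> J \<Longrightarrow> keys (chain_boundary p (g b)) \<subseteq> Q"
    by (rule real_chain_integral_combination[OF c]) (rule that)
  obtain y where y: "\<And>b. b \<in> J \<Longrightarrow> singular_chain (Suc p) X (y b)"
      "\<And>b. b \<in> J \<Longrightarrow> keys (g b - chain_boundary (Suc p) (y b)) \<subseteq> P"
    using int[OF gc gQ] by metis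
  define w where "w = (\<Sum>b\<in>J. r b *\<^sub>R real_frag (y b))"
  show thesis
  proof
    show "w \<in> real_chains (Suc p) X"
      unfolding w_def using y(1)
      by (intro subspace_scale subspace_sum subspace_real_chains) (auto simp: singular_chain_real_frag)
    have "c - real_boundary (Suc p) w = (\<Sum>b\<in>J. r b *\<^sub>R real_frag (g b - chain_boundary (Suc p) (y b)))"
      by (simp add: J(2) w_def real_boundary_sum real_boundary_scale real_frag_diff
          real_frag_boundary scaleR_diff_right sum_subtractf)
    moreover have "\<dots> \<in> {c. keys c \<subseteq> P}"
      using y(2) by (intro subspace_scale subspace_sum subspace_keys) auto
    ultimately show "keys (c - real_boundary (Suc p) w) \<subseteq> P" by simp
  qed
qed

text \<open>An integral cycle that bounds over the reals is torsion in integral homology: in a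
  decomposition of \<open>w\<close>, the component at the basis element 1 has boundary
  \<open>N\<close> times \<open>z\<close>.\<close>

lemma integral_multiple_boundary:
  assumes z: "real_boundary (Suc p) w = real_frag z" and w: "w \<in> real_chains (Suc p) X"
  obtains N :: int and y where "N > 0" "singular_chain (Suc p) X y"
    "chain_boundary (Suc p) y = frag_cmul N z"
proof -
  obtain J N g where J: "finite J" "1 \<in> J" and N: "N > 0"
    and Nc: "real_of_int N *\<^sub>R w = (\<Sum>b\<in>J. b *\<^sub>R real_frag (g b))"
    and g: "\<And>b. keys (g b) \<subseteq> keys w"
    and ind: "\<And>k :: real \<Rightarrow> int. (\<Sum>b\<in>J. b * real_of_int (k b)) = 0 \<Longrightarrow> \<forall>b\<in>J. k b = 0"
    using real_chain_decomposition[of w] by blast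
  have gc: "singular_chain (Suc p) X (g b)" for b
    using g[of b] w by (auto simp: singular_chain_def real_chains_def)
  have "lookup (chain_boundary (Suc p) (g 1)) s = N * lookup z s" for s
  proof -
    \<comment> \<open>The boundary of \<open>N\<close> times \<open>w\<close> is integral, so as a
      combination of \<open>J\<close> it is concentrated at 1. \<open>k\<close> is the difference of
      the two expansions at the simplex \<open>s\<close>, and independence makes it vanish.\<close>
    define k where "k b = lookup (chain_boundary (Suc p) (g b)) s - (if b = 1 then N * lookup z s else 0)" for b
    have "real_boundary (Suc p) (real_of_int N *\<^sub>R w) = (\<Sum>b\<in>J. b *\<^sub>R real_frag (chain_boundary (Suc p) (g b)))"
      unfolding Nc by (simp add: real_boundary_sum real_boundary_scale real_frag_boundary)
    then have "real_of_int N *\<^sub>R real_frag z = (\<Sum>b\<in>J. b *\<^sub>R real_frag (chain_boundary (Suc p) (g b)))"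
      using z by (simp add: real_boundary_scale)
    then have "real_of_int N * real_of_int (lookup z s) = (\<Sum>b\<in>J. b * real_of_int (lookup (chain_boundary (Suc p) (g b)) s))"
      by (metis (mono_tags, lifting) lookup_real_frag lookup_scaleR lookup_sum_apply real_scaleR_def sum.cong)
    moreover have "(\<Sum>b\<in>J. b * real_of_int (if b = 1 then N * lookup z s else 0)) = real_of_int N * real_of_int (lookup z s)"
    proof -
      have "(\<Sum>b\<in>J. b * real_of_int (if b = 1 then N * lookup z s else 0))
          = (\<Sum>b\<in>J. if b = 1 then real_of_int (N * lookup z s) else 0)"
        by (intro sum.cong) auto
      then show ?thesis using J by (simp add: sum.delta)
    qed
    ultimately have "(\<Sum>b\<in>J. b * real_of_int (k b)) = 0"
      by (simp add: k_def right_diff_distrib sum_subtractf)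
    then have "k 1 = 0" using ind J(2) by blast
    then show ?thesis by (simp add: k_def)
  qed
  then have "chain_boundary (Suc p) (g 1) = frag_cmul N z"
    by (intro poly_mapping_eqI) simp
  then show thesis using that N gc by blast
qed

subsection \<open>Chains in subspaces\<close>

abbreviation "RC p U \<equiv> real_chains p (top_of_set U)"

lemma singular_simplex_top_of_set:
  "singular_simplex p (top_of_set U) f \<longleftrightarrow> singular_simplex p euclidean f \<and> f ` standard_simplex p \<subseteq> U"
  by (rule singular_simplex_subtopology)

lemma RC_mono: "U \<subseteq> V \<Longrightarrow> c \<in> RC p U \<Longrightarrow> c \<in> RC p V"
  unfolding real_chains_def singular_simplex_top_of_set by auto

lemma RC_Int: "c \<in> RC p U \<Longrightarrow> c \<in> RC p V \<Longrightarrow> c \<in> RC p (U \<inter> V)"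
  unfolding real_chains_def singular_simplex_top_of_set by (simp add: subset_iff)

lemmas RC_zero [simp] = subspace_0[OF subspace_real_chains]
  and RC_add = subspace_add[OF subspace_real_chains]
  and RC_diff = subspace_diff[OF subspace_real_chains]
  and RC_scale = subspace_scale[OF subspace_real_chains]
  and RC_neg = subspace_neg[OF subspace_real_chains]
  and RC_sum = subspace_sum[OF subspace_real_chains]

lemma RC_empty: "c \<in> RC p {} \<Longrightarrow> c = 0"
  using singular_simplex_empty[of "top_of_set {}" p] keys_eq_empty[of c] by (fastforce simp: real_chains_def simp del: keys_eq_empty)

section \<open>Augmentation and reduced homology\<close>

definition coeff_sum :: "('b \<Rightarrow>\<^sub>0 real) \<Rightarrow> real" where
  "coeff_sum c = (\<Sum>f\<in>keys c. lookup c f)"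

lemma linear_coeff_sum: "linear coeff_sum"
  using linear_extension[of "\<lambda>_. 1::real"] by (simp add: coeff_sum_def[abs_def])

lemma coeff_sum_single [simp]: "coeff_sum (Poly_Mapping.single f r) = r"
  by (simp add: coeff_sum_def)

lemma coeff_sum_boundary: "coeff_sum (real_boundary (Suc 0) c) = 0"
  by (simp add: real_boundary_def linear_sum[OF linear_coeff_sum] linear_scale[OF linear_coeff_sum]
      linear_add[OF linear_coeff_sum])

text \<open>\<open>real_boundary 0\<close> is zero rather than the augmentation, so the latter is
  imposed separately in degree 0.\<close>

definition reduced_cycles :: "nat \<Rightarrow> 'a topology \<Rightarrow> 'a real_chain set" where
  "reduced_cycles p X = {c \<in> real_cycles p X. p = 0 \<longrightarrow> coeff_sum c = 0}"

lemma reduced_cycles_iff: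
  "c \<in> reduced_cycles p X \<longleftrightarrow> c \<in> real_chains p X \<and> real_boundary p c = 0 \<and> (p = 0 \<longrightarrow> coeff_sum c = 0)"
  by (auto simp: reduced_cycles_def real_cycles_def)

lemma boundary_in_reduced_cycles:
  "c \<in> real_chains (Suc p) X \<Longrightarrow> real_boundary (Suc p) c \<in> reduced_cycles p X"
  by (auto simp: reduced_cycles_iff real_boundary_in_chains_Suc real_boundary_boundary coeff_sum_boundary)

lemma subspace_reduced_cycles: "subspace (reduced_cycles p X)"
proof (rule subspaceI)
  show "0 \<in> reduced_cycles p X" by (simp add: reduced_cycles_iff subspace_0[OF subspace_real_chains] linear_0[OF linear_coeff_sum])
  show "x + y \<in> reduced_cycles p X" if "x \<in> reduced_cycles p X" "y \<in> reduced_cycles p X" for x y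
    using that by (simp add: reduced_cycles_iff RC_add real_boundary_add linear_add[OF linear_coeff_sum])
  show "r *\<^sub>R x \<in> reduced_cycles p X" if "x \<in> reduced_cycles p X" for r x
    using that by (simp add: reduced_cycles_iff RC_scale real_boundary_scale linear_scale[OF linear_coeff_sum])
qed

lemma subspace_real_boundaries: "subspace (real_boundaries p X)"
  unfolding real_boundaries_def by (rule linear_subspace_image[OF linear_real_boundary subspace_real_chains])

text \<open>Vanishing of reduced homology. The empty set qualifies, since its chains are zero; a
  point of the set has to be supplied separately where one is wanted.\<close>

definition acyclic_set :: "'a::topological_space set \<Rightarrow> bool" where
  "acyclic_set U \<longleftrightarrow> (\<forall>p. \<forall>c\<in>reduced_cycles p (top_of_set U). \<exists>y\<in>RC (Suc p) U. real_boundary (Suc p) y = c)"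

lemma small_chains:
  assumes U: "openin (top_of_set (U \<union> V)) U" and V: "openin (top_of_set (U \<union> V)) V"
    and c: "c \<in> RC p (U \<union> V)" and bd: "real_boundary p c = a + b" "a \<in> RC (p - 1) U" "b \<in> RC (p - 1) V"
  obtains y c1 c2 where "y \<in> RC (Suc p) (U \<union> V)" "c = real_boundary (Suc p) y + c1 + c2"
    "c1 \<in> RC p U" "c2 \<in> RC p V"
proof -
  let ?W = "top_of_set (U \<union> V)"
  let ?S = "\<lambda>p. singular_simplex_set p (top_of_set U) \<union> singular_simplex_set p (top_of_set V)"
  have int: "\<exists>y. singular_chain (Suc p) ?W y \<and> keys (d - chain_boundary (Suc p) y) \<subseteq> ?S p"
    if d: "singular_chain p ?W d" and bd: "keys (chain_boundary p d) \<subseteq> ?S (p - 1)" for d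
  proof -
    obtain n where n: "\<And>m f. \<lbrakk>n \<le> m; f \<in> keys ((singular_subdivision p ^^ m) d)\<rbrakk>
                            \<Longrightarrow> \<exists>T \<in> {U, V}. f \<in> (standard_simplex p) \<rightarrow> T"
      by (rule sufficient_iterated_singular_subdivision_exists[of "{U,V}" ?W p d]) (use U V d in auto)
    obtain h where h0: "\<And>p. h p 0 = (0 :: 'a chain)"
        and hd: "\<And>p c1 c2. h p (c1-c2) = h p c1 - h p c2"
        and hc: "\<And>p X c. singular_chain p X c \<Longrightarrow> singular_chain (Suc p) X (h p c)"
        and hb: "\<And>p X c. singular_chain p X c
                 \<Longrightarrow> chain_boundary (Suc p) (h p c) + h (p - Suc 0) (chain_boundary p c)
                   = (singular_subdivision p ^^ n) c - c"
      using chain_homotopic_iterated_singular_subdivision[where n = n] by metis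
    have sd: "singular_chain p ?W ((singular_subdivision p ^^ k) d)" for k
      by (induction k) (auto simp: d singular_chain_singular_subdivision)
    have k1: "keys ((singular_subdivision p ^^ n) d) \<subseteq> ?S p"
    proof
      fix f assume f: "f \<in> keys ((singular_subdivision p ^^ n) d)"
      then have "singular_simplex p ?W f" using sd[of n] by (auto simp: singular_chain_def)
      then show "f \<in> ?S p"
        using n[OF order_refl f] by (auto simp: singular_simplex_top_of_set)
    qed
    \<comment> \<open>Naturality: \<open>h\<close> keeps the two parts of the boundary inside
      \<open>U\<close> and \<open>V\<close>. In degree 0 the subtraction is truncated, but there the
      boundary is zero.\<close>
    have k2: "keys (h (p - 1) (chain_boundary p d)) \<subseteq> ?S p"
    proof (cases "p = 0")
      case True
      then show ?thesis by (simp add: chain_boundary_def h0)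
    next
      case False
      obtain e1 e2 where e: "keys e1 \<subseteq> singular_simplex_set (p - 1) (top_of_set U)"
          "keys e2 \<subseteq> singular_simplex_set (p - 1) (top_of_set V)" "e1 + e2 = chain_boundary p d"
        using frag_split[OF bd] by metis
      have hneg: "h q (- x) = - h q x" for q x
        using hd[of q 0 x] h0 by simp
      have "h (p - 1) (chain_boundary p d) = h (p - 1) e1 - h (p - 1) (- e2)"
        using hd[of "p - 1" e1 "- e2"] e(3) by simp
      then have eq: "h (p - 1) (chain_boundary p d) = h (p - 1) e1 + h (p - 1) e2"
        by (simp add: hneg)
      have "keys (h (p - 1) e1) \<subseteq> singular_simplex_set p (top_of_set U)"
        using hc[of "p - 1" "top_of_set U" e1] e(1) False by (simp add: singular_chain_def)
      moreover have "keys (h (p - 1) e2) \<subseteq> singular_simplex_set p (top_of_set V)"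
        using hc[of "p - 1" "top_of_set V" e2] e(2) False by (simp add: singular_chain_def)
      ultimately show ?thesis
        unfolding eq using keys_add[of "h (p - 1) e1" "h (p - 1) e2"] by blast
    qed
    have "d - chain_boundary (Suc p) (- h p d) = (singular_subdivision p ^^ n) d - h (p - 1) (chain_boundary p d)"
      using hb[OF d] by (simp add: chain_boundary_minus algebra_simps)
    then have "keys (d - chain_boundary (Suc p) (- h p d)) \<subseteq> ?S p"
      using order_trans[OF keys_diff Un_least[OF k1 k2]] by (simp only:)
    moreover have "singular_chain (Suc p) ?W (- h p d)" using hc[OF d] by (simp add: singular_chain_minus)
    ultimately show ?thesis by (intro exI[of _ "- h p d"] conjI)
  qed
  have bdk: "keys (real_boundary p c) \<subseteq> ?S (p - 1)"
    unfolding bd(1) using keys_add[of a b] bd(2,3) by (auto simp: real_chains_def)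
  obtain y where y: "y \<in> RC (Suc p) (U \<union> V)" "keys (c - real_boundary (Suc p) y) \<subseteq> ?S p"
    by (rule real_chain_transfer[OF int c bdk]) (assumption | rule that)+
  obtain c1 c2 where "c - real_boundary (Suc p) y = c1 + c2"
      "keys c1 \<subseteq> singular_simplex_set p (top_of_set U)" "keys c2 \<subseteq> singular_simplex_set p (top_of_set V)"
    using keys_subset_split[OF y(2)] by blast
  then show thesis
    using that[of y c1 c2] y(1) by (simp add: real_chains_def algebra_simps)
qed

text \<open>Splitting \<open>w\<close> over the two sets moves \<open>u\<close> and
  \<open>v\<close>, without changing their boundary, onto one and the same chain; lying in both
  sets, it lies in the intersection.\<close>

lemma Mayer_Vietoris_bounding:
  assumes U: "openin (top_of_set (U \<union> V)) U" and V: "openin (top_of_set (U \<union> V)) V"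
    and u: "u \<in> RC (Suc p) U" and v: "v \<in> RC (Suc p) V"
    and eq: "real_boundary (Suc p) u = real_boundary (Suc p) v"
    and w: "w \<in> RC (Suc (Suc p)) (U \<union> V)" "real_boundary (Suc (Suc p)) w = u - v"
  obtains y where "y \<in> RC (Suc p) (U \<inter> V)" "real_boundary (Suc p) y = real_boundary (Suc p) u"
proof -
  obtain x w1 w2 where x: "x \<in> RC (Suc (Suc (Suc p))) (U \<union> V)"
     "w = real_boundary (Suc (Suc (Suc p))) x + w1 + w2"
     and w1: "w1 \<in> RC (Suc (Suc p)) U" and w2: "w2 \<in> RC (Suc (Suc p)) V"
    by (rule small_chains[OF U V w(1), of u "- v"]) (use w(2) u v RC_neg in auto)
  have e: "u - v = real_boundary (Suc (Suc p)) w1 + real_boundary (Suc (Suc p)) w2"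
    using w(2) unfolding x(2) by (simp add: real_boundary_add real_boundary_boundary[OF x(1)])
  define y where "y = u - real_boundary (Suc (Suc p)) w1"
  have y2: "y = v + real_boundary (Suc (Suc p)) w2"
    using e by (simp add: y_def algebra_simps)
  show thesis
  proof
    show "y \<in> RC (Suc p) (U \<inter> V)"
    proof (rule RC_Int)
      show "y \<in> RC (Suc p) U" unfolding y_def by (intro RC_diff u real_boundary_in_chains_Suc w1)
      show "y \<in> RC (Suc p) V" unfolding y2 by (intro RC_add v real_boundary_in_chains_Suc w2)
    qed
    show "real_boundary (Suc p) y = real_boundary (Suc p) u"
      by (simp add: y_def real_boundary_diff real_boundary_boundary[OF w1])
  qed
qed

subsection \<open>Acyclic spaces and spheres\<close>

lemma trivial_homology_group_imp_boundary:
  assumes "trivial_group (homology_group (int p) X)" "singular_relcycle p X {} c"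
  obtains y where "singular_chain (Suc p) X y" "chain_boundary (Suc p) y = c"
proof -
  have "homologous_rel_set p X {} c \<in> carrier (homology_group (int p) X)"
    using assms(2) by (auto simp: carrier_relative_homology_group)
  then have "homologous_rel_set p X {} c = singular_relboundary_set p X {}"
    using assms(1) by (simp add: trivial_group_def)
  then have "singular_relboundary p X {} c"
    by (simp only: homologous_rel_set_eq_relboundary)
  then show thesis using that by (auto simp: singular_boundary)
qed

lemma trivial_homology_group_real_boundary:
  assumes "trivial_group (homology_group (int p) X)" "c \<in> real_cycles p X"
  obtains y where "y \<in> real_chains (Suc p) X" "real_boundary (Suc p) y = c"
proof -
  obtain y where "y \<in> real_chains (Suc p) X" "keys (c - real_boundary (Suc p) y) \<subseteq> {}"
  proof (rule real_chain_transfer[of p X "{}" "{}" c])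
    fix d assume d: "singular_chain p X d" "keys (chain_boundary p d) \<subseteq> {}"
    then have "singular_relcycle p X {} d" by (simp add: singular_cycle)
    then obtain y where "singular_chain (Suc p) X y" "chain_boundary (Suc p) y = d"
      using trivial_homology_group_imp_boundary[OF assms(1)] by blast
    then show "\<exists>y. singular_chain (Suc p) X y \<and> keys (d - chain_boundary (Suc p) y) \<subseteq> {}" by auto
  qed (use assms(2) in \<open>auto simp: real_cycles_def\<close>)
  then show thesis using that by auto
qed

text \<open>Every point is homologous to one fixed point, so a 0-chain is homologous to its
  coefficient sum times that point.\<close>

lemma path_connected_real_boundary_0:
  assumes X: "path_connected_space X" and c: "c \<in> reduced_cycles 0 X"
  obtains y where "y \<in> real_chains 1 X" "real_boundary 1 y = c"
proof (cases "keys c = {}")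
  case True
  then show thesis using that[of 0] by (simp add: subspace_0[OF subspace_real_chains])
next
  case False
  then obtain f0 where f0: "f0 \<in> keys c" by blast
  have ss: "singular_simplex 0 X f" if "f \<in> keys c" for f
    using c that by (auto simp: reduced_cycles_iff real_chains_def)
  have "\<exists>y. y \<in> real_chains 1 X \<and> real_boundary 1 y = Poly_Mapping.single f 1 - Poly_Mapping.single f0 1"
    if f: "f \<in> keys c" for f
  proof -
    obtain d where "singular_chain (Suc 0) X d" "chain_boundary (Suc 0) d = frag_of f - frag_of f0"
      using iso_integer_zeroth_homology_group_aux[OF X ss[OF f] ss[OF f0]]
      by (auto simp: homologous_rel_def singular_boundary)
    then have "real_frag d \<in> real_chains 1 X"
      "real_boundary 1 (real_frag d) = Poly_Mapping.single f 1 - Poly_Mapping.single f0 1"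
      by (auto simp: singular_chain_real_frag real_frag_diff real_frag_of simp flip: real_frag_boundary)
    then show ?thesis by blast
  qed
  then obtain Y where Y: "\<And>f. f \<in> keys c \<Longrightarrow> Y f \<in> real_chains 1 X"
     "\<And>f. f \<in> keys c \<Longrightarrow> real_boundary 1 (Y f) = Poly_Mapping.single f 1 - Poly_Mapping.single f0 1"
    by metis
  define y where "y = (\<Sum>f\<in>keys c. lookup c f *\<^sub>R Y f)"
  show thesis
  proof
    show "y \<in> real_chains 1 X" unfolding y_def
      by (intro subspace_sum subspace_scale subspace_real_chains) (use Y in auto)
    have "real_boundary 1 y = (\<Sum>f\<in>keys c. lookup c f *\<^sub>R (Poly_Mapping.single f 1 - Poly_Mapping.single f0 1))"
      unfolding y_def by (simp add: real_boundary_sum real_boundary_scale Y(2)[simplified])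
    also have "\<dots> = c - coeff_sum c *\<^sub>R Poly_Mapping.single f0 1"
      using real_chain_expansion[of c]
      by (simp add: scaleR_diff_right sum_subtractf coeff_sum_def scaleR_sum_left)
    finally show "real_boundary 1 y = c" using c by (simp add: reduced_cycles_iff)
  qed
qed

lemma contractible_space_real_boundary:
  assumes "contractible_space X" "c \<in> reduced_cycles p X"
  obtains y where "y \<in> real_chains (Suc p) X" "real_boundary (Suc p) y = c"
proof (cases "p = 0")
  case True
  then show thesis
    using path_connected_real_boundary_0[OF contractible_imp_path_connected_space[OF assms(1)]] assms(2) that
    by auto
next
  case False
  have "trivial_group (homology_group (int p) X)"
    using trivial_reduced_homology_group_contractible_space[OF assms(1), of p] False
    by (simp add: un_reduced_homology_group)
  then show thesis
    using trivial_homology_group_real_boundary assms(2) that by (auto simp: reduced_cycles_def)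
qed

lemma contractible_imp_acyclic_set: "contractible_space (top_of_set U) \<Longrightarrow> acyclic_set U"
  unfolding acyclic_set_def using contractible_space_real_boundary by blast

text \<open>The segment from a point \<open>q\<close> other than \<open>a\<close> to the antipode of
  \<open>a\<close> avoids the closed ray spanned by \<open>a\<close>; radial projection turns it
  into a path on the sphere that misses \<open>a\<close>.\<close>

lemma contractible_space_punctured_nsphere:
  assumes a: "a \<in> topspace (nsphere n)"
  shows "contractible_space (subtopology (nsphere n) (- {a}))"
proof -
  let ?N = "\<lambda>x::nat \<Rightarrow> real. sqrt (\<Sum>j\<le>n. x j ^ 2)"
  let ?g = "\<lambda>x i. x i / ?N x"
  let ?h = "\<lambda>(t,q) i. (1 - t) * q i - t * a i"
  \<comment> \<open>Vectors off the closed ray spanned by \<open>a\<close>: exactly where radial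
    projection is defined and misses \<open>a\<close>.\<close>
  let ?Y = "subtopology (Euclidean_space (Suc n)) {x. (\<exists>i\<le>n. x i \<noteq> 0) \<and> (\<forall>r\<ge>0. \<exists>i\<le>n. x i \<noteq> r * a i)}"
  have a1: "(\<Sum>i\<le>n. (a i)\<^sup>2) = 1" "\<And>i. i > n \<Longrightarrow> a i = 0"
    using a by (auto simp: nsphere)
  have ray: "x = a" if x: "(\<Sum>i\<le>n. (x i)\<^sup>2) = 1" "\<forall>i>n. x i = 0" and r: "r \<ge> 0" "\<And>i. i \<le> n \<Longrightarrow> x i = r * a i" for x r
  proof -
    have "(\<Sum>i\<le>n. (x i)\<^sup>2) = (\<Sum>i\<le>n. r\<^sup>2 * (a i)\<^sup>2)"
      using r(2) by (intro sum.cong) (auto simp: power_mult_distrib)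
    also have "\<dots> = r\<^sup>2" using a1 by (simp flip: sum_distrib_left)
    finally have "r = 1" using x r(1) by (simp add: power2_eq_1_iff)
    then show "x = a" using r(2) x(2) a1(2) by (metis ext linorder_not_less mult_1)
  qed
  \<comment> \<open>Meeting the ray would put \<open>x\<close> itself on it, and a unit vector on
    the ray is \<open>a\<close>. The case \<open>r = 0\<close> says that the segment avoids the
    origin.\<close>
  have Yn: "\<exists>i\<le>n. (1 - t) * x i - t * a i \<noteq> r * a i"
    if x: "(\<Sum>i\<le>n. (x i)\<^sup>2) = 1" "\<forall>i>n. x i = 0" "x \<noteq> a" and t: "0 \<le> t" "t \<le> 1" and r: "r \<ge> 0" for x t r
  proof (rule ccontr)
    assume "\<not> ?thesis"
    then have eq: "\<And>i. i \<le> n \<Longrightarrow> (1 - t) * x i = (t + r) * a i" by (auto simp: algebra_simps)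
    show False
    proof (cases "t = 1")
      case True
      then have "\<And>i. i \<le> n \<Longrightarrow> a i = 0" using eq r by auto
      then show False using a1(1) by simp
    next
      case False
      then have "\<And>i. i \<le> n \<Longrightarrow> x i = ((t + r) / (1 - t)) * a i"
        using eq by (simp add: field_simps)
      then show False using ray[OF x(1,2), of "(t + r) / (1 - t)"] t r x(3) by auto
    qed
  qed
  have "continuous_map (prod_topology (top_of_set {0..1}) (subtopology (nsphere n) (- {a})))
                       (subtopology (nsphere n) (- {a})) (?g \<circ> ?h)"
  proof (rule continuous_map_compose)
    have im: "?h tq \<in> {x. (\<exists>i\<le>n. x i \<noteq> 0) \<and> (\<forall>r\<ge>0. \<exists>i\<le>n. x i \<noteq> r * a i)}"
      if tq: "tq \<in> topspace (prod_topology (top_of_set {0..1}) (subtopology (nsphere n) (- {a})))" for tq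
    proof -
      obtain t q where tq': "tq = (t, q)" by fastforce
      have "(\<Sum>i\<le>n. (q i)\<^sup>2) = 1" "\<forall>i>n. q i = 0" "q \<noteq> a" "0 \<le> t" "t \<le> 1"
        using tq by (auto simp: tq' nsphere)
      then have *: "\<exists>i\<le>n. (1 - t) * q i - t * a i \<noteq> r * a i" if "r \<ge> 0" for r using Yn that by blast
      then show ?thesis using *[of 0] by (auto simp: tq')
    qed
    have cont: "continuous_map (prod_topology (top_of_set {0..1}) (subtopology (nsphere n) (- {a}))) (Euclidean_space (Suc n)) ?h"
      unfolding Euclidean_space_def continuous_map_in_subtopology
    proof (intro conjI)
      show "continuous_map (prod_topology (top_of_set {0..1}) (subtopology (nsphere n) (- {a}))) (powertop_real UNIV) ?h"
        unfolding continuous_map_componentwise_UNIV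
      proof
        fix k
        have 1: "continuous_map (prod_topology (top_of_set {0..1}) (subtopology (nsphere n) (- {a}))) euclideanreal (\<lambda>x. fst x)"
          using continuous_map_fst[of "top_of_set {0..1::real}" "subtopology (nsphere n) (- {a})"]
          by (simp add: continuous_map_in_subtopology)
        have "continuous_map (subtopology (nsphere n) (- {a})) euclideanreal (\<lambda>x. x k)"
          by (intro continuous_map_from_subtopology continuous_map_nsphere_projection)
        then have 2: "continuous_map (prod_topology (top_of_set {0..1}) (subtopology (nsphere n) (- {a}))) euclideanreal (\<lambda>x. snd x k)"
          using continuous_map_compose[OF continuous_map_snd] by (fastforce simp: o_def)
        show "continuous_map (prod_topology (top_of_set {0..1}) (subtopology (nsphere n) (- {a}))) euclideanreal (\<lambda>x. ?h x k)"
          unfolding case_prod_unfold by (intro continuous_intros 1 2)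
      qed
      show "?h \<in> topspace (prod_topology (top_of_set {0..1}) (subtopology (nsphere n) (- {a}))) \<rightarrow> {x. \<forall>i\<ge>Suc n. x i = 0}"
        using a1(2) by (auto simp: nsphere)
    qed
    show "continuous_map (prod_topology (top_of_set {0..1}) (subtopology (nsphere n) (- {a}))) ?Y ?h"
      unfolding continuous_map_in_subtopology[of _ "Euclidean_space (Suc n)"] using cont im by blast
  next
    have 1: "(\<Sum>i\<le>n. (x i / ?N x)\<^sup>2) = 1" if "i \<le> n" "x i \<noteq> 0" for x i
      using that by (force simp: sum_nonneg sum_nonneg_eq_0_iff field_split_simps simp flip: sum_divide_distrib)
    have cm: "continuous_map ?Y (nsphere n) ?g"
      unfolding Euclidean_space_def nsphere subtopology_subtopology continuous_map_in_subtopology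
    proof (intro continuous_intros conjI)
      show "continuous_map
               (subtopology (powertop_real UNIV) ({x. \<forall>i\<ge>Suc n. x i = 0} \<inter> {x. (\<exists>i\<le>n. x i \<noteq> 0) \<and> (\<forall>r\<ge>0. \<exists>i\<le>n. x i \<noteq> r * a i)}))
               (powertop_real UNIV) ?g"
        unfolding continuous_map_componentwise
        by (intro continuous_intros conjI ballI) (auto simp: sum_nonneg_eq_0_iff)
    qed (auto simp: 1)
    have "?g x \<noteq> a" if x: "\<exists>i\<le>n. x i \<noteq> 0" "\<forall>r\<ge>0. \<exists>i\<le>n. x i \<noteq> r * a i" for x
    proof
      assume g: "?g x = a"
      have N: "?N x > 0"
        using x(1) by (metis (no_types, lifting) atMost_iff finite_atMost linorder_not_less order_le_imp_less_or_eq real_sqrt_eq_zero_cancel_iff real_sqrt_ge_0_iff sum_nonneg sum_nonneg_eq_0_iff zero_eq_power2 zero_le_power2)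
      have "x i = ?N x * a i" for i using fun_cong[OF g, of i] N by (simp add: field_simps)
      then show False using x(2) N by (metis less_imp_le)
    qed
    then show "continuous_map ?Y (subtopology (nsphere n) (- {a})) ?g"
      unfolding continuous_map_in_subtopology using cm by auto
  qed
  moreover have "(?g \<circ> ?h) (0, x) = x" if "x \<in> topspace (subtopology (nsphere n) (- {a}))" for x
    using that by (simp add: nsphere)
  moreover have "(?g \<circ> ?h) (1, x) = (\<lambda>i. - a i)" for x
    using a1 by simp
  ultimately show ?thesis
    apply (simp add: contractible_space_def homotopic_with)
    apply (rule_tac x="\<lambda>i. - a i" in exI)
    apply (rule_tac x="?g \<circ> ?h" in exI, force)
    done
qed

lemma contractible_space_punctured_sphere:
  assumes hom: "top_of_set X homeomorphic_space nsphere m" and x: "x \<in> X"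
  shows "contractible_space (top_of_set (X - {x}))"
proof -
  obtain f where f: "homeomorphic_map (top_of_set X) (nsphere m) f"
    using hom homeomorphic_space by blast
  have fx: "f x \<in> topspace (nsphere m)"
    using homeomorphic_imp_surjective_map[OF f] x by auto
  have inj: "inj_on f X" using homeomorphic_imp_injective_map[OF f] by simp
  have "homeomorphic_map (subtopology (top_of_set X) (X - {x})) (subtopology (nsphere m) (- {f x})) f"
  proof (rule homeomorphic_map_subtopologies_alt[OF f])
    fix y assume "y \<in> topspace (top_of_set X)"  "f y \<in> topspace (nsphere m)"
    then show "f y \<in> - {f x} \<longleftrightarrow> y \<in> X - {x}" using inj x by (auto simp: inj_on_def)
  qed
  then have "top_of_set (X - {x}) homeomorphic_space subtopology (nsphere m) (- {f x})"
    using homeomorphic_map_imp_homeomorphic_space by (fastforce simp: subtopology_subtopology Int_absorb1)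
  then show ?thesis
    using homeomorphic_space_contractibility contractible_space_punctured_nsphere[OF fx] by blast
qed

text \<open>Two points lie in a common punctured sphere, which is contractible: among three distinct
  points one differs from both and can be removed.\<close>

lemma path_connected_space_nsphere:
  assumes "m \<ge> 1"
  shows "path_connected_space (nsphere m)"
  unfolding path_connected_space_def
proof (intro ballI)
  fix p q assume pq: "p \<in> topspace (nsphere m)" "q \<in> topspace (nsphere m)"
  define e0 e1 :: "nat \<Rightarrow> real" where "e0 = (\<lambda>i. if i = 0 then 1 else 0)" and "e1 = (\<lambda>i. if i = 1 then 1 else 0)"
  define e2 :: "nat \<Rightarrow> real" where "e2 = (\<lambda>i. if i = 0 then -1 else 0)"
  have "e0 \<in> topspace (nsphere m)" "e1 \<in> topspace (nsphere m)" "e2 \<in> topspace (nsphere m)"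
    using assms by (auto simp: nsphere e0_def e1_def e2_def power2_eq_square if_distrib [where f = "\<lambda>x. x * _"] cong: if_cong)
  moreover have "e0 \<noteq> e1" "e0 \<noteq> e2" "e1 \<noteq> e2"
    by (auto simp: e0_def e1_def e2_def fun_eq_iff)
  ultimately obtain a where a: "a \<in> topspace (nsphere m)" "a \<noteq> p" "a \<noteq> q" by metis
  have "path_connected_space (subtopology (nsphere m) (- {a}))"
    using contractible_space_punctured_nsphere[OF a(1)] contractible_imp_path_connected_space by blast
  then obtain g where "pathin (subtopology (nsphere m) (- {a})) g" "g 0 = p" "g 1 = q"
    unfolding path_connected_space_def using pq a(2,3) by auto
  then show "\<exists>g. pathin (nsphere m) g \<and> g 0 = p \<and> g 1 = q"
    by (auto simp: pathin_subtopology)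
qed

section \<open>Degree of top-dimensional cycles and the fundamental cycle\<close>

lemma homologous_rel_set_hom:
  "homologous_rel_set p X S \<in> hom (relcycle_group p X S) (relative_homology_group (int p) X S)"
  using normal.r_coset_hom_Mod[OF normal_subgroup_singular_relboundary_relcycle, of p X S]
  by (simp add: right_coset_singular_relboundary nontrivial_relative_homology_group)

text \<open>Replaces cosets by chains: an isomorphism with the integers becomes a degree on cycles,
  whose kernel consists of the boundaries.\<close>

lemma infinite_cyclic_homology_degree:
  assumes "homology_group (int p) X \<cong> integer_group"
  obtains deg :: "'a chain \<Rightarrow> int" and z where "singular_relcycle p X {} z" "deg z = 1"
    "\<And>a b. singular_relcycle p X {} a \<Longrightarrow> singular_relcycle p X {} b \<Longrightarrow> deg (a + b) = deg a + deg b"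
    "\<And>a. singular_relcycle p X {} a \<Longrightarrow> deg a = 0 \<longleftrightarrow> singular_relboundary p X {} a"
proof -
  let ?H = "homology_group (int p) X"
  obtain \<phi> where \<phi>: "\<phi> \<in> iso ?H integer_group" using assms by (auto simp: is_iso_def)
  define deg where "deg c = \<phi> (homologous_rel_set p X {} c)" for c
  have hom: "\<phi> \<in> hom ?H integer_group" and bij: "bij_betw \<phi> (carrier ?H) (carrier integer_group)"
    using \<phi> by (auto simp: iso_def)
  have cl: "homologous_rel_set p X {} c \<in> carrier ?H" if "singular_relcycle p X {} c" for c
    using that by (auto simp: carrier_relative_homology_group)
  have one: "\<phi> \<one>\<^bsub>?H\<^esub> = 0"
    using hom_one[OF hom] by simp
  have "(1::int) \<in> \<phi> ` carrier ?H" using bij by (simp add: bij_betw_def)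
  then obtain z where z: "singular_relcycle p X {} z" "deg z = 1"
    by (auto simp: deg_def carrier_relative_homology_group)
  show thesis
  proof
    show "singular_relcycle p X {} z" "deg z = 1" by fact+
    show "deg (a + b) = deg a + deg b" if "singular_relcycle p X {} a" "singular_relcycle p X {} b" for a b
    proof -
      have "homologous_rel_set p X {} (a + b) = homologous_rel_set p X {} a \<otimes>\<^bsub>?H\<^esub> homologous_rel_set p X {} b"
        using hom_mult[OF homologous_rel_set_hom, of a p X "{}" b] that by simp
      then show ?thesis
        using hom_mult[OF hom cl[OF that(1)] cl[OF that(2)]] by (simp add: deg_def)
    qed
    show "deg a = 0 \<longleftrightarrow> singular_relboundary p X {} a" if a: "singular_relcycle p X {} a" for a
    proof -
      have "\<one>\<^bsub>?H\<^esub> \<in> carrier ?H" using group.is_monoid monoid.one_closed group_relative_homology_group by blast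
      then have "deg a = 0 \<longleftrightarrow> homologous_rel_set p X {} a = \<one>\<^bsub>?H\<^esub>"
        unfolding deg_def using one bij cl[OF a] by (metis bij_betw_def inj_on_def)
      then show ?thesis by (simp add: homologous_rel_set_eq_relboundary)
    qed
  qed
qed

lemma int_additive_eq_mult:
  fixes f :: "int \<Rightarrow> int"
  assumes "\<And>k l. f (k + l) = f k + f l"
  shows "f k = k * f 1"
proof (induction k rule: int_induct[where k = 0])
  case base
  show ?case using assms[of 0 0] by simp
next
  case (step1 i)
  then show ?case using assms[of i 1] by (simp add: algebra_simps)
next
  case (step2 i)
  then show ?case using assms[of "i - 1" 1] by (simp add: algebra_simps)
qed

locale sphere_space =
  fixes X :: "'a::euclidean_space set" and m :: nat
  assumes sphere: "top_of_set X homeomorphic_space nsphere m" and m: "m \<ge> 1"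
begin

lemma cycle_bounds:
  assumes p: "p \<noteq> m" and c: "c \<in> reduced_cycles p (top_of_set X)"
  obtains y where "y \<in> RC (Suc p) X" "real_boundary (Suc p) y = c"
proof (cases "p = 0")
  case True
  have "path_connected_space (top_of_set X)"
    using homeomorphic_path_connected_space_imp[of "nsphere m" "top_of_set X"]
      path_connected_space_nsphere[OF m] sphere homeomorphic_space_sym by blast
  then show thesis
    using path_connected_real_boundary_0 c True that by (metis One_nat_def)
next
  case False
  have "trivial_group (reduced_homology_group (int p) (nsphere m))"
    using p by (simp add: reduced_homology_group_nsphere)
  then have "trivial_group (homology_group (int p) (nsphere m))"
    using False by (simp add: un_reduced_homology_group)
  then have "trivial_group (homology_group (int p) (top_of_set X))"
    using isomorphic_group_triviality[OF homeomorphic_space_imp_isomorphic_homology_groups[OF sphere, of "int p"]]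
    by simp
  then show thesis
    using trivial_homology_group_real_boundary c that by (auto simp: reduced_cycles_def)
qed

text \<open>\<open>z\<close> comes from a generator of integral homology. If it bounded over the
  reals, a positive multiple would bound integrally, against its degree. Every real cycle is a
  combination of integral cycles, each of which is a multiple of the generator up to a
  boundary.\<close>

lemma fundamental_cycle:
  obtains z where "z \<in> RC m X" "real_boundary m z = 0" "z \<notin> real_boundaries m (top_of_set X)"
    "\<And>c. c \<in> RC m X \<Longrightarrow> real_boundary m c = 0 \<Longrightarrow>
       \<exists>r. \<exists>y\<in>RC (Suc m) X. c = r *\<^sub>R z + real_boundary (Suc m) y"
proof -
  let ?X = "top_of_set X"
  have "homology_group (int m) ?X \<cong> homology_group (int m) (nsphere m)"
    by (rule homeomorphic_space_imp_isomorphic_homology_groups[OF sphere])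
  moreover have "homology_group (int m) (nsphere m) \<cong> integer_group"
    using reduced_homology_group_nsphere(1)[of m] m by (simp add: un_reduced_homology_group)
  ultimately have "homology_group (int m) ?X \<cong> integer_group"
    using iso_trans by blast
  then obtain deg and z where z: "singular_relcycle m ?X {} z" "deg z = 1"
    and add: "\<And>a b. singular_relcycle m ?X {} a \<Longrightarrow> singular_relcycle m ?X {} b \<Longrightarrow> deg (a + b) = deg a + (deg b :: int)"
    and ker: "\<And>a. singular_relcycle m ?X {} a \<Longrightarrow> deg a = 0 \<longleftrightarrow> singular_relboundary m ?X {} a"
    by (rule infinite_cyclic_homology_degree) (rule that)
  have degz: "deg (frag_cmul k z) = k" for k
    using int_additive_eq_mult[of "\<lambda>k. deg (frag_cmul k z)" k] z add
    by (simp add: frag_cmul_distrib singular_relcycle_cmul)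
  have zc: "singular_chain m ?X z" "chain_boundary m z = 0" using z(1) by (auto simp: singular_cycle)
  show thesis
  proof
    show "real_frag z \<in> RC m X" using zc by (simp flip: singular_chain_real_frag)
    show "real_boundary m (real_frag z) = 0" using zc by (simp flip: real_frag_boundary)
    show "real_frag z \<notin> real_boundaries m ?X"
    proof
      assume "real_frag z \<in> real_boundaries m ?X"
      then obtain w where w: "w \<in> RC (Suc m) X" "real_boundary (Suc m) w = real_frag z"
        by (auto simp: real_boundaries_def)
      obtain N :: int and y where N: "N > 0" "singular_chain (Suc m) ?X y" "chain_boundary (Suc m) y = frag_cmul N z"
        by (rule integral_multiple_boundary[OF w(2,1)])
      then have "singular_relboundary m ?X {} (frag_cmul N z)" by (auto simp: singular_boundary)
      then have "deg (frag_cmul N z) = 0"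
        using ker[of "frag_cmul N z"] z by (simp add: singular_relcycle_cmul)
      then show False using degz N(1) by simp
    qed
    fix c assume c: "c \<in> RC m X" "real_boundary m c = 0"
    then have c': "keys (real_boundary m c) \<subseteq> {}" by simp
    obtain J :: "real set" and r g where J: "finite J" "c = (\<Sum>b\<in>J. r b *\<^sub>R real_frag (g b))"
      and gc: "\<And>b. b \<in> J \<Longrightarrow> singular_chain m ?X (g b)"
      and gQ: "\<And>b. b \<in> J \<Longrightarrow> keys (chain_boundary m (g b)) \<subseteq> {}"
      by (rule real_chain_integral_combination[OF c(1) c']) (rule that)
    have gcy: "singular_relcycle m ?X {} (g b)" if "b \<in> J" for b
      using gc[OF that] gQ[OF that] by (simp add: singular_cycle)
    have "\<exists>y. singular_chain (Suc m) ?X y \<and> g b = frag_cmul (deg (g b)) z + chain_boundary (Suc m) y" if b: "b \<in> J" for b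
    proof -
      have cy: "singular_relcycle m ?X {} (frag_cmul (- deg (g b)) z)" using z(1) by (rule singular_relcycle_cmul)
      have "deg (g b + frag_cmul (- deg (g b)) z) = 0"
        using add[OF gcy[OF b] cy] degz by simp
      then have "singular_relboundary m ?X {} (g b + frag_cmul (- deg (g b)) z)"
        using ker singular_relcycle_add[OF gcy[OF b] cy] by blast
      then obtain y where "singular_chain (Suc m) ?X y" "chain_boundary (Suc m) y = g b + frag_cmul (- deg (g b)) z"
        by (auto simp: singular_boundary)
      then show ?thesis by (intro exI[of _ y]) (simp flip: minus_frag_cmul)
    qed
    then obtain y where y: "\<And>b. b \<in> J \<Longrightarrow> singular_chain (Suc m) ?X (y b)"
      "\<And>b. b \<in> J \<Longrightarrow> g b = frag_cmul (deg (g b)) z + chain_boundary (Suc m) (y b)"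
      by metis
    have "c = (\<Sum>b\<in>J. r b *\<^sub>R (of_int (deg (g b)) *\<^sub>R real_frag z + real_boundary (Suc m) (real_frag (y b))))"
      unfolding J(2)
    proof (intro sum.cong refl arg_cong[where f = "\<lambda>x. _ *\<^sub>R x"])
      fix b assume "b \<in> J"
      then show "real_frag (g b) = of_int (deg (g b)) *\<^sub>R real_frag z + real_boundary (Suc m) (real_frag (y b))"
        by (subst y(2)) (auto simp: real_frag_add real_frag_cmul real_frag_boundary)
    qed
    then have "c = (\<Sum>b\<in>J. r b * of_int (deg (g b))) *\<^sub>R real_frag z
        + real_boundary (Suc m) (\<Sum>b\<in>J. r b *\<^sub>R real_frag (y b))"
      by (simp add: scaleR_add_right sum.distrib scaleR_sum_left real_boundary_sum real_boundary_scale)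
    moreover have "(\<Sum>b\<in>J. r b *\<^sub>R real_frag (y b)) \<in> RC (Suc m) X"
      using y(1) by (intro RC_sum RC_scale) (auto simp: singular_chain_real_frag)
    ultimately show "\<exists>r. \<exists>y\<in>RC (Suc m) X. c = r *\<^sub>R real_frag z + real_boundary (Suc m) y" by blast
  qed
qed

subsection \<open>Complements of convex sets in a sphere\<close>

text \<open>Compactness of the support lets a chain that misses one slice of a convex set also miss
  a slab around it.\<close>

lemma compact_chain_support:
  assumes "y \<in> RC p U"
  shows "compact (\<Union>f\<in>keys y. f ` standard_simplex p)" "(\<Union>f\<in>keys y. f ` standard_simplex p) \<subseteq> U"
    "(\<Union>f\<in>keys y. f ` standard_simplex p) \<inter> A = {} \<Longrightarrow> y \<in> RC p (U - A)"
proof -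
  have ss: "singular_simplex p (top_of_set U) f" if "f \<in> keys y" for f
    using assms that by (auto simp: real_chains_def)
  have "compact (f ` standard_simplex p)" if f: "f \<in> keys y" for f
  proof -
    have "continuous_map (subtopology (powertop_real UNIV) (standard_simplex p)) euclidean f"
      using ss[OF f] by (auto simp: singular_simplex_def continuous_map_in_subtopology)
    then have "compactin euclidean (f ` standard_simplex p)"
      using image_compactin compactin_standard_simplex by (metis compactin_subtopology order_refl)
    then show ?thesis by simp
  qed
  then show "compact (\<Union>f\<in>keys y. f ` standard_simplex p)" by (intro compact_UN) auto
  show "(\<Union>f\<in>keys y. f ` standard_simplex p) \<subseteq> U"
    using ss by (auto simp: singular_simplex_top_of_set)
  assume "(\<Union>f\<in>keys y. f ` standard_simplex p) \<inter> A = {}"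
  then show "y \<in> RC p (U - A)"
    using ss by (fastforce simp: real_chains_def singular_simplex_top_of_set)
qed

text \<open>If a cycle bounds in the complement of each of two adjacent slabs of \<open>C\<close>, it bounds in the
  complement of their union, by Mayer--Vietoris and acyclicity of the complement of the common
  slice; a single slice can be thickened by compactness of chains.\<close>

lemma acyclic_complement_convex:
  assumes "compact C" "convex C" "C \<noteq> {}" "C \<subseteq> X"
  shows "acyclic_set (X - C)"
proof -
  \<comment> \<open>Induction on the affine dimension, which drops when \<open>C\<close> is cut by a
    suitable hyperplane.\<close>
  have "\<forall>C. compact C \<and> convex C \<and> C \<noteq> {} \<and> C \<subseteq> X \<and> aff_dim C \<le> int n \<longrightarrow> acyclic_set (X - C)" for n
  proof (induction n)
    case 0
    show ?case
    proof (intro allI impI)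
      fix C assume C: "compact C \<and> convex C \<and> C \<noteq> {} \<and> C \<subseteq> X \<and> aff_dim C \<le> int 0"
      then have "aff_dim C = 0" using aff_dim_geq[of C] aff_dim_empty[of C] by (smt (verit) of_nat_0)
      then obtain x where "C = {x}" using aff_dim_eq_0 by blast
      then show "acyclic_set (X - C)"
        using contractible_space_punctured_sphere[OF sphere, of x] C contractible_imp_acyclic_set by auto
    qed
  next
    case (Suc n)
    show ?case
    proof (intro allI impI)
      fix C assume C: "compact C \<and> convex C \<and> C \<noteq> {} \<and> C \<subseteq> X \<and> aff_dim C \<le> int (Suc n)"
      show "acyclic_set (X - C)"
      proof (cases "aff_dim C \<le> int n")
        case True
        then show ?thesis using Suc.IH C by blast
      next
        case False
        have "\<not> (\<exists>x. C = {x})" using False by auto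
        then obtain p q where pq: "p \<in> C" "q \<in> C" "p \<noteq> q" using C by blast
        \<comment> \<open>The height \<open>a \<bullet> x\<close> is not constant on
          \<open>C\<close>, so every slice has smaller dimension than \<open>C\<close>.\<close>
        define a where "a = q - p"
        have apq: "a \<bullet> p < a \<bullet> q"
          using pq(3) by (simp add: a_def inner_diff_left inner_diff_right inner_commute algebra_simps)
             (smt (verit) inner_commute inner_diff_left inner_diff_right inner_gt_zero_iff right_minus_eq)
        obtain lo where lo: "lo \<in> C" "\<And>x. x \<in> C \<Longrightarrow> a \<bullet> lo \<le> a \<bullet> x"
          using continuous_attains_inf[of C "\<lambda>x. a \<bullet> x"] C continuous_on_inner[OF continuous_on_const continuous_on_id, of C a] by auto
        obtain hi where hi: "hi \<in> C" "\<And>x. x \<in> C \<Longrightarrow> a \<bullet> x \<le> a \<bullet> hi"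
          using continuous_attains_sup[of C "\<lambda>x. a \<bullet> x"] C continuous_on_inner[OF continuous_on_const continuous_on_id, of C a] by auto
        define sl where "sl s t = {x \<in> C. s \<le> a \<bullet> x \<and> a \<bullet> x \<le> t}" for s t
        have slC: "sl s t \<subseteq> C" for s t by (auto simp: sl_def)
        have slcomp: "compact (sl s t)" for s t
        proof -
          have "sl s t = C \<inter> ({x. s \<le> a \<bullet> x} \<inter> {x. a \<bullet> x \<le> t})" by (auto simp: sl_def)
          moreover have "closed ({x. s \<le> a \<bullet> x} \<inter> {x. a \<bullet> x \<le> t})"
            by (intro closed_Int closed_Collect_le continuous_intros)
          ultimately show ?thesis using C compact_Int_closed by metis
        qed
        have slconv: "convex (sl s t)" for s t
        proof -
          have "sl s t = C \<inter> ({x. a \<bullet> x \<ge> s} \<inter> {x. a \<bullet> x \<le> t})" by (auto simp: sl_def)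
          then show ?thesis using C by (simp add: convex_Int convex_halfspace_le convex_halfspace_ge)
        qed
        have opn: "openin (top_of_set (X - T)) (X - sl s t)" if "T \<subseteq> sl s t" for T s t
        proof -
          have "X - sl s t = (X - T) \<inter> (- sl s t)" using that by auto
          then show ?thesis using slcomp[of s t] compact_imp_closed openin_open_Int by (metis open_Compl)
        qed
        have slice: "acyclic_set (X - sl t t)" if t: "a \<bullet> lo \<le> t" "t \<le> a \<bullet> hi" for t
        proof -
          have "\<exists>x\<in>C. a \<bullet> x = t"
            using connected_ivt_hyperplane[OF convex_connected lo(1) hi(1) t] C by blast
          then have ne: "sl t t \<noteq> {}" by (auto simp: sl_def)
          have "sl t t \<subseteq> affine hull C \<inter> {x. a \<bullet> x = t}"
            using hull_subset[of C affine] by (auto simp: sl_def)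
          then have "aff_dim (sl t t) \<le> aff_dim (affine hull C \<inter> {x. a \<bullet> x = t})" by (rule aff_dim_subset)
          also have "\<dots> \<le> aff_dim C - 1"
          proof -
            have "\<not> affine hull C \<subseteq> {x. a \<bullet> x = t}"
            proof
              assume h: "affine hull C \<subseteq> {x. a \<bullet> x = t}"
              have "a \<bullet> p = t" "a \<bullet> q = t"
                using subsetD[OF h hull_inc[OF pq(1)]] subsetD[OF h hull_inc[OF pq(2)]] by auto
              then show False using apq by simp
            qed
            then show ?thesis
              using aff_dim_affine_Int_hyperplane[of "affine hull C" a t] False by auto
          qed
          finally have "aff_dim (sl t t) \<le> int n" using C by auto
          moreover have "sl t t \<subseteq> X" using slC C by blast
          ultimately show ?thesis using Suc.IH slcomp slconv ne by blast
        qed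
        show ?thesis
          unfolding acyclic_set_def
        proof (intro allI ballI)
          fix p z assume z: "z \<in> reduced_cycles p (top_of_set (X - C))"
          have zA: "z \<in> reduced_cycles p (top_of_set (X - A))" if "A \<subseteq> C" for A
            using z RC_mono[of "X - C" "X - A"] that by (auto simp: reduced_cycles_iff)
          \<comment> \<open>A property of intervals of heights, suited to Bolzano's principle. The
            side condition keeps the cutting height of the transitivity step in the range of heights
            of \<open>C\<close>, where slices are nonempty.\<close>
          define Q where "Q s t \<longleftrightarrow> a \<bullet> lo \<le> s \<and> t \<le> a \<bullet> hi \<longrightarrow>
             (\<exists>y\<in>RC (Suc p) (X - sl s t). real_boundary (Suc p) y = z)" for s t
          have "a \<bullet> lo \<le> a \<bullet> hi" using lo hi by auto
          then have "Q (a \<bullet> lo) (a \<bullet> hi)"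
          proof (induction rule: Bolzano)
            case (trans r s t)
            show ?case unfolding Q_def
            proof (intro impI)
              assume rt: "a \<bullet> lo \<le> r \<and> t \<le> a \<bullet> hi"
              obtain u where u: "u \<in> RC (Suc p) (X - sl r s)" "real_boundary (Suc p) u = z"
                using trans rt by (auto simp: Q_def)
              obtain v where v: "v \<in> RC (Suc p) (X - sl s t)" "real_boundary (Suc p) v = z"
                using trans rt by (auto simp: Q_def)
              have un: "(X - sl r s) \<union> (X - sl s t) = X - sl s s"
                using trans by (auto simp: sl_def)
              have int: "(X - sl r s) \<inter> (X - sl s t) = X - sl r t"
                using trans by (auto simp: sl_def)
              have "u - v \<in> reduced_cycles (Suc p) (top_of_set (X - sl s s))"
                using u v RC_mono[of "X - sl r s" "X - sl s s" u] RC_mono[of "X - sl s t" "X - sl s s" v] un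
                by (auto simp: reduced_cycles_iff real_boundary_diff intro!: RC_diff)
              moreover have "acyclic_set (X - sl s s)" using slice trans rt by auto
              ultimately obtain w where w: "w \<in> RC (Suc (Suc p)) (X - sl s s)" "real_boundary (Suc (Suc p)) w = u - v"
                unfolding acyclic_set_def by blast
              have o1: "openin (top_of_set ((X - sl r s) \<union> (X - sl s t))) (X - sl r s)"
                unfolding un by (rule opn) (use trans in \<open>auto simp: sl_def\<close>)
              have o2: "openin (top_of_set ((X - sl r s) \<union> (X - sl s t))) (X - sl s t)"
                unfolding un by (rule opn) (use trans in \<open>auto simp: sl_def\<close>)
              obtain y where "y \<in> RC (Suc p) ((X - sl r s) \<inter> (X - sl s t))" "real_boundary (Suc p) y = real_boundary (Suc p) u"
                using Mayer_Vietoris_bounding[OF o1 o2 u(1) v(1)] u(2) v(2) w unfolding un by metis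
              then show "\<exists>y\<in>RC (Suc p) (X - sl r t). real_boundary (Suc p) y = z"
                using u(2) int by auto
            qed
          next
            case (local t)
            obtain y where y: "y \<in> RC (Suc p) (X - sl t t)" "real_boundary (Suc p) y = z"
              using slice[OF local] zA[OF slC] unfolding acyclic_set_def by blast
            define E where "E = (\<Union>f\<in>keys y. f ` standard_simplex (Suc p))"
            have E: "compact E" "E \<subseteq> X - sl t t" "\<And>A. E \<inter> A = {} \<Longrightarrow> y \<in> RC (Suc p) ((X - sl t t) - A)"
              using compact_chain_support[OF y(1)] by (auto simp: E_def)
            \<comment> \<open>The support of \<open>y\<close> misses the slice, so by compactness
              its points in \<open>C\<close> have heights bounded away from \<open>t\<close>; a slab
              around \<open>t\<close> thinner than that bound misses the support.\<close>
            obtain d where d: "d > 0" "\<And>x. x \<in> E \<inter> C \<Longrightarrow> d \<le> \<bar>a \<bullet> x - t\<bar>"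
            proof (cases "E \<inter> C = {}")
              case True
              then show ?thesis using that[of 1] by auto
            next
              case False
              have "compact (E \<inter> C)" using E(1) C by (simp add: compact_Int)
              moreover have "continuous_on (E \<inter> C) (\<lambda>x. \<bar>a \<bullet> x - t\<bar>)" by (intro continuous_intros)
              ultimately obtain x0 where x0: "x0 \<in> E \<inter> C" "\<And>x. x \<in> E \<inter> C \<Longrightarrow> \<bar>a \<bullet> x0 - t\<bar> \<le> \<bar>a \<bullet> x - t\<bar>"
                using continuous_attains_inf[of "E \<inter> C" "\<lambda>x. \<bar>a \<bullet> x - t\<bar>"] False by blast
              have "a \<bullet> x0 \<noteq> t" using x0(1) E(2) by (auto simp: sl_def)
              then show ?thesis using that[of "\<bar>a \<bullet> x0 - t\<bar>"] x0 by auto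
            qed
            show ?case
            proof (intro exI[of _ d] conjI allI impI d(1))
              fix r s assume rs: "r \<le> t \<and> t \<le> s \<and> s - r < d"
              have "E \<inter> sl r s = {}"
                using d(2) rs by (fastforce simp: sl_def)
              then have "y \<in> RC (Suc p) ((X - sl t t) - sl r s)" by (rule E(3))
              then have "y \<in> RC (Suc p) (X - sl r s)" by (rule RC_mono[rotated]) auto
              then show "Q r s" using y(2) by (auto simp: Q_def)
            qed
          qed
          moreover have "sl (a \<bullet> lo) (a \<bullet> hi) = C" using lo hi by (auto simp: sl_def)
          ultimately show "\<exists>y\<in>RC (Suc p) (X - C). real_boundary (Suc p) y = z" by (simp add: Q_def)
        qed
      qed
    qed
  qed
  moreover have "aff_dim C \<le> int (nat (aff_dim C))" by simp
  ultimately show ?thesis using assms by blast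
qed

end

subsection \<open>Deformation retracts\<close>

text \<open>The straight-line homotopy fixes \<open>S\<close>, so it acts on relative cycles. The
  relative form serves twice: applied to cycles it gives surjectivity on homology, applied to
  bounding chains it gives injectivity.\<close>

lemma deformation_retract_chains:
  fixes U :: "'a::euclidean_space set"
  assumes SU: "S \<subseteq> U" and r: "continuous_on U r" "r ` U \<subseteq> S" "\<And>x. x \<in> S \<Longrightarrow> r x = x"
    and seg: "\<And>x t. x \<in> U \<Longrightarrow> 0 \<le> t \<Longrightarrow> t \<le> 1 \<Longrightarrow> (1 - t) *\<^sub>R x + t *\<^sub>R r x \<in> U"
    and c: "c \<in> RC p U" "real_boundary p c \<in> RC (p - 1) S"
  obtains y where "y \<in> RC (Suc p) U" "c - real_boundary (Suc p) y \<in> RC p S"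
proof -
  let ?U = "top_of_set U"
  have hom: "homotopic_with (\<lambda>h. h \<in> S \<rightarrow> S) ?U ?U id r"
    unfolding homotopic_with
  proof -
    let ?h = "\<lambda>y::real \<times> 'a. (1 - fst y) *\<^sub>R snd y + fst y *\<^sub>R r (snd y)"
    have "continuous_on ({0..1} \<times> U) ?h"
    proof -
      have "continuous_on ({0..1::real} \<times> U) (\<lambda>y. r (snd y))"
        by (rule continuous_on_compose2[OF r(1)]) (auto intro: continuous_intros)
      then show ?thesis by (intro continuous_intros)
    qed
    then have "continuous_map (prod_topology (top_of_set {0..1}) ?U) ?U ?h"
      using seg by (auto simp: continuous_map_in_subtopology simp flip: subtopology_Times euclidean_product_topology)
    then show "homotopic_with (\<lambda>h. h \<in> S \<rightarrow> S) ?U ?U id r"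
      unfolding homotopic_with_def using r(3)
      by (intro exI[of _ ?h]) (auto simp flip: scaleR_left.add)
  qed
  have int: "\<exists>y. singular_chain (Suc p) ?U y \<and> keys (d - chain_boundary (Suc p) y) \<subseteq> singular_simplex_set p (top_of_set S)"
    if d: "singular_chain p ?U d" "keys (chain_boundary p d) \<subseteq> singular_simplex_set (p - 1) (top_of_set S)" for d
  proof -
    have sS: "subtopology ?U S = top_of_set S" using SU by (simp add: subtopology_subtopology Int_absorb1)
    have rel: "singular_relcycle p ?U S d"
      using d sS by (simp add: singular_relcycle singular_chain_def)
    have "homologous_rel p ?U S (chain_map p id d) (chain_map p r d)"
      by (rule homotopic_imp_homologous_rel_chain_maps[OF hom rel])
    moreover have "chain_map p id d = d" using d(1) by (rule chain_map_id_gen) simp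
    ultimately have "singular_relboundary p ?U S (d - chain_map p r d)" by (simp add: homologous_rel_def)
    then obtain y e where y: "singular_chain (Suc p) ?U y" "singular_chain p (top_of_set S) e"
        "chain_boundary (Suc p) y + e = d - chain_map p r d"
      by (auto simp: singular_relboundary sS)
    have "continuous_map ?U (top_of_set S) r" using r by (auto simp: continuous_map_in_subtopology)
    then have "singular_chain p (top_of_set S) (chain_map p r d)"
      using d(1) singular_chain_chain_map by blast
    then have "singular_chain p (top_of_set S) (e + chain_map p r d)" using y(2) by (simp add: singular_chain_add)
    moreover have "d - chain_boundary (Suc p) y = e + chain_map p r d" using y(3) by (simp add: algebra_simps)
    ultimately show ?thesis using y(1) by (intro exI[of _ y]) (simp add: singular_chain_def)
  qed
  have "keys (real_boundary p c) \<subseteq> singular_simplex_set (p - 1) (top_of_set S)"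
    using c(2) by (simp add: real_chains_def)
  then obtain y where "y \<in> RC (Suc p) U" "keys (c - real_boundary (Suc p) y) \<subseteq> singular_simplex_set p (top_of_set S)"
    using real_chain_transfer[of p ?U "singular_simplex_set (p - 1) (top_of_set S)" "singular_simplex_set p (top_of_set S)" c]
      int c(1) by metis
  then show thesis using that by (auto simp: real_chains_def)
qed

subsection \<open>Barycentric coordinates in a geometric simplicial complex\<close>

text \<open>A linear functional that is 1 on \<open>v - v0\<close> and 0 on the other differences
  recovers the coordinate after a shift. Being continuous everywhere, it later makes coordinates
  continuous on each simplex.\<close>

lemma barycentric_functional:
  fixes V :: "'a::euclidean_space set"
  assumes V: "\<not> affine_dependent V" and v: "v \<in> V"
  obtains f :: "'a \<Rightarrow> real" where "continuous_on UNIV f"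
    "\<And>u. sum u V = 1 \<Longrightarrow> f (\<Sum>w\<in>V. u w *\<^sub>R w) = u v"
proof -
  have fin: "finite V" using V by (rule aff_independent_finite)
  show thesis
  proof (cases "V = {v}")
    case True
    then show ?thesis using that[of "\<lambda>_. 1"] by auto
  next
    case False
    then obtain v0 where v0: "v0 \<in> V" "v0 \<noteq> v" using v by blast
    have ind: "independent ((\<lambda>x. x - v0) ` (V - {v0}))"
      using V v0(1) affine_dependent_iff_dependent2[OF v0(1)] by (simp add: image_def)
    obtain g :: "'a \<Rightarrow> real" where g: "linear g" "\<And>x. x \<in> (\<lambda>x. x - v0) ` (V - {v0}) \<Longrightarrow> g x = (if x = v - v0 then 1 else 0)"
      using linear_independent_extend[OF ind, of "\<lambda>x. if x = v - v0 then 1 else 0"] by blast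
    have gw: "g w - g v0 = (if w = v then 1 else 0)" if "w \<in> V" for w
    proof (cases "w = v0")
      case True
      then show ?thesis using v0 by simp
    next
      case False
      then have "g (w - v0) = (if w - v0 = v - v0 then 1 else 0)" using that by (intro g(2)) auto
      then show ?thesis using g(1) by (simp add: linear_diff)
    qed
    show ?thesis
    proof
      show "continuous_on UNIV (\<lambda>x. g x - g v0)"
        using g(1) by (intro continuous_intros linear_continuous_on) (simp add: linear_conv_bounded_linear)
      fix u :: "'a \<Rightarrow> real" assume u: "sum u V = 1"
      have "g (\<Sum>w\<in>V. u w *\<^sub>R w) - g v0 = (\<Sum>w\<in>V. u w * g w) - (\<Sum>w\<in>V. u w) * g v0"
        using g(1) u by (simp add: linear_sum linear_scale)
      also have "\<dots> = (\<Sum>w\<in>V. u w * (g w - g v0))"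
        by (simp add: right_diff_distrib sum_subtractf sum_distrib_right)
      also have "\<dots> = (\<Sum>w\<in>V. if w = v then u w else 0)"
        using gw by (intro sum.cong) auto
      also have "\<dots> = u v" using fin v by (simp add: sum.delta)
      finally show "g (\<Sum>w\<in>V. u w *\<^sub>R w) - g v0 = u v" .
    qed
  qed
qed

lemma continuous_on_Max_image:
  fixes f :: "'i \<Rightarrow> 'b::topological_space \<Rightarrow> real"
  assumes "finite I" "I \<noteq> {}" "\<And>i. i \<in> I \<Longrightarrow> continuous_on S (f i)"
  shows "continuous_on S (\<lambda>x. Max ((\<lambda>i. f i x) ` I))"
  using assms
proof (induction I rule: finite_ne_induct)
  case (insert i I)
  then have "continuous_on S (\<lambda>x. max (f i x) (Max ((\<lambda>i. f i x) ` I)))"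
    by (intro continuous_on_max) auto
  then show ?case using insert by simp
qed simp

lemma continuous_on_Min_image:
  fixes f :: "'i \<Rightarrow> 'b::topological_space \<Rightarrow> real"
  assumes "finite I" "I \<noteq> {}" "\<And>i. i \<in> I \<Longrightarrow> continuous_on S (f i)"
  shows "continuous_on S (\<lambda>x. Min ((\<lambda>i. f i x) ` I))"
  using assms
proof (induction I rule: finite_ne_induct)
  case (insert i I)
  then have "continuous_on S (\<lambda>x. min (f i x) (Min ((\<lambda>i. f i x) ` I)))"
    by (intro continuous_on_min) auto
  then show ?case using insert by simp
qed simp

text \<open>Simplices are encoded by their vertex sets, which makes faces subsets.
  \<open>hull_Int\<close> is the axiom that simplices meet in common faces, and the empty simplex is
  excluded.\<close>

locale geometric_complex =
  fixes VS :: "'a::euclidean_space set set"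
  assumes finVS: "finite VS"
    and aff_ind: "V \<in> VS \<Longrightarrow> \<not> affine_dependent V"
    and nonempty: "V \<in> VS \<Longrightarrow> V \<noteq> {}"
    and face: "V \<in> VS \<Longrightarrow> W \<subseteq> V \<Longrightarrow> W \<noteq> {} \<Longrightarrow> W \<in> VS"
    and hull_Int: "V \<in> VS \<Longrightarrow> W \<in> VS \<Longrightarrow> convex hull V \<inter> convex hull W = convex hull (V \<inter> W)"
begin

definition "Vert = \<Union>VS"
definition poly :: "'a set set \<Rightarrow> 'a set" where "poly L = (\<Union>V\<in>L. convex hull V)"
abbreviation "X \<equiv> poly VS"

lemma finV: "V \<in> VS \<Longrightarrow> finite V"
  using aff_ind aff_independent_finite by blast

lemma finVert: "finite Vert"
  unfolding Vert_def using finVS finV by blast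

lemma subVert: "V \<in> VS \<Longrightarrow> V \<subseteq> Vert"
  by (auto simp: Vert_def)

definition coords :: "('a \<Rightarrow> real) \<Rightarrow> 'a \<Rightarrow> bool" where
  "coords u x \<longleftrightarrow> (\<forall>v. u v \<ge> 0) \<and> {v. u v \<noteq> 0} \<in> VS \<and> sum u Vert = 1 \<and> x = (\<Sum>v\<in>Vert. u v *\<^sub>R v)"

lemma sum_Vert_eq:
  assumes "V \<in> VS" "\<And>v. v \<notin> V \<Longrightarrow> u v = 0"
  shows "sum u Vert = sum u V" "(\<Sum>v\<in>Vert. u v *\<^sub>R v) = (\<Sum>v\<in>V. u v *\<^sub>R v)"
  using subVert[OF assms(1)] finVert assms(2) by (auto intro!: sum.mono_neutral_right)

lemma coordsI:
  assumes V: "V \<in> VS" and u: "\<And>v. u v \<ge> 0" "\<And>v. v \<notin> V \<Longrightarrow> u v = 0" "sum u V = 1"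
  shows "coords u (\<Sum>v\<in>V. u v *\<^sub>R v)"
proof -
  have "{v. u v \<noteq> 0} \<subseteq> V" using u(2) by auto
  moreover have "{v. u v \<noteq> 0} \<noteq> {}"
    using u(3) by (metis (mono_tags, lifting) empty_iff mem_Collect_eq sum.neutral zero_neq_one)
  ultimately have "{v. u v \<noteq> 0} \<in> VS" using face V by blast
  then show ?thesis
    unfolding coords_def using u sum_Vert_eq[OF V u(2)] by auto
qed

lemma coords_in_hull:
  assumes "coords u x" "{v. u v \<noteq> 0} \<subseteq> V" "V \<in> VS"
  shows "x \<in> convex hull V"
proof -
  have z: "u v = 0" if "v \<notin> V" for v using assms(2) that by auto
  show ?thesis
    unfolding convex_hull_finite[OF finV[OF assms(3)]]
    using assms(1) sum_Vert_eq[OF assms(3), of u] z unfolding coords_def by auto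
qed

lemma hull_coords:
  assumes "V \<in> VS" "x \<in> convex hull V"
  obtains u where "coords u x" "\<And>v. v \<notin> V \<Longrightarrow> u v = 0"
proof -
  obtain u where u: "\<And>v. v \<in> V \<Longrightarrow> 0 \<le> u v" "sum u V = 1" "(\<Sum>v\<in>V. u v *\<^sub>R v) = x"
    using assms(2) unfolding convex_hull_finite[OF finV[OF assms(1)]] by auto
  define u' where "u' v = (if v \<in> V then u v else 0)" for v
  have "coords u' (\<Sum>v\<in>V. u' v *\<^sub>R v)"
    using u by (intro coordsI[OF assms(1)]) (auto simp: u'_def)
  moreover have "(\<Sum>v\<in>V. u' v *\<^sub>R v) = x" using u(3) by (auto simp: u'_def)
  ultimately show thesis using that[of u'] by (auto simp: u'_def)
qed

lemma coords_functional:
  assumes "coords u x" "{v. u v \<noteq> 0} \<subseteq> V" "V \<in> VS"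
    and "\<And>u. sum u V = 1 \<Longrightarrow> f (\<Sum>w\<in>V. u w *\<^sub>R w) = u v"
  shows "f x = u v"
proof -
  have z: "u v = 0" if "v \<notin> V" for v using assms(2) that by auto
  show ?thesis
    using assms(1,4) sum_Vert_eq[OF assms(3), of u] z unfolding coords_def by auto
qed

text \<open>By \<open>hull_Int\<close> the point lies in the hull of the intersection of the two
  supports; affine independence forces each of the two expansions to agree with an expansion
  there.\<close>

lemma coords_unique:
  assumes u: "coords u x" and w: "coords w x"
  shows "u = w"
proof -
  define S T where "S = {v. u v \<noteq> 0}" and "T = {v. w v \<noteq> 0}"
  have ST: "S \<in> VS" "T \<in> VS" using u w by (auto simp: S_def T_def coords_def)
  have "x \<in> convex hull S" "x \<in> convex hull T"
    using coords_in_hull u w ST by (auto simp: S_def T_def)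
  then have x: "x \<in> convex hull (S \<inter> T)" using hull_Int[OF ST] by blast
  then have "S \<inter> T \<noteq> {}" by auto
  then have STVS: "S \<inter> T \<in> VS" using face[OF ST(1)] by blast
  obtain y where y: "coords y x" "\<And>v. v \<notin> S \<inter> T \<Longrightarrow> y v = 0"
    using hull_coords[OF STVS x] by blast
  have eq: "z = y" if z: "coords z x" "{v. z v \<noteq> 0} \<in> VS" "S \<inter> T \<subseteq> {v. z v \<noteq> 0}" for z
  proof
    fix v
    show "z v = y v"
    proof (cases "z v = 0")
      case True
      then show ?thesis using y(2) z(3) by auto
    next
      case False
      then have v: "v \<in> {v. z v \<noteq> 0}" by simp
      obtain f where "continuous_on UNIV f" and f: "\<And>u. sum u {v. z v \<noteq> 0} = 1 \<Longrightarrow> f (\<Sum>w\<in>{v. z v \<noteq> 0}. u w *\<^sub>R w) = (u v :: real)"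
        by (rule barycentric_functional[OF aff_ind[OF z(2)] v]) (rule that)
      have "f x = z v" by (rule coords_functional[OF z(1) order_refl z(2) f])
      moreover have "f x = y v"
        by (rule coords_functional[OF y(1) _ z(2) f]) (use y(2) z(3) in auto)
      ultimately show ?thesis by simp
    qed
  qed
  show ?thesis
    using eq[OF u] eq[OF w] ST unfolding S_def T_def by auto
qed

definition lam :: "'a \<Rightarrow> 'a \<Rightarrow> real" where "lam x = (THE u. coords u x)"
definition "supp x = {v. lam x v \<noteq> 0}"

lemma lam_eqI: "coords u x \<Longrightarrow> lam x = u"
  unfolding lam_def by (rule the_equality) (auto intro: coords_unique)

lemma coords_lam: "x \<in> X \<Longrightarrow> coords (lam x) x"
  using hull_coords lam_eqI unfolding poly_def by (metis UN_E)

lemma lam_nonneg: "x \<in> X \<Longrightarrow> lam x v \<ge> 0"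
  and supp_VS: "x \<in> X \<Longrightarrow> supp x \<in> VS"
  and sum_lam: "x \<in> X \<Longrightarrow> sum (lam x) Vert = 1"
  and lam_expand: "x \<in> X \<Longrightarrow> x = (\<Sum>v\<in>Vert. lam x v *\<^sub>R v)"
  using coords_lam by (auto simp: coords_def supp_def)

lemma coords_in_X: "coords u x \<Longrightarrow> x \<in> X"
  using coords_in_hull[OF _ order_refl] unfolding poly_def coords_def by blast

lemma hull_iff_supp:
  assumes "V \<in> VS" "x \<in> X"
  shows "x \<in> convex hull V \<longleftrightarrow> supp x \<subseteq> V"
proof
  assume "x \<in> convex hull V"
  then obtain u where "coords u x" "\<And>v. v \<notin> V \<Longrightarrow> u v = 0" using hull_coords[OF assms(1)] by blast
  then show "supp x \<subseteq> V" using lam_eqI by (auto simp: supp_def)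
next
  assume "supp x \<subseteq> V"
  then show "x \<in> convex hull V" using coords_in_hull[OF coords_lam[OF assms(2)] _ assms(1)] by (simp add: supp_def)
qed

lemma hull_subset_X: "V \<in> VS \<Longrightarrow> convex hull V \<subseteq> X"
  by (auto simp: poly_def)

lemma compact_hull: "V \<in> VS \<Longrightarrow> compact (convex hull V)"
  using finV by (simp add: finite_imp_compact_convex_hull)

lemma compact_poly: "L \<subseteq> VS \<Longrightarrow> compact (poly L)"
  unfolding poly_def using finVS compact_hull by (intro compact_UN) (auto intro: finite_subset)

lemma continuous_lam: "continuous_on X (\<lambda>x. lam x v)"
proof -
  have "continuous_on (\<Union>V\<in>VS. convex hull V) (\<lambda>x. lam x v)"
  proof (rule continuous_on_closed_Union)
    fix V assume V: "V \<in> VS"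
    show "closed (convex hull V)" using compact_hull[OF V] compact_imp_closed by blast
    have xX: "x \<in> X" if "x \<in> convex hull V" for x using that V by (auto simp: poly_def)
    show "continuous_on (convex hull V) (\<lambda>x. lam x v)"
    proof (cases "v \<in> V")
      case True
      obtain f where f: "continuous_on UNIV f" "\<And>u. sum u V = 1 \<Longrightarrow> f (\<Sum>w\<in>V. u w *\<^sub>R w) = (u v :: real)"
        by (rule barycentric_functional[OF aff_ind[OF V] True]) (rule that)
      have "lam x v = f x" if x: "x \<in> convex hull V" for x
        using coords_functional[OF coords_lam[OF xX[OF x]] _ V f(2)] hull_iff_supp[OF V xX[OF x]] x
        by (simp add: supp_def)
      then show ?thesis using continuous_on_subset[OF f(1)] by (metis (no_types, lifting) continuous_on_cong subset_UNIV)
    next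
      case False
      have "lam x v = 0" if x: "x \<in> convex hull V" for x
        using hull_iff_supp[OF V xX[OF x]] x False by (auto simp: supp_def)
      then show ?thesis by (metis (no_types, lifting) continuous_on_cong continuous_on_const)
    qed
  qed (rule finVS)
  then show ?thesis by (simp add: poly_def)
qed

lemma lam_notin_Vert: "x \<in> X \<Longrightarrow> v \<notin> Vert \<Longrightarrow> lam x v = 0"
  using supp_VS[of x] subVert by (auto simp: supp_def)

text \<open>Coordinates are affine on each simplex separately, hence the common simplex
  \<open>V\<close> for all the points.\<close>

lemma lam_sum_combination:
  assumes V: "V \<in> VS" and I: "finite I" "\<And>i. i \<in> I \<Longrightarrow> y i \<in> convex hull V"
    and c: "\<And>i. i \<in> I \<Longrightarrow> c i \<ge> 0" "sum c I = 1"
  shows "lam (\<Sum>i\<in>I. c i *\<^sub>R y i) v = (\<Sum>i\<in>I. c i * lam (y i) v)" "(\<Sum>i\<in>I. c i *\<^sub>R y i) \<in> X"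
proof -
  define u where "u v = (\<Sum>i\<in>I. c i * lam (y i) v)" for v
  have yX: "y i \<in> X" if "i \<in> I" for i using I(2)[OF that] V by (auto simp: poly_def)
  have "coords u (\<Sum>v\<in>V. u v *\<^sub>R v)"
  proof (rule coordsI[OF V])
    show "u v \<ge> 0" for v unfolding u_def by (intro sum_nonneg mult_nonneg_nonneg c lam_nonneg yX) auto
    have z: "lam (y i) v = 0" if "i \<in> I" "v \<notin> V" for i v
      using hull_iff_supp[OF V yX[OF that(1)]] I(2)[OF that(1)] that(2) by (auto simp: supp_def)
    show "u v = 0" if "v \<notin> V" for v unfolding u_def using z that by (intro sum.neutral) auto
    have "sum u V = (\<Sum>i\<in>I. c i * (\<Sum>v\<in>V. lam (y i) v))"
      unfolding u_def by (subst sum.swap) (simp add: sum_distrib_left)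
    also have "\<dots> = (\<Sum>i\<in>I. c i)"
      using sum_Vert_eq(1)[OF V, of "lam (y _)"] z sum_lam[OF yX] by (intro sum.cong) (metis mult.right_neutral)+
    finally show "sum u V = 1" using c by simp
  qed
  moreover have "(\<Sum>v\<in>V. u v *\<^sub>R v) = (\<Sum>i\<in>I. c i *\<^sub>R y i)"
  proof -
    have z: "lam (y i) v = 0" if "i \<in> I" "v \<notin> V" for i v
      using hull_iff_supp[OF V yX[OF that(1)]] I(2)[OF that(1)] that(2) by (auto simp: supp_def)
    have e: "y i = (\<Sum>v\<in>V. lam (y i) v *\<^sub>R v)" if "i \<in> I" for i
      using lam_expand[OF yX[OF that]] sum_Vert_eq(2)[OF V, of "lam (y i)"] z[OF that] by metis
    have "(\<Sum>v\<in>V. u v *\<^sub>R v) = (\<Sum>i\<in>I. c i *\<^sub>R (\<Sum>v\<in>V. lam (y i) v *\<^sub>R v))"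
      unfolding u_def by (simp add: scaleR_sum_left scaleR_sum_right) (rule sum.swap)
    also have "\<dots> = (\<Sum>i\<in>I. c i *\<^sub>R y i)" using e by (intro sum.cong) auto
    finally show ?thesis .
  qed
  ultimately have "coords u (\<Sum>i\<in>I. c i *\<^sub>R y i)" by simp
  then show "lam (\<Sum>i\<in>I. c i *\<^sub>R y i) v = (\<Sum>i\<in>I. c i * lam (y i) v)" "(\<Sum>i\<in>I. c i *\<^sub>R y i) \<in> X"
    using lam_eqI coords_in_X by (auto simp: u_def)
qed

lemma lam_segment:
  assumes V: "V \<in> VS" "x \<in> convex hull V" "y \<in> convex hull V" and t: "0 \<le> t" "t \<le> 1"
  shows "lam ((1 - t) *\<^sub>R x + t *\<^sub>R y) v = (1 - t) * lam x v + t * lam y v"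
    "(1 - t) *\<^sub>R x + t *\<^sub>R y \<in> X"
  using lam_sum_combination[OF V(1), of "{0,1::nat}" "\<lambda>i. if i = 0 then x else y" "\<lambda>i. if i = 0 then 1 - t else t"]
    V t by simp_all

end

subsection \<open>Polyhedra, their open neighbourhoods and dual polyhedra\<close>

context geometric_complex
begin

definition "mx x = Max (lam x ` Vert)"
text \<open>The dual counterpart of the support: \<open>supp x\<close> is the least simplex
  containing \<open>x\<close>, and \<open>am x\<close> is the largest simplex whose dual cell
  contains \<open>x\<close>.\<close>

definition "am x = {v \<in> Vert. lam x v = mx x}"
definition "down_closed L \<longleftrightarrow> L \<subseteq> VS \<and> (\<forall>V\<in>L. \<forall>W. W \<subseteq> V \<and> W \<noteq> {} \<longrightarrow> W \<in> L)"
text \<open>The largest level \<open>t\<close> such that the vertices of coordinate at least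
  \<open>t\<close> include a simplex outside \<open>L\<close>, or 0 if there is none. For
  down-closed \<open>L\<close> it is 0 exactly on \<open>poly L\<close> and equal to
  \<open>mx x\<close> exactly on \<open>dual_poly L\<close>. Points in between are moved to either
  polyhedron by comparing coordinates with it.\<close>

definition "thr L x = Max (insert 0 ((\<lambda>\<rho>. Min (lam x ` \<rho>)) ` (VS - L)))"
text \<open>The complement of the dual polyhedron. Unlike \<open>poly L\<close> it is open in the
  polyhedron, and it commutes with unions and intersections of subcomplexes.\<close>

definition "nbhd L = {x \<in> X. am x \<in> L}"
definition "dual_poly L = {x \<in> X. am x \<notin> L}"

lemma down_closed_VS: "down_closed VS"
  using face by (auto simp: down_closed_def)

lemma down_closedD: "down_closed L \<Longrightarrow> V \<in> L \<Longrightarrow> W \<subseteq> V \<Longrightarrow> W \<noteq> {} \<Longrightarrow> W \<in> L"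
  by (auto simp: down_closed_def)

lemma down_closed_subset: "down_closed L \<Longrightarrow> L \<subseteq> VS"
  by (auto simp: down_closed_def)

lemma down_closed_Int: "down_closed A \<Longrightarrow> down_closed B \<Longrightarrow> down_closed (A \<inter> B)"
  unfolding down_closed_def by blast

lemma Vert_nonempty: "x \<in> X \<Longrightarrow> Vert \<noteq> {}"
  using sum_lam[of x] by auto

lemma lam_le_mx: "x \<in> X \<Longrightarrow> lam x v \<le> mx x"
proof -
  assume x: "x \<in> X"
  have *: "lam x w \<le> mx x" if "w \<in> Vert" for w
    unfolding mx_def using finVert that by (intro Max_ge) auto
  show "lam x v \<le> mx x"
  proof (cases "v \<in> Vert")
    case False
    obtain w where "w \<in> Vert" using Vert_nonempty[OF x] by blast
    then show ?thesis using *[of w] lam_nonneg[OF x, of w] lam_notin_Vert[OF x False] by simp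
  qed (rule *)
qed

lemma mx_pos: "x \<in> X \<Longrightarrow> mx x > 0"
proof -
  assume x: "x \<in> X"
  obtain v where "v \<in> supp x" using supp_VS[OF x] nonempty by blast
  then have "lam x v > 0" using lam_nonneg[OF x, of v] by (simp add: supp_def)
  then show ?thesis using lam_le_mx[OF x, of v] by linarith
qed

lemma am_nonempty: "x \<in> X \<Longrightarrow> am x \<noteq> {}"
proof -
  assume x: "x \<in> X"
  have "mx x \<in> lam x ` Vert" unfolding mx_def using finVert Vert_nonempty[OF x] by (intro Max_in) auto
  then show ?thesis by (auto simp: am_def)
qed

lemma am_subset_supp: "x \<in> X \<Longrightarrow> am x \<subseteq> supp x"
  using mx_pos by (fastforce simp: am_def supp_def)

lemma am_VS: "x \<in> X \<Longrightarrow> am x \<in> VS"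
  using face[OF supp_VS am_subset_supp am_nonempty] by blast

lemma am_iff: "x \<in> X \<Longrightarrow> v \<in> am x \<longleftrightarrow> lam x v = mx x"
  using lam_notin_Vert[of x v] mx_pos[of x] unfolding am_def by (cases "v \<in> Vert") auto

lemma am_iff': "x \<in> X \<Longrightarrow> v \<in> am x \<longleftrightarrow> (\<forall>w. lam x w \<le> lam x v)"
  using am_iff lam_le_mx am_nonempty by (metis ex_in_conv order_antisym)

lemma thr_ge:
  assumes "\<rho> \<in> VS" "\<rho> \<notin> L"
  shows "Min (lam x ` \<rho>) \<le> thr L x"
  unfolding thr_def using finVS assms by (intro Max_ge) auto

lemma thr_nonneg: "thr L x \<ge> 0"
  unfolding thr_def using finVS by (intro Max_ge) auto

lemma thr_cases: "thr L x = 0 \<or> (\<exists>\<rho>\<in>VS - L. thr L x = Min (lam x ` \<rho>))"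
proof -
  have "thr L x \<in> insert 0 ((\<lambda>\<rho>. Min (lam x ` \<rho>)) ` (VS - L))"
    unfolding thr_def using finVS by (intro Max_in) auto
  then show ?thesis by auto
qed

lemma thr_pos_witness:
  assumes "thr L x > 0"
  obtains \<rho> where "\<rho> \<in> VS" "\<rho> \<notin> L" "\<And>v. v \<in> \<rho> \<Longrightarrow> thr L x \<le> lam x v"
proof -
  obtain \<rho> where \<rho>: "\<rho> \<in> VS - L" "thr L x = Min (lam x ` \<rho>)" using thr_cases[of L x] assms by auto
  have "thr L x \<le> lam x v" if "v \<in> \<rho>" for v
    unfolding \<rho>(2) using finV \<rho>(1) that by (intro Min_le) auto
  then show thesis using that \<rho>(1) by blast
qed

lemma thr_le_mx: "x \<in> X \<Longrightarrow> thr L x \<le> mx x"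
proof (cases "thr L x > 0")
  case True
  assume x: "x \<in> X"
  obtain \<rho> where "\<rho> \<in> VS" "\<And>v. v \<in> \<rho> \<Longrightarrow> thr L x \<le> lam x v" using thr_pos_witness[OF True] by metis
  then show ?thesis using nonempty lam_le_mx[OF x] by (metis all_not_in_conv order_trans)
next
  case False
  assume x: "x \<in> X"
  show ?thesis using False mx_pos[OF x] by simp
qed

lemma thr_eq_0_iff:
  assumes L: "down_closed L" and x: "x \<in> X"
  shows "thr L x = 0 \<longleftrightarrow> supp x \<in> L"
proof
  assume t: "thr L x = 0"
  show "supp x \<in> L"
  proof (rule ccontr)
    assume "supp x \<notin> L"
    then have "Min (lam x ` supp x) \<le> 0" using thr_ge[OF supp_VS[OF x], of L x] t by simp
    moreover have "Min (lam x ` supp x) \<in> lam x ` supp x"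
      using finV[OF supp_VS[OF x]] nonempty[OF supp_VS[OF x]] by (intro Min_in) auto
    ultimately obtain v where "v \<in> supp x" "lam x v \<le> 0" by auto
    then show False using lam_nonneg[OF x, of v] by (simp add: supp_def)
  qed
next
  assume s: "supp x \<in> L"
  show "thr L x = 0"
  proof (rule ccontr)
    assume "thr L x \<noteq> 0"
    then have "thr L x > 0" using thr_nonneg[of L x] by simp
    then obtain \<rho> where \<rho>: "\<rho> \<in> VS" "\<rho> \<notin> L" "\<And>v. v \<in> \<rho> \<Longrightarrow> thr L x \<le> lam x v"
      by (rule thr_pos_witness) (rule that)
    have "\<rho> \<subseteq> supp x" using \<rho>(3) \<open>thr L x > 0\<close> by (fastforce simp: supp_def)
    then show False using down_closedD[OF L s] \<rho> nonempty by blast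
  qed
qed

lemma thr_eq_mx_iff:
  assumes L: "down_closed L" and x: "x \<in> X"
  shows "thr L x = mx x \<longleftrightarrow> am x \<notin> L"
proof
  assume t: "thr L x = mx x"
  show "am x \<notin> L"
  proof
    assume a: "am x \<in> L"
    have "thr L x > 0" using mx_pos[OF x] t by simp
    then obtain \<rho> where \<rho>: "\<rho> \<in> VS" "\<rho> \<notin> L" "\<And>v. v \<in> \<rho> \<Longrightarrow> thr L x \<le> lam x v"
      by (rule thr_pos_witness) (rule that)
    have "\<rho> \<subseteq> am x" using \<rho>(3) t lam_le_mx[OF x] am_iff[OF x] by (auto intro: antisym)
    then show False using down_closedD[OF L a] \<rho> nonempty by blast
  qed
next
  assume "am x \<notin> L"
  then have "Min (lam x ` am x) \<le> thr L x" using thr_ge[OF am_VS[OF x]] by blast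
  moreover have "Min (lam x ` am x) \<in> lam x ` am x"
    using finV[OF am_VS[OF x]] am_nonempty[OF x] by (intro Min_in) auto
  ultimately have "mx x \<le> thr L x" using am_iff[OF x] by auto
  then show "thr L x = mx x" using thr_le_mx[OF x, of L] by simp
qed

lemma poly_iff:
  assumes L: "down_closed L" and x: "x \<in> X"
  shows "x \<in> poly L \<longleftrightarrow> supp x \<in> L"
proof
  assume "x \<in> poly L"
  then obtain V where V: "V \<in> L" "x \<in> convex hull V" by (auto simp: poly_def)
  then have "supp x \<subseteq> V" using hull_iff_supp[of V x] x down_closed_subset[OF L] by blast
  then show "supp x \<in> L" using down_closedD[OF L V(1)] nonempty[OF supp_VS[OF x]] by blast
next
  assume "supp x \<in> L"
  then show "x \<in> poly L" using hull_iff_supp[OF supp_VS[OF x] x] by (auto simp: poly_def)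
qed

lemma poly_subset: "L \<subseteq> VS \<Longrightarrow> poly L \<subseteq> X"
  by (auto simp: poly_def)

lemma continuous_thr: "continuous_on X (thr L)"
proof -
  have m: "continuous_on X (\<lambda>x. Min (lam x ` \<rho>))" if "\<rho> \<in> VS" for \<rho>
    using continuous_on_Min_image[OF finV[OF that] nonempty[OF that], of X "\<lambda>v x. lam x v"] continuous_lam by simp
  show ?thesis
  proof (cases "VS - L = {}")
    case True
    then show ?thesis unfolding thr_def[abs_def] True by simp
  next
    case False
    have "continuous_on X (\<lambda>x. max 0 (Max ((\<lambda>\<rho>. Min (lam x ` \<rho>)) ` (VS - L))))"
      using continuous_on_Max_image[of "VS - L" X "\<lambda>\<rho> x. Min (lam x ` \<rho>)"] m False finVS
      by (intro continuous_on_max continuous_on_const) auto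
    then show ?thesis unfolding thr_def[abs_def] using False finVS by (simp add: Max_insert)
  qed
qed

lemma continuous_mx: "continuous_on X mx"
proof (cases "Vert = {}")
  case True
  then have "X = {}" using Vert_nonempty by blast
  then show ?thesis by simp
next
  case False
  then show ?thesis
    using continuous_on_Max_image[OF finVert False, of X "\<lambda>v x. lam x v"] continuous_lam
    by (simp add: mx_def[abs_def])
qed

lemma openin_nbhd:
  assumes "down_closed L"
  shows "openin (top_of_set X) (nbhd L)"
proof -
  have "nbhd L = {x \<in> X. thr L x < mx x}"
    unfolding nbhd_def using thr_eq_mx_iff[OF assms] thr_le_mx[of _ L] by (auto simp: less_le)
  also have "\<dots> = X \<inter> (\<lambda>x. mx x - thr L x) -` {0<..}" by auto
  finally show ?thesis
    using continuous_openin_preimage_gen[of X "\<lambda>x. mx x - thr L x" "{0<..}"] continuous_mx continuous_thr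
    by (simp add: continuous_on_diff)
qed

lemma openin_complement_poly: "L \<subseteq> VS \<Longrightarrow> openin (top_of_set X) (X - poly L)"
  using compact_imp_closed[OF compact_poly, of L] openin_open_Int[of "- poly L" X] by (simp add: Diff_eq open_Compl)

lemma nbhd_Int: "nbhd (A \<inter> B) = nbhd A \<inter> nbhd B"
  and nbhd_Un: "nbhd (A \<union> B) = nbhd A \<union> nbhd B"
  by (auto simp: nbhd_def)

lemma nbhd_mono: "A \<subseteq> B \<Longrightarrow> nbhd A \<subseteq> nbhd B"
  by (auto simp: nbhd_def)

lemma poly_subset_nbhd: "down_closed L \<Longrightarrow> poly L \<subseteq> nbhd L"
  using poly_iff poly_subset down_closed_subset am_subset_supp am_nonempty down_closedD
  unfolding nbhd_def by (smt (verit, best) mem_Collect_eq subset_iff)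

lemma weighted_point:
  assumes x: "x \<in> X" and w: "\<And>v. w v \<ge> 0" "\<And>v. v \<notin> supp x \<Longrightarrow> w v = 0" "sum w Vert > 0"
  defines "r \<equiv> \<Sum>v\<in>Vert. (w v / sum w Vert) *\<^sub>R v"
  shows "r \<in> convex hull (supp x)" "r \<in> X" "lam r v = w v / sum w Vert"
proof -
  define u where "u v = w v / sum w Vert" for v
  have S: "supp x \<in> VS" using supp_VS[OF x] .
  have z: "u v = 0" if "v \<notin> supp x" for v using w(2)[OF that] by (simp add: u_def)
  have "sum u Vert = 1" unfolding u_def using w(3) by (simp flip: sum_divide_distrib)
  then have "coords u (\<Sum>v\<in>supp x. u v *\<^sub>R v)"
    using sum_Vert_eq(1)[OF S z] by (intro coordsI[OF S]) (use w z in \<open>auto simp: u_def\<close>)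
  moreover have "(\<Sum>v\<in>supp x. u v *\<^sub>R v) = r"
    using sum_Vert_eq(2)[OF S, of u] z by (simp add: r_def u_def)
  ultimately have c: "coords u r" by simp
  show "r \<in> X" using c by (rule coords_in_X)
  show "lam r v = w v / sum w Vert" using lam_eqI[OF c] by (simp add: u_def)
  show "r \<in> convex hull (supp x)" using coords_in_hull[OF c _ S] z by blast
qed

lemma continuous_weighted_point:
  assumes "U \<subseteq> X" "\<And>v. continuous_on U (\<lambda>x. w x v)" "\<And>x. x \<in> U \<Longrightarrow> sum (w x) Vert > 0"
  shows "continuous_on U (\<lambda>x. \<Sum>v\<in>Vert. (w x v / sum (w x) Vert) *\<^sub>R v)"
  using assms(2,3) by (intro continuous_intros) (auto simp: less_imp_neq[THEN not_sym])

lemma supp_in_hull: "x \<in> X \<Longrightarrow> x \<in> convex hull (supp x)"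
  using hull_iff_supp[OF supp_VS] by blast

text \<open>Subtract the threshold from all coordinates, drop negative values and renormalise. The
  surviving vertices lie strictly above the threshold, so they span a simplex of \<open>L\<close>.
  The order of the coordinates is kept, so \<open>am x\<close> stays constant along the segment and
  the segment stays in the neighbourhood.\<close>

lemma nbhd_deformation:
  assumes L: "down_closed L" and c: "c \<in> RC p (nbhd L)" "real_boundary p c \<in> RC (p - 1) (poly L)"
  obtains y where "y \<in> RC (Suc p) (nbhd L)" "c - real_boundary (Suc p) y \<in> RC p (poly L)"
proof -
  define w where "w x v = max 0 (lam x v - thr L x)" for x v
  define r where "r x = (\<Sum>v\<in>Vert. (w x v / sum (w x) Vert) *\<^sub>R v)" for x
  have NX: "nbhd L \<subseteq> X" by (auto simp: nbhd_def)
  have w0: "w x v \<ge> 0" for x v by (simp add: w_def)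
  have ws: "w x v = 0" if "x \<in> X" "v \<notin> supp x" for x v
    using that thr_nonneg[of L x] by (simp add: w_def supp_def)
  have lt: "thr L x < mx x" if "x \<in> nbhd L" for x
    using that thr_eq_mx_iff[OF L, of x] thr_le_mx[of x L] by (auto simp: nbhd_def less_le)
  have wpos: "sum (w x) Vert > 0" if x: "x \<in> nbhd L" for x
  proof -
    obtain v where v: "v \<in> am x" using am_nonempty x by (auto simp: nbhd_def)
    have "w x v > 0" using lt[OF x] v by (auto simp: w_def am_def)
    then show ?thesis using v finVert w0 by (intro sum_pos2[of Vert v]) (auto simp: am_def)
  qed
  have rp: "r x \<in> convex hull (supp x)" "r x \<in> X" "lam (r x) v = w x v / sum (w x) Vert" if x: "x \<in> nbhd L" for x v
    using weighted_point[of x "w x"] x w0 ws[of x] wpos[OF x] unfolding r_def by (auto simp: nbhd_def)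
  have cw: "continuous_on (nbhd L) (\<lambda>x. w x v)" for v
    unfolding w_def by (intro continuous_intros continuous_on_subset[OF continuous_lam NX] continuous_on_subset[OF continuous_thr NX])
  have cr: "continuous_on (nbhd L) r"
    unfolding r_def using continuous_weighted_point[of "nbhd L" w] NX cw wpos by auto
  have rim: "r ` nbhd L \<subseteq> poly L"
  proof clarify
    fix x assume x: "x \<in> nbhd L"
    have "supp (r x) = {v. lam x v > thr L x}"
    proof -
      have "w x v \<noteq> 0 \<longleftrightarrow> lam x v > thr L x" for v by (auto simp: w_def max_def)
      then show ?thesis using wpos[OF x] by (simp add: supp_def rp(3)[OF x])
    qed
    moreover have "supp (r x) \<in> VS" using supp_VS rp(2)[OF x] by blast
    ultimately have s: "{v. lam x v > thr L x} \<in> VS" by simp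
    have "supp (r x) \<in> L"
    proof (rule ccontr)
      assume "supp (r x) \<notin> L"
      then have "Min (lam x ` {v. lam x v > thr L x}) \<le> thr L x"
        using thr_ge[OF s] \<open>supp (r x) = _\<close> by simp
      moreover have "Min (lam x ` {v. lam x v > thr L x}) \<in> lam x ` {v. lam x v > thr L x}"
        using finV[OF s] nonempty[OF s] by (intro Min_in) auto
      ultimately show False by auto
    qed
    then show "r x \<in> poly L" using poly_iff[OF L rp(2)[OF x]] by simp
  qed
  have fx: "r x = x" if x: "x \<in> poly L" for x
  proof -
    have xX: "x \<in> X" using x poly_subset[OF down_closed_subset[OF L]] by blast
    have "thr L x = 0" using thr_eq_0_iff[OF L xX] poly_iff[OF L xX] x by simp
    then have "w x = lam x" using lam_nonneg[OF xX] by (auto simp: w_def fun_eq_iff)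
    then show ?thesis using sum_lam[OF xX] lam_expand[OF xX] by (simp add: r_def)
  qed
  have seg: "(1 - t) *\<^sub>R x + t *\<^sub>R r x \<in> nbhd L" if x: "x \<in> nbhd L" and t: "0 \<le> t" "t \<le> 1" for x t
  proof -
    have xX: "x \<in> X" using x NX by blast
    let ?y = "(1 - t) *\<^sub>R x + t *\<^sub>R r x"
    have l: "lam ?y v = (1 - t) * lam x v + t * (w x v / sum (w x) Vert)" for v
      using lam_segment(1)[OF supp_VS[OF xX] supp_in_hull[OF xX] rp(1)[OF x] t] rp(3)[OF x] by simp
    have yX: "?y \<in> X"
      using lam_segment(2)[OF supp_VS[OF xX] supp_in_hull[OF xX] rp(1)[OF x] t] .
    have le: "lam ?y v \<le> lam ?y u" if "lam x v \<le> lam x u" for u v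
      unfolding l using that t wpos[OF x]
      by (intro add_mono mult_left_mono divide_right_mono) (auto simp: w_def)
    \<comment> \<open>Maximal coordinates stay strictly larger: at \<open>t = 1\<close> because of
      the new weights, before that because of the old coordinates.\<close>
    have less: "lam ?y v < lam ?y u" if u: "u \<in> am x" and v: "v \<notin> am x" for u v
    proof -
      have vu: "lam x v < lam x u" "lam x u > thr L x"
        using u v am_iff[OF xX] lam_le_mx[OF xX, of v] lt[OF x] by (auto simp: less_le)
      then have w: "w x v < w x u" by (auto simp: w_def)
      show ?thesis
      proof (cases "t = 1")
        case True
        then show ?thesis unfolding l using w wpos[OF x] by (simp add: divide_strict_right_mono)
      next
        case False
        have "(1 - t) * lam x v < (1 - t) * lam x u" using vu False t by simp
        moreover have "t * (w x v / sum (w x) Vert) \<le> t * (w x u / sum (w x) Vert)"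
          using w t wpos[OF x] by (intro mult_left_mono divide_right_mono) auto
        ultimately show ?thesis unfolding l by linarith
      qed
    qed
    have "am ?y = am x"
    proof (rule subset_antisym; rule subsetI)
      fix u assume u: "u \<in> am ?y"
      obtain u' where u': "u' \<in> am x" using am_nonempty[OF xX] by blast
      show "u \<in> am x"
        using less[OF u', of u] am_iff'[OF yX, of u] u by (metis not_less)
    next
      fix u assume "u \<in> am x"
      then show "u \<in> am ?y" using le am_iff'[OF yX] am_iff'[OF xX] by blast
    qed
    then show ?thesis using x yX by (simp add: nbhd_def)
  qed
  show thesis
    by (rule deformation_retract_chains[OF poly_subset_nbhd[OF L] cr rim fx seg c]) (assumption | rule that)+
qed

lemma dual_poly_subset:
  assumes L: "down_closed L"
  shows "dual_poly L \<subseteq> X - poly L"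
  using poly_iff[OF L] am_subset_supp am_nonempty down_closedD[OF L] unfolding dual_poly_def by blast

text \<open>Cut all coordinates off at the threshold and renormalise. The vertices at or above it
  become maximal, and they include a simplex outside \<open>L\<close>. No positive coordinate
  becomes zero along the segment, so the support stays outside \<open>L\<close>.\<close>

lemma complement_deformation:
  assumes L: "down_closed L" and c: "c \<in> RC p (X - poly L)" "real_boundary p c \<in> RC (p - 1) (dual_poly L)"
  obtains y where "y \<in> RC (Suc p) (X - poly L)" "c - real_boundary (Suc p) y \<in> RC p (dual_poly L)"
proof -
  define w where "w x v = min (lam x v) (thr L x)" for x v
  define r where "r x = (\<Sum>v\<in>Vert. (w x v / sum (w x) Vert) *\<^sub>R v)" for x
  let ?U = "X - poly L"
  have w0: "w x v \<ge> 0" if "x \<in> X" for x v using lam_nonneg[OF that] thr_nonneg[of L x] by (simp add: w_def)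
  have ws: "w x v = 0" if "v \<notin> supp x" for x v
    using that thr_nonneg[of L x] by (simp add: w_def supp_def)
  have tp: "thr L x > 0" if "x \<in> ?U" for x
    using that thr_eq_0_iff[OF L, of x] poly_iff[OF L, of x] thr_nonneg[of L x] by (auto simp: less_le)
  have wpos: "sum (w x) Vert > 0" if x: "x \<in> ?U" for x
  proof -
    obtain v where v: "v \<in> am x" using am_nonempty x by blast
    have "w x v > 0" using tp[OF x] v mx_pos[of x] x by (auto simp: w_def am_def)
    then show ?thesis using v finVert w0[of x] x by (intro sum_pos2[of Vert v]) (auto simp: am_def)
  qed
  have rp: "r x \<in> convex hull (supp x)" "r x \<in> X" "lam (r x) v = w x v / sum (w x) Vert" if x: "x \<in> ?U" for x v
    using weighted_point[of x "w x"] x w0[of x] ws[of _ x] wpos[OF x] unfolding r_def by auto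
  have cw: "continuous_on ?U (\<lambda>x. w x v)" for v
    unfolding w_def by (intro continuous_intros continuous_on_subset[OF continuous_lam] continuous_on_subset[OF continuous_thr]) auto
  have cr: "continuous_on ?U r"
    unfolding r_def using continuous_weighted_point[of ?U w] cw wpos by auto
  have rim: "r ` ?U \<subseteq> dual_poly L"
  proof clarify
    fix x assume x: "x \<in> X" "x \<notin> poly L"
    then have x': "x \<in> ?U" by simp
    obtain \<rho> where \<rho>: "\<rho> \<in> VS" "\<rho> \<notin> L" "\<And>v. v \<in> \<rho> \<Longrightarrow> thr L x \<le> lam x v"
      by (rule thr_pos_witness[OF tp[OF x']]) (rule that)
    have "\<rho> \<subseteq> am (r x)"
    proof
      fix v assume "v \<in> \<rho>"
      then have "w x u \<le> w x v" for u using \<rho>(3)[of v] by (auto simp: w_def)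
      then show "v \<in> am (r x)"
        unfolding am_iff'[OF rp(2)[OF x']] rp(3)[OF x'] using wpos[OF x'] by (auto intro: divide_right_mono)
    qed
    then have "am (r x) \<notin> L" using down_closedD[OF L] \<rho> nonempty by blast
    then show "r x \<in> dual_poly L" using rp(2)[OF x'] by (simp add: dual_poly_def)
  qed
  have fx: "r x = x" if x: "x \<in> dual_poly L" for x
  proof -
    have xX: "x \<in> X" using x by (simp add: dual_poly_def)
    have "thr L x = mx x" using thr_eq_mx_iff[OF L xX] x by (simp add: dual_poly_def)
    then have "w x = lam x" using lam_le_mx[OF xX] by (auto simp: w_def fun_eq_iff)
    then show ?thesis using sum_lam[OF xX] lam_expand[OF xX] by (simp add: r_def)
  qed
  have seg: "(1 - t) *\<^sub>R x + t *\<^sub>R r x \<in> ?U" if x: "x \<in> ?U" and t: "0 \<le> t" "t \<le> 1" for x t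
  proof -
    have xX: "x \<in> X" using x by blast
    let ?y = "(1 - t) *\<^sub>R x + t *\<^sub>R r x"
    have l: "lam ?y v = (1 - t) * lam x v + t * (w x v / sum (w x) Vert)" for v
      using lam_segment(1)[OF supp_VS[OF xX] supp_in_hull[OF xX] rp(1)[OF x] t] rp(3)[OF x] by simp
    have yX: "?y \<in> X"
      using lam_segment(2)[OF supp_VS[OF xX] supp_in_hull[OF xX] rp(1)[OF x] t] .
    have "lam ?y v \<noteq> 0" if "lam x v \<noteq> 0" for v
    proof -
      have p: "lam x v > 0" using that lam_nonneg[OF xX, of v] by simp
      then have "w x v > 0" using tp[OF x] by (simp add: w_def)
      then have q: "w x v / sum (w x) Vert > 0" using wpos[OF x] by simp
      have "lam ?y v > 0"
      proof (cases "t = 1")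
        case False
        then have "(1 - t) * lam x v > 0" using p t by simp
        moreover have "t * (w x v / sum (w x) Vert) \<ge> 0" using q t by (intro mult_nonneg_nonneg) auto
        ultimately show ?thesis unfolding l by linarith
      qed (use q l in simp)
      then show ?thesis by simp
    qed
    then have "supp x \<subseteq> supp ?y" by (auto simp: supp_def)
    moreover have "supp x \<notin> L" using x poly_iff[OF L xX] by simp
    ultimately have "supp ?y \<notin> L" using down_closedD[OF L] nonempty[OF supp_VS[OF xX]] by blast
    then show ?thesis using yX poly_iff[OF L yX] by simp
  qed
  show thesis
    by (rule deformation_retract_chains[OF dual_poly_subset[OF L] cr rim fx seg c]) (assumption | rule that)+
qed

section \<open>Closures of single simplices\<close>

definition "closure_of_simplex V = {W. W \<subseteq> V \<and> W \<noteq> {}}"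

lemma closure_of_simplex_down_closed: "V \<in> VS \<Longrightarrow> down_closed (closure_of_simplex V)"
  using face by (auto simp: down_closed_def closure_of_simplex_def)

lemma poly_closure_of_simplex:
  assumes "V \<in> VS" shows "poly (closure_of_simplex V) = convex hull V"
proof
  show "poly (closure_of_simplex V) \<subseteq> convex hull V"
    unfolding poly_def closure_of_simplex_def using hull_mono by blast
  show "convex hull V \<subseteq> poly (closure_of_simplex V)"
    unfolding poly_def closure_of_simplex_def using nonempty[OF assms] by auto
qed

text \<open>Cycles of the neighbourhood are pushed into the simplex, which is convex. This provides
  the base case of the induction over subcomplexes.\<close>

lemma acyclic_nbhd_simplex:
  assumes V: "V \<in> VS"
  shows "acyclic_set (nbhd (closure_of_simplex V))"
  unfolding acyclic_set_def
proof (intro allI ballI)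
  fix p c assume c: "c \<in> reduced_cycles p (top_of_set (nbhd (closure_of_simplex V)))"
  let ?C = "closure_of_simplex V"
  have d: "down_closed ?C" using closure_of_simplex_down_closed[OF V] .
  obtain y where y: "y \<in> RC (Suc p) (nbhd ?C)" "c - real_boundary (Suc p) y \<in> RC p (poly ?C)"
    using nbhd_deformation[OF d, of c p] c by (auto simp: reduced_cycles_iff)
  have "c - real_boundary (Suc p) y \<in> reduced_cycles p (top_of_set (nbhd ?C))"
    using subspace_diff[OF subspace_reduced_cycles c boundary_in_reduced_cycles[OF y(1)]] .
  then have "c - real_boundary (Suc p) y \<in> reduced_cycles p (top_of_set (convex hull V))"
    using y(2) by (simp add: reduced_cycles_iff poly_closure_of_simplex[OF V])
  moreover have "contractible_space (top_of_set (convex hull V))"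
    by (simp add: convex_imp_contractible)
  ultimately obtain y' where y': "y' \<in> RC (Suc p) (convex hull V)" "real_boundary (Suc p) y' = c - real_boundary (Suc p) y"
    using contractible_space_real_boundary by blast
  have "y' \<in> RC (Suc p) (nbhd ?C)"
    using RC_mono[OF _ y'(1)] poly_subset_nbhd[OF d] poly_closure_of_simplex[OF V] by simp
  then show "\<exists>y\<in>RC (Suc p) (nbhd ?C). real_boundary (Suc p) y = c"
    using y(1) y'(2) by (intro bexI[of _ "y + y'"]) (auto simp: real_boundary_add RC_add)
qed

end

subsection \<open>Simplicial chains and cochains\<close>

lemma antisymmetric_double_sum:
  fixes f :: "'b \<Rightarrow> 'b \<Rightarrow> 'v::real_vector"
  assumes S: "finite S" and f: "\<And>v w. v \<in> S \<Longrightarrow> w \<in> S \<Longrightarrow> v \<noteq> w \<Longrightarrow> f v w = - f w v"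
  shows "(\<Sum>v\<in>S. \<Sum>w\<in>S - {v}. f v w) = 0"
proof -
  define g where "g v w = (if v = w then 0 else f v w)" for v w
  have e: "(\<Sum>w\<in>S - {v}. f v w) = (\<Sum>w\<in>S. g v w)" if "v \<in> S" for v
    using S that by (intro sum.mono_neutral_cong_left) (auto simp: g_def)
  have "(\<Sum>v\<in>S. \<Sum>w\<in>S. g v w) = (\<Sum>v\<in>S. \<Sum>w\<in>S. - g w v)"
  proof (intro sum.cong refl)
    fix v w assume vw: "v \<in> S" "w \<in> S"
    show "g v w = - g w v"
    proof (cases "v = w")
      case False
      then show ?thesis using f[OF vw False] by (simp add: g_def)
    qed (simp add: g_def)
  qed
  also have "\<dots> = - (\<Sum>v\<in>S. \<Sum>w\<in>S. g w v)" by (simp add: sum_negf)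
  also have "(\<Sum>v\<in>S. \<Sum>w\<in>S. g w v) = (\<Sum>v\<in>S. \<Sum>w\<in>S. g v w)" by (rule sum.swap)
  finally have "(\<Sum>v\<in>S. \<Sum>w\<in>S. g v w) + (\<Sum>v\<in>S. \<Sum>w\<in>S. g v w) = 0" by (simp add: eq_neg_iff_add_eq_0)
  then have "(2::real) *\<^sub>R (\<Sum>v\<in>S. \<Sum>w\<in>S. g v w) = 0" by (simp add: scaleR_2)
  then show ?thesis using e by simp
qed

context geometric_complex
begin

definition vord :: "'a \<Rightarrow> nat" where "vord = (SOME f. inj_on f Vert)"

lemma inj_vord: "inj_on vord Vert"
  unfolding vord_def using finite_imp_inj_to_nat_seg[OF finVert] by (metis someI)

text \<open>The incidence sign of \<open>\<rho>\<close> in \<open>insert v \<rho>\<close>: the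
  parity of the position of \<open>v\<close> in an arbitrary fixed order of the vertices.\<close>

definition sg :: "'a \<Rightarrow> 'a set \<Rightarrow> real" where
  "sg v \<rho> = (-1) ^ card {u \<in> \<rho>. vord u < vord v}"

lemma sg_square [simp]: "sg v \<rho> * sg v \<rho> = 1"
  by (simp add: sg_def flip: power_add mult_2)

lemma sg_square2 [simp]: "sg v \<rho> * (sg v \<rho> * a) = a"
  by (simp flip: mult.assoc)

lemma sg_nonzero [simp]: "sg v \<rho> \<noteq> 0"
  by (simp add: sg_def)

lemma sg_empty [simp]: "sg v {} = 1"
  by (simp add: sg_def)

lemma sg_insert:
  assumes "finite \<rho>" "v \<notin> \<rho>"
  shows "sg w (insert v \<rho>) = (if vord v < vord w then - sg w \<rho> else sg w \<rho>)"
proof (cases "vord v < vord w")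
  case True
  then have "{u \<in> insert v \<rho>. vord u < vord w} = insert v {u \<in> \<rho>. vord u < vord w}" by auto
  then show ?thesis using assms True by (simp add: sg_def)
next
  case False
  then have "{u \<in> insert v \<rho>. vord u < vord w} = {u \<in> \<rho>. vord u < vord w}" by auto
  then show ?thesis using False by (simp add: sg_def)
qed

lemma sg_anti:
  assumes "finite \<rho>" "v \<notin> \<rho>" "w \<notin> \<rho>" "v \<noteq> w" "v \<in> Vert" "w \<in> Vert"
  shows "sg v \<rho> * sg w (insert v \<rho>) = - (sg w \<rho> * sg v (insert w \<rho>))"
proof -
  have "vord v \<noteq> vord w" using inj_vord assms by (auto simp: inj_on_def)
  then show ?thesis using assms by (auto simp: sg_insert)
qed

lemma sg_anti':
  assumes "finite \<rho>" "v \<notin> \<rho>" "w \<notin> \<rho>" "v \<noteq> w" "v \<in> Vert" "w \<in> Vert"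
  shows "sg v (insert w \<rho>) = - (sg w (insert v \<rho>) * (sg v \<rho> * sg w \<rho>))"
proof -
  have "sg w \<rho> * (sg w \<rho> * sg v (insert w \<rho>)) = sg w \<rho> * (- (sg v \<rho> * sg w (insert v \<rho>)))"
    using sg_anti[OF assms] by simp
  then show ?thesis by (simp add: mult_ac)
qed

text \<open>The value 0 at the empty set makes this the unreduced boundary; the augmentation is
  imposed separately as the sum over \<open>{v}\<close>.\<close>

definition sbd :: "('a set \<Rightarrow> real) \<Rightarrow> 'a set \<Rightarrow> real" where
  "sbd x = (\<lambda>\<rho>. if \<rho> = {} then 0 else \<Sum>v\<in>Vert - \<rho>. sg v \<rho> * x (insert v \<rho>))"

definition scobd :: "('a set \<Rightarrow> real) \<Rightarrow> 'a set \<Rightarrow> real" where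
  "scobd y = (\<lambda>\<sigma>. \<Sum>v\<in>\<sigma>. sg v (\<sigma> - {v}) * y (\<sigma> - {v}))"

text \<open>Chains are graded by number of vertices, so the simplices in \<open>SC A k\<close> have
  dimension \<open>k - 1\<close>. For subcomplexes, degree 0 is trivial because the empty set is not
  a simplex.\<close>

definition SC :: "'a set set \<Rightarrow> nat \<Rightarrow> ('a set \<Rightarrow> real) set" where
  "SC A k = {x. \<forall>\<sigma>. x \<sigma> \<noteq> 0 \<longrightarrow> \<sigma> \<in> A \<and> card \<sigma> = k}"

lemma linear_sbd: "linear sbd"
  by (rule linearI) (auto simp: sbd_def fun_eq_iff algebra_simps sum.distrib sum_distrib_left)

lemma linear_scobd: "linear scobd"
  by (rule linearI) (auto simp: scobd_def fun_eq_iff algebra_simps sum.distrib sum_distrib_left)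

lemmas sbd_add = linear_add[OF linear_sbd] and sbd_diff = linear_diff[OF linear_sbd]
  and sbd_neg = linear_neg[OF linear_sbd] and sbd_0 [simp] = linear_0[OF linear_sbd]
lemmas scobd_add = linear_add[OF linear_scobd] and scobd_diff = linear_diff[OF linear_scobd]
  and scobd_neg = linear_neg[OF linear_scobd] and scobd_0 [simp] = linear_0[OF linear_scobd]

lemma subspace_SC: "subspace (SC A k)"
proof (rule subspaceI)
  fix x y assume "x \<in> SC A k" "y \<in> SC A k"
  then have "(x + y) \<sigma> \<noteq> 0 \<Longrightarrow> \<sigma> \<in> A \<and> card \<sigma> = k" for \<sigma>
    by (cases "x \<sigma> = 0") (auto simp: SC_def)
  then show "x + y \<in> SC A k" by (simp add: SC_def)
qed (auto simp: SC_def)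

lemmas SC_add = subspace_add[OF subspace_SC] and SC_diff = subspace_diff[OF subspace_SC]
  and SC_neg = subspace_neg[OF subspace_SC] and SC_0 [simp] = subspace_0[OF subspace_SC]

lemma SC_mono: "A \<subseteq> B \<Longrightarrow> x \<in> SC A k \<Longrightarrow> x \<in> SC B k"
  by (auto simp: SC_def)

lemma SC_zero_card: "down_closed A \<Longrightarrow> x \<in> SC A 0 \<Longrightarrow> x = 0"
  using finV nonempty down_closed_subset unfolding SC_def fun_eq_iff
  by (metis (mono_tags, lifting) card_0_eq mem_Collect_eq subset_iff zero_fun_apply)

lemma sbd_SC:
  assumes A: "down_closed A" and x: "x \<in> SC A (Suc k)"
  shows "sbd x \<in> SC A k"
  unfolding SC_def
proof (intro CollectI allI impI)
  fix \<rho> assume nz: "sbd x \<rho> \<noteq> 0"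
  then have ne: "\<rho> \<noteq> {}" by (auto simp: sbd_def)
  then have "(\<Sum>v\<in>Vert - \<rho>. sg v \<rho> * x (insert v \<rho>)) \<noteq> 0" using nz by (simp add: sbd_def)
  then obtain v where v: "v \<in> Vert - \<rho>" "sg v \<rho> * x (insert v \<rho>) \<noteq> 0"
    by (rule sum.not_neutral_contains_not_neutral)
  then have i: "insert v \<rho> \<in> A" "card (insert v \<rho>) = Suc k" using x by (auto simp: SC_def)
  then have "finite (insert v \<rho>)" using finV[of "insert v \<rho>"] down_closed_subset[OF A] by auto
  then show "\<rho> \<in> A \<and> card \<rho> = k" using i v down_closedD[OF A i(1) _ ne] by auto
qed

lemma sbd_SC_1: "down_closed A \<Longrightarrow> x \<in> SC A (Suc 0) \<Longrightarrow> sbd x = 0"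
  using sbd_SC SC_zero_card by blast

lemma sbd_sbd:
  assumes x: "x \<in> SC VS k"
  shows "sbd (sbd x) = 0"
proof
  fix \<rho>
  show "sbd (sbd x) \<rho> = 0 \<rho>"
  proof (cases "\<rho> = {}")
    case False
    have "sbd (sbd x) \<rho> = (\<Sum>v\<in>Vert - \<rho>. \<Sum>w\<in>(Vert - \<rho>) - {v}. sg v \<rho> * sg w (insert v \<rho>) * x (insert w (insert v \<rho>)))"
    proof -
      have "Vert - insert v \<rho> = Vert - \<rho> - {v}" for v by blast
      then show ?thesis using False by (simp add: sbd_def sum_distrib_left mult.assoc)
    qed
    also have "\<dots> = 0"
    proof (rule antisymmetric_double_sum)
      show "finite (Vert - \<rho>)" using finVert by simp
      fix v w assume vw: "v \<in> Vert - \<rho>" "w \<in> Vert - \<rho>" "v \<noteq> w"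
      show "sg v \<rho> * sg w (insert v \<rho>) * x (insert w (insert v \<rho>)) = - (sg w \<rho> * sg v (insert w \<rho>) * x (insert v (insert w \<rho>)))"
      proof (cases "x (insert w (insert v \<rho>)) = 0")
        case False
        then have "insert w (insert v \<rho>) \<in> VS" using x by (auto simp: SC_def)
        then have "finite \<rho>" using finV by fastforce
        then show ?thesis using sg_anti[of \<rho> v w] vw by (simp add: insert_commute)
      qed (simp add: insert_commute)
    qed
    finally show ?thesis by simp
  qed (simp add: sbd_def)
qed

text \<open>Removing two vertices in either order gives opposite signs. Values in a vector space let
  the identity serve real cochains and families of singular chains alike.\<close>

lemma face_sum_twice:
  fixes g :: "'a set \<Rightarrow> 'v::real_vector"
  assumes \<sigma>: "\<sigma> \<in> VS"
  shows "(\<Sum>v\<in>\<sigma>. sg v (\<sigma> - {v}) *\<^sub>R (\<Sum>w\<in>\<sigma> - {v}. sg w (\<sigma> - {v} - {w}) *\<^sub>R g (\<sigma> - {v} - {w}))) = 0"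
proof -
  have "(\<Sum>v\<in>\<sigma>. sg v (\<sigma> - {v}) *\<^sub>R (\<Sum>w\<in>\<sigma> - {v}. sg w (\<sigma> - {v} - {w}) *\<^sub>R g (\<sigma> - {v} - {w})))
      = (\<Sum>v\<in>\<sigma>. \<Sum>w\<in>\<sigma> - {v}. (sg v (\<sigma> - {v}) * sg w (\<sigma> - {v} - {w})) *\<^sub>R g (\<sigma> - {v} - {w}))"
    by (simp add: scaleR_sum_right)
  also have "\<dots> = 0"
  proof (rule antisymmetric_double_sum)
    show "finite \<sigma>" using finV[OF \<sigma>] .
    fix v w assume vw: "v \<in> \<sigma>" "w \<in> \<sigma>" "v \<noteq> w"
    define \<rho> where "\<rho> = \<sigma> - {v} - {w}"
    have e: "\<sigma> - {v} = insert w \<rho>" "\<sigma> - {w} = insert v \<rho>"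
      using vw by (auto simp: \<rho>_def)
    have e': "\<sigma> - {v} - {w} = \<rho>" "\<sigma> - {w} - {v} = \<rho>" by (auto simp: \<rho>_def)
    have "sg w \<rho> * sg v (insert w \<rho>) = - (sg v \<rho> * sg w (insert v \<rho>))"
      by (rule sg_anti) (use vw finV[OF \<sigma>] subVert[OF \<sigma>] in \<open>auto simp: \<rho>_def\<close>)
    then show "(sg v (\<sigma> - {v}) * sg w (\<sigma> - {v} - {w})) *\<^sub>R g (\<sigma> - {v} - {w})
        = - ((sg w (\<sigma> - {w}) * sg v (\<sigma> - {w} - {v})) *\<^sub>R g (\<sigma> - {w} - {v}))"
      unfolding e' unfolding e by (simp add: mult.commute)
  qed
  finally show ?thesis .
qed

lemma scobd_scobd: "\<sigma> \<in> VS \<Longrightarrow> scobd (scobd y) \<sigma> = 0"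
  using face_sum_twice[of \<sigma> y] by (simp add: scobd_def)

text \<open>Both sides sum over incident pairs of a simplex and a facet. The empty facet of a vertex
  contributes nothing because \<open>g {} = 0\<close>.\<close>

lemma sbd_adjoint:
  fixes g :: "'a set \<Rightarrow> 'v::real_vector"
  assumes x: "x \<in> SC VS k" and g: "g {} = 0"
  shows "(\<Sum>\<sigma>\<in>VS. x \<sigma> *\<^sub>R (\<Sum>v\<in>\<sigma>. sg v (\<sigma> - {v}) *\<^sub>R g (\<sigma> - {v}))) = (\<Sum>\<rho>\<in>VS. sbd x \<rho> *\<^sub>R g \<rho>)"
proof -
  have "(\<Sum>\<sigma>\<in>VS. x \<sigma> *\<^sub>R (\<Sum>v\<in>\<sigma>. sg v (\<sigma> - {v}) *\<^sub>R g (\<sigma> - {v})))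
      = (\<Sum>(\<sigma>,v)\<in>(SIGMA \<sigma>:VS. \<sigma>). (x \<sigma> * sg v (\<sigma> - {v})) *\<^sub>R g (\<sigma> - {v}))"
    using finVS finV by (simp add: scaleR_sum_right sum.Sigma)
  also have "\<dots> = (\<Sum>(\<rho>,v)\<in>(SIGMA \<rho>:VS. Vert - \<rho>). (x (insert v \<rho>) * sg v \<rho>) *\<^sub>R g \<rho>)"
  \<comment> \<open>Pairs are matched by removing and adding \<open>v\<close>. Unmatched are the
    pairs with empty facet and the pairs whose join is not a simplex; both kinds contribute
    zero.\<close>
  proof (rule sum.reindex_bij_witness_not_neutral[where
        S' = "{p \<in> (SIGMA \<sigma>:VS. \<sigma>). fst p - {snd p} = {}}" and
        T' = "{p \<in> (SIGMA \<rho>:VS. Vert - \<rho>). insert (snd p) (fst p) \<notin> VS}" and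
        i = "\<lambda>(\<rho>,v). (insert v \<rho>, v)" and j = "\<lambda>(\<sigma>,v). (\<sigma> - {v}, v)"])
    show "finite {p \<in> (SIGMA \<sigma>:VS. \<sigma>). fst p - {snd p} = {}}"
      using finVS finV by (intro finite_subset[OF _ finite_SigmaI[of VS "\<lambda>\<sigma>. \<sigma>"]]) auto
    show "finite {p \<in> (SIGMA \<rho>:VS. Vert - \<rho>). insert (snd p) (fst p) \<notin> VS}"
      using finVS finVert by (intro finite_subset[OF _ finite_SigmaI[of VS "\<lambda>\<rho>. Vert - \<rho>"]]) auto
    fix p assume p: "p \<in> (SIGMA \<sigma>:VS. \<sigma>) - {p \<in> (SIGMA \<sigma>:VS. \<sigma>). fst p - {snd p} = {}}"
    obtain \<sigma> v where pv: "p = (\<sigma>, v)" by (cases p)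
    have \<sigma>: "p = (\<sigma>, v)" "\<sigma> \<in> VS" "v \<in> \<sigma>" "\<sigma> - {v} \<noteq> {}" using p pv by auto
    have i: "insert v (\<sigma> - {v}) = \<sigma>" using \<sigma> by auto
    show "(\<lambda>(\<rho>,v). (insert v \<rho>, v)) ((\<lambda>(\<sigma>,v). (\<sigma> - {v}, v)) p) = p" using \<sigma> i by auto
    have "\<sigma> - {v} \<in> VS" using face[OF \<sigma>(2) _ \<sigma>(4)] by blast
    moreover have "v \<in> Vert" using subVert \<sigma> by blast
    ultimately show "(\<lambda>(\<sigma>,v). (\<sigma> - {v}, v)) p \<in> (SIGMA \<rho>:VS. Vert - \<rho>) - {p \<in> (SIGMA \<rho>:VS. Vert - \<rho>). insert (snd p) (fst p) \<notin> VS}"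
      using \<sigma> i by auto
  next
    fix p assume "p \<in> (SIGMA \<sigma>:VS. \<sigma>)"
    then show "(case (\<lambda>(\<sigma>,v). (\<sigma> - {v}, v)) p of (\<rho>,v) \<Rightarrow> (x (insert v \<rho>) * sg v \<rho>) *\<^sub>R g \<rho>) =
        (case p of (\<sigma>,v) \<Rightarrow> (x \<sigma> * sg v (\<sigma> - {v})) *\<^sub>R g (\<sigma> - {v}))"
      by (auto simp: insert_absorb)
  next
    fix p assume p: "p \<in> (SIGMA \<rho>:VS. Vert - \<rho>) - {p \<in> (SIGMA \<rho>:VS. Vert - \<rho>). insert (snd p) (fst p) \<notin> VS}"
    then obtain \<rho> v where \<rho>: "p = (\<rho>, v)" "\<rho> \<in> VS" "v \<in> Vert" "v \<notin> \<rho>" "insert v \<rho> \<in> VS" by auto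
    have i: "insert v \<rho> - {v} = \<rho>" using \<rho> by auto
    show "(\<lambda>(\<sigma>,v). (\<sigma> - {v}, v)) ((\<lambda>(\<rho>,v). (insert v \<rho>, v)) p) = p" using \<rho> i by auto
    show "(\<lambda>(\<rho>,v). (insert v \<rho>, v)) p \<in> (SIGMA \<sigma>:VS. \<sigma>) - {p \<in> (SIGMA \<sigma>:VS. \<sigma>). fst p - {snd p} = {}}"
      using \<rho> i nonempty[OF \<rho>(2)] by auto
  next
    fix p assume p: "p \<in> {p \<in> (SIGMA \<sigma>:VS. \<sigma>). fst p - {snd p} = {}}"
    obtain \<sigma> v where pv: "p = (\<sigma>, v)" by (cases p)
    then have "\<sigma> - {v} = {}" using p by auto
    then show "(case p of (\<sigma>,v) \<Rightarrow> (x \<sigma> * sg v (\<sigma> - {v})) *\<^sub>R g (\<sigma> - {v})) = 0"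
      unfolding pv split_conv by (simp only: g scaleR_zero_right)
  next
    fix p assume "p \<in> {p \<in> (SIGMA \<rho>:VS. Vert - \<rho>). insert (snd p) (fst p) \<notin> VS}"
    then show "(case p of (\<rho>,v) \<Rightarrow> (x (insert v \<rho>) * sg v \<rho>) *\<^sub>R g \<rho>) = 0"
      using x by (cases p) (auto simp: SC_def)
  qed
  also have "\<dots> = (\<Sum>\<rho>\<in>VS. \<Sum>v\<in>Vert - \<rho>. (x (insert v \<rho>) * sg v \<rho>) *\<^sub>R g \<rho>)"
    using finVS finVert by (simp add: sum.Sigma)
  also have "\<dots> = (\<Sum>\<rho>\<in>VS. sbd x \<rho> *\<^sub>R g \<rho>)"
    using nonempty by (intro sum.cong refl) (auto simp: sbd_def scaleR_sum_left mult.commute)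
  finally show ?thesis .
qed

text \<open>The cone over \<open>x\<close> with apex \<open>v0\<close>. The assumption
  \<open>red\<close> stands for the boundary at the empty set, which \<open>sbd\<close>
  suppresses.\<close>

lemma simplex_cycle_bounds:
  assumes V: "V \<in> VS" and x: "x \<in> SC (closure_of_simplex V) (Suc k)" and bd: "sbd x = 0"
    and red: "(\<Sum>v\<in>Vert. x {v}) = 0"
  obtains x' where "x' \<in> SC (closure_of_simplex V) (Suc (Suc k))" "sbd x' = x"
proof -
  obtain v0 where v0: "v0 \<in> V" using nonempty[OF V] by blast
  have v0V: "v0 \<in> Vert" using v0 subVert[OF V] by blast
  have xe: "x {} = 0" using x by (auto simp: SC_def closure_of_simplex_def)
  have xV: "\<sigma> \<subseteq> V" "finite \<sigma>" if "x \<sigma> \<noteq> 0" for \<sigma>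
    using x that finV[OF V] by (auto simp: SC_def closure_of_simplex_def intro: finite_subset)
  define h where "h \<sigma> = (if v0 \<in> \<sigma> then sg v0 (\<sigma> - {v0}) * x (\<sigma> - {v0}) else 0)" for \<sigma>
  show thesis
  proof
    show "h \<in> SC (closure_of_simplex V) (Suc (Suc k))"
      unfolding SC_def
    proof (intro CollectI allI impI)
      fix \<sigma> assume "h \<sigma> \<noteq> 0"
      then have \<sigma>: "v0 \<in> \<sigma>" "x (\<sigma> - {v0}) \<noteq> 0" by (auto simp: h_def split: if_splits)
      then have "\<sigma> - {v0} \<subseteq> V" "finite (\<sigma> - {v0})" "card (\<sigma> - {v0}) = Suc k"
        using xV[OF \<sigma>(2)] x unfolding SC_def by blast+
      moreover have "card \<sigma> = Suc (card (\<sigma> - {v0}))"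
        using \<sigma>(1) \<open>finite (\<sigma> - {v0})\<close> by (intro card.remove) auto
      moreover have "\<sigma> \<subseteq> V" "\<sigma> \<noteq> {}" using \<open>\<sigma> - {v0} \<subseteq> V\<close> v0 \<sigma>(1) by blast+
      ultimately show "\<sigma> \<in> closure_of_simplex V \<and> card \<sigma> = Suc (Suc k)"
        by (simp add: closure_of_simplex_def)
    qed
    show "sbd h = x"
    proof
      fix \<rho>
      consider "\<rho> = {}" | "\<rho> \<noteq> {}" "v0 \<notin> \<rho>" | "v0 \<in> \<rho>" by blast
      then show "sbd h \<rho> = x \<rho>"
      proof cases
        case 1
        then show ?thesis using xe by (simp add: sbd_def)
      next
        case 2
        have "sbd h \<rho> = (\<Sum>v\<in>Vert - \<rho>. sg v \<rho> * h (insert v \<rho>))" using 2 by (simp add: sbd_def)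
        also have "\<dots> = (\<Sum>v\<in>{v0}. sg v \<rho> * h (insert v \<rho>))"
          using 2 v0V finVert by (intro sum.mono_neutral_right) (auto simp: h_def)
        also have "\<dots> = x \<rho>" using 2 by (simp add: h_def)
        finally show ?thesis .
      next
        case 3
        define \<rho>' where "\<rho>' = \<rho> - {v0}"
        have \<rho>: "\<rho> = insert v0 \<rho>'" "v0 \<notin> \<rho>'" using 3 by (auto simp: \<rho>'_def)
        have "sbd h \<rho> = (\<Sum>v\<in>Vert - \<rho>. sg v \<rho> * h (insert v \<rho>))" using 3 by (auto simp: sbd_def)
        also have "\<dots> = (\<Sum>v\<in>Vert - \<rho>. - sg v0 \<rho>' * (sg v \<rho>' * x (insert v \<rho>')))"
        proof (rule sum.cong[OF refl])
          fix v assume v: "v \<in> Vert - \<rho>"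
          have e: "insert v \<rho> - {v0} = insert v \<rho>'" using v \<rho> by auto
          show "sg v \<rho> * h (insert v \<rho>) = - sg v0 \<rho>' * (sg v \<rho>' * x (insert v \<rho>'))"
          proof (cases "x (insert v \<rho>') = 0")
            case True
            then show ?thesis using 3 e by (simp add: h_def)
          next
            case False
            then have "finite \<rho>'" using xV by fastforce
            then have "sg v (insert v0 \<rho>') = - (sg v0 (insert v \<rho>') * (sg v \<rho>' * sg v0 \<rho>'))"
              using v \<rho> v0V by (intro sg_anti') auto
            then show ?thesis using 3 e unfolding \<rho>(1) by (simp add: h_def mult_ac)
          qed
        qed
        also have "\<dots> = - sg v0 \<rho>' * (\<Sum>v\<in>Vert - \<rho>. sg v \<rho>' * x (insert v \<rho>'))"
          by (simp add: sum_distrib_left)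
        also have "(\<Sum>v\<in>Vert - \<rho>. sg v \<rho>' * x (insert v \<rho>')) = (\<Sum>v\<in>Vert - \<rho>'. sg v \<rho>' * x (insert v \<rho>')) - sg v0 \<rho>' * x \<rho>"
        proof -
          have "Vert - \<rho>' = insert v0 (Vert - \<rho>)" using v0V \<rho> by auto
          moreover have f: "finite (Vert - \<rho>)" "v0 \<notin> Vert - \<rho>" using finVert 3 by auto
          ultimately show ?thesis by (simp only: sum.insert[OF f] \<rho>(1)[symmetric] add_diff_cancel_left')
        qed
        also have "(\<Sum>v\<in>Vert - \<rho>'. sg v \<rho>' * x (insert v \<rho>')) = 0"
        proof (cases "\<rho>' = {}")
          case True
          then show ?thesis using red by simp
        next
          case False
          then show ?thesis using fun_cong[OF bd, of \<rho>'] by (simp add: sbd_def)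
        qed
        finally show ?thesis by simp
      qed
    qed
  qed
qed

text \<open>Contraction with \<open>v0\<close>, the transpose of the cone construction. The number
  \<open>Suc (Suc k)\<close> of vertices means positive degree; in degree 0 the analogue is
  constancy, \<open>edge_cocycle_constant\<close>.\<close>

lemma simplex_cocycle_bounds:
  assumes V: "V \<in> VS" and y: "\<And>\<sigma>. y \<sigma> \<noteq> 0 \<Longrightarrow> card \<sigma> = Suc (Suc k)"
    and bd: "\<And>\<sigma>. \<sigma> \<in> closure_of_simplex V \<Longrightarrow> scobd y \<sigma> = 0"
  obtains y' where "y' \<in> SC VS (Suc k)" "\<And>\<sigma>. \<sigma> \<in> closure_of_simplex V \<Longrightarrow> scobd y' \<sigma> = y \<sigma>"
proof -
  obtain v0 where v0: "v0 \<in> V" using nonempty[OF V] by blast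
  have v0V: "v0 \<in> Vert" using v0 subVert[OF V] by blast
  define h where "h \<sigma> = (if v0 \<notin> \<sigma> \<and> \<sigma> \<in> closure_of_simplex V then sg v0 \<sigma> * y (insert v0 \<sigma>) else 0)" for \<sigma>
  have single: "y {v} = 0" for v using y[of "{v}"] by auto
  show thesis
  proof
    show "h \<in> SC VS (Suc k)"
      unfolding SC_def
    proof (intro CollectI allI impI)
      fix \<sigma> assume "h \<sigma> \<noteq> 0"
      then have \<sigma>: "v0 \<notin> \<sigma>" "\<sigma> \<in> closure_of_simplex V" "y (insert v0 \<sigma>) \<noteq> 0" by (auto simp: h_def split: if_splits)
      then have "\<sigma> \<in> VS" using down_closed_subset closure_of_simplex_down_closed[OF V] by blast
      then show "\<sigma> \<in> VS \<and> card \<sigma> = Suc k" using y[OF \<sigma>(3)] \<sigma>(1) finV by auto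
    qed
    fix \<sigma> assume \<sigma>: "\<sigma> \<in> closure_of_simplex V"
    then have \<sigma>VS: "\<sigma> \<in> VS" using down_closed_subset closure_of_simplex_down_closed[OF V] by blast
    have fin: "finite \<sigma>" using finV[OF \<sigma>VS] .
    have h: "h (\<sigma> - {v}) = (if v0 \<notin> \<sigma> - {v} then sg v0 (\<sigma> - {v}) * y (insert v0 (\<sigma> - {v})) else 0)" if "v \<in> \<sigma>" for v
    proof (cases "\<sigma> - {v} = {}")
      case True
      show ?thesis using single[of v0] unfolding True by (simp add: h_def closure_of_simplex_def)
    next
      case False
      then show ?thesis using \<sigma> by (auto simp: h_def closure_of_simplex_def)
    qed
    show "scobd h \<sigma> = y \<sigma>"
    proof (cases "v0 \<in> \<sigma>")
      case True
      have "scobd h \<sigma> = (\<Sum>v\<in>{v0}. sg v (\<sigma> - {v}) * h (\<sigma> - {v}))"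
        unfolding scobd_def using True fin h by (intro sum.mono_neutral_right) auto
      also have "\<dots> = y \<sigma>" using h[OF True] True by (simp add: insert_absorb)
      finally show ?thesis .
    next
      case False
      have "insert v0 \<sigma> \<in> closure_of_simplex V" using \<sigma> v0 by (auto simp: closure_of_simplex_def)
      then have "0 = scobd y (insert v0 \<sigma>)" using bd by simp
      also have "\<dots> = sg v0 \<sigma> * y \<sigma> + (\<Sum>v\<in>\<sigma>. sg v (insert v0 \<sigma> - {v}) * y (insert v0 \<sigma> - {v}))"
        unfolding scobd_def using False fin by simp
      also have "(\<Sum>v\<in>\<sigma>. sg v (insert v0 \<sigma> - {v}) * y (insert v0 \<sigma> - {v}))
          = (\<Sum>v\<in>\<sigma>. - sg v0 \<sigma> * (sg v (\<sigma> - {v}) * h (\<sigma> - {v})))"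
      proof (rule sum.cong[OF refl])
        fix v assume v: "v \<in> \<sigma>"
        define \<rho> where "\<rho> = \<sigma> - {v}"
        have e: "insert v0 \<sigma> - {v} = insert v0 \<rho>" "\<sigma> = insert v \<rho>" using v False by (auto simp: \<rho>_def)
        have "sg v (insert v0 \<rho>) = - (sg v0 (insert v \<rho>) * (sg v \<rho> * sg v0 \<rho>))"
          using v False v0V subVert[OF \<sigma>VS] fin by (intro sg_anti') (auto simp: \<rho>_def)
        moreover have "h \<rho> = sg v0 \<rho> * y (insert v0 \<rho>)" using h[OF v] False by (simp add: \<rho>_def)
        ultimately show "sg v (insert v0 \<sigma> - {v}) * y (insert v0 \<sigma> - {v}) = - sg v0 \<sigma> * (sg v (\<sigma> - {v}) * h (\<sigma> - {v}))"
          unfolding e(1) \<rho>_def[symmetric] by (simp add: e(2)[symmetric] mult_ac)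
      qed
      also have "\<dots> = - sg v0 \<sigma> * scobd h \<sigma>" by (simp add: scobd_def sum_distrib_left)
      finally have "sg v0 \<sigma> * (sg v0 \<sigma> * y \<sigma>) = sg v0 \<sigma> * (sg v0 \<sigma> * scobd h \<sigma>)" by (simp add: algebra_simps)
      then show ?thesis by simp
    qed
  qed
qed

lemma edge_cocycle_constant:
  assumes vw: "{v, w} \<in> VS" "v \<noteq> w" and y: "scobd y {v, w} = 0"
  shows "y {v} = y {w}"
proof -
  have V: "v \<in> Vert" "w \<in> Vert" using subVert[OF vw(1)] by auto
  have "scobd y {v, w} = sg v {w} * y {w} + sg w {v} * y {v}"
    using vw(2) by (simp add: scobd_def insert_Diff_if)
  moreover have "sg v {w} = - sg w {v}"
    using sg_anti[of "{}" v w] vw(2) V by simp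
  ultimately have "sg w {v} * (sg w {v} * (y {v} - y {w})) = 0" using y by (simp add: algebra_simps)
  then show ?thesis by simp
qed

text \<open>Split off a simplex \<open>V\<close> of largest dimension. \<open>A - {V}\<close> and
  its intersection with the closure of \<open>V\<close> have fewer simplices than \<open>A\<close>,
  while the closure itself is covered by \<open>simplex\<close>, even if it is all of
  \<open>A\<close>.\<close>

lemma down_closed_induct:
  assumes A: "down_closed A" and empty: "P {}"
    and simplex: "\<And>V. V \<in> VS \<Longrightarrow> P (closure_of_simplex V)"
    and union: "\<And>A B. down_closed A \<Longrightarrow> down_closed B \<Longrightarrow> P A \<Longrightarrow> P B \<Longrightarrow> P (A \<inter> B) \<Longrightarrow> P (A \<union> B)"
  shows "P A"
  using A
proof (induction "card A" arbitrary: A rule: less_induct)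
  case less
  have finA: "finite A" using less.prems finVS down_closed_subset finite_subset by blast
  show ?case
  proof (cases "A = {}")
    case False
    then have "Max (card ` A) \<in> card ` A" using finA by (intro Max_in) auto
    then obtain V where "V \<in> A" "card V = Max (card ` A)" by auto
    then have V: "V \<in> A" "\<And>W. W \<in> A \<Longrightarrow> card W \<le> card V"
      using finA by auto
    have VVS: "V \<in> VS" using V(1) down_closed_subset[OF less.prems] by blast
    have max: "W = V" if "W \<in> A" "V \<subseteq> W" for W
      using V(2)[OF that(1)] that card_seteq[of W V] finV down_closed_subset[OF less.prems] by blast
    let ?B = "A - {V}" and ?C = "closure_of_simplex V"
    have CA: "?C \<subseteq> A" using down_closedD[OF less.prems V(1)] by (auto simp: closure_of_simplex_def)
    have dB: "down_closed ?B"
      unfolding down_closed_def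
    proof (intro conjI ballI allI impI)
      show "?B \<subseteq> VS" using down_closed_subset[OF less.prems] by blast
      fix U W assume U: "U \<in> ?B" and W: "W \<subseteq> U \<and> W \<noteq> {}"
      then have "W \<in> A" using down_closedD[OF less.prems] by blast
      moreover have "W \<noteq> V" using max U W by blast
      ultimately show "W \<in> ?B" by blast
    qed
    have dC: "down_closed ?C" by (rule closure_of_simplex_down_closed[OF VVS])
    have "card ?B < card A" using V(1) finA by (rule card_Diff1_less[rotated])
    then have PB: "P ?B" using less.hyps dB by blast
    have "card (?B \<inter> ?C) \<le> card ?B" using finA by (intro card_mono) auto
    then have "P (?B \<inter> ?C)" using less.hyps down_closed_Int[OF dB dC] \<open>card ?B < card A\<close> by simp
    then have "P (?B \<union> ?C)" using union[OF dB dC PB simplex[OF VVS]] by blast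
    moreover have "?B \<union> ?C = A"
      using CA V(1) nonempty[OF VVS] by (auto simp: closure_of_simplex_def)
    ultimately show ?thesis by simp
  qed (use empty in simp)
qed

text \<open>Recursion on dimension. By \<open>local\<close> the condition at a simplex involves only
  its faces, so later choices do not disturb earlier ones. The fixed value \<open>d\<close> at
  \<open>{}\<close> takes care of the facets of vertices.\<close>

lemma simplexwise_choice:
  assumes local: "\<And>f g \<sigma>. \<sigma> \<in> VS \<Longrightarrow> (\<And>\<tau>. \<tau> \<subseteq> \<sigma> \<Longrightarrow> f \<tau> = g \<tau>) \<Longrightarrow> Q f \<sigma> \<Longrightarrow> Q g \<sigma>"
    and step: "\<And>f \<sigma>. \<sigma> \<in> VS \<Longrightarrow> f {} = d \<Longrightarrow> (\<And>\<tau>. \<tau> \<subset> \<sigma> \<Longrightarrow> \<tau> \<noteq> {} \<Longrightarrow> Q f \<tau>) \<Longrightarrow> \<exists>a. Q (f(\<sigma> := a)) \<sigma>"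
  obtains f :: "'a set \<Rightarrow> 'b" where "f {} = d" "\<And>\<sigma>. \<sigma> \<in> VS \<Longrightarrow> Q f \<sigma>"
proof -
  have "\<exists>f :: 'a set \<Rightarrow> 'b. f {} = d \<and> (\<forall>\<sigma>\<in>VS. card \<sigma> \<le> k \<longrightarrow> Q f \<sigma>)" for k
  proof (induction k)
    case 0
    show ?case using finV nonempty by (intro exI[of _ "\<lambda>_. d"]) (auto simp: card_0_eq)
  next
    case (Suc k)
    then obtain f :: "'a set \<Rightarrow> 'b" where f: "f {} = d" "\<And>\<sigma>. \<sigma> \<in> VS \<Longrightarrow> card \<sigma> \<le> k \<Longrightarrow> Q f \<sigma>" by blast
    define f' where "f' \<sigma> = (if \<sigma> \<in> VS \<and> card \<sigma> = Suc k then SOME a. Q (f(\<sigma> := a)) \<sigma> else f \<sigma>)" for \<sigma>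
    have small: "card \<tau> < card \<sigma>" if "\<sigma> \<in> VS" "\<tau> \<subset> \<sigma>" for \<sigma> \<tau>
      using finV[OF that(1)] that(2) by (rule psubset_card_mono)
    have "Q f' \<sigma>" if \<sigma>: "\<sigma> \<in> VS" "card \<sigma> \<le> Suc k" for \<sigma>
    proof (cases "card \<sigma> = Suc k")
      case True
      have "Q f \<tau>" if "\<tau> \<subset> \<sigma>" "\<tau> \<noteq> {}" for \<tau>
        using f(2)[of \<tau>] face[OF \<sigma>(1), of \<tau>] that small[OF \<sigma>(1) that(1)] True by auto
      then have "\<exists>a. Q (f(\<sigma> := a)) \<sigma>" using step[of \<sigma> f] \<sigma>(1) f(1) by blast
      then have "Q (f(\<sigma> := (SOME a. Q (f(\<sigma> := a)) \<sigma>))) \<sigma>" by (rule someI_ex)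
      moreover have "(f(\<sigma> := (SOME a. Q (f(\<sigma> := a)) \<sigma>))) \<tau> = f' \<tau>" if "\<tau> \<subseteq> \<sigma>" for \<tau>
        using small[OF \<sigma>(1), of \<tau>] that True \<sigma>(1) by (cases "\<tau> = \<sigma>") (auto simp: f'_def psubset_eq)
      ultimately show ?thesis using local[OF \<sigma>(1)] by blast
    next
      case False
      then have k: "card \<sigma> \<le> k" using \<sigma>(2) by simp
      have "f \<tau> = f' \<tau>" if "\<tau> \<subseteq> \<sigma>" for \<tau>
        using small[OF \<sigma>(1), of \<tau>] that k by (cases "\<tau> = \<sigma>") (auto simp: f'_def psubset_eq)
      then show ?thesis using local[OF \<sigma>(1)] f(2)[OF \<sigma>(1) k] by blast
    qed
    moreover have "f' {} = d" using f(1) by (simp add: f'_def)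
    ultimately show ?case by blast
  qed
  then obtain f :: "'a set \<Rightarrow> 'b" where f: "f {} = d" "\<forall>\<sigma>\<in>VS. card \<sigma> \<le> card Vert \<longrightarrow> Q f \<sigma>" by blast
  moreover have "card \<sigma> \<le> card Vert" if "\<sigma> \<in> VS" for \<sigma>
    using card_mono[OF finVert subVert[OF that]] .
  ultimately show thesis using that by blast
qed

end

subsection \<open>Simplicial and singular homology of a polyhedron\<close>

context geometric_complex
begin

text \<open>An acyclic-carrier choice in place of an affine parametrisation: support, boundary
  relation and normalisation at vertices are all that the comparison uses.\<close>

definition simplex_chain_at :: "('a set \<Rightarrow> 'a real_chain) \<Rightarrow> 'a set \<Rightarrow> bool" where
  "simplex_chain_at s \<sigma> \<longleftrightarrow> s \<sigma> \<in> RC (card \<sigma> - 1) (convex hull \<sigma>)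
     \<and> real_boundary (card \<sigma> - 1) (s \<sigma>) = (\<Sum>v\<in>\<sigma>. sg v (\<sigma> - {v}) *\<^sub>R s (\<sigma> - {v}))
     \<and> (card \<sigma> = 1 \<longrightarrow> coeff_sum (s \<sigma>) = 1)"

lemma exists_simplex_chains:
  "\<exists>s. s {} = 0 \<and> (\<forall>\<sigma>\<in>VS. simplex_chain_at s \<sigma>)"
proof -
  obtain s where "s {} = 0" "\<And>\<sigma>. \<sigma> \<in> VS \<Longrightarrow> simplex_chain_at s \<sigma>"
  proof (rule simplexwise_choice[where Q = simplex_chain_at and d = 0])
    fix f g :: "'a set \<Rightarrow> 'a real_chain" and \<sigma>
    assume \<sigma>: "\<sigma> \<in> VS" and fg: "\<And>\<tau>. \<tau> \<subseteq> \<sigma> \<Longrightarrow> f \<tau> = g \<tau>" and f: "simplex_chain_at f \<sigma>"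
    have "f (\<sigma> - {v}) = g (\<sigma> - {v})" for v using fg by blast
    then show "simplex_chain_at g \<sigma>" using f fg[OF order_refl] by (simp add: simplex_chain_at_def)
  next
    fix f and \<sigma> :: "'a set"
    assume \<sigma>: "\<sigma> \<in> VS" and f0: "f {} = 0" and f: "\<And>\<tau>. \<tau> \<subset> \<sigma> \<Longrightarrow> \<tau> \<noteq> {} \<Longrightarrow> simplex_chain_at f \<tau>"
    have fin: "finite \<sigma>" using finV[OF \<sigma>] .
    have *: "\<exists>a. simplex_chain_at (f(\<sigma> := a)) \<sigma>"
      if "a \<in> RC (card \<sigma> - 1) (convex hull \<sigma>)" "real_boundary (card \<sigma> - 1) a = (\<Sum>v\<in>\<sigma>. sg v (\<sigma> - {v}) *\<^sub>R f (\<sigma> - {v}))"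
        "card \<sigma> = 1 \<longrightarrow> coeff_sum a = 1" for a
    proof -
      have "(f(\<sigma> := a)) (\<sigma> - {v}) = f (\<sigma> - {v})" if "v \<in> \<sigma>" for v using that by auto
      then have "(\<Sum>v\<in>\<sigma>. sg v (\<sigma> - {v}) *\<^sub>R (f(\<sigma> := a)) (\<sigma> - {v})) = (\<Sum>v\<in>\<sigma>. sg v (\<sigma> - {v}) *\<^sub>R f (\<sigma> - {v}))"
        by (intro sum.cong refl) simp
      then show ?thesis using that by (intro exI[of _ a]) (simp add: simplex_chain_at_def)
    qed
    show "\<exists>a. simplex_chain_at (f(\<sigma> := a)) \<sigma>"
    proof (cases "card \<sigma> = 1")
      case True
      then obtain v where v: "\<sigma> = {v}" by (auto simp: card_1_singleton_iff)
      let ?a = "Poly_Mapping.single (restrict (\<lambda>_. v) (standard_simplex 0)) (1::real)"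
      have "continuous_map (subtopology (powertop_real UNIV) (standard_simplex 0)) (top_of_set {v}) (\<lambda>_. v)" by simp
      then have "continuous_map (subtopology (powertop_real UNIV) (standard_simplex 0)) (top_of_set {v}) (restrict (\<lambda>_. v) (standard_simplex 0))"
        by (rule continuous_map_eq) (auto simp: topspace_subtopology)
      then have "singular_simplex 0 (top_of_set {v}) (restrict (\<lambda>_. v) (standard_simplex 0))"
        by (simp add: singular_simplex_def)
      then have "?a \<in> RC 0 {v}" by (simp add: real_chains_def)
      then show ?thesis by (intro *[of ?a]) (auto simp: v f0)
    next
      case False
      then obtain k where k: "card \<sigma> = Suc (Suc k)"
        using nonempty[OF \<sigma>] fin by (metis One_nat_def card_0_eq not0_implies_Suc)
      have face_card: "card (\<sigma> - {v}) = Suc k" if "v \<in> \<sigma>" for v using k that fin by simp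
      have fv: "simplex_chain_at f (\<sigma> - {v})" if "v \<in> \<sigma>" for v
        using f[of "\<sigma> - {v}"] that face_card[OF that] by fastforce
      \<comment> \<open>The boundary prescribed by the facets. It is a reduced cycle of the hull,
        which is contractible.\<close>
      define b where "b = (\<Sum>v\<in>\<sigma>. sg v (\<sigma> - {v}) *\<^sub>R f (\<sigma> - {v}))"
      have "b \<in> reduced_cycles k (top_of_set (convex hull \<sigma>))"
        unfolding reduced_cycles_iff
      proof (intro conjI impI)
        have "f (\<sigma> - {v}) \<in> RC k (convex hull \<sigma>)" if "v \<in> \<sigma>" for v
          using fv[OF that] face_card[OF that] RC_mono[of "convex hull (\<sigma> - {v})" "convex hull \<sigma>"]
          by (auto simp: simplex_chain_at_def hull_mono)
        then show "b \<in> RC k (convex hull \<sigma>)" unfolding b_def by (intro RC_sum RC_scale)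
        have "real_boundary k (f (\<sigma> - {v})) = (\<Sum>w\<in>\<sigma> - {v}. sg w (\<sigma> - {v} - {w}) *\<^sub>R f (\<sigma> - {v} - {w}))" if "v \<in> \<sigma>" for v
          using fv[OF that] unfolding simplex_chain_at_def face_card[OF that] by simp
        then have "real_boundary k b = (\<Sum>v\<in>\<sigma>. sg v (\<sigma> - {v}) *\<^sub>R (\<Sum>w\<in>\<sigma> - {v}. sg w (\<sigma> - {v} - {w}) *\<^sub>R f (\<sigma> - {v} - {w})))"
          unfolding b_def real_boundary_sum real_boundary_scale
          by (intro sum.cong refl) simp
        then show "real_boundary k b = 0" using face_sum_twice[OF \<sigma>] by simp
        \<comment> \<open>For an edge, the two endpoints have coefficient sum 1 and opposite
          signs.\<close>
        assume "k = 0"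
        then obtain v w where vw: "\<sigma> = {v, w}" "v \<noteq> w" using k by (metis card_2_iff numeral_2_eq_2)
        have V: "v \<in> Vert" "w \<in> Vert" using subVert[OF \<sigma>] vw by auto
        have d: "{v, w} - {v} = {w}" "{v, w} - {w} = {v}" using vw(2) by auto
        have "coeff_sum (f {w}) = 1" "coeff_sum (f {v}) = 1"
          using fv[of v] fv[of w] unfolding vw(1) d by (auto simp: simplex_chain_at_def)
        then have "coeff_sum b = sg v {w} + sg w {v}"
          unfolding b_def vw(1) using vw(2)
          by (simp add: d linear_add[OF linear_coeff_sum] linear_scale[OF linear_coeff_sum])
        also have "\<dots> = 0" using sg_anti[of "{}" v w] vw(2) V by simp
        finally show "coeff_sum b = 0" .
      qed
      moreover have "contractible_space (top_of_set (convex hull \<sigma>))"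
        by (simp add: convex_imp_contractible)
      ultimately obtain a where "a \<in> RC (Suc k) (convex hull \<sigma>)" "real_boundary (Suc k) a = b"
        using contractible_space_real_boundary by blast
      then show ?thesis by (intro *[of a]) (auto simp: k b_def)
    qed
  qed (rule that)
  then show ?thesis by blast
qed

definition simplex_chain :: "'a set \<Rightarrow> 'a real_chain" where
  "simplex_chain = (SOME s. s {} = 0 \<and> (\<forall>\<sigma>\<in>VS. simplex_chain_at s \<sigma>))"

lemma simplex_chain_empty: "simplex_chain {} = 0"
  and simplex_chain: "\<sigma> \<in> VS \<Longrightarrow> simplex_chain_at simplex_chain \<sigma>"
  using someI_ex[OF exists_simplex_chains] by (auto simp: simplex_chain_def)

definition realize :: "('a set \<Rightarrow> real) \<Rightarrow> 'a real_chain" where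
  "realize x = (\<Sum>\<sigma>\<in>VS. x \<sigma> *\<^sub>R simplex_chain \<sigma>)"

lemma linear_realize: "linear realize"
  by (rule linearI) (auto simp: realize_def scaleR_add_left sum.distrib scaleR_sum_right)

lemmas realize_add = linear_add[OF linear_realize] and realize_diff = linear_diff[OF linear_realize]
  and realize_neg = linear_neg[OF linear_realize] and realize_0 [simp] = linear_0[OF linear_realize]

lemma realize_in_chains:
  assumes "x \<in> SC A p"
  shows "realize x \<in> RC (p - 1) (poly A)"
  unfolding realize_def
proof (rule RC_sum)
  fix \<sigma> assume \<sigma>: "\<sigma> \<in> VS"
  show "x \<sigma> *\<^sub>R simplex_chain \<sigma> \<in> RC (p - 1) (poly A)"
  proof (cases "x \<sigma> = 0")
    case False
    then have "\<sigma> \<in> A" "card \<sigma> = p" using assms by (auto simp: SC_def)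
    then have "simplex_chain \<sigma> \<in> RC (p - 1) (poly A)"
      using simplex_chain[OF \<sigma>] RC_mono[of "convex hull \<sigma>" "poly A"] by (auto simp: simplex_chain_at_def poly_def)
    then show ?thesis by (rule RC_scale)
  qed simp
qed

lemma realize_boundary:
  assumes x: "x \<in> SC VS p"
  shows "real_boundary (p - 1) (realize x) = realize (sbd x)"
proof -
  have "real_boundary (p - 1) (realize x) = (\<Sum>\<sigma>\<in>VS. x \<sigma> *\<^sub>R (\<Sum>v\<in>\<sigma>. sg v (\<sigma> - {v}) *\<^sub>R simplex_chain (\<sigma> - {v})))"
    unfolding realize_def real_boundary_sum real_boundary_scale
  proof (rule sum.cong[OF refl])
    fix \<sigma> assume \<sigma>: "\<sigma> \<in> VS"
    show "x \<sigma> *\<^sub>R real_boundary (p - 1) (simplex_chain \<sigma>) = x \<sigma> *\<^sub>R (\<Sum>v\<in>\<sigma>. sg v (\<sigma> - {v}) *\<^sub>R simplex_chain (\<sigma> - {v}))"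
    proof (cases "x \<sigma> = 0")
      case False
      then have "card \<sigma> = p" using x by (auto simp: SC_def)
      then show ?thesis using simplex_chain[OF \<sigma>] by (auto simp: simplex_chain_at_def)
    qed simp
  qed
  also have "\<dots> = realize (sbd x)"
    unfolding realize_def by (rule sbd_adjoint[where g = simplex_chain, OF x simplex_chain_empty])
  finally show ?thesis .
qed

lemma sum_singletons:
  assumes x: "x \<in> SC VS 1"
  shows "(\<Sum>\<sigma>\<in>VS. x \<sigma>) = (\<Sum>v\<in>Vert. x {v})"
proof -
  have "(\<Sum>\<sigma>\<in>VS. x \<sigma>) = (\<Sum>\<sigma>\<in>(\<lambda>v. {v}) ` Vert. x \<sigma>)"
  proof (rule sum.mono_neutral_right[OF finVS])
    show "(\<lambda>v. {v}) ` Vert \<subseteq> VS" using face by (auto simp: Vert_def)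
    show "\<forall>\<sigma>\<in>VS - (\<lambda>v. {v}) ` Vert. x \<sigma> = 0"
    proof
      fix \<sigma> assume \<sigma>: "\<sigma> \<in> VS - (\<lambda>v. {v}) ` Vert"
      show "x \<sigma> = 0"
      proof (rule ccontr)
        assume "x \<sigma> \<noteq> 0"
        then have "card \<sigma> = 1" using x by (auto simp: SC_def)
        then obtain v where "\<sigma> = {v}" by (auto simp: card_1_singleton_iff)
        then show False using \<sigma> subVert by auto
      qed
    qed
  qed
  also have "\<dots> = (\<Sum>v\<in>Vert. x {v})" by (simp add: sum.reindex)
  finally show ?thesis .
qed

lemma realize_coeff_sum:
  assumes x: "x \<in> SC VS 1"
  shows "coeff_sum (realize x) = (\<Sum>v\<in>Vert. x {v})"
proof -
  have "coeff_sum (realize x) = (\<Sum>\<sigma>\<in>VS. x \<sigma> * coeff_sum (simplex_chain \<sigma>))"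
    by (simp add: realize_def linear_sum[OF linear_coeff_sum] linear_scale[OF linear_coeff_sum])
  also have "\<dots> = (\<Sum>\<sigma>\<in>VS. x \<sigma>)"
  proof (rule sum.cong[OF refl])
    fix \<sigma> assume \<sigma>: "\<sigma> \<in> VS"
    show "x \<sigma> * coeff_sum (simplex_chain \<sigma>) = x \<sigma>"
      using simplex_chain[OF \<sigma>] x by (cases "x \<sigma> = 0") (auto simp: simplex_chain_at_def SC_def)
  qed
  also have "\<dots> = (\<Sum>v\<in>Vert. x {v})" by (rule sum_singletons[OF x])
  finally show ?thesis .
qed

lemma singleton_sum_zero:
  assumes "x \<in> SC A k" "k \<noteq> 1"
  shows "(\<Sum>v\<in>Vert. x {v}) = 0"
proof -
  have "x {v} = 0" for v
  proof (rule ccontr)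
    assume "x {v} \<noteq> 0"
    then have "card {v} = k" using assms(1) by (auto simp: SC_def)
    then show False using assms(2) by simp
  qed
  then show ?thesis by simp
qed

text \<open>Acyclicity of the mapping cone of \<^const>\<open>realize\<close>, with singular chains taken in the open
  neighbourhood \<^const>\<open>nbhd\<close> so that Mayer--Vietoris applies.\<close>

definition cone_acyclic :: "'a set set \<Rightarrow> bool" where
  "cone_acyclic A \<longleftrightarrow> (\<forall>p c x. c \<in> RC p (nbhd A) \<longrightarrow> x \<in> SC A p \<longrightarrow> real_boundary p c + realize x = 0 \<longrightarrow> sbd x = 0 \<longrightarrow>
     (\<exists>c' x'. c' \<in> RC (Suc p) (nbhd A) \<and> x' \<in> SC A (Suc p) \<and> c = real_boundary (Suc p) c' + realize x' \<and> x = - sbd x'))"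

lemma realize_in_nbhd: "down_closed A \<Longrightarrow> x \<in> SC A p \<Longrightarrow> realize x \<in> RC (p - 1) (nbhd A)"
  using realize_in_chains RC_mono poly_subset_nbhd by blast

text \<open>Singular and simplicial chains of a simplex are both acyclic in the reduced sense. In
  the cone a singular chain of degree \<open>p\<close> is paired with a simplicial chain on
  \<open>p\<close> vertices, of dimension \<open>p - 1\<close>.\<close>

lemma cone_acyclic_simplex:
  assumes V: "V \<in> VS"
  shows "cone_acyclic (closure_of_simplex V)"
  unfolding cone_acyclic_def
proof (intro allI impI)
  let ?A = "closure_of_simplex V"
  fix p c x assume c: "c \<in> RC p (nbhd ?A)" and x: "x \<in> SC ?A p" and D: "real_boundary p c + realize x = 0" "sbd x = 0"
  have dc: "down_closed ?A" by (rule closure_of_simplex_down_closed[OF V])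
  have AVS: "?A \<subseteq> VS" by (rule down_closed_subset[OF dc])
  have bounds: "\<exists>y\<in>RC (Suc p) (nbhd ?A). real_boundary (Suc p) y = e" if "e \<in> reduced_cycles p (top_of_set (nbhd ?A))" for e
    using acyclic_nbhd_simplex[OF V] that by (auto simp: acyclic_set_def)
  show "\<exists>c' x'. c' \<in> RC (Suc p) (nbhd ?A) \<and> x' \<in> SC ?A (Suc p) \<and> c = real_boundary (Suc p) c' + realize x' \<and> x = - sbd x'"
  proof (cases p)
    case 0
    then have x0: "x = 0" using SC_zero_card[OF dc] x by simp
    obtain v0 where v0: "v0 \<in> V" using nonempty[OF V] by blast
    \<comment> \<open>A multiple of one vertex cancels the coefficient sum of \<open>c\<close>, the
      only obstruction in degree 0.\<close>
    define x' where "x' \<sigma> = (if \<sigma> = {v0} then coeff_sum c else 0)" for \<sigma>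
    have x': "x' \<in> SC ?A (Suc 0)" using v0 by (auto simp: SC_def x'_def closure_of_simplex_def)
    have "coeff_sum (realize x') = (\<Sum>v\<in>Vert. if v = v0 then coeff_sum c else 0)"
      using realize_coeff_sum[of x'] SC_mono[OF AVS x'] by (simp add: x'_def)
    also have "\<dots> = coeff_sum c" using v0 subVert[OF V] finVert by (simp add: subset_iff)
    finally have cs: "coeff_sum (realize x') = coeff_sum c" .
    have "c - realize x' \<in> reduced_cycles p (top_of_set (nbhd ?A))"
      using c realize_in_nbhd[OF dc x'] cs 0
      by (auto simp: reduced_cycles_iff linear_diff[OF linear_coeff_sum] intro!: RC_diff)
    then obtain y where "y \<in> RC (Suc p) (nbhd ?A)" "real_boundary (Suc p) y = c - realize x'" using bounds by blast
    then show ?thesis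
      using x' sbd_SC_1[OF dc x'] x0 0 by (intro exI[of _ y] exI[of _ x']) auto
  next
    case (Suc k)
    \<comment> \<open>If \<open>x\<close> consists of vertices, taking coefficient sums in the first
      cone equation shows that \<open>x\<close> is reduced.\<close>
    have red: "(\<Sum>v\<in>Vert. x {v}) = 0"
    proof (cases "k = 0")
      case True
      have "coeff_sum (real_boundary p c + realize x) = coeff_sum (realize x)"
        using True Suc by (simp add: linear_add[OF linear_coeff_sum] coeff_sum_boundary)
      then show ?thesis
        using D(1) realize_coeff_sum[of x] SC_mono[OF AVS x] True Suc by (simp add: linear_0[OF linear_coeff_sum])
    next
      case False
      then show ?thesis using singleton_sum_zero[OF x] Suc by simp
    qed
    obtain x'' where x'': "x'' \<in> SC ?A (Suc (Suc k))" "sbd x'' = x"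
      using simplex_cycle_bounds[OF V, of x k] x D(2) red Suc by blast
    define x' where "x' = - x''"
    have x': "x' \<in> SC ?A (Suc p)" "x = - sbd x'"
      using x'' Suc by (auto simp: x'_def sbd_neg intro: SC_neg)
    have "real_boundary p (realize x') = realize (sbd x')"
      using realize_boundary[of x' "Suc p"] SC_mono[OF AVS x'(1)] by simp
    then have "real_boundary p (c - realize x') = 0"
      using D(1) x'(2) by (simp add: real_boundary_diff realize_neg add_eq_0_iff)
    then have "c - realize x' \<in> reduced_cycles p (top_of_set (nbhd ?A))"
      using c realize_in_nbhd[OF dc x'(1)] Suc by (auto simp: reduced_cycles_iff intro!: RC_diff)
    then obtain y where "y \<in> RC (Suc p) (nbhd ?A)" "real_boundary (Suc p) y = c - realize x'" using bounds by blast
    then show ?thesis using x' by (intro exI[of _ y] exI[of _ x']) auto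
  qed
qed

text \<open>Mayer--Vietoris carried out on elements: split a cone cycle over \<open>A\<close> and
  \<open>B\<close>, bound the resulting cone cycle over \<open>A \<inter> B\<close>, use this to
  correct the two parts to cone cycles, and bound these separately.\<close>

lemma cone_acyclic_Un:
  assumes dA: "down_closed A" and dB: "down_closed B"
    and A: "cone_acyclic A" and B: "cone_acyclic B" and AB: "cone_acyclic (A \<inter> B)"
  shows "cone_acyclic (A \<union> B)"
  unfolding cone_acyclic_def
proof (intro allI impI)
  fix p c x assume c: "c \<in> RC p (nbhd (A \<union> B))" and x: "x \<in> SC (A \<union> B) p"
    and D: "real_boundary p c + realize x = 0" "sbd x = 0"
  have sub: "A \<subseteq> VS" "B \<subseteq> VS" using dA dB down_closed_subset by auto
  define x1 where "x1 \<sigma> = (if \<sigma> \<in> A then x \<sigma> else 0)" for \<sigma>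
  define x2 where "x2 = x - x1"
  have x1: "x1 \<in> SC A p" using x by (auto simp: SC_def x1_def)
  have x2: "x2 \<in> SC B p" using x by (auto simp: SC_def x2_def x1_def)
  have x12: "x = x1 + x2" by (simp add: x2_def)
  have oA: "openin (top_of_set (nbhd A \<union> nbhd B)) (nbhd A)"
    by (rule openin_subset_trans[OF openin_nbhd[OF dA]]) (auto simp: nbhd_def)
  have oB: "openin (top_of_set (nbhd A \<union> nbhd B)) (nbhd B)"
    by (rule openin_subset_trans[OF openin_nbhd[OF dB]]) (auto simp: nbhd_def)
  have bdc: "real_boundary p c = - realize x1 + - realize x2"
    using eq_neg_iff_add_eq_0[THEN iffD2, OF D(1)] by (simp add: x12 realize_add)
  obtain y c1 c2 where y: "y \<in> RC (Suc p) (nbhd A \<union> nbhd B)" "c = real_boundary (Suc p) y + c1 + c2"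
      and c1: "c1 \<in> RC p (nbhd A)" and c2: "c2 \<in> RC p (nbhd B)"
    by (rule small_chains[OF oA oB c[unfolded nbhd_Un] bdc RC_neg[OF realize_in_nbhd[OF dA x1]] RC_neg[OF realize_in_nbhd[OF dB x2]]])
       (rule that)
  have y': "y \<in> RC (Suc p) (nbhd (A \<union> B))" using y(1) by (simp add: nbhd_Un)
  have bdsum: "real_boundary p c = real_boundary p c1 + real_boundary p c2"
    by (simp add: y(2) real_boundary_add real_boundary_boundary[OF y(1)])
  obtain c3 x3 where c3: "c3 \<in> RC p (nbhd (A \<inter> B))" and x3: "x3 \<in> SC (A \<inter> B) p"
    and e3: "real_boundary p c1 + realize x1 = real_boundary p c3 + realize x3" and f3: "sbd x1 = sbd x3"
  proof (cases p)
    case 0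
    then have "x1 = 0" using SC_zero_card[OF dA] x1 by simp
    then show thesis using that[of 0 0] 0 by simp
  next
    case (Suc q)
    \<comment> \<open>With \<open>f\<close>, the cone boundary of the part over \<open>A\<close>. It
      is minus the cone boundary of the part over \<open>B\<close>, so it lives over the
      intersection.\<close>
    define e where "e = real_boundary p c1 + realize x1"
    define f where "f = - sbd x1"
    have e2: "e = - (real_boundary p c2 + realize x2)"
    proof -
      have "e + (real_boundary p c2 + realize x2) = real_boundary p c + realize x"
        by (simp add: e_def bdsum x12 realize_add algebra_simps)
      then show ?thesis using D(1) by (simp only: eq_neg_iff_add_eq_0)
    qed
    have "sbd x1 + sbd x2 = 0" using D(2) unfolding x12 sbd_add .
    then have f2: "f = sbd x2" by (simp add: f_def add_eq_0_iff)
    have "e \<in> RC q (nbhd A)"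
      unfolding e_def using real_boundary_in_chains[OF c1] realize_in_nbhd[OF dA x1] Suc by (auto intro: RC_add)
    moreover have "e \<in> RC q (nbhd B)"
      unfolding e2 using real_boundary_in_chains[OF c2] realize_in_nbhd[OF dB x2] Suc by (intro RC_neg RC_add) auto
    ultimately have eAB: "e \<in> RC q (nbhd (A \<inter> B))" unfolding nbhd_Int by (rule RC_Int)
    have "f \<in> SC A q" unfolding f_def using sbd_SC[OF dA] x1 Suc by (auto intro: SC_neg)
    moreover have "f \<in> SC B q" unfolding f2 using sbd_SC[OF dB] x2 Suc by auto
    ultimately have fAB: "f \<in> SC (A \<inter> B) q" by (auto simp: SC_def)
    have "real_boundary q e = realize (sbd x1)"
      using realize_boundary[of x1 p] SC_mono[OF sub(1) x1] Suc c1
      by (simp add: e_def real_boundary_add real_boundary_boundary[of c1 q])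
    then have "real_boundary q e + realize f = 0" by (simp add: f_def realize_neg)
    moreover have "sbd f = 0" unfolding f_def sbd_neg using sbd_sbd[OF SC_mono[OF sub(1) x1]] by simp
    ultimately obtain c3 x3 where "c3 \<in> RC (Suc q) (nbhd (A \<inter> B))" "x3 \<in> SC (A \<inter> B) (Suc q)"
      "e = real_boundary (Suc q) c3 + realize x3" "f = - sbd x3"
      using AB eAB fAB unfolding cone_acyclic_def by blast
    then show thesis using that[of c3 x3] Suc by (simp add: e_def f_def)
  qed
  have c3A: "c3 \<in> RC p (nbhd A)" "c3 \<in> RC p (nbhd B)"
    using c3 RC_mono[OF nbhd_mono] by (metis Int_lower1, metis Int_lower2)
  have x3A: "x3 \<in> SC A p" "x3 \<in> SC B p" using x3 SC_mono by (metis Int_lower1, metis Int_lower2)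
  have "real_boundary p (c1 - c3) + realize (x1 - x3) = 0"
    using e3 by (simp add: real_boundary_diff realize_diff algebra_simps)
  moreover have "sbd (x1 - x3) = 0" using f3 by (simp add: sbd_diff)
  ultimately obtain c1' x1' where 1: "c1' \<in> RC (Suc p) (nbhd A)" "x1' \<in> SC A (Suc p)"
      "c1 - c3 = real_boundary (Suc p) c1' + realize x1'" "x1 - x3 = - sbd x1'"
    using A RC_diff[OF c1 c3A(1)] SC_diff[OF x1 x3A(1)] unfolding cone_acyclic_def by blast
  have "real_boundary p (c2 + c3) + realize (x2 + x3) = (real_boundary p c2 + realize x2) + (real_boundary p c1 + realize x1)"
    unfolding e3 by (simp add: real_boundary_add realize_add algebra_simps)
  also have "\<dots> = real_boundary p c + realize x" by (simp add: bdsum x12 realize_add algebra_simps)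
  finally have "real_boundary p (c2 + c3) + realize (x2 + x3) = 0" using D(1) by simp
  moreover have "sbd (x2 + x3) = 0" using f3 D(2) unfolding x12 sbd_add by (simp add: add.commute)
  ultimately obtain c2' x2' where 2: "c2' \<in> RC (Suc p) (nbhd B)" "x2' \<in> SC B (Suc p)"
      "c2 + c3 = real_boundary (Suc p) c2' + realize x2'" "x2 + x3 = - sbd x2'"
    using B RC_add[OF c2 c3A(2)] SC_add[OF x2 x3A(2)] unfolding cone_acyclic_def by blast
  have "c = real_boundary (Suc p) y + (c1 - c3) + (c2 + c3)" by (simp add: y(2))
  also have "\<dots> = real_boundary (Suc p) (y + c1' + c2') + realize (x1' + x2')"
    unfolding 1(3) 2(3) by (simp add: real_boundary_add realize_add)
  finally have "c = real_boundary (Suc p) (y + c1' + c2') + realize (x1' + x2')" .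
  moreover have "x = - sbd (x1' + x2')"
  proof -
    have "x = (x1 - x3) + (x2 + x3)" by (simp add: x12)
    then show ?thesis unfolding 1(4) 2(4) by (simp add: sbd_add)
  qed
  moreover have "y + c1' + c2' \<in> RC (Suc p) (nbhd (A \<union> B))"
    using y' 1(1) 2(1) RC_mono[of "nbhd A" "nbhd (A \<union> B)"] RC_mono[of "nbhd B" "nbhd (A \<union> B)"] nbhd_mono[of A "A \<union> B"] nbhd_mono[of B "A \<union> B"]
    by (intro RC_add) auto
  moreover have "x1' + x2' \<in> SC (A \<union> B) (Suc p)"
    using SC_mono[of A "A \<union> B"] SC_mono[of B "A \<union> B"] 1(2) 2(2) by (intro SC_add) auto
  ultimately show "\<exists>c' x'. c' \<in> RC (Suc p) (nbhd (A \<union> B)) \<and> x' \<in> SC (A \<union> B) (Suc p) \<and> c = real_boundary (Suc p) c' + realize x' \<and> x = - sbd x'"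
    by blast
qed

lemma cone_acyclic_all:
  assumes "down_closed A"
  shows "cone_acyclic A"
proof (rule down_closed_induct[OF assms])
  have "nbhd {} = {}" by (simp add: nbhd_def)
  then show "cone_acyclic {}"
    unfolding cone_acyclic_def
  proof (intro allI impI)
    fix p c x assume "c \<in> RC p (nbhd {})" "x \<in> SC {} p"
    then have "c = 0" "x = 0" using RC_empty \<open>nbhd {} = {}\<close> by (auto simp: SC_def fun_eq_iff)
    then show "\<exists>c' x'. c' \<in> RC (Suc p) (nbhd {}) \<and> x' \<in> SC {} (Suc p) \<and> c = real_boundary (Suc p) c' + realize x' \<and> x = - sbd x'"
      by (intro exI[of _ 0]) simp
  qed
qed (auto intro: cone_acyclic_simplex cone_acyclic_Un)

text \<open>The augmentation condition is automatic for \<open>k > 0\<close>, where chains vanish on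
  single vertices.\<close>

definition "simplicial_cycles A k = {x \<in> SC A (Suc k). sbd x = 0 \<and> (\<Sum>v\<in>Vert. x {v}) = 0}"
definition "simplicial_boundaries A k = sbd ` SC A (Suc (Suc k))"

lemma subspace_simplicial_cycles: "subspace (simplicial_cycles A k)"
proof (rule subspaceI)
  show "0 \<in> simplicial_cycles A k" by (simp add: simplicial_cycles_def)
  show "x + y \<in> simplicial_cycles A k" if "x \<in> simplicial_cycles A k" "y \<in> simplicial_cycles A k" for x y
    using that by (auto simp: simplicial_cycles_def sbd_add sum.distrib intro: SC_add)
  show "r *\<^sub>R x \<in> simplicial_cycles A k" if "x \<in> simplicial_cycles A k" for r x
    using that by (auto simp: simplicial_cycles_def linear_scale[OF linear_sbd] subspace_scale[OF subspace_SC] simp flip: sum_distrib_left)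
qed

lemma subspace_simplicial_boundaries: "subspace (simplicial_boundaries A k)"
  unfolding simplicial_boundaries_def by (rule linear_subspace_image[OF linear_sbd subspace_SC])

lemma simplicial_quotient_basis_exists:
  assumes "A \<subseteq> VS"
  obtains S where "quotient_basis (simplicial_cycles A k) (simplicial_boundaries A k) S"
proof (rule quotient_basis_exists[OF subspace_simplicial_cycles subspace_simplicial_boundaries])
  let ?F = "(\<lambda>\<sigma>. indicator {\<sigma>}) ` A :: ('a set \<Rightarrow> real) set"
  have finA: "finite A" using assms finVS finite_subset by blast
  then show "finite ?F" by simp
  show "simplicial_cycles A k \<subseteq> span ?F"
  proof
    fix x assume "x \<in> simplicial_cycles A k"
    then have "x \<sigma> = 0" if "\<sigma> \<notin> A" for \<sigma> using that by (auto simp: simplicial_cycles_def SC_def)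
    then have "x = (\<Sum>\<sigma>\<in>A. x \<sigma> *\<^sub>R indicator {\<sigma>})" by (rule function_expansion[OF finA])
    also have "\<dots> \<in> span ?F" by (intro span_sum span_scale span_base) auto
    finally show "x \<in> span ?F" .
  qed
qed (rule that)

text \<open>A simplicial cycle together with a singular chain it bounds is a cone cycle, which gives
  injectivity; a singular cycle with zero simplicial part gives surjectivity. Cone acyclicity
  concerns \<open>nbhd A\<close>, and the deformation brings bounding chains back to
  \<open>poly A\<close>.\<close>

lemma singular_homology_of_poly:
  assumes A: "down_closed A" and S: "quotient_basis (simplicial_cycles A k) (simplicial_boundaries A k) S"
  shows "quotient_basis (reduced_cycles k (top_of_set (poly A))) (real_boundaries k (top_of_set (poly A))) (realize ` S)"
    "card (realize ` S) = card S"
proof -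
  have sub: "A \<subseteq> VS" by (rule down_closed_subset[OF A])
  have ca: "cone_acyclic A" by (rule cone_acyclic_all[OF A])
  note T = quotient_basis_image[OF linear_realize subspace_simplicial_cycles _ _ _ subspace_real_boundaries S]
  have 1: "realize x \<in> reduced_cycles k (top_of_set (poly A))" if x: "x \<in> simplicial_cycles A k" for x
  proof -
    have xs: "x \<in> SC A (Suc k)" "sbd x = 0" "(\<Sum>v\<in>Vert. x {v}) = 0" using x by (auto simp: simplicial_cycles_def)
    have "realize x \<in> RC k (poly A)" using realize_in_chains[OF xs(1)] by simp
    moreover have "real_boundary k (realize x) = 0" using realize_boundary[OF SC_mono[OF sub xs(1)]] xs(2) by simp
    moreover have "coeff_sum (realize x) = 0" if "k = 0"
      using realize_coeff_sum[of x] SC_mono[OF sub xs(1)] that xs(3) by simp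
    ultimately show ?thesis by (simp add: reduced_cycles_iff)
  qed
  have 2: "realize x \<in> real_boundaries k (top_of_set (poly A)) \<longleftrightarrow> x \<in> simplicial_boundaries A k" if x: "x \<in> simplicial_cycles A k" for x
  proof
    assume "realize x \<in> real_boundaries k (top_of_set (poly A))"
    then obtain c where c: "c \<in> RC (Suc k) (poly A)" "real_boundary (Suc k) c = realize x"
      by (auto simp: real_boundaries_def)
    have cN: "- c \<in> RC (Suc k) (nbhd A)" using RC_neg[OF RC_mono[OF poly_subset_nbhd[OF A] c(1)]] .
    have "real_boundary (Suc k) (- c) + realize x = 0" using c(2) by (simp add: real_boundary_neg)
    then obtain c' x' where "x' \<in> SC A (Suc (Suc k))" "x = - sbd x'"
      using ca cN x unfolding cone_acyclic_def simplicial_cycles_def by blast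
    then have "x = sbd (- x')" "- x' \<in> SC A (Suc (Suc k))" by (auto simp: sbd_neg intro: SC_neg)
    then show "x \<in> simplicial_boundaries A k" by (auto simp: simplicial_boundaries_def)
  next
    assume "x \<in> simplicial_boundaries A k"
    then obtain x' where x': "x' \<in> SC A (Suc (Suc k))" "x = sbd x'" by (auto simp: simplicial_boundaries_def)
    then have "realize x = real_boundary (Suc k) (realize x')" using realize_boundary[OF SC_mono[OF sub x'(1)]] by simp
    then show "realize x \<in> real_boundaries k (top_of_set (poly A))"
      using realize_in_chains[OF x'(1)] by (auto simp: real_boundaries_def)
  qed
  have 3: "\<exists>x\<in>simplicial_cycles A k. c - realize x \<in> real_boundaries k (top_of_set (poly A))"
    if c: "c \<in> reduced_cycles k (top_of_set (poly A))" for c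
  proof -
    have cP: "c \<in> RC k (poly A)" "real_boundary k c = 0" using c by (auto simp: reduced_cycles_iff)
    have "c \<in> RC k (nbhd A)" using RC_mono[OF poly_subset_nbhd[OF A] cP(1)] .
    moreover have "real_boundary k c + realize 0 = 0" using cP by simp
    ultimately obtain c' x' where c': "c' \<in> RC (Suc k) (nbhd A)" and x': "x' \<in> SC A (Suc k)"
      and e: "c = real_boundary (Suc k) c' + realize x'" and z: "0 = - sbd x'"
      using ca SC_0[of A k] sbd_0 unfolding cone_acyclic_def by metis
    have "(\<Sum>v\<in>Vert. x' {v}) = 0"
    proof (cases "k = 0")
      case True
      have "coeff_sum (realize x') = coeff_sum c - coeff_sum (real_boundary (Suc k) c')"
        unfolding e by (simp add: linear_add[OF linear_coeff_sum])
      then show ?thesis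
        using c True realize_coeff_sum[of x'] SC_mono[OF sub x'] by (simp add: reduced_cycles_iff coeff_sum_boundary)
    next
      case False
      then show ?thesis using singleton_sum_zero[OF x'] by simp
    qed
    then have xc: "x' \<in> simplicial_cycles A k" using x' z by (simp add: simplicial_cycles_def)
    have "real_boundary (Suc k) c' = c - realize x'" using e by simp
    moreover have "c - realize x' \<in> RC k (poly A)" using RC_diff[OF cP(1)] realize_in_chains[OF x'] by simp
    \<comment> \<open>\<open>c'\<close> lies in the neighbourhood and its boundary in the
      polyhedron, as the relative deformation requires.\<close>
    ultimately have "real_boundary (Suc k) c' \<in> RC (Suc k - 1) (poly A)" by simp
    then obtain y where y: "y \<in> RC (Suc (Suc k)) (nbhd A)" "c' - real_boundary (Suc (Suc k)) y \<in> RC (Suc k) (poly A)"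
      using nbhd_deformation[OF A c'] by blast
    have "real_boundary (Suc k) (c' - real_boundary (Suc (Suc k)) y) = c - realize x'"
      using \<open>real_boundary (Suc k) c' = c - realize x'\<close> real_boundary_boundary[OF y(1)] by (simp add: real_boundary_diff)
    then have "c - realize x' \<in> real_boundaries k (top_of_set (poly A))"
      unfolding real_boundaries_def using y(2) by (metis imageI)
    then show ?thesis using xc by blast
  qed
  show "quotient_basis (reduced_cycles k (top_of_set (poly A))) (real_boundaries k (top_of_set (poly A))) (realize ` S)"
    using T(1)[OF 1 2 3] by blast
  show "card (realize ` S) = card S" using T(2)[OF 1 2 3] by blast
qed

end

subsection \<open>Alexander duality in a triangulated sphere\<close>

locale triangulated_sphere = geometric_complex VS for VS :: "'a::euclidean_space set set" +
  fixes m :: nat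
  assumes homeo: "top_of_set X homeomorphic_space nsphere m" and m_pos: "m \<ge> 1"
    and dim_le: "V \<in> VS \<Longrightarrow> card V \<le> Suc m"

sublocale triangulated_sphere \<subseteq> sph: sphere_space "poly VS" m
  using homeo m_pos by unfold_locales

context triangulated_sphere
begin

definition fcycle :: "'a real_chain" where
  "fcycle = (SOME z. z \<in> RC m X \<and> real_boundary m z = 0 \<and> z \<notin> real_boundaries m (top_of_set X) \<and>
    (\<forall>c. c \<in> RC m X \<longrightarrow> real_boundary m c = 0 \<longrightarrow> (\<exists>r. \<exists>y\<in>RC (Suc m) X. c = r *\<^sub>R z + real_boundary (Suc m) y)))"

lemma fcycle: "fcycle \<in> RC m X" "real_boundary m fcycle = 0" "fcycle \<notin> real_boundaries m (top_of_set X)"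
    "c \<in> RC m X \<Longrightarrow> real_boundary m c = 0 \<Longrightarrow> \<exists>r. \<exists>y\<in>RC (Suc m) X. c = r *\<^sub>R fcycle + real_boundary (Suc m) y"
proof -
  have "\<exists>z. z \<in> RC m X \<and> real_boundary m z = 0 \<and> z \<notin> real_boundaries m (top_of_set X) \<and>
    (\<forall>c. c \<in> RC m X \<longrightarrow> real_boundary m c = 0 \<longrightarrow> (\<exists>r. \<exists>y\<in>RC (Suc m) X. c = r *\<^sub>R z + real_boundary (Suc m) y))"
    by (rule sph.fundamental_cycle) blast
  from someI_ex[OF this, folded fcycle_def]
  show "fcycle \<in> RC m X" "real_boundary m fcycle = 0" "fcycle \<notin> real_boundaries m (top_of_set X)"
    "c \<in> RC m X \<Longrightarrow> real_boundary m c = 0 \<Longrightarrow> \<exists>r. \<exists>y\<in>RC (Suc m) X. c = r *\<^sub>R fcycle + real_boundary (Suc m) y"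
    by blast+
qed

lemma acyclic_complement_simplex: "V \<in> VS \<Longrightarrow> acyclic_set (X - convex hull V)"
  by (intro sph.acyclic_complement_convex compact_hull hull_subset_X) (auto simp: nonempty)

text \<open>A sphere consisting of one simplex would be contractible, but \<open>fcycle\<close> does
  not bound. Acyclicity alone would allow an empty complement.\<close>

lemma complement_simplex_nonempty:
  assumes V: "V \<in> VS"
  shows "X - convex hull V \<noteq> {}"
proof
  assume "X - convex hull V = {}"
  then have "X = convex hull V" using hull_subset_X[OF V] by blast
  then have "contractible_space (top_of_set X)"
    using convex_imp_contractible[OF convex_convex_hull, of V] by simp
  moreover have "fcycle \<in> reduced_cycles m (top_of_set X)" using fcycle m_pos by (simp add: reduced_cycles_iff)
  ultimately obtain y where "y \<in> RC (Suc m) X" "real_boundary (Suc m) y = fcycle"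
    using contractible_space_real_boundary by blast
  then show False using fcycle(3) unfolding real_boundaries_def by (metis imageI)
qed

text \<open>The homology of the sphere relative to the complement of a simplex: as the complement is
  acyclic, only degree \<open>m\<close> survives, and \<open>fcycle\<close> spans it.\<close>

lemma relative_cycle_simplex:
  assumes V: "V \<in> VS" and c: "c \<in> RC j X" "real_boundary j c \<in> RC (j - 1) (X - convex hull V)"
  obtains r y where "y \<in> RC (Suc j) X" "c - r *\<^sub>R (if j = m then fcycle else 0) - real_boundary (Suc j) y \<in> RC j (X - convex hull V)"
proof (cases "j = 0")
  case True
  obtain p where p: "p \<in> X - convex hull V" using complement_simplex_nonempty[OF V] by blast
  have "contractible_space (top_of_set {p})" by simp
  let ?f = "restrict (\<lambda>_. p) (standard_simplex 0)"
  have "continuous_map (subtopology (powertop_real UNIV) (standard_simplex 0)) (top_of_set {p}) (\<lambda>_. p)" by simp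
  then have "continuous_map (subtopology (powertop_real UNIV) (standard_simplex 0)) (top_of_set {p}) ?f"
    by (rule continuous_map_eq) auto
  then have "singular_simplex 0 (top_of_set {p}) ?f" by (simp add: singular_simplex_def)
  then have f: "Poly_Mapping.single ?f (1::real) \<in> RC 0 {p}" by (simp add: real_chains_def)
  define g where "g = coeff_sum c *\<^sub>R Poly_Mapping.single ?f (1::real)"
  have g: "g \<in> RC 0 (X - convex hull V)" unfolding g_def using RC_scale[OF RC_mono[OF _ f]] p by blast
  have "g \<in> RC 0 X" using RC_mono[OF _ g] by blast
  then have "c - g \<in> reduced_cycles 0 (top_of_set X)"
    using c(1) True by (auto simp: reduced_cycles_iff linear_diff[OF linear_coeff_sum] g_def linear_scale[OF linear_coeff_sum] intro!: RC_diff)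
  then obtain y where y: "y \<in> RC (Suc 0) X" "real_boundary (Suc 0) y = c - g"
    using sph.cycle_bounds[of 0] m_pos by auto
  show thesis by (rule that[of y 0]) (use y g True in auto)
next
  case False
  then obtain i where i: "j = Suc i" by (cases j) auto
  have "real_boundary j c \<in> reduced_cycles i (top_of_set (X - convex hull V))"
    using boundary_in_reduced_cycles[of c i "top_of_set X"] c i by (auto simp: reduced_cycles_iff)
  then obtain g where g: "g \<in> RC j (X - convex hull V)" "real_boundary j g = real_boundary j c"
    using acyclic_complement_simplex[OF V] i unfolding acyclic_set_def by blast
  have gX: "g \<in> RC j X" using RC_mono[OF _ g(1)] by blast
  have cg: "c - g \<in> RC j X" "real_boundary j (c - g) = 0" using c(1) gX g(2) by (auto simp: real_boundary_diff intro: RC_diff)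
  show thesis
  proof (cases "j = m")
    case True
    then obtain r y where y: "y \<in> RC (Suc m) X" "c - g = r *\<^sub>R fcycle + real_boundary (Suc m) y"
      using fcycle(4)[of "c - g"] cg by blast
    have "c - r *\<^sub>R fcycle - real_boundary (Suc m) y = g" using y(2) by (simp add: algebra_simps)
    then show thesis using that[of y r] y(1) g(1) True by simp
  next
    case False
    have "c - g \<in> reduced_cycles j (top_of_set X)" using cg i by (simp add: reduced_cycles_iff)
    then obtain y where y: "y \<in> RC (Suc j) X" "real_boundary (Suc j) y = c - g"
      using sph.cycle_bounds[OF False] by blast
    then show thesis using that[of y 0] g(1) False by simp
  qed
qed

text \<open>\<open>I \<sigma>\<close> plays the role of the intersection number with \<open>\<sigma>\<close>: a functional on singular chains of
  complementary dimension that vanishes off \<open>\<sigma>\<close> and turns the boundary of chains into the coboundary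
  of simplices.\<close>

definition intersection_at :: "('a set \<Rightarrow> 'a real_chain \<Rightarrow> real) \<Rightarrow> 'a set \<Rightarrow> bool" where
  "intersection_at I \<sigma> \<longleftrightarrow> linear (I \<sigma>)
    \<and> (\<forall>g\<in>RC (Suc m - card \<sigma>) (X - convex hull \<sigma>). I \<sigma> g = 0)
    \<and> (\<forall>c\<in>RC (Suc (Suc m - card \<sigma>)) X. I \<sigma> (real_boundary (Suc (Suc m - card \<sigma>)) c) = (\<Sum>v\<in>\<sigma>. sg v (\<sigma> - {v}) * I (\<sigma> - {v}) c))
    \<and> (card \<sigma> = 1 \<longrightarrow> I \<sigma> fcycle = 1)"

text \<open>At a vertex the functional is a local orientation. On a larger simplex its values on
  boundaries are prescribed by the facets, and the prescription is consistent because relative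
  cycles are boundaries up to multiples of \<open>fcycle\<close> and chains off the simplex.\<close>

lemma exists_intersection:
  "\<exists>I. I {} = (\<lambda>_. 0) \<and> (\<forall>\<sigma>\<in>VS. intersection_at I \<sigma>)"
proof -
  obtain I where "I {} = (\<lambda>_. 0)" "\<And>\<sigma>. \<sigma> \<in> VS \<Longrightarrow> intersection_at I \<sigma>"
  proof (rule simplexwise_choice[where Q = intersection_at and d = "\<lambda>_. 0"])
    fix f g :: "'a set \<Rightarrow> 'a real_chain \<Rightarrow> real" and \<sigma>
    assume \<sigma>: "\<sigma> \<in> VS" and fg: "\<And>\<tau>. \<tau> \<subseteq> \<sigma> \<Longrightarrow> f \<tau> = g \<tau>" and f: "intersection_at f \<sigma>"
    have "f (\<sigma> - {v}) = g (\<sigma> - {v})" for v using fg by blast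
    then show "intersection_at g \<sigma>" using f fg[OF order_refl] by (simp add: intersection_at_def)
  next
    fix f and \<sigma> :: "'a set"
    assume \<sigma>: "\<sigma> \<in> VS" and f0: "f {} = (\<lambda>_. 0 :: real)" and f: "\<And>\<tau>. \<tau> \<subset> \<sigma> \<Longrightarrow> \<tau> \<noteq> {} \<Longrightarrow> intersection_at f \<tau>"
    have fin: "finite \<sigma>" using finV[OF \<sigma>] .
    have cle: "card \<sigma> \<le> Suc m" using dim_le[OF \<sigma>] .
    have *: "\<exists>a. intersection_at (f(\<sigma> := a)) \<sigma>"
      if "linear a" "\<And>g. g \<in> RC (Suc m - card \<sigma>) (X - convex hull \<sigma>) \<Longrightarrow> a g = 0"
        "\<And>c. c \<in> RC (Suc (Suc m - card \<sigma>)) X \<Longrightarrow> a (real_boundary (Suc (Suc m - card \<sigma>)) c) = (\<Sum>v\<in>\<sigma>. sg v (\<sigma> - {v}) * f (\<sigma> - {v}) c)"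
        "card \<sigma> = 1 \<longrightarrow> a fcycle = 1" for a
    proof -
      have "(f(\<sigma> := a)) (\<sigma> - {v}) = f (\<sigma> - {v})" if "v \<in> \<sigma>" for v using that by auto
      then have "(\<Sum>v\<in>\<sigma>. sg v (\<sigma> - {v}) * (f(\<sigma> := a)) (\<sigma> - {v}) c) = (\<Sum>v\<in>\<sigma>. sg v (\<sigma> - {v}) * f (\<sigma> - {v}) c)" for c
        by (intro sum.cong refl) simp
      then show ?thesis using that by (intro exI[of _ a]) (simp add: intersection_at_def)
    qed
    show "\<exists>a. intersection_at (f(\<sigma> := a)) \<sigma>"
    proof (cases "card \<sigma> = 1")
      case True
      then obtain v where v: "\<sigma> = {v}" by (auto simp: card_1_singleton_iff)
      \<comment> \<open>Everything on which the functional has to vanish. \<open>fcycle\<close> is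
        not of this kind: otherwise acyclicity of the complement of the vertex would make it
        bound.\<close>
      define W where "W = {x + y |x y. x \<in> RC m (X - convex hull \<sigma>) \<and> y \<in> real_boundaries m (top_of_set X)}"
      have W: "subspace W" unfolding W_def by (intro subspace_sums subspace_real_chains subspace_real_boundaries)
      have "fcycle \<notin> W"
      proof
        assume "fcycle \<in> W"
        then obtain g w where g: "fcycle = g + real_boundary (Suc m) w" "g \<in> RC m (X - convex hull \<sigma>)" "w \<in> RC (Suc m) X"
          by (auto simp: W_def real_boundaries_def)
        have "real_boundary m g = 0"
          using fcycle(2) unfolding g(1) by (simp add: real_boundary_add real_boundary_boundary[OF g(3)])
        then have "g \<in> reduced_cycles m (top_of_set (X - convex hull \<sigma>))" using g(2) m_pos by (simp add: reduced_cycles_iff)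
        then obtain y where y: "y \<in> RC (Suc m) (X - convex hull \<sigma>)" "real_boundary (Suc m) y = g"
          using acyclic_complement_simplex[OF \<sigma>] unfolding acyclic_set_def by blast
        have "y + w \<in> RC (Suc m) X" using RC_add[OF RC_mono[OF _ y(1)] g(3)] by blast
        moreover have "real_boundary (Suc m) (y + w) = fcycle" using y(2) g(1) by (simp add: real_boundary_add)
        ultimately show False using fcycle(3) unfolding real_boundaries_def by (metis imageI)
      qed
      then obtain a :: "'a real_chain \<Rightarrow> real" where a: "linear a" "\<And>w. w \<in> W \<Longrightarrow> a w = 0" "a fcycle = 1"
        using functional_separating[OF W] by blast
      have "a g = 0" if "g \<in> RC m (X - convex hull \<sigma>)" for g
      proof -
        have "g + 0 \<in> W" unfolding W_def using that subspace_0[OF subspace_real_boundaries] by blast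
        then show ?thesis using a(2) by simp
      qed
      moreover have "a (real_boundary (Suc m) c) = 0" if "c \<in> RC (Suc m) X" for c
      proof -
        have "0 + real_boundary (Suc m) c \<in> W"
          unfolding W_def real_boundaries_def using that RC_zero[of m "top_of_set (X - convex hull \<sigma>)"] by blast
        then show ?thesis using a(2) by simp
      qed
      ultimately show ?thesis using a(1,3) by (intro *[of a]) (auto simp: v f0)
    next
      case False
      then obtain k where k: "card \<sigma> = Suc (Suc k)"
        using nonempty[OF \<sigma>] fin by (metis One_nat_def card_0_eq not0_implies_Suc)
      \<comment> \<open>The complementary degree. By \<open>dim_le\<close> the subtraction is exact,
        and a simplex of top dimension has \<open>j = 0\<close>.\<close>
      define j where "j = m - Suc k"
      have mk: "m - k = Suc j" "Suc m - card \<sigma> = j" using cle k by (auto simp: j_def)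
      have face_card: "card (\<sigma> - {v}) = Suc k" if "v \<in> \<sigma>" for v using k that fin by simp
      have pface: "\<sigma> - {v} \<subset> \<sigma>" "\<sigma> - {v} \<noteq> {}" if "v \<in> \<sigma>" for v using that face_card[OF that] by fastforce+
      have fv: "intersection_at f (\<sigma> - {v})" if "v \<in> \<sigma>" for v by (rule f[OF pface[OF that]])
      have flin: "linear (f (\<sigma> - {v}))"
        and fvan: "\<And>g. g \<in> RC (Suc j) (X - convex hull (\<sigma> - {v})) \<Longrightarrow> f (\<sigma> - {v}) g = 0"
        and fbd: "\<And>c. c \<in> RC (Suc (Suc j)) X \<Longrightarrow> f (\<sigma> - {v}) (real_boundary (Suc (Suc j)) c) = (\<Sum>w\<in>\<sigma> - {v}. sg w (\<sigma> - {v} - {w}) * f (\<sigma> - {v} - {w}) c)"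
        if "v \<in> \<sigma>" for v
        using fv[OF that] unfolding intersection_at_def face_card[OF that] by (auto simp: mk)
      \<comment> \<open>The value that the functional must take on the boundary of
        \<open>c\<close>.\<close>
      define l where "l c = (\<Sum>v\<in>\<sigma>. sg v (\<sigma> - {v}) * f (\<sigma> - {v}) c)" for c
      have llin: "linear l"
        by (rule linearI) (auto simp: l_def linear_add[OF flin] linear_scale[OF flin] algebra_simps sum.distrib sum_distrib_left intro!: sum.cong)
      have lvan: "l g = 0" if "g \<in> RC (Suc j) (X - convex hull \<sigma>)" for g
      proof -
        have "f (\<sigma> - {v}) g = 0" if "v \<in> \<sigma>" for v
          by (rule fvan[OF that]) (rule RC_mono[OF _ \<open>g \<in> _\<close>], use hull_mono[of "\<sigma> - {v}" \<sigma> convex] in blast)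
        then show ?thesis by (simp add: l_def)
      qed
      have lbd: "l (real_boundary (Suc (Suc j)) c) = 0" if "c \<in> RC (Suc (Suc j)) X" for c
      proof -
        have "l (real_boundary (Suc (Suc j)) c)
            = (\<Sum>v\<in>\<sigma>. sg v (\<sigma> - {v}) *\<^sub>R (\<Sum>w\<in>\<sigma> - {v}. sg w (\<sigma> - {v} - {w}) *\<^sub>R f (\<sigma> - {v} - {w}) c))"
          unfolding l_def using fbd that by (intro sum.cong refl) simp
        also have "\<dots> = 0" by (rule face_sum_twice[OF \<sigma>])
        finally show ?thesis .
      qed
      \<comment> \<open>Well-definedness: up to boundaries and chains off \<open>\<sigma>\<close>,
        on both of which \<open>l\<close> vanishes, a relative cycle is a multiple of
        \<open>fcycle\<close> or zero.\<close>
      have lker: "l c = 0" if c: "c \<in> RC (Suc j) X" "real_boundary (Suc j) c \<in> RC j (X - convex hull \<sigma>)" for c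
      proof -
        obtain r y where y: "y \<in> RC (Suc (Suc j)) X"
            "c - r *\<^sub>R (if Suc j = m then fcycle else 0) - real_boundary (Suc (Suc j)) y \<in> RC (Suc j) (X - convex hull \<sigma>)"
          by (rule relative_cycle_simplex[OF \<sigma> c(1)]) (use c(2) that in auto)
        have "l c = r * l (if Suc j = m then fcycle else 0)"
          using lvan[OF y(2)] lbd[OF y(1)] by (simp add: linear_diff[OF llin] linear_scale[OF llin] split del: if_split)
        \<comment> \<open>\<open>fcycle\<close> has degree \<open>Suc j\<close> only if
          \<open>\<sigma>\<close> is an edge; there both endpoints give 1, with opposite
          signs.\<close>
        moreover have "l (if Suc j = m then fcycle else 0) = 0"
        proof (cases "Suc j = m")
          case True
          then have "k = 0" using mk by auto
          then obtain v w where vw: "\<sigma> = {v, w}" "v \<noteq> w" using k by (metis card_2_iff numeral_2_eq_2)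
          have V: "v \<in> Vert" "w \<in> Vert" using subVert[OF \<sigma>] vw by auto
          have d: "{v, w} - {v} = {w}" "{v, w} - {w} = {v}" using vw(2) by auto
          have "f {w} fcycle = 1" "f {v} fcycle = 1"
            using fv[of v] fv[of w] unfolding vw(1) d by (auto simp: intersection_at_def)
          then have "l fcycle = sg v {w} + sg w {v}" unfolding l_def vw(1) using vw(2) by (simp add: d)
          also have "\<dots> = 0" using sg_anti[of "{}" v w] vw(2) V by simp
          finally show ?thesis using True by simp
        qed (simp add: linear_0[OF llin])
        ultimately show ?thesis by simp
      qed
      obtain \<mu> :: "'a real_chain \<Rightarrow> real" where "linear \<mu>" "\<And>c. c \<in> RC (Suc j) X \<Longrightarrow> \<mu> (real_boundary (Suc j) c) = l c"
          "\<And>w. w \<in> RC j (X - convex hull \<sigma>) \<Longrightarrow> \<mu> w = 0"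
        by (rule functional_factor[OF subspace_real_chains[of "Suc j" "top_of_set X"] subspace_real_chains[of j "top_of_set (X - convex hull \<sigma>)"] linear_real_boundary[of "Suc j"] llin lker])
           (assumption | rule that)+
      then show ?thesis by (intro *[of \<mu>]) (use False in \<open>auto simp: mk l_def\<close>)
    qed
  qed (rule that)
  then show ?thesis by blast
qed

definition intersection :: "'a set \<Rightarrow> 'a real_chain \<Rightarrow> real" where
  "intersection = (SOME I. I {} = (\<lambda>_. 0) \<and> (\<forall>\<sigma>\<in>VS. intersection_at I \<sigma>))"

lemma intersection_empty: "intersection {} c = 0"
  and intersection_at: "\<sigma> \<in> VS \<Longrightarrow> intersection_at intersection \<sigma>"
  using someI_ex[OF exists_intersection] by (auto simp: intersection_def)

section \<open>Intersection numbers as a cochain map, and its mapping cone\<close>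

definition Phi :: "nat \<Rightarrow> 'a real_chain \<Rightarrow> 'a set \<Rightarrow> real" where
  "Phi j c \<sigma> = (if \<sigma> \<in> VS \<and> card \<sigma> + j = Suc m then intersection \<sigma> c else 0)"

lemma linear_Phi: "linear (\<lambda>c. Phi j c \<sigma>)"
proof (cases "\<sigma> \<in> VS \<and> card \<sigma> + j = Suc m")
  case True
  then show ?thesis using intersection_at[of \<sigma>] unfolding intersection_at_def
    by (auto simp: Phi_def[abs_def])
next
  case False
  then have "(\<lambda>c. Phi j c \<sigma>) = (\<lambda>_. 0)" by (auto simp: Phi_def fun_eq_iff)
  then show ?thesis by (simp add: linear_zero)
qed

lemmas Phi_add = linear_add[OF linear_Phi] and Phi_diff = linear_diff[OF linear_Phi]
  and Phi_scale = linear_scale[OF linear_Phi] and Phi_0 [simp] = linear_0[OF linear_Phi]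

lemma Phi_vanish:
  assumes "g \<in> RC j (X - poly A)" "\<sigma> \<in> A"
  shows "Phi j g \<sigma> = 0"
proof (cases "\<sigma> \<in> VS \<and> card \<sigma> + j = Suc m")
  case True
  then have j: "j = Suc m - card \<sigma>" by auto
  have "convex hull \<sigma> \<subseteq> poly A" using assms(2) by (auto simp: poly_def)
  then have "g \<in> RC j (X - convex hull \<sigma>)" using RC_mono[OF _ assms(1)] by blast
  then show ?thesis using intersection_at[of \<sigma>] True unfolding intersection_at_def j by (auto simp: Phi_def)
qed (auto simp: Phi_def)

lemma scobd_Phi:
  assumes c: "c \<in> RC (Suc j) X" and \<sigma>: "\<sigma> \<in> VS"
  shows "scobd (Phi (Suc j) c) \<sigma> = Phi j (real_boundary (Suc j) c) \<sigma>"
proof (cases "card \<sigma> + j = Suc m")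
  case cj: True
  then have j: "j = Suc m - card \<sigma>" by auto
  have "Phi (Suc j) c (\<sigma> - {v}) = intersection (\<sigma> - {v}) c" if v: "v \<in> \<sigma>" for v
  proof (cases "\<sigma> - {v} = {}")
    case True
    then show ?thesis unfolding True using nonempty by (auto simp: Phi_def intersection_empty)
  next
    case False
    then have "\<sigma> - {v} \<in> VS" by (intro face[OF \<sigma>]) auto
    moreover have "card (\<sigma> - {v}) + Suc j = Suc m" using card.remove[OF finV[OF \<sigma>] v] cj by arith
    ultimately show ?thesis by (simp add: Phi_def)
  qed
  then have "scobd (Phi (Suc j) c) \<sigma> = (\<Sum>v\<in>\<sigma>. sg v (\<sigma> - {v}) * intersection (\<sigma> - {v}) c)"
    unfolding scobd_def by (intro sum.cong refl) simp
  also have "\<dots> = intersection \<sigma> (real_boundary (Suc j) c)"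
  proof -
    have "\<forall>c\<in>RC (Suc j) X. intersection \<sigma> (real_boundary (Suc j) c) = (\<Sum>v\<in>\<sigma>. sg v (\<sigma> - {v}) * intersection (\<sigma> - {v}) c)"
      using intersection_at[OF \<sigma>] unfolding intersection_at_def j[symmetric] by blast
    then show ?thesis using c by simp
  qed
  finally show ?thesis using cj \<sigma> by (simp add: Phi_def)
next
  case False
  have "Phi (Suc j) c (\<sigma> - {v}) = 0" if v: "v \<in> \<sigma>" for v
    using card.remove[OF finV[OF \<sigma>] v] False by (simp add: Phi_def)
  then show ?thesis using False by (simp add: scobd_def Phi_def)
qed

lemma Phi_fcycle:
  assumes "{v} \<in> VS"
  shows "Phi m fcycle {v} = 1"
  using intersection_at[OF assms] assms by (simp add: Phi_def intersection_at_def)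

text \<open>Indexed so that \<open>Phi (Suc j)\<close> takes values in \<open>SY j\<close>: in the
  cone, a chain of degree \<open>j\<close> is paired with a cochain on \<open>m - j\<close>
  vertices. For \<open>j \<ge> m\<close> only the zero cochain remains.\<close>

definition SY :: "nat \<Rightarrow> ('a set \<Rightarrow> real) set" where
  "SY j = {y. \<forall>\<sigma>. y \<sigma> \<noteq> 0 \<longrightarrow> \<sigma> \<in> VS \<and> card \<sigma> + j = m}"

lemma subspace_SY: "subspace (SY j)"
proof (rule subspaceI)
  fix x y assume "x \<in> SY j" "y \<in> SY j"
  then have "(x + y) \<sigma> \<noteq> 0 \<Longrightarrow> \<sigma> \<in> VS \<and> card \<sigma> + j = m" for \<sigma>
    by (cases "x \<sigma> = 0") (auto simp: SY_def)
  then show "x + y \<in> SY j" by (simp add: SY_def)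
qed (auto simp: SY_def)

lemma Phi_SY: "Phi (Suc j) c \<in> SY j"
  by (auto simp: SY_def Phi_def split: if_splits)

text \<open>The mapping cone of \<open>Phi\<close>, from chains of the sphere modulo the complement
  of \<open>poly A\<close> to cochains of \<open>A\<close>. Both quotients are handled by
  representatives: chains are compared up to chains off \<open>poly A\<close>, cochains by their
  values on \<open>A\<close>.\<close>

definition dual_cone_acyclic :: "'a set set \<Rightarrow> bool" where
  "dual_cone_acyclic A \<longleftrightarrow> (\<forall>j c y. c \<in> RC j X \<longrightarrow> y \<in> SY j \<longrightarrow> real_boundary j c \<in> RC (j - 1) (X - poly A) \<longrightarrow>
     (\<forall>\<sigma>\<in>A. Phi j c \<sigma> = scobd y \<sigma>) \<longrightarrow>
     (\<exists>c' y'. c' \<in> RC (Suc j) X \<and> y' \<in> SY (Suc j) \<and> c - real_boundary (Suc j) c' \<in> RC j (X - poly A) \<and>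
        (\<forall>\<sigma>\<in>A. y \<sigma> = Phi (Suc j) c' \<sigma> - scobd y' \<sigma>)))"

text \<open>Source and target of \<open>Phi\<close> each have one-dimensional homology: relative
  chains are generated by \<open>fcycle\<close> in degree \<open>m\<close>, cochains by the constant
  0-cochain, and \<open>Phi\<close> takes one generator to the other.\<close>

lemma dual_cone_acyclic_simplex:
  assumes V: "V \<in> VS"
  shows "dual_cone_acyclic (closure_of_simplex V)"
  unfolding dual_cone_acyclic_def poly_closure_of_simplex[OF V]
proof (intro allI impI)
  let ?A = "closure_of_simplex V"
  fix j c y assume c: "c \<in> RC j X" and y: "y \<in> SY j" and bd: "real_boundary j c \<in> RC (j - 1) (X - convex hull V)"
    and Pc: "\<forall>\<sigma>\<in>?A. Phi j c \<sigma> = scobd y \<sigma>"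
  have AVS: "?A \<subseteq> VS" by (rule down_closed_subset[OF closure_of_simplex_down_closed[OF V]])
  have van: "Phi i g \<sigma> = 0" if "g \<in> RC i (X - convex hull V)" "\<sigma> \<in> ?A" for i g \<sigma>
    using Phi_vanish[of g i ?A \<sigma>] that poly_closure_of_simplex[OF V] by simp
  obtain r c0 where c0: "c0 \<in> RC (Suc j) X" "c - r *\<^sub>R (if j = m then fcycle else 0) - real_boundary (Suc j) c0 \<in> RC j (X - convex hull V)"
    using relative_cycle_simplex[OF V c bd] by blast
  show "\<exists>c' y'. c' \<in> RC (Suc j) X \<and> y' \<in> SY (Suc j) \<and> c - real_boundary (Suc j) c' \<in> RC j (X - convex hull V) \<and>
        (\<forall>\<sigma>\<in>?A. y \<sigma> = Phi (Suc j) c' \<sigma> - scobd y' \<sigma>)"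
  proof (cases "j < m")
    case False
    have y0: "y = 0"
    proof
      fix \<sigma> show "y \<sigma> = 0 \<sigma>"
      proof (rule ccontr)
        assume "y \<sigma> \<noteq> 0 \<sigma>"
        then have "\<sigma> \<in> VS" "card \<sigma> + j = m" using y by (auto simp: SY_def)
        then show False using False finV[of \<sigma>] nonempty[of \<sigma>] by auto
      qed
    qed
    have P0: "Phi (Suc j) e \<sigma> = 0" for e \<sigma>
    proof (rule ccontr)
      assume "Phi (Suc j) e \<sigma> \<noteq> 0"
      then have \<sigma>: "\<sigma> \<in> VS \<and> card \<sigma> + Suc j = Suc m" unfolding Phi_def by presburger
      then have "card \<sigma> = 0" using False by arith
      then show False using \<sigma> finV[of \<sigma>] nonempty[of \<sigma>] by simp
    qed
    have "c - real_boundary (Suc j) c0 \<in> RC j (X - convex hull V)"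
    proof (cases "j = m")
      case True
      \<comment> \<open>Evaluation at a vertex detects the multiple \<open>r\<close> of
        \<open>fcycle\<close>.\<close>
      obtain v where v: "v \<in> V" using nonempty[OF V] by blast
      then have vA: "{v} \<in> ?A" by (simp add: closure_of_simplex_def)
      then have vVS: "{v} \<in> VS" using AVS by blast
      have "scobd (Phi (Suc j) c0) {v} = Phi j (real_boundary (Suc j) c0) {v}" by (rule scobd_Phi[OF c0(1) vVS])
      then have "Phi j (real_boundary (Suc j) c0) {v} = 0" by (simp add: scobd_def P0)
      moreover have "Phi j c {v} = 0" using Pc vA y0 by simp
      ultimately have "r = 0"
        using van[OF c0(2) vA] True Phi_fcycle[OF vVS] by (simp add: Phi_diff Phi_scale)
      then show ?thesis using c0(2) by simp
    qed (use c0(2) in simp)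
    then show ?thesis using c0(1) P0 y0
      by (intro exI[of _ c0] exI[of _ 0]) (auto simp: subspace_0[OF subspace_SY])
  next
    case True
    then have c0': "c - real_boundary (Suc j) c0 \<in> RC j (X - convex hull V)" using c0(2) by simp
    \<comment> \<open>After the contribution of \<open>c0\<close> is subtracted, the cochain is a
      cocycle on the simplex.\<close>
    define y1 where "y1 = y - Phi (Suc j) c0"
    have y1S: "y1 \<in> SY j" unfolding y1_def by (intro subspace_diff[OF subspace_SY] y Phi_SY)
    have y1c: "scobd y1 \<sigma> = 0" if "\<sigma> \<in> ?A" for \<sigma>
    proof -
      have "scobd y1 \<sigma> = Phi j c \<sigma> - Phi j (real_boundary (Suc j) c0) \<sigma>"
        using Pc that scobd_Phi[OF c0(1)] AVS by (auto simp: y1_def scobd_diff)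
      also have "\<dots> = Phi j (c - real_boundary (Suc j) c0) \<sigma>" by (simp add: Phi_diff)
      also have "\<dots> = 0" by (rule van[OF c0' that])
      finally show ?thesis .
    qed
    show ?thesis
    proof (cases "m - j = 1")
      case True
      then have mj: "m = Suc j" using \<open>j < m\<close> by simp
      obtain v where v: "v \<in> V" using nonempty[OF V] by blast
      have const: "y1 {w} = y1 {v}" if "w \<in> V" for w
      proof (cases "w = v")
        case False
        have "{w, v} \<in> ?A" using that v by (simp add: closure_of_simplex_def)
        then show ?thesis using edge_cocycle_constant[of w v y1] False y1c AVS by blast
      qed simp
      \<comment> \<open>A 0-cocycle is constant on the simplex, and a multiple of
        \<open>fcycle\<close> realises this constant.\<close>
      define c' where "c' = c0 + y1 {v} *\<^sub>R fcycle"
      have "y \<sigma> = Phi (Suc j) c' \<sigma> - scobd 0 \<sigma>" if \<sigma>: "\<sigma> \<in> ?A" for \<sigma>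
      proof (cases "card \<sigma> = 1")
        case True
        then obtain w where w: "\<sigma> = {w}" by (auto simp: card_1_singleton_iff)
        then have "w \<in> V" "{w} \<in> VS" using \<sigma> AVS by (auto simp: closure_of_simplex_def)
        moreover have "Phi (Suc j) c' {w} = Phi (Suc j) c0 {w} + y1 {v} * Phi m fcycle {w}"
          by (simp only: c'_def Phi_add Phi_scale mj[symmetric] real_scaleR_def)
        ultimately show ?thesis using const[of w] Phi_fcycle[of w] w by (simp add: y1_def)
      next
        case False
        have "y \<sigma> = 0" using y False mj unfolding SY_def by auto
        moreover have "\<not> card \<sigma> + Suc j = Suc m" using False mj by arith
        then have "Phi (Suc j) c' \<sigma> = 0" unfolding Phi_def by simp
        ultimately show ?thesis by simp
      qed
      moreover have "c' \<in> RC (Suc j) X" unfolding c'_def using fcycle(1) mj by (intro RC_add RC_scale c0) simp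
      moreover have "real_boundary (Suc j) c' = real_boundary (Suc j) c0"
        using fcycle(2) mj by (simp add: c'_def real_boundary_add real_boundary_scale)
      ultimately show ?thesis using c0' by (intro exI[of _ c'] exI[of _ 0]) (auto simp: subspace_0[OF subspace_SY])
    next
      case False
      then obtain k where k: "m - j = Suc (Suc k)" using \<open>j < m\<close> by (metis One_nat_def Suc_diff_Suc not0_implies_Suc)
      have "card \<sigma> = Suc (Suc k)" if "y1 \<sigma> \<noteq> 0" for \<sigma> using y1S that k unfolding SY_def by auto
      then obtain y'' where y'': "y'' \<in> SC VS (Suc k)" "\<And>\<sigma>. \<sigma> \<in> ?A \<Longrightarrow> scobd y'' \<sigma> = y1 \<sigma>"
        using simplex_cocycle_bounds[OF V, of y1 k] y1c by blast
      have "- y'' \<in> SY (Suc j)" using y''(1) k unfolding SC_def SY_def by auto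
      moreover have "y \<sigma> = Phi (Suc j) c0 \<sigma> - scobd (- y'') \<sigma>" if "\<sigma> \<in> ?A" for \<sigma>
        using y''(2)[OF that] by (simp add: scobd_neg y1_def)
      ultimately show ?thesis using c0(1) c0' by (intro exI[of _ c0] exI[of _ "- y''"]) auto
    qed
  qed
qed

lemma poly_Int:
  assumes A: "down_closed A" and B: "down_closed B"
  shows "poly (A \<inter> B) = poly A \<inter> poly B"
proof -
  have "x \<in> X \<Longrightarrow> x \<in> poly (A \<inter> B) \<longleftrightarrow> x \<in> poly A \<inter> poly B" for x
    using poly_iff[OF A, of x] poly_iff[OF B, of x] poly_iff[OF down_closed_Int[OF A B], of x] by simp
  then show ?thesis
    using poly_subset[OF down_closed_subset[OF A]] poly_subset[OF down_closed_subset[OF down_closed_Int[OF A B]]] by blast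
qed

lemma poly_Un: "poly (A \<union> B) = poly A \<union> poly B"
  by (auto simp: poly_def)

text \<open>The coboundary at a simplex of \<open>A\<close> sees only its facets, so cochains may be
  changed freely outside \<open>A\<close>.\<close>

lemma scobd_cong:
  assumes A: "down_closed A" and \<sigma>: "\<sigma> \<in> A" and yz: "\<And>\<tau>. \<tau> \<in> A \<Longrightarrow> y \<tau> = z \<tau>" and e: "y {} = z {}"
  shows "scobd y \<sigma> = scobd z \<sigma>"
  unfolding scobd_def
proof (intro sum.cong refl)
  fix v
  have "y (\<sigma> - {v}) = z (\<sigma> - {v})"
  proof (cases "\<sigma> - {v} = {}")
    case True
    show ?thesis unfolding True by (rule e)
  next
    case False
    then show ?thesis using yz down_closedD[OF A \<sigma>, of "\<sigma> - {v}"] by blast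
  qed
  then show "sg v (\<sigma> - {v}) * y (\<sigma> - {v}) = sg v (\<sigma> - {v}) * z (\<sigma> - {v})" by simp
qed

text \<open>Mayer--Vietoris with the complements as open sets, so that unions and intersections
  change places. The additional task is to glue two cochains: their discrepancy on \<open>A\<close>
  vanishes on \<open>A \<inter> B\<close> and is extended by zero.\<close>

lemma dual_cone_acyclic_Un:
  assumes dA: "down_closed A" and dB: "down_closed B"
    and A: "dual_cone_acyclic A" and B: "dual_cone_acyclic B" and AB: "dual_cone_acyclic (A \<inter> B)"
  shows "dual_cone_acyclic (A \<union> B)"
  unfolding dual_cone_acyclic_def
proof (intro allI impI)
  fix j c y assume c: "c \<in> RC j X" and y: "y \<in> SY j" and bd: "real_boundary j c \<in> RC (j - 1) (X - poly (A \<union> B))"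
    and Pc: "\<forall>\<sigma>\<in>A \<union> B. Phi j c \<sigma> = scobd y \<sigma>"
  have AVS: "A \<subseteq> VS" "B \<subseteq> VS" using dA dB down_closed_subset by auto
  let ?U = "X - poly A" and ?V = "X - poly B"
  have UV: "?U \<union> ?V = X - poly (A \<inter> B)" "?U \<inter> ?V = X - poly (A \<union> B)"
    using poly_Int[OF dA dB] poly_Un by auto
  have "real_boundary j c \<in> RC (j - 1) ?U" using RC_mono[OF _ bd] UV(2) by blast
  then obtain c1 y1 where c1: "c1 \<in> RC (Suc j) X" "c - real_boundary (Suc j) c1 \<in> RC j ?U"
      and y1: "y1 \<in> SY (Suc j)" "\<And>\<sigma>. \<sigma> \<in> A \<Longrightarrow> y \<sigma> = Phi (Suc j) c1 \<sigma> - scobd y1 \<sigma>"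
    using A c y Pc unfolding dual_cone_acyclic_def by blast
  have "real_boundary j c \<in> RC (j - 1) ?V" using RC_mono[OF _ bd] UV(2) by blast
  then obtain c2 y2 where c2: "c2 \<in> RC (Suc j) X" "c - real_boundary (Suc j) c2 \<in> RC j ?V"
      and y2: "y2 \<in> SY (Suc j)" "\<And>\<sigma>. \<sigma> \<in> B \<Longrightarrow> y \<sigma> = Phi (Suc j) c2 \<sigma> - scobd y2 \<sigma>"
    using B c y Pc unfolding dual_cone_acyclic_def by blast
  define g h where "g = c - real_boundary (Suc j) c1" and "h = c - real_boundary (Suc j) c2"
  have gh: "g \<in> RC j ?U" "h \<in> RC j ?V" using c1 c2 by (auto simp: g_def h_def)
  have bd12: "real_boundary (Suc j) (c1 - c2) = - g + h" by (simp add: g_def h_def real_boundary_diff)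
  have "- g + h \<in> RC j (X - poly (A \<inter> B))"
    using gh RC_mono[of ?U "X - poly (A \<inter> B)"] RC_mono[of ?V "X - poly (A \<inter> B)"] UV(1)
    by (intro RC_add RC_neg) blast+
  then have 1: "real_boundary (Suc j) (c1 - c2) \<in> RC (Suc j - 1) (X - poly (A \<inter> B))" by (simp add: bd12)
  \<comment> \<open>Together with 1: the solutions over \<open>A\<close> and over \<open>B\<close>
    differ on the overlap by a cone cycle.\<close>
  have 2: "\<forall>\<sigma>\<in>A \<inter> B. Phi (Suc j) (c1 - c2) \<sigma> = scobd (y1 - y2) \<sigma>"
    using y1(2) y2(2) by (fastforce simp: Phi_diff scobd_diff)
  obtain c3 y3 where c3: "c3 \<in> RC (Suc (Suc j)) X" "c1 - c2 - real_boundary (Suc (Suc j)) c3 \<in> RC (Suc j) (X - poly (A \<inter> B))"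
      and y3: "y3 \<in> SY (Suc (Suc j))" "\<And>\<sigma>. \<sigma> \<in> A \<inter> B \<Longrightarrow> (y1 - y2) \<sigma> = Phi (Suc (Suc j)) c3 \<sigma> - scobd y3 \<sigma>"
    using AB RC_diff[OF c1(1) c2(1)] subspace_diff[OF subspace_SY y1(1) y2(1)] 1 2 unfolding dual_cone_acyclic_def by blast
  define q where "q = c1 - c2 - real_boundary (Suc (Suc j)) c3"
  have q: "q \<in> RC (Suc j) (?U \<union> ?V)" using c3(2) unfolding UV(1) q_def .
  have bq: "real_boundary (Suc j) q = - g + h"
    using bd12 real_boundary_boundary[OF c3(1)] by (simp add: q_def real_boundary_diff)
  have oU: "openin (top_of_set (?U \<union> ?V)) ?U"
    by (rule openin_subset_trans[OF openin_complement_poly[OF AVS(1)]]) auto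
  have oV: "openin (top_of_set (?U \<union> ?V)) ?V"
    by (rule openin_subset_trans[OF openin_complement_poly[OF AVS(2)]]) auto
  have g': "- g \<in> RC (Suc j - 1) ?U" and h': "h \<in> RC (Suc j - 1) ?V" using gh RC_neg by auto
  obtain w q1 q2 where w: "w \<in> RC (Suc (Suc j)) (?U \<union> ?V)" and qw: "q = real_boundary (Suc (Suc j)) w + q1 + q2"
      and q1: "q1 \<in> RC (Suc j) ?U" and q2: "q2 \<in> RC (Suc j) ?V"
    by (rule small_chains[OF oU oV q bq g' h']) (rule that)
  have wX: "w \<in> RC (Suc (Suc j)) X" using RC_mono[OF _ w] by blast
  have c3w: "c3 + w \<in> RC (Suc (Suc j)) X" by (rule RC_add[OF c3(1) wX])
  \<comment> \<open>The common bounding chain. Up to a boundary it is also \<open>c1 - q1\<close>,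
    so it works over both sets.\<close>
  define e where "e = c2 + q2"
  have e1: "e = c1 - q1 - real_boundary (Suc (Suc j)) (c3 + w)"
    using qw by (simp add: e_def q_def real_boundary_add algebra_simps)
  \<comment> \<open>What must be added to \<open>y2\<close> on \<open>A\<close> to match the cochain
    belonging to \<open>c1\<close>. The summand \<open>scobd y3\<close> does not affect coboundaries
    and makes \<open>\<eta>\<close> vanish on the overlap.\<close>
  define \<eta> where "\<eta> = y1 - y2 - Phi (Suc (Suc j)) (c3 + w) + scobd y3"
  have \<eta>0: "\<eta> \<sigma> = 0" if \<sigma>: "\<sigma> \<in> A \<inter> B" for \<sigma>
  proof -
    have "Phi (Suc (Suc j)) w \<sigma> = 0" using Phi_vanish[OF w[unfolded UV(1)] \<sigma>] .
    then show ?thesis using y3(2)[OF \<sigma>] by (simp add: \<eta>_def Phi_add)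
  qed
  define h1 where "h1 \<sigma> = (if \<sigma> \<in> A then \<eta> \<sigma> else 0)" for \<sigma>
  define ey where "ey = y2 + h1"
  have h1B: "h1 \<sigma> = 0" if "\<sigma> \<in> B" for \<sigma> using \<eta>0 that by (auto simp: h1_def)
  have emp: "{} \<notin> VS" using nonempty by blast
  have y0: "y1 {} = 0" "y2 {} = 0" "y3 {} = 0" "Phi i e' {} = 0" for i e'
    using y1(1) y2(1) y3(1) emp by (auto simp: SY_def Phi_def)
  have h1e: "h1 {} = 0" using emp AVS by (auto simp: h1_def)
  have scz: "scobd z {} = 0" for z by (simp add: scobd_def)
  have "h1 \<in> SY (Suc j)"
    unfolding SY_def
  proof (intro CollectI allI impI)
    fix \<sigma> assume nz: "h1 \<sigma> \<noteq> 0"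
    then have \<sigma>: "\<sigma> \<in> A" "\<eta> \<sigma> \<noteq> 0" by (auto simp: h1_def split: if_splits)
    then have \<sigma>VS: "\<sigma> \<in> VS" using AVS by blast
    have "card \<sigma> + Suc j = m"
    proof (rule ccontr)
      assume ne: "card \<sigma> + Suc j \<noteq> m"
      have "y1 \<sigma> = 0" "y2 \<sigma> = 0" using y1(1) y2(1) ne by (auto simp: SY_def)
      moreover have "Phi (Suc (Suc j)) (c3 + w) \<sigma> = 0" using ne by (auto simp: Phi_def)
      moreover have "y3 (\<sigma> - {v}) = 0" if v: "v \<in> \<sigma>" for v
        using y3(1) ne card.remove[OF finV[OF \<sigma>VS] v] by (auto simp: SY_def)
      then have "scobd y3 \<sigma> = 0" by (simp add: scobd_def)
      ultimately show False using \<sigma>(2) by (simp add: \<eta>_def)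
    qed
    then show "\<sigma> \<in> VS \<and> card \<sigma> + Suc j = m" using \<sigma>VS by simp
  qed
  then have eyS: "ey \<in> SY (Suc j)" unfolding ey_def by (intro subspace_add[OF subspace_SY] y2(1))
  have onB: "y \<sigma> = Phi (Suc j) e \<sigma> - scobd ey \<sigma>" if \<sigma>: "\<sigma> \<in> B" for \<sigma>
  proof -
    have "scobd ey \<sigma> = scobd y2 \<sigma>"
      by (rule scobd_cong[OF dB \<sigma>]) (auto simp: ey_def h1B h1e)
    moreover have "Phi (Suc j) e \<sigma> = Phi (Suc j) c2 \<sigma>" using Phi_vanish[OF q2 \<sigma>] by (simp add: e_def Phi_add)
    ultimately show ?thesis using y2(2)[OF \<sigma>] by simp
  qed
  have onA: "y \<sigma> = Phi (Suc j) e \<sigma> - scobd ey \<sigma>" if \<sigma>: "\<sigma> \<in> A" for \<sigma>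
  proof -
    have \<sigma>VS: "\<sigma> \<in> VS" using \<sigma> AVS by blast
    have "scobd ey \<sigma> = scobd (y1 - Phi (Suc (Suc j)) (c3 + w) + scobd y3) \<sigma>"
      by (rule scobd_cong[OF dA \<sigma>]) (auto simp: ey_def h1_def \<eta>_def y0 h1e scz)
    also have "\<dots> = scobd y1 \<sigma> - Phi (Suc j) (real_boundary (Suc (Suc j)) (c3 + w)) \<sigma>"
      using scobd_scobd[OF \<sigma>VS] scobd_Phi[OF c3w \<sigma>VS] by (simp add: scobd_add scobd_diff)
    finally have "scobd ey \<sigma> = scobd y1 \<sigma> - Phi (Suc j) (real_boundary (Suc (Suc j)) (c3 + w)) \<sigma>" .
    moreover have "Phi (Suc j) e \<sigma> = Phi (Suc j) c1 \<sigma> - Phi (Suc j) (real_boundary (Suc (Suc j)) (c3 + w)) \<sigma>"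
      using Phi_vanish[OF q1 \<sigma>] by (simp add: e1 Phi_diff)
    ultimately show ?thesis using y1(2)[OF \<sigma>] by simp
  qed
  have "c - real_boundary (Suc j) e \<in> RC j ?U"
  proof -
    have "c - real_boundary (Suc j) e = g + real_boundary (Suc j) q1"
      by (simp add: e1 g_def real_boundary_diff real_boundary_boundary[OF c3w])
    then show ?thesis using gh(1) real_boundary_in_chains_Suc[OF q1] by (simp add: RC_add)
  qed
  moreover have "c - real_boundary (Suc j) e \<in> RC j ?V"
  proof -
    have "c - real_boundary (Suc j) e = h - real_boundary (Suc j) q2"
      by (simp add: e_def h_def real_boundary_add)
    then show ?thesis using gh(2) real_boundary_in_chains_Suc[OF q2] by (simp add: RC_diff)
  qed
  ultimately have "c - real_boundary (Suc j) e \<in> RC j (X - poly (A \<union> B))"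
    unfolding UV(2)[symmetric] by (rule RC_Int)
  moreover have "e \<in> RC (Suc j) X" unfolding e_def using RC_mono[OF _ q2] by (intro RC_add c2) blast
  ultimately show "\<exists>c' y'. c' \<in> RC (Suc j) X \<and> y' \<in> SY (Suc j) \<and> c - real_boundary (Suc j) c' \<in> RC j (X - poly (A \<union> B)) \<and>
        (\<forall>\<sigma>\<in>A \<union> B. y \<sigma> = Phi (Suc j) c' \<sigma> - scobd y' \<sigma>)"
    using eyS onA onB by blast
qed

lemma dual_cone_acyclic_all:
  assumes "down_closed A"
  shows "dual_cone_acyclic A"
proof (rule down_closed_induct[OF assms])
  show "dual_cone_acyclic {}"
    unfolding dual_cone_acyclic_def
    by (auto simp: poly_def intro!: exI[of _ 0] subspace_0[OF subspace_SY])
qed (auto intro: dual_cone_acyclic_simplex dual_cone_acyclic_Un)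

end

section \<open>The linking pairing and its two kernels\<close>

context triangulated_sphere
begin

text \<open>For a cycle \<open>x\<close> and a chain \<open>c\<close> whose boundary avoids the
  support of \<open>x\<close>, this is the linking number of \<open>x\<close> with the boundary of
  \<open>c\<close>.\<close>

definition intersection_pairing :: "nat \<Rightarrow> ('a set \<Rightarrow> real) \<Rightarrow> 'a real_chain \<Rightarrow> real" where
  "intersection_pairing j x c = (\<Sum>\<sigma>\<in>VS. x \<sigma> * Phi j c \<sigma>)"

lemma linear_intersection_pairing:
  "linear (intersection_pairing j x)" "linear (\<lambda>x. intersection_pairing j x c)"
  by (rule linearI; simp add: intersection_pairing_def Phi_add Phi_scale algebra_simps sum.distrib sum_distrib_left)+

lemma sbd_scobd_adjoint:
  assumes "x \<in> SC VS k" "y {} = 0"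
  shows "(\<Sum>\<sigma>\<in>VS. x \<sigma> * scobd y \<sigma>) = (\<Sum>\<rho>\<in>VS. sbd x \<rho> * y \<rho>)"
  using sbd_adjoint[of x k y] assms by (simp add: scobd_def)

lemma Phi_empty: "Phi j c {} = 0"
  using nonempty by (auto simp: Phi_def)

lemma pairing_boundary:
  assumes "x \<in> SC VS k" "sbd x = 0" "c \<in> RC (Suc j) X"
  shows "intersection_pairing j x (real_boundary (Suc j) c) = 0"
proof -
  have "intersection_pairing j x (real_boundary (Suc j) c) = (\<Sum>\<sigma>\<in>VS. x \<sigma> * scobd (Phi (Suc j) c) \<sigma>)"
    unfolding intersection_pairing_def using scobd_Phi[OF assms(3)] by (intro sum.cong refl) simp
  also have "\<dots> = 0" using sbd_scobd_adjoint[OF assms(1), of "Phi (Suc j) c"] assms(2) Phi_empty by simp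
  finally show ?thesis .
qed

lemma pairing_off_support:
  assumes "x \<in> SC L k" "g \<in> RC j (X - poly L)"
  shows "intersection_pairing j x g = 0"
  unfolding intersection_pairing_def
proof (rule sum.neutral, rule ballI)
  fix \<sigma>
  show "x \<sigma> * Phi j g \<sigma> = 0"
  proof (cases "x \<sigma> = 0")
    case False
    then have "\<sigma> \<in> L" using assms(1) by (auto simp: SC_def)
    then show ?thesis using Phi_vanish[OF assms(2)] by simp
  qed simp
qed

lemma pairing_fcycle:
  assumes x: "x \<in> SC VS 1" and "(\<Sum>v\<in>Vert. x {v}) = 0"
  shows "intersection_pairing m x fcycle = 0"
proof -
  have "intersection_pairing m x fcycle = (\<Sum>\<sigma>\<in>VS. x \<sigma>)"
    unfolding intersection_pairing_def
  proof (rule sum.cong[OF refl])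
    fix \<sigma> assume \<sigma>: "\<sigma> \<in> VS"
    show "x \<sigma> * Phi m fcycle \<sigma> = x \<sigma>"
    proof (cases "x \<sigma> = 0")
      case False
      then have "card \<sigma> = 1" using x by (auto simp: SC_def)
      then obtain v where "\<sigma> = {v}" by (auto simp: card_1_singleton_iff)
      then show ?thesis using Phi_fcycle[of v] \<sigma> by simp
    qed simp
  qed
  then show ?thesis using sum_singletons[OF x] assms(2) by simp
qed

lemma indicator_SC: "\<sigma> \<in> A \<Longrightarrow> card \<sigma> = k \<Longrightarrow> indicator {\<sigma>} \<in> SC A k"
  by (auto simp: SC_def indicator_def split: if_splits)

lemma sum_indicator_VS: "\<sigma> \<in> VS \<Longrightarrow> (\<Sum>\<tau>\<in>VS. indicator {\<sigma>} \<tau> * f \<tau>) = (f \<sigma> :: real)"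
  using finVS by (simp add: indicator_def sum.delta if_distrib[of "\<lambda>z. z * _"] cong: if_cong)

text \<open>Replaces a functional on chains by the cochain of its values on single simplices, so
  that separation arguments yield cochains.\<close>

lemma functional_expansion:
  fixes \<mu> :: "('a set \<Rightarrow> real) \<Rightarrow> real"
  assumes \<mu>: "linear \<mu>" and x: "x \<in> SC VS k"
  shows "\<mu> x = (\<Sum>\<sigma>\<in>VS. x \<sigma> * (if \<sigma> \<in> VS \<and> card \<sigma> = k then \<mu> (indicator {\<sigma>}) else 0))"
proof -
  have "x = (\<Sum>\<sigma>\<in>VS. x \<sigma> *\<^sub>R indicator {\<sigma>})"
    using x by (intro function_expansion[OF finVS]) (auto simp: SC_def)
  then have "\<mu> x = \<mu> (\<Sum>\<sigma>\<in>VS. x \<sigma> *\<^sub>R indicator {\<sigma>})" by simp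
  also have "\<dots> = (\<Sum>\<sigma>\<in>VS. x \<sigma> * \<mu> (indicator {\<sigma>}))" by (simp add: linear_sum[OF \<mu>] linear_scale[OF \<mu>])
  also have "\<dots> = (\<Sum>\<sigma>\<in>VS. x \<sigma> * (if \<sigma> \<in> VS \<and> card \<sigma> = k then \<mu> (indicator {\<sigma>}) else 0))"
    using x by (intro sum.cong refl) (auto simp: SC_def)
  finally show ?thesis .
qed

lemma scobd_functional:
  fixes \<mu> :: "('a set \<Rightarrow> real) \<Rightarrow> real"
  assumes \<mu>: "linear \<mu>" and \<sigma>: "\<sigma> \<in> VS" "card \<sigma> = Suc k"
    and y: "y = (\<lambda>\<tau>. if \<tau> \<in> VS \<and> card \<tau> = k then \<mu> (indicator {\<tau>}) else 0)"
  shows "scobd y \<sigma> = \<mu> (sbd (indicator {\<sigma>}))"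
proof -
  have i: "indicator {\<sigma>} \<in> SC VS (Suc k)" by (rule indicator_SC[OF \<sigma>])
  have "scobd y \<sigma> = (\<Sum>\<tau>\<in>VS. indicator {\<sigma>} \<tau> * scobd y \<tau>)" using sum_indicator_VS[OF \<sigma>(1)] by simp
  also have "\<dots> = (\<Sum>\<rho>\<in>VS. sbd (indicator {\<sigma>}) \<rho> * y \<rho>)"
    using nonempty by (intro sbd_scobd_adjoint[OF i]) (auto simp: y)
  also have "\<dots> = \<mu> (sbd (indicator {\<sigma>}))"
    unfolding y using functional_expansion[OF \<mu> sbd_SC[OF down_closed_VS i]] by simp
  finally show ?thesis .
qed

lemma scobd_other_card:
  assumes \<sigma>: "\<sigma> \<in> VS" "card \<sigma> \<noteq> Suc k" and y: "\<And>\<tau>. y \<tau> \<noteq> 0 \<Longrightarrow> card \<tau> = k"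
  shows "scobd y \<sigma> = 0"
proof -
  have "y (\<sigma> - {v}) = 0" if "v \<in> \<sigma>" for v
    using y[of "\<sigma> - {v}"] card.remove[OF finV[OF \<sigma>(1)] that] \<sigma>(2) by auto
  then show ?thesis by (simp add: scobd_def)
qed

lemma dual_cone_acyclicD:
  assumes "dual_cone_acyclic A" "c \<in> RC j X" "y \<in> SY j" "real_boundary j c \<in> RC (j - 1) (X - poly A)"
    "\<And>\<sigma>. \<sigma> \<in> A \<Longrightarrow> Phi j c \<sigma> = scobd y \<sigma>"
  obtains c' y' where "c' \<in> RC (Suc j) X" "y' \<in> SY (Suc j)" "c - real_boundary (Suc j) c' \<in> RC j (X - poly A)"
    "\<And>\<sigma>. \<sigma> \<in> A \<Longrightarrow> y \<sigma> = Phi (Suc j) c' \<sigma> - scobd y' \<sigma>"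
  using assms unfolding dual_cone_acyclic_def by blast

text \<open>Since \<open>j < m\<close>, every reduced cycle of the dual polyhedron bounds in the
  sphere, and so the boundary identifies \<open>V'\<close> modulo \<open>W'\<close> with the reduced
  homology. The kernels of the pairing are computed from acyclicity of the dual cone; the complement
  deformation then moves chains from off \<open>poly L\<close> into
  \<open>dual_poly L\<close>.\<close>

lemma Alexander_duality:
  assumes L: "down_closed L" and k: "k < m"
    and S: "quotient_basis (simplicial_cycles L k) (simplicial_boundaries L k) S"
  obtains S' where "quotient_basis (reduced_cycles (m - Suc k) (top_of_set (dual_poly L)))
      (real_boundaries (m - Suc k) (top_of_set (dual_poly L))) S'" "card S' = card S"
proof -
  define j where "j = m - Suc k"
  have jk: "Suc k + j = m" using k by (simp add: j_def)
  have LVS: "L \<subseteq> VS" by (rule down_closed_subset[OF L])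
  have dps: "dual_poly L \<subseteq> X - poly L" by (rule dual_poly_subset[OF L])
  have acy: "dual_cone_acyclic L" by (rule dual_cone_acyclic_all[OF L])
  let ?D = "top_of_set (dual_poly L)"
  let ?P = "intersection_pairing (Suc j)"
  define V' where "V' = {c \<in> RC (Suc j) X. real_boundary (Suc j) c \<in> RC j (dual_poly L)}"
  define W' where "W' = {c \<in> V'. real_boundary (Suc j) c \<in> real_boundaries j ?D}"
  have V': "subspace V'"
    unfolding V'_def by (rule subspaceI) (auto simp: real_boundary_add real_boundary_scale intro: RC_add RC_scale)
  have W': "subspace W'"
    unfolding W'_def using V'
    by (intro subspaceI) (auto simp: subspace_def real_boundary_add real_boundary_scale
        subspace_0[OF subspace_real_boundaries] subspace_add[OF subspace_real_boundaries] subspace_scale[OF subspace_real_boundaries])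
  have cyc: "x \<in> SC L (Suc k)" "x \<in> SC VS (Suc k)" "sbd x = 0" "(\<Sum>v\<in>Vert. x {v}) = 0" if "x \<in> simplicial_cycles L k" for x
    using that SC_mono[OF LVS] by (auto simp: simplicial_cycles_def)
  have ker1: "(\<forall>c\<in>V'. ?P x c = 0) \<longleftrightarrow> x \<in> simplicial_boundaries L k" if x: "x \<in> simplicial_cycles L k" for x
  proof
    assume "x \<in> simplicial_boundaries L k"
    then obtain x' where x': "x' \<in> SC L (Suc (Suc k))" "x = sbd x'" by (auto simp: simplicial_boundaries_def)
    show "\<forall>c\<in>V'. ?P x c = 0"
    proof
      fix c assume c: "c \<in> V'"
      have "?P x c = (\<Sum>\<sigma>\<in>VS. x' \<sigma> * scobd (Phi (Suc j) c) \<sigma>)"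
        unfolding intersection_pairing_def x'(2)
        using sbd_scobd_adjoint[OF SC_mono[OF LVS x'(1)], of "Phi (Suc j) c"] Phi_empty by simp
      also have "\<dots> = intersection_pairing j x' (real_boundary (Suc j) c)"
        unfolding intersection_pairing_def using scobd_Phi c by (intro sum.cong refl) (auto simp: V'_def)
      also have "\<dots> = 0"
        by (rule pairing_off_support[OF x'(1)]) (use c RC_mono[OF dps] in \<open>auto simp: V'_def\<close>)
      finally show "?P x c = 0" .
    qed
  next
    assume all: "\<forall>c\<in>V'. ?P x c = 0"
    show "x \<in> simplicial_boundaries L k"
    proof (rule ccontr)
      assume "x \<notin> simplicial_boundaries L k"
      then obtain \<mu> :: "('a set \<Rightarrow> real) \<Rightarrow> real" where \<mu>: "linear \<mu>" "\<And>w. w \<in> simplicial_boundaries L k \<Longrightarrow> \<mu> w = 0" "\<mu> x = 1"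
        using functional_separating[OF subspace_simplicial_boundaries] by metis
      \<comment> \<open>A functional separating \<open>x\<close> from boundaries is a cocycle on
        \<open>L\<close>. Acyclicity of the dual cone, with zero as chain part, represents it up to
        a coboundary by a chain \<open>c'\<close>, which then pairs to 1 with
        \<open>x\<close>.\<close>
      define y where "y = (\<lambda>\<tau>. if \<tau> \<in> VS \<and> card \<tau> = Suc k then \<mu> (indicator {\<tau>}) else 0)"
      have ySY: "y \<in> SY j" using jk by (auto simp: SY_def y_def split: if_splits)
      have y0: "scobd y \<sigma> = 0" if \<sigma>: "\<sigma> \<in> L" for \<sigma>
      proof (cases "card \<sigma> = Suc (Suc k)")
        case True
        have "scobd y \<sigma> = \<mu> (sbd (indicator {\<sigma>}))" using LVS \<sigma> by (intro scobd_functional[OF \<mu>(1) _ True y_def]) auto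
        moreover have "sbd (indicator {\<sigma>}) \<in> simplicial_boundaries L k"
          unfolding simplicial_boundaries_def using indicator_SC[OF \<sigma> True] by blast
        ultimately show ?thesis using \<mu>(2) by simp
      next
        case False
        have "card \<tau> = Suc k" if "y \<tau> \<noteq> 0" for \<tau> using that unfolding y_def by presburger
        then show ?thesis using scobd_other_card[of \<sigma> "Suc k" y] LVS \<sigma> False by blast
      qed
      obtain c' y' where c': "c' \<in> RC (Suc j) X" "0 - real_boundary (Suc j) c' \<in> RC j (X - poly L)"
          and y': "y' \<in> SY (Suc j)" "\<And>\<sigma>. \<sigma> \<in> L \<Longrightarrow> y \<sigma> = Phi (Suc j) c' \<sigma> - scobd y' \<sigma>"
        by (rule dual_cone_acyclicD[OF acy _ ySY, of 0]) (use y0 that in auto)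
      have bc': "real_boundary (Suc j) c' \<in> RC j (X - poly L)" using RC_neg[OF c'(2)] by simp
      \<comment> \<open>The boundary of \<open>c'\<close> is a cycle off \<open>poly L\<close>.
        Deforming it into the dual polyhedron changes \<open>c'\<close> by a chain \<open>w\<close>
        off \<open>poly L\<close>, which does not affect the pairing.\<close>
      have "real_boundary j (real_boundary (Suc j) c') \<in> RC (j - 1) (dual_poly L)"
        using real_boundary_boundary[OF c'(1)] by simp
      then obtain w where w: "w \<in> RC (Suc j) (X - poly L)" "real_boundary (Suc j) c' - real_boundary (Suc j) w \<in> RC j (dual_poly L)"
        using complement_deformation[OF L bc'] by blast
      have wX: "w \<in> RC (Suc j) X" using RC_mono[OF _ w(1)] by blast
      have "c' - w \<in> V'" using c'(1) wX w(2) by (auto simp: V'_def real_boundary_diff intro: RC_diff)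
      then have "?P x (c' - w) = 0" using all by blast
      moreover have "?P x w = 0" by (rule pairing_off_support[OF cyc(1)[OF x] w(1)])
      ultimately have "?P x c' = 0" by (simp add: linear_diff[OF linear_intersection_pairing(1)])
      moreover have "?P x c' = (\<Sum>\<sigma>\<in>VS. x \<sigma> * (y \<sigma> + scobd y' \<sigma>))"
        unfolding intersection_pairing_def
      proof (intro sum.cong refl)
        fix \<sigma>
        show "x \<sigma> * Phi (Suc j) c' \<sigma> = x \<sigma> * (y \<sigma> + scobd y' \<sigma>)"
        proof (cases "x \<sigma> = 0")
          case False
          then have "\<sigma> \<in> L" using cyc(1)[OF x] by (auto simp: SC_def)
          then show ?thesis using y'(2) by simp
        qed simp
      qed
      moreover have "(\<Sum>\<sigma>\<in>VS. x \<sigma> * (y \<sigma> + scobd y' \<sigma>)) = (\<Sum>\<sigma>\<in>VS. x \<sigma> * y \<sigma>) + (\<Sum>\<sigma>\<in>VS. x \<sigma> * scobd y' \<sigma>)"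
        by (simp add: algebra_simps sum.distrib)
      moreover have "(\<Sum>\<sigma>\<in>VS. x \<sigma> * y \<sigma>) = 1"
        using functional_expansion[OF \<mu>(1) cyc(2)[OF x]] \<mu>(3) by (simp add: y_def)
      moreover have "y' {} = 0" using y'(1) nonempty by (auto simp: SY_def)
      then have "(\<Sum>\<sigma>\<in>VS. x \<sigma> * scobd y' \<sigma>) = 0"
        using sbd_scobd_adjoint[OF cyc(2)[OF x], of y'] cyc(3)[OF x] by simp
      ultimately show False by simp
    qed
  qed
  have ker2: "(\<forall>x\<in>simplicial_cycles L k. ?P x c = 0) \<longleftrightarrow> c \<in> W'" if c: "c \<in> V'" for c
  proof
    assume "c \<in> W'"
    then obtain g where g: "g \<in> RC (Suc j) (dual_poly L)" "real_boundary (Suc j) g = real_boundary (Suc j) c"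
      by (auto simp: W'_def real_boundaries_def)
    have gU: "g \<in> RC (Suc j) (X - poly L)" using RC_mono[OF dps g(1)] .
    have gX: "g \<in> RC (Suc j) X" using RC_mono[OF _ gU] by blast
    have cg: "c - g \<in> RC (Suc j) X" "real_boundary (Suc j) (c - g) = 0"
      using c gX g(2) by (auto simp: V'_def real_boundary_diff intro: RC_diff)
    show "\<forall>x\<in>simplicial_cycles L k. ?P x c = 0"
    proof
      fix x assume x: "x \<in> simplicial_cycles L k"
      have "?P x (c - g) = 0"
      \<comment> \<open>\<open>c - g\<close> is a cycle of the sphere. It bounds unless its degree
        is \<open>m\<close>, and then \<open>fcycle\<close> pairs to zero with \<open>x\<close>
        because the coefficients of \<open>x\<close> sum to zero.\<close>
      proof (cases "k = 0")
        case True
        then have mj: "Suc j = m" using jk by simp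
        then obtain r y where y: "y \<in> RC (Suc m) X" "c - g = r *\<^sub>R fcycle + real_boundary (Suc m) y"
          using fcycle(4)[of "c - g"] cg by auto
        have "intersection_pairing m x (real_boundary (Suc m) y) = 0"
          by (rule pairing_boundary[OF cyc(2)[OF x] cyc(3)[OF x] y(1)])
        moreover have "intersection_pairing m x fcycle = 0"
          using pairing_fcycle[of x] cyc(2,4)[OF x] True by simp
        ultimately show ?thesis unfolding y(2) mj
          by (simp add: linear_add[OF linear_intersection_pairing(1)] linear_scale[OF linear_intersection_pairing(1)])
      next
        case False
        then have "Suc j \<noteq> m" using jk by simp
        moreover have "c - g \<in> reduced_cycles (Suc j) (top_of_set X)" using cg by (simp add: reduced_cycles_iff)
        ultimately obtain y where y: "y \<in> RC (Suc (Suc j)) X" "real_boundary (Suc (Suc j)) y = c - g"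
          using sph.cycle_bounds by blast
        then show ?thesis using pairing_boundary[OF cyc(2)[OF x] cyc(3)[OF x] y(1)] by simp
      qed
      then show "?P x c = 0"
        using pairing_off_support[OF cyc(1)[OF x] gU] by (simp add: linear_diff[OF linear_intersection_pairing(1)])
    qed
  next
    assume all: "\<forall>x\<in>simplicial_cycles L k. ?P x c = 0"
    \<comment> \<open>Reduced cycles are the kernel of \<open>T\<close> on chains of
      \<open>L\<close>, so pairing with \<open>c\<close> factors through \<open>T\<close>: on
      \<open>L\<close> it is a coboundary plus, in the case of vertices, a constant
      \<open>r\<close>.\<close>
    define T where "T x = (sbd x, \<Sum>v\<in>Vert. x {v})" for x :: "'a set \<Rightarrow> real"
    have T: "linear T"
      by (rule linearI) (auto simp: T_def sbd_add linear_scale[OF linear_sbd] sum.distrib sum_distrib_left)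
    have s0: "subspace {0 :: ('a set \<Rightarrow> real) \<times> real}" by simp
    have ker: "?P x c = 0" if "x \<in> SC L (Suc k)" "T x \<in> {0}" for x
      using all that by (auto simp: T_def simplicial_cycles_def zero_prod_def)
    obtain M :: "('a set \<Rightarrow> real) \<times> real \<Rightarrow> real" where M: "linear M" "\<And>x. x \<in> SC L (Suc k) \<Longrightarrow> M (T x) = ?P x c"
      by (rule functional_factor[OF subspace_SC[of L "Suc k"] s0 T linear_intersection_pairing(2) ker]) (assumption | rule that)+
    define \<mu> where "\<mu> z = M (z, 0)" for z
    have \<mu>: "linear \<mu>"
    proof (rule linearI)
      fix a b :: "'a set \<Rightarrow> real" and r :: real
      show "\<mu> (a + b) = \<mu> a + \<mu> b" using linear_add[OF M(1), of "(a,0)" "(b,0)"] by (simp add: \<mu>_def)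
      show "\<mu> (r *\<^sub>R a) = r *\<^sub>R \<mu> a" using linear_scale[OF M(1), of r "(a,0)"] by (simp add: \<mu>_def)
    qed
    define r where "r = M (0, 1)"
    have MT: "M (z, s) = \<mu> z + s * r" for z s
      using linear_add[OF M(1), of "(z,0)" "(0,s)"] linear_scale[OF M(1), of s "(0,1)"] by (simp add: \<mu>_def r_def)
    define y where "y = (\<lambda>\<tau>. if \<tau> \<in> VS \<and> card \<tau> = k then \<mu> (indicator {\<tau>}) else 0)"
    have ySY: "y \<in> SY (Suc j)" using jk by (auto simp: SY_def y_def split: if_splits)
    \<comment> \<open>For \<open>k = 0\<close> the constant is removed by \<open>r\<close> times
      \<open>fcycle\<close>, whose degree fits only in this case.\<close>
    define c1 where "c1 = c - (if k = 0 then r else 0) *\<^sub>R (if k = 0 then fcycle else 0)"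
    have Phic: "Phi (Suc j) c \<sigma> = scobd y \<sigma> + (if k = 0 then r else 0)" if \<sigma>: "\<sigma> \<in> L" "card \<sigma> = Suc k" for \<sigma>
    proof -
      have \<sigma>VS: "\<sigma> \<in> VS" using \<sigma> LVS by blast
      have "Phi (Suc j) c \<sigma> = ?P (indicator {\<sigma>}) c" using sum_indicator_VS[OF \<sigma>VS] by (simp add: intersection_pairing_def)
      also have "\<dots> = M (T (indicator {\<sigma>}))" using M(2) indicator_SC[OF \<sigma>] by simp
      also have "\<dots> = \<mu> (sbd (indicator {\<sigma>})) + (\<Sum>v\<in>Vert. indicator {\<sigma>} {v}) * r" by (simp add: T_def MT)
      also have "\<mu> (sbd (indicator {\<sigma>})) = scobd y \<sigma>" by (rule scobd_functional[OF \<mu> \<sigma>VS \<sigma>(2) y_def, symmetric])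
      also have "(\<Sum>v\<in>Vert. indicator {\<sigma>} {v}) = (if k = 0 then 1 else (0::real))"
      proof (cases "k = 0")
        case True
        have "(\<Sum>v\<in>Vert. indicator {\<sigma>} {v}) = (\<Sum>\<tau>\<in>VS. indicator {\<sigma>} \<tau> :: real)"
          using sum_singletons[of "indicator {\<sigma>}"] indicator_SC[OF \<sigma>VS, of 1] \<sigma>(2) True by simp
        then show ?thesis using sum_indicator_VS[OF \<sigma>VS, of "\<lambda>_. 1"] True by simp
      next
        case False
        then show ?thesis using singleton_sum_zero[OF indicator_SC[OF \<sigma>]] by simp
      qed
      finally show ?thesis by simp
    qed
    have Phic1: "Phi (Suc j) c1 \<sigma> = scobd y \<sigma>" if \<sigma>: "\<sigma> \<in> L" for \<sigma>
    proof (cases "card \<sigma> = Suc k")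
      case True
      show ?thesis
      proof (cases "k = 0")
        case k0: True
        obtain v where v: "\<sigma> = {v}" using True k0 by (auto simp: card_1_singleton_iff)
        have "Suc j = m" using jk k0 by simp
        then have "Phi (Suc j) fcycle \<sigma> = 1" using Phi_fcycle[of v] \<sigma> LVS v by auto
        then show ?thesis using Phic[OF \<sigma> True] k0 by (simp add: c1_def Phi_diff Phi_scale)
      qed (use Phic[OF \<sigma> True] in \<open>simp add: c1_def\<close>)
    next
      case False
      have "\<not> card \<sigma> + Suc j = Suc m" using False jk by arith
      then have "Phi (Suc j) c1 \<sigma> = 0" unfolding Phi_def by simp
      moreover have "card \<tau> = k" if "y \<tau> \<noteq> 0" for \<tau> using that unfolding y_def by presburger
      then have "scobd y \<sigma> = 0" using scobd_other_card[of \<sigma> k y] LVS \<sigma> False by blast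
      ultimately show ?thesis by simp
    qed
    have c1X: "c1 \<in> RC (Suc j) X" "real_boundary (Suc j) c1 = real_boundary (Suc j) c"
    proof -
      have "(if k = 0 then fcycle else 0) \<in> RC (Suc j) X \<and> real_boundary (Suc j) (if k = 0 then fcycle else 0) = 0"
      proof (cases "k = 0")
        case True
        then have "m = Suc j" using jk by simp
        then show ?thesis using fcycle(1,2) True by metis
      qed simp
      then show "c1 \<in> RC (Suc j) X" "real_boundary (Suc j) c1 = real_boundary (Suc j) c"
        using c by (auto simp: c1_def V'_def real_boundary_diff real_boundary_scale simp del: if_split intro!: RC_diff RC_scale)
    qed
    have bdual: "real_boundary (Suc j) c \<in> RC j (dual_poly L)" using c by (simp add: V'_def)
    then have "real_boundary (Suc j) c1 \<in> RC (Suc j - 1) (X - poly L)" using c1X(2) RC_mono[OF dps] by simp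
    from dual_cone_acyclicD[OF acy c1X(1) ySY this Phic1]
    obtain c2 where c2: "c2 \<in> RC (Suc (Suc j)) X" "c1 - real_boundary (Suc (Suc j)) c2 \<in> RC (Suc j) (X - poly L)"
      by blast
    define g where "g = c1 - real_boundary (Suc (Suc j)) c2"
    have g: "g \<in> RC (Suc j) (X - poly L)" "real_boundary (Suc j) g = real_boundary (Suc j) c"
      using c2 c1X(2) real_boundary_boundary[OF c2(1)] by (auto simp: g_def real_boundary_diff)
    have "real_boundary (Suc j) g \<in> RC (Suc j - 1) (dual_poly L)" using g(2) bdual by simp
    then obtain w where w: "w \<in> RC (Suc (Suc j)) (X - poly L)" "g - real_boundary (Suc (Suc j)) w \<in> RC (Suc j) (dual_poly L)"
      using complement_deformation[OF L g(1)] by blast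
    have "real_boundary (Suc j) (g - real_boundary (Suc (Suc j)) w) = real_boundary (Suc j) c"
      using g(2) real_boundary_boundary[OF w(1)] by (simp add: real_boundary_diff)
    then have "real_boundary (Suc j) c \<in> real_boundaries j ?D"
      unfolding real_boundaries_def using w(2) by (metis imageI)
    then show "c \<in> W'" using c by (simp add: W'_def)
  qed
  obtain S1 where S1: "quotient_basis V' W' S1" "card S1 = card S"
    by (rule perfect_pairing_quotient_basis[OF subspace_simplicial_cycles V' W' linear_intersection_pairing(2) linear_intersection_pairing(1) ker1 ker2 S])
       (assumption | rule that)+
  have a: "real_boundary (Suc j) c \<in> reduced_cycles j ?D" if "c \<in> V'" for c
    using boundary_in_reduced_cycles[of c j "top_of_set X"] that by (auto simp: V'_def reduced_cycles_iff)
  have b: "real_boundary (Suc j) c \<in> real_boundaries j ?D \<longleftrightarrow> c \<in> W'" if "c \<in> V'" for c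
    using that by (simp add: W'_def)
  have c: "\<exists>c\<in>V'. b - real_boundary (Suc j) c \<in> real_boundaries j ?D" if b: "b \<in> reduced_cycles j ?D" for b
  proof -
    have "dual_poly L \<subseteq> X" using dps by blast
    then have "b \<in> reduced_cycles j (top_of_set X)" using b RC_mono by (auto simp: reduced_cycles_iff)
    moreover have "j \<noteq> m" using jk by simp
    ultimately obtain y where y: "y \<in> RC (Suc j) X" "real_boundary (Suc j) y = b"
      using sph.cycle_bounds by blast
    then have "y \<in> V'" using b by (simp add: V'_def reduced_cycles_iff)
    then show ?thesis using y(2) subspace_0[OF subspace_real_boundaries] by (intro bexI[of _ y]) auto
  qed
  have "quotient_basis (reduced_cycles j ?D) (real_boundaries j ?D) (real_boundary (Suc j) ` S1)"
    "card (real_boundary (Suc j) ` S1) = card S1"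
    using quotient_basis_image[OF linear_real_boundary V' a b c subspace_real_boundaries S1(1)] by blast+
  then show thesis using that S1(2) unfolding j_def by metis
qed

end

subsection \<open>Barycentres and dual cells\<close>

context geometric_complex
begin

definition bc :: "'a set \<Rightarrow> 'a" where "bc V = (1 / real (card V)) *\<^sub>R \<Sum>V"
text \<open>The dual cell in coordinates. A larger \<open>V\<close> imposes more conditions, which
  reverses inclusions.\<close>

definition dcell :: "'a set \<Rightarrow> 'a set" where "dcell V = {x \<in> X. V \<subseteq> am x}"

lemma lam_bc:
  assumes V: "V \<in> VS"
  shows "lam (bc V) = (\<lambda>v. if v \<in> V then 1 / real (card V) else 0)" "bc V \<in> X"
proof -
  let ?u = "\<lambda>v. if v \<in> V then 1 / real (card V) else 0"
  have "card V > 0" using finV[OF V] nonempty[OF V] by (simp add: card_gt_0_iff)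
  then have "coords ?u (\<Sum>v\<in>V. ?u v *\<^sub>R v)" by (intro coordsI[OF V]) auto
  moreover have "(\<Sum>v\<in>V. ?u v *\<^sub>R v) = bc V" by (simp add: bc_def scaleR_sum_right)
  ultimately have c: "coords ?u (bc V)" by simp
  show "lam (bc V) = ?u" by (rule lam_eqI[OF c])
  show "bc V \<in> X" by (rule coords_in_X[OF c])
qed

lemma card_VS_pos: "V \<in> VS \<Longrightarrow> card V > 0"
  using finV nonempty by (simp add: card_gt_0_iff)

lemma supp_bc: "V \<in> VS \<Longrightarrow> supp (bc V) = V"
  using card_VS_pos[of V] by (auto simp: supp_def lam_bc split: if_splits)

lemma am_bc: "V \<in> VS \<Longrightarrow> am (bc V) = V"
proof -
  assume V: "V \<in> VS"
  obtain u where u: "u \<in> V" using nonempty[OF V] by blast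
  have pos: "1 / real (card V) > 0" using card_VS_pos[OF V] by simp
  have "v \<in> am (bc V) \<longleftrightarrow> v \<in> V" for v
  proof
    assume "v \<in> am (bc V)"
    then have "lam (bc V) u \<le> lam (bc V) v" using am_iff'[OF lam_bc(2)[OF V]] by blast
    then show "v \<in> V" using u pos by (auto simp: lam_bc(1)[OF V] split: if_splits)
  next
    assume "v \<in> V"
    then show "v \<in> am (bc V)" unfolding am_iff'[OF lam_bc(2)[OF V]] by (auto simp: lam_bc(1)[OF V])
  qed
  then show ?thesis by blast
qed

lemma bc_inj: "V \<in> VS \<Longrightarrow> W \<in> VS \<Longrightarrow> bc V = bc W \<Longrightarrow> V = W"
  using supp_bc by metis

lemma bc_in_hull: "V \<in> VS \<Longrightarrow> bc V \<in> convex hull V"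
  using hull_iff_supp[of V "bc V"] lam_bc(2) supp_bc by simp

text \<open>The coordinate form of transversality: equal coordinates on \<open>V\<close> and zero
  elsewhere determine the point, so a simplex meets its dual cell in the barycentre only.\<close>

lemma eq_bc:
  assumes x: "x \<in> X" and V: "V \<in> VS" and s: "supp x \<subseteq> V" and a: "V \<subseteq> am x"
  shows "x = bc V"
proof -
  have l: "lam x v = (if v \<in> V then mx x else 0)" for v
    using s a am_iff[OF x, of v] by (auto simp: supp_def)
  have "1 = sum (lam x) V" using sum_lam[OF x] sum_Vert_eq(1)[OF V, of "lam x"] l by simp
  also have "\<dots> = real (card V) * mx x" by (simp add: l)
  finally have "mx x = 1 / real (card V)" using card_VS_pos[OF V] by (simp add: field_simps)
  then have "lam x = lam (bc V)" using l by (auto simp: lam_bc(1)[OF V] fun_eq_iff)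
  then show ?thesis using lam_expand[OF x] lam_expand[OF lam_bc(2)[OF V]] by metis
qed

lemma hull_subset_iff:
  assumes "V \<in> VS" "W \<in> VS"
  shows "convex hull V \<subseteq> convex hull W \<longleftrightarrow> V \<subseteq> W"
proof
  assume "convex hull V \<subseteq> convex hull W"
  then have "bc V \<in> convex hull W" using bc_in_hull[OF assms(1)] by blast
  then show "V \<subseteq> W" using hull_iff_supp[OF assms(2) lam_bc(2)[OF assms(1)]] supp_bc[OF assms(1)] by simp
qed (rule hull_mono)

lemma dcell_subset_iff:
  assumes "V \<in> VS" "W \<in> VS"
  shows "dcell V \<subseteq> dcell W \<longleftrightarrow> W \<subseteq> V"
proof
  assume "dcell V \<subseteq> dcell W"
  moreover have "bc V \<in> dcell V" using lam_bc(2)[OF assms(1)] am_bc[OF assms(1)] by (simp add: dcell_def)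
  ultimately show "W \<subseteq> V" using am_bc[OF assms(1)] by (auto simp: dcell_def)
qed (auto simp: dcell_def)

lemma dual_poly_eq_Union:
  assumes "down_closed L"
  shows "dual_poly L = (\<Union>V\<in>VS - L. dcell V)"
proof
  show "dual_poly L \<subseteq> (\<Union>V\<in>VS - L. dcell V)"
    using am_VS by (auto simp: dual_poly_def dcell_def)
  show "(\<Union>V\<in>VS - L. dcell V) \<subseteq> dual_poly L"
    using down_closedD[OF assms] nonempty by (fastforce simp: dual_poly_def dcell_def)
qed

text \<open>The flag has a largest simplex \<open>T\<close>, on which coordinates are affine. Each
  barycentre of the flag has maximal coordinates on all of \<open>V\<close>, and convex combinations
  preserve this.\<close>

lemma flag_hull_subset_dcell:
  assumes F: "F \<subseteq> VS" and chain: "\<And>\<rho> \<tau>. \<rho> \<in> F \<Longrightarrow> \<tau> \<in> F \<Longrightarrow> \<rho> \<subseteq> \<tau> \<or> \<tau> \<subseteq> \<rho>"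
    and V: "V \<in> F" "\<And>\<rho>. \<rho> \<in> F \<Longrightarrow> V \<subseteq> \<rho>"
  shows "convex hull (bc ` F) \<subseteq> dcell V"
proof
  fix x assume x: "x \<in> convex hull (bc ` F)"
  have finF: "finite F" using F finVS finite_subset by blast
  have "finite (card ` F)" "card ` F \<noteq> {}" using finF V(1) by auto
  then have "Max (card ` F) \<in> card ` F" by (rule Max_in)
  then obtain T where T: "T \<in> F" "card T = Max (card ` F)" by auto
  have TVS: "T \<in> VS" using T F by blast
  have top: "\<rho> \<subseteq> T" if "\<rho> \<in> F" for \<rho>
  proof -
    have "card \<rho> \<le> card T" using T(2) finF that by simp
    then show ?thesis using chain[OF that T(1)] card_seteq[of \<rho> T] finV F that by blast
  qed
  obtain c where c: "\<And>b. b \<in> bc ` F \<Longrightarrow> c b \<ge> 0" "sum c (bc ` F) = 1" "(\<Sum>b\<in>bc ` F. c b *\<^sub>R b) = x"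
    using x finF unfolding convex_hull_finite[OF finite_imageI[OF finF]] by auto
  have hull: "b \<in> convex hull T" if "b \<in> bc ` F" for b
    using that top bc_in_hull F hull_mono by blast
  have l: "lam x v = (\<Sum>b\<in>bc ` F. c b * lam b v)" for v
    using lam_sum_combination(1)[OF TVS, of "bc ` F" "\<lambda>b. b" c] finite_imageI[OF finF, of bc] hull c by auto
  have xX: "x \<in> X"
    using lam_sum_combination(2)[OF TVS, of "bc ` F" "\<lambda>b. b" c] finite_imageI[OF finF, of bc] hull c by auto
  have "V \<subseteq> am x"
  proof
    fix v assume v: "v \<in> V"
    have "lam x w \<le> lam x v" for w
      unfolding l
    proof (rule sum_mono)
      fix b assume b: "b \<in> bc ` F"
      then obtain \<rho> where \<rho>: "\<rho> \<in> F" "b = bc \<rho>" by blast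
      have "v \<in> am b" using am_bc[of \<rho>] \<rho> V(2) v F by blast
      then have "lam b w \<le> lam b v" using am_iff'[of b v] lam_bc(2)[of \<rho>] \<rho> F by auto
      then show "c b * lam b w \<le> c b * lam b v" using c(1)[OF b] by (rule mult_left_mono)
    qed
    then show "v \<in> am x" using am_iff'[OF xX] by blast
  qed
  then show "x \<in> dcell V" using xX by (simp add: dcell_def)
qed

text \<open>Peeling off the smallest positive coordinate writes a point as a convex combination of the
  barycentres of its superlevel sets.\<close>

lemma dcell_flag:
  assumes "x \<in> X" "V \<in> VS" "V \<subseteq> am x"
  shows "\<exists>F. F \<subseteq> VS \<and> V \<in> F \<and> (\<forall>\<rho>\<in>F. V \<subseteq> \<rho> \<and> \<rho> \<subseteq> supp x) \<and> (\<forall>\<rho>\<in>F. \<forall>\<tau>\<in>F. \<rho> \<subseteq> \<tau> \<or> \<tau> \<subseteq> \<rho>) \<and> x \<in> convex hull (bc ` F)"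
  using assms
proof (induction "card (supp x)" arbitrary: x rule: less_induct)
  case less
  note x = less.prems(1) and V = less.prems(2) and Vx = less.prems(3)
  have S: "supp x \<in> VS" by (rule supp_VS[OF x])
  have VS: "V \<subseteq> supp x" using Vx am_subset_supp[OF x] by blast
  show ?case
  proof (cases "supp x \<subseteq> am x")
    case True
    have "x = bc (supp x)" by (rule eq_bc[OF x S order_refl True])
    then have "x \<in> convex hull (bc ` {V, supp x})" using hull_inc[of x "bc ` {V, supp x}" convex] by auto
    then show ?thesis using V S VS by (intro exI[of _ "{V, supp x}"]) auto
  next
    case False
    \<comment> \<open>The smallest positive coordinate. As not all positive coordinates are maximal,
      subtracting it leaves positive mass \<open>s\<close> and a smaller support; the mass removed
      is a multiple of the barycentre of the support.\<close>
    define c where "c = Min (lam x ` supp x)"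
    have fS: "finite (supp x)" "supp x \<noteq> {}" using finV[OF S] nonempty[OF S] by auto
    have "c \<in> lam x ` supp x" unfolding c_def using fS by (intro Min_in) auto
    then obtain v1 where v1: "v1 \<in> supp x" "lam x v1 = c" by auto
    have cle: "c \<le> lam x v" if "v \<in> supp x" for v unfolding c_def using fS that by (intro Min_le) auto
    have cpos: "c > 0" using v1 lam_nonneg[OF x, of v1] by (auto simp: supp_def)
    obtain v2 where v2: "v2 \<in> am x" using am_nonempty[OF x] by blast
    obtain v3 where v3: "v3 \<in> supp x" "v3 \<notin> am x" using False by blast
    have "lam x v3 < mx x" using v3(2) am_iff[OF x] lam_le_mx[OF x, of v3] by (auto simp: less_le)
    then have cmx: "c < mx x" using cle[OF v3(1)] by simp
    define w where "w v = (if v \<in> supp x then lam x v - c else 0)" for v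
    define s where "s = sum w Vert"
    define y where "y = (\<Sum>v\<in>Vert. (w v / s) *\<^sub>R v)"
    have w0: "w v \<ge> 0" for v using cle by (simp add: w_def)
    have wz: "w v = 0" if "v \<notin> supp x" for v using that by (simp add: w_def)
    have sval: "s = 1 - c * real (card (supp x))"
    proof -
      have "s = sum w (supp x)" unfolding s_def by (rule sum_Vert_eq(1)[OF S wz])
      also have "\<dots> = sum (lam x) (supp x) - c * real (card (supp x))" by (simp add: w_def sum_subtractf)
      also have "sum (lam x) (supp x) = 1" using sum_lam[OF x] sum_Vert_eq(1)[OF S, of "lam x"] by (simp add: supp_def)
      finally show ?thesis .
    qed
    have "w v2 > 0" using v2 am_subset_supp[OF x] am_iff[OF x] cmx by (auto simp: w_def)
    then have spos: "s > 0" unfolding s_def using v2 finVert w0 by (intro sum_pos2[of Vert v2]) (auto simp: am_def)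
    have yX: "y \<in> X" and ly: "lam y v = w v / s" for v
      using weighted_point[OF x w0 wz] spos by (auto simp: y_def s_def)
    have suppy: "supp y = {v \<in> supp x. lam x v \<noteq> c}"
      using spos by (auto simp: supp_def ly w_def split: if_splits)
    then have "supp y \<subset> supp x" using v1 by auto
    then have cardlt: "card (supp y) < card (supp x)" using fS(1) by (rule psubset_card_mono[rotated])
    have Vy: "V \<subseteq> am y"
    proof
      fix v assume "v \<in> V"
      then have v: "v \<in> am x" using Vx by blast
      then have "w u \<le> w v" for u
        using am_iff[OF x] lam_le_mx[OF x, of u] am_subset_supp[OF x] cmx by (auto simp: w_def)
      then show "v \<in> am y" unfolding am_iff'[OF yX] ly using spos by (auto intro: divide_right_mono)
    qed
    obtain F where F: "F \<subseteq> VS" "V \<in> F" "\<And>\<rho>. \<rho> \<in> F \<Longrightarrow> V \<subseteq> \<rho> \<and> \<rho> \<subseteq> supp y"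
        "\<And>\<rho> \<tau>. \<rho> \<in> F \<Longrightarrow> \<tau> \<in> F \<Longrightarrow> \<rho> \<subseteq> \<tau> \<or> \<tau> \<subseteq> \<rho>" "y \<in> convex hull (bc ` F)"
      using less.hyps[OF cardlt yX V Vy] by (elim exE conjE) (rule that, auto)
    let ?F = "insert (supp x) F"
    have "x = s *\<^sub>R y + (1 - s) *\<^sub>R bc (supp x)"
    proof -
      have "s *\<^sub>R y = (\<Sum>v\<in>Vert. w v *\<^sub>R v)" using spos by (simp add: y_def scaleR_sum_right)
      also have "\<dots> = (\<Sum>v\<in>supp x. w v *\<^sub>R v)" by (rule sum_Vert_eq(2)[OF S wz])
      also have "\<dots> = (\<Sum>v\<in>supp x. lam x v *\<^sub>R v) - c *\<^sub>R \<Sum>(supp x)"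
        by (simp add: w_def scaleR_diff_left sum_subtractf scaleR_sum_right)
      also have "(\<Sum>v\<in>supp x. lam x v *\<^sub>R v) = x"
        using lam_expand[OF x] sum_Vert_eq(2)[OF S, of "lam x"] by (simp add: supp_def)
      also have "c *\<^sub>R \<Sum>(supp x) = (1 - s) *\<^sub>R bc (supp x)"
        using card_VS_pos[OF S] by (simp add: bc_def sval)
      finally show ?thesis by simp
    qed
    moreover have "s \<le> 1" using sval cpos by simp
    moreover have "y \<in> convex hull (bc ` ?F)" using F(5) hull_mono[of "bc ` F" "bc ` ?F" convex] by auto
    moreover have "bc (supp x) \<in> convex hull (bc ` ?F)" by (intro hull_inc) auto
    ultimately have "x \<in> convex hull (bc ` ?F)"
      using convexD[OF convex_convex_hull, of y "bc ` ?F" "bc (supp x)" s "1 - s"] spos by simp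
    moreover have sub: "\<rho> \<subseteq> supp x" if "\<rho> \<in> ?F" for \<rho> using F(3)[of \<rho>] suppy that by auto
    moreover have "\<rho> \<subseteq> \<tau> \<or> \<tau> \<subseteq> \<rho>" if "\<rho> \<in> ?F" "\<tau> \<in> ?F" for \<rho> \<tau>
      using that F(4)[of \<rho> \<tau>] sub[OF that(1)] sub[OF that(2)] by (elim insertE) simp_all
    moreover have "?F \<subseteq> VS" "V \<in> ?F" using F(1,2) S by auto
    moreover have "V \<subseteq> \<rho>" if "\<rho> \<in> ?F" for \<rho> using F(3)[of \<rho>] VS that by auto
    ultimately show ?thesis by (intro exI[of _ ?F] conjI ballI) simp_all
  qed
qed

end

subsection \<open>Betti numbers\<close>

lemma subspace_real_cycles: "subspace (real_cycles p X)"
  by (rule subspaceI) (auto simp: real_cycles_def real_boundary_add real_boundary_scale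
      subspace_0[OF subspace_real_chains] RC_add RC_scale)

text \<open>The extra class in degree 0 is represented by a point of \<open>U\<close>; it accounts
  for the difference from reduced homology.\<close>

lemma betti_eq_card:
  assumes S: "quotient_basis (reduced_cycles p (top_of_set U)) (real_boundaries p (top_of_set U)) S"
    and ne: "p = 0 \<Longrightarrow> U \<noteq> {}"
  shows "betti p (top_of_set U) = card S + (if p = 0 then 1 else 0)"
proof (cases "p = 0")
  case False
  then have "real_cycles p (top_of_set U) = reduced_cycles p (top_of_set U)" by (auto simp: reduced_cycles_def)
  then show ?thesis
    using quotient_dim_eq_card[OF subspace_reduced_cycles subspace_real_boundaries S] False by (simp add: betti_def)
next
  case True
  obtain u where u: "u \<in> U" using ne True by blast
  let ?f = "restrict (\<lambda>_. u) (standard_simplex 0)"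
  have "continuous_map (subtopology (powertop_real UNIV) (standard_simplex 0)) (top_of_set U) (\<lambda>_. u)" using u by simp
  then have "continuous_map (subtopology (powertop_real UNIV) (standard_simplex 0)) (top_of_set U) ?f"
    by (rule continuous_map_eq) auto
  then have "singular_simplex 0 (top_of_set U) ?f" by (simp add: singular_simplex_def)
  then have v0: "Poly_Mapping.single ?f (1::real) \<in> real_cycles p (top_of_set U)"
    using True by (simp add: real_cycles_def real_chains_def)
  have S': "quotient_basis {v \<in> real_cycles p (top_of_set U). coeff_sum v = 0} (real_boundaries p (top_of_set U)) S"
    using S True by (simp add: reduced_cycles_def)
  have We: "coeff_sum w = 0" if "w \<in> real_boundaries p (top_of_set U)" for w
    using that True by (auto simp: real_boundaries_def coeff_sum_boundary)
  note Q = quotient_basis_add_functional[OF subspace_real_cycles subspace_real_boundaries linear_coeff_sum We v0 _ S']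
  then show ?thesis
    using quotient_dim_eq_card[OF subspace_real_cycles subspace_real_boundaries Q(1)] True by (simp add: betti_def)
qed

text \<open>By invariance of domain, the relative interior of too large a simplex would map onto an
  open subset of a space of dimension \<open>m + 1\<close>, yet inside its unit sphere, which has no
  interior points.\<close>

lemma card_affine_independent_in_sphere:
  fixes X :: "'a::euclidean_space set"
  assumes hom: "top_of_set X homeomorphic_space nsphere m"
    and V: "\<not> affine_dependent V" "convex hull V \<subseteq> X"
  shows "card V \<le> Suc m"
proof (rule ccontr)
  assume "\<not> card V \<le> Suc m"
  then have cV: "card V \<ge> Suc (Suc m)" by simp
  have ad: "aff_dim (convex hull V) = int (card V) - 1" using V(1) by (simp add: aff_dim_affine_independent aff_dim_convex_hull)
  then have "int (card V) - 1 \<le> int DIM('a)" using aff_dim_le_DIM[of "convex hull V"] by simp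
  then have "Suc m \<le> card (Basis :: 'a set)" using cV by simp
  \<comment> \<open>The excess of vertices guarantees enough dimensions to realise the abstract
    \<open>m\<close>-sphere as a unit sphere in the same Euclidean space.\<close>
  then obtain B :: "'a set" where B: "B \<subseteq> Basis" "card B = Suc m" by (rule obtain_subset_with_card_n)
  have indB: "independent B" using B(1) independent_Basis independent_mono by blast
  have "pairwise orthogonal B" using B(1) by (auto simp: pairwise_def orthogonal_def intro!: inner_not_same_Basis)
  then obtain f :: "(nat \<Rightarrow> real) \<Rightarrow> 'a" and g where fg: "homeomorphic_maps (nsphere (Suc m - 1)) (top_of_set (sphere 0 1 \<inter> span B)) f g"
    by (rule homeomorphic_maps_nsphere_euclidean_sphere[OF indB _ B(2)]) (use B(1) in \<open>auto intro: that\<close>)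
  then have "nsphere m homeomorphic_space top_of_set (sphere 0 1 \<inter> span B)"
    unfolding homeomorphic_space_def by auto
  then have "X homeomorphic (sphere 0 1 \<inter> span B)"
    using hom homeomorphic_space_trans by (metis homeomorphic_space_iff_homeomorphic)
  then obtain h k where hk: "homeomorphism X (sphere 0 1 \<inter> span B) h k" by (auto simp: homeomorphic_def)
  then have h: "continuous_on X h" "h ` X = sphere 0 1 \<inter> span B" "\<And>x. x \<in> X \<Longrightarrow> k (h x) = x"
    by (auto simp: homeomorphism_def)
  let ?R = "rel_interior (convex hull V)"
  have RX: "?R \<subseteq> X" using rel_interior_subset V(2) by blast
  have "openin (top_of_set (span B)) (h ` ?R)"
  proof (rule invariance_of_domain_affine_sets)
    show "openin (top_of_set (affine hull (convex hull V))) ?R" by (rule openin_rel_interior)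
    show "aff_dim (span B) \<le> aff_dim (affine hull (convex hull V))"
      using ad cV B(2) dim_span_eq_card_independent[OF indB] by (simp add: aff_dim_subspace subspace_span aff_dim_convex_hull)
    show "continuous_on ?R h" by (rule continuous_on_subset[OF h(1) RX])
    show "h ` ?R \<subseteq> span B" using h(2) image_mono[OF RX, of h] by simp
    show "inj_on h ?R" using h(3) RX by (intro inj_on_inverseI[of _ k]) auto
  qed (simp_all add: subspace_imp_affine)
  moreover have "?R \<noteq> {}"
  proof -
    have "convex hull V \<noteq> {}" using cV by auto
    then show ?thesis by (simp add: rel_interior_eq_empty)
  qed
  ultimately obtain y e where y: "y \<in> h ` ?R" and e: "e > 0" "ball y e \<inter> span B \<subseteq> h ` ?R"
    unfolding openin_contains_ball by (meson ex_in_conv image_is_empty)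
  have sph: "h ` ?R \<subseteq> sphere 0 1 \<inter> span B" using h(2) image_mono[OF RX, of h] by simp
  have ny: "norm y = 1" "y \<in> span B" using y sph by auto
  define y' where "y' = (1 + e / 2) *\<^sub>R y"
  have "dist y y' = e / 2" using e(1) ny by (simp add: y'_def dist_norm algebra_simps)
  then have "y' \<in> ball y e \<inter> span B" using e(1) ny by (simp add: y'_def span_scale)
  then have "y' \<in> sphere 0 1" using subsetD[OF e(2)] subsetD[OF sph] by blast
  then have "norm y' = 1" by simp
  then show False using e(1) ny by (simp add: y'_def)
qed

context triangulated_sphere
begin

text \<open>One simplicial basis \<open>S\<close> counts both Betti numbers; degree 0 adds its extra
  class on whichever side it occurs.\<close>

lemma Alexander_betti:
  assumes L: "down_closed L" and k: "k < m" and ne: "L \<noteq> {}" "m - Suc k = 0 \<Longrightarrow> dual_poly L \<noteq> {}"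
    and S: "quotient_basis (simplicial_cycles L k) (simplicial_boundaries L k) S"
  shows "betti k (top_of_set (poly L)) = card S + (if k = 0 then 1 else 0)"
    "betti (m - Suc k) (top_of_set (dual_poly L)) = card S + (if m - Suc k = 0 then 1 else 0)"
proof -
  obtain V where V: "V \<in> L" using ne by blast
  then have "bc V \<in> poly L" using bc_in_hull[of V] down_closed_subset[OF L] by (auto simp: poly_def)
  then have "poly L \<noteq> {}" by blast
  then show "betti k (top_of_set (poly L)) = card S + (if k = 0 then 1 else 0)"
    using betti_eq_card[OF singular_homology_of_poly(1)[OF L S]] singular_homology_of_poly(2)[OF L S] by simp
  obtain S' where S': "quotient_basis (reduced_cycles (m - Suc k) (top_of_set (dual_poly L)))
      (real_boundaries (m - Suc k) (top_of_set (dual_poly L))) S'" "card S' = card S"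
    using Alexander_duality[OF L k S] by blast
  then show "betti (m - Suc k) (top_of_set (dual_poly L)) = card S + (if m - Suc k = 0 then 1 else 0)"
    using betti_eq_card[OF S'(1)] ne(2) by simp
qed

text \<open>Otherwise simplicial homology would vanish in degree \<open>m\<close>, against
  \<open>fcycle\<close>. The barycentre of such a simplex shows later that dual polyhedra are
  nonempty.\<close>

lemma exists_top_simplex: "\<exists>V\<in>VS. card V = Suc m"
proof (rule ccontr)
  assume no: "\<not> ?thesis"
  have "simplicial_cycles VS m = {0}"
  proof -
    have "x = 0" if "x \<in> SC VS (Suc m)" for x
      using that no by (auto simp: SC_def fun_eq_iff)
    then show ?thesis using subspace_0[OF subspace_simplicial_cycles] by (auto simp: simplicial_cycles_def)
  qed
  then have "quotient_basis (simplicial_cycles VS m) (simplicial_boundaries VS m) {}"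
    using subspace_0[OF subspace_simplicial_boundaries] by (auto simp: quotient_basis_def)
  from singular_homology_of_poly(1)[OF down_closed_VS this]
  have "\<forall>c\<in>reduced_cycles m (top_of_set X). c \<in> real_boundaries m (top_of_set X)"
    by (simp add: quotient_basis_def)
  moreover have "fcycle \<in> reduced_cycles m (top_of_set X)" using fcycle m_pos by (simp add: reduced_cycles_iff)
  ultimately show False using fcycle(3) by blast
qed

text \<open>The sphere is acyclic below its dimension. This is what makes the reduced homology of
  the full \<open>n\<close>-skeleton vanish in degree \<open>n - 1\<close>.\<close>

lemma simplicial_cycles_bound:
  assumes "k < m"
  shows "simplicial_cycles VS k = simplicial_boundaries VS k"
proof -
  obtain S where S: "quotient_basis (simplicial_cycles VS k) (simplicial_boundaries VS k) S"
    using simplicial_quotient_basis_exists[of VS] by blast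
  have "quotient_basis (reduced_cycles k (top_of_set X)) (real_boundaries k (top_of_set X)) {}"
    unfolding quotient_basis_def
  proof (intro conjI ballI)
    fix c assume "c \<in> reduced_cycles k (top_of_set X)"
    then obtain y where "y \<in> RC (Suc k) X" "real_boundary (Suc k) y = c"
      using sph.cycle_bounds[of k c] assms by auto
    then show "\<exists>u. c - (\<Sum>s\<in>{}. u s *\<^sub>R s) \<in> real_boundaries k (top_of_set X)" by (auto simp: real_boundaries_def)
  qed auto
  then have "card S = 0"
    using quotient_dim_eq_card[OF subspace_reduced_cycles subspace_real_boundaries]
      singular_homology_of_poly[OF down_closed_VS S] by (metis card.empty)
  then have "S = {}" using S by (simp add: quotient_basis_def)
  then have "simplicial_cycles VS k \<subseteq> simplicial_boundaries VS k" using S by (auto simp: quotient_basis_def)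
  moreover have "simplicial_boundaries VS k \<subseteq> simplicial_cycles VS k"
  proof
    fix x assume "x \<in> simplicial_boundaries VS k"
    then obtain x' where x': "x' \<in> SC VS (Suc (Suc k))" "x = sbd x'" by (auto simp: simplicial_boundaries_def)
    have xS: "x \<in> SC VS (Suc k)" using sbd_SC[OF down_closed_VS x'(1)] x'(2) by simp
    have "(\<Sum>v\<in>Vert. x {v}) = 0"
    proof (cases "k = 0")
      case True
      have "realize x = real_boundary (Suc 0) (realize x')" using realize_boundary[OF x'(1)] x'(2) True by simp
      then show ?thesis using realize_coeff_sum[of x] xS True by (simp add: coeff_sum_boundary)
    next
      case False
      then show ?thesis using singleton_sum_zero[OF xS] by simp
    qed
    then show "x \<in> simplicial_cycles VS k" using xS x'(2) sbd_sbd[OF x'(1)] by (simp add: simplicial_cycles_def)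
  qed
  ultimately show ?thesis by blast
qed

end

subsection \<open>Dual cells as unions of flags\<close>

context geometric_complex
begin

text \<open>Delivers both clauses in the definition of a dual cell. If the barycentre of
  \<open>V\<close> lies inside a segment of the flag hull, nonnegativity of coordinates puts both
  endpoints into the simplex of \<open>V\<close>, and \<open>eq_bc\<close> makes them
  coincide.\<close>

lemma flag_hull_transverse:
  assumes F: "F \<subseteq> VS" and chain: "\<And>\<rho> \<tau>. \<rho> \<in> F \<Longrightarrow> \<tau> \<in> F \<Longrightarrow> \<rho> \<subseteq> \<tau> \<or> \<tau> \<subseteq> \<rho>"
    and V: "V \<in> F" "\<And>\<rho>. \<rho> \<in> F \<Longrightarrow> V \<subseteq> \<rho>" and T: "T \<in> VS" "\<And>\<rho>. \<rho> \<in> F \<Longrightarrow> \<rho> \<subseteq> T"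
  shows "bc V extreme_point_of convex hull (bc ` F)" "convex hull (bc ` F) \<inter> convex hull V = {bc V}"
proof -
  have VVS: "V \<in> VS" using F V(1) by blast
  have sub: "convex hull (bc ` F) \<subseteq> dcell V" by (rule flag_hull_subset_dcell[OF F chain V])
  have bcV: "bc V \<in> convex hull (bc ` F)" using V(1) by (intro hull_inc) blast
  have uniq: "y = bc V" if "y \<in> convex hull (bc ` F)" "supp y \<subseteq> V" for y
    using eq_bc[of y V] sub that VVS by (auto simp: dcell_def)
  have "bc ` F \<subseteq> convex hull T" using T F bc_in_hull hull_mono by blast
  then have subT: "convex hull (bc ` F) \<subseteq> convex hull T" by (intro hull_minimal) auto
  show "convex hull (bc ` F) \<inter> convex hull V = {bc V}"
  proof
    show "convex hull (bc ` F) \<inter> convex hull V \<subseteq> {bc V}"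
    proof
      fix y assume y: "y \<in> convex hull (bc ` F) \<inter> convex hull V"
      then have "y \<in> X" using VVS by (auto simp: poly_def)
      then have "supp y \<subseteq> V" using hull_iff_supp[OF VVS] y by blast
      then show "y \<in> {bc V}" using uniq y by blast
    qed
    show "{bc V} \<subseteq> convex hull (bc ` F) \<inter> convex hull V" using bcV bc_in_hull[OF VVS] by blast
  qed
  have False if a: "a \<in> convex hull (bc ` F)" and b: "b \<in> convex hull (bc ` F)" and seg: "bc V \<in> open_segment a b" for a b
  proof -
    obtain u where u: "a \<noteq> b" "0 < u" "u < 1" "bc V = (1 - u) *\<^sub>R a + u *\<^sub>R b" using seg by (auto simp: in_segment)
    have aT: "a \<in> convex hull T" "b \<in> convex hull T" using a b subT by auto
    have X: "a \<in> X" "b \<in> X" using a b sub by (auto simp: dcell_def)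
    have z: "lam a v = 0 \<and> lam b v = 0" if "v \<notin> V" for v
    proof -
      have "(1 - u) * lam a v + u * lam b v = lam (bc V) v"
        using lam_segment(1)[OF T(1) aT, of u v] u by simp
      also have "\<dots> = 0" using that by (simp add: lam_bc(1)[OF VVS])
      finally have s: "(1 - u) * lam a v + u * lam b v = 0" .
      have "(1 - u) * lam a v \<ge> 0" "u * lam b v \<ge> 0" using u lam_nonneg X by auto
      then have "(1 - u) * lam a v = 0" "u * lam b v = 0" using s by linarith+
      then show ?thesis using u by auto
    qed
    then have "supp a \<subseteq> V" "supp b \<subseteq> V" by (auto simp: supp_def)
    then show False using uniq[OF a] uniq[OF b] u(1) by simp
  qed
  then show "bc V extreme_point_of convex hull (bc ` F)" using bcV by (auto simp: extreme_point_of_def)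
qed

end

subsection \<open>Simplicial complexes\<close>

definition vertex_sets :: "'a::euclidean_space set set \<Rightarrow> 'a set set" where
  "vertex_sets K = {V. V \<noteq> {} \<and> \<not> affine_dependent V \<and> convex hull V \<in> K}"

lemma affine_independent_hull_eq:
  fixes V :: "'a::euclidean_space set"
  assumes "\<not> affine_dependent V" "\<not> affine_dependent W" "convex hull V = convex hull W"
  shows "V = W"
  using assms extreme_point_of_convex_hull_affine_independent by (metis subsetI subset_antisym)

text \<open>For the intersection axiom: a common face is spanned by vertices of either simplex, and
  affine independence makes the two spanning sets equal.\<close>

lemma geometric_complex_vertex_sets:
  fixes K :: "'a::euclidean_space set set"
  assumes K: "simplicial_complex K"
  shows "geometric_complex (vertex_sets K)"
proof
  have fin: "finite K" and fac: "\<And>F S. S \<in> K \<Longrightarrow> F face_of S \<Longrightarrow> F \<in> K"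
    and int: "\<And>S S'. S \<in> K \<Longrightarrow> S' \<in> K \<Longrightarrow> (S \<inter> S') face_of S"
    using K unfolding simplicial_complex_def by blast+
  have "inj_on (\<lambda>V. convex hull V) (vertex_sets K)"
    by (rule inj_onI) (auto simp: vertex_sets_def dest: affine_independent_hull_eq)
  moreover have "finite ((\<lambda>V. convex hull V) ` vertex_sets K)"
    by (rule finite_subset[OF _ fin]) (auto simp: vertex_sets_def)
  ultimately show "finite (vertex_sets K)" by (rule finite_imageD[rotated])
  fix V assume V: "V \<in> vertex_sets K"
  then show "\<not> affine_dependent V" "V \<noteq> {}" by (auto simp: vertex_sets_def)
  note indV = this(1)
  show "W \<in> vertex_sets K" if W: "W \<subseteq> V" "W \<noteq> {}" for W
  proof -
    have "convex hull W face_of convex hull V"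
      using face_of_convex_hull_affine_independent[OF indV] W(1) by blast
    moreover have "\<not> affine_dependent W" using affine_independent_subset[OF indV W(1)] .
    ultimately show ?thesis using fac V W(2) by (auto simp: vertex_sets_def)
  qed
  show "convex hull V \<inter> convex hull W = convex hull (V \<inter> W)" if W: "W \<in> vertex_sets K" for W
  proof
    have indW: "\<not> affine_dependent W" using W by (simp add: vertex_sets_def)
    have VK: "convex hull V \<in> K" "convex hull W \<in> K" using V W by (auto simp: vertex_sets_def)
    have "(convex hull V \<inter> convex hull W) face_of convex hull V" by (rule int[OF VK])
    then obtain c where c: "c \<subseteq> V" "convex hull V \<inter> convex hull W = convex hull c"
      using face_of_convex_hull_affine_independent[OF indV] by blast
    have "(convex hull W \<inter> convex hull V) face_of convex hull W" by (rule int[OF VK(2,1)])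
    then obtain d where d: "d \<subseteq> W" "convex hull W \<inter> convex hull V = convex hull d"
      using face_of_convex_hull_affine_independent[OF indW] by blast
    have "c = d"
      by (rule affine_independent_hull_eq)
        (use c d affine_independent_subset[OF indV c(1)] affine_independent_subset[OF indW d(1)] in auto)
    then show "convex hull V \<inter> convex hull W \<subseteq> convex hull (V \<inter> W)"
      unfolding c(2) using c(1) d(1) by (intro hull_mono) blast
    show "convex hull (V \<inter> W) \<subseteq> convex hull V \<inter> convex hull W" by (simp add: hull_mono)
  qed
qed

lemma simplex_vertex_set:
  assumes "\<sigma> \<in> K" "int k simplex \<sigma>"
  obtains V where "V \<in> vertex_sets K" "card V = Suc k" "\<sigma> = convex hull V"
proof -
  obtain C where C: "\<not> affine_dependent C" "int (card C) = int k + 1" "\<sigma> = convex hull C"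
    using assms(2) by (auto simp: simplex_def)
  then have "card C = Suc k" by linarith
  moreover from this have "C \<noteq> {}" by auto
  ultimately show ?thesis using that[of C] C assms(1) by (simp add: vertex_sets_def)
qed

lemma vertex_set_simplex:
  assumes "V \<in> vertex_sets K"
  shows "convex hull V \<in> K" "int (card V - 1) simplex convex hull V" "card V > 0"
proof -
  show "convex hull V \<in> K" using assms by (simp add: vertex_sets_def)
  have V: "\<not> affine_dependent V" "V \<noteq> {}" using assms by (auto simp: vertex_sets_def)
  then show pos: "card V > 0" using aff_independent_finite by (simp add: card_gt_0_iff)
  then show "int (card V - 1) simplex convex hull V" unfolding simplex_def
    by (intro exI[of _ V]) (use V in auto)
qed

lemma nonempty_simplex:
  assumes K: "simplicial_complex K" and \<sigma>: "\<sigma> \<in> K" "\<sigma> \<noteq> {}"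
  obtains V where "V \<in> vertex_sets K" "\<sigma> = convex hull V"
proof -
  obtain k where "k simplex \<sigma>" using K \<sigma>(1) unfolding simplicial_complex_def by blast
  then obtain C where C: "\<not> affine_dependent C" "\<sigma> = convex hull C" by (auto simp: simplex_def)
  then have "C \<noteq> {}" using \<sigma>(2) by auto
  then show ?thesis using that[of C] C \<sigma>(1) by (simp add: vertex_sets_def)
qed

subsection \<open>The polynomial as a sum over sets of cells\<close>

text \<open>By \<open>sub\<close> a cell properly contained in another belongs to \<open>A\<close>,
  so \<open>A\<close> with any set of \<open>n\<close>-cells is a subcomplex. The abstract index
  lets this apply to simplices and, with dimensions reversed, to dual cells.\<close>

lemma spanning_subcomplexes:
  fixes cell :: "'i \<Rightarrow> nat \<times> 'a set"
  assumes inj: "inj_on cell (A \<union> B)" and disj: "A \<inter> B = {}" and n: "n \<ge> 1"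
    and A: "\<And>a. a \<in> A \<Longrightarrow> fst (cell a) < n" and B: "\<And>b. b \<in> B \<Longrightarrow> fst (cell b) = n"
    and sub: "\<And>a b. a \<in> A \<union> B \<Longrightarrow> b \<in> A \<union> B \<Longrightarrow> snd (cell a) \<subseteq> snd (cell b) \<Longrightarrow> a = b \<or> a \<in> A"
  shows "{L. spanning_subcomplex n (cell ` (A \<union> B)) L} = (\<lambda>E. cell ` (A \<union> E)) ` Pow B"
    "inj_on (\<lambda>E. cell ` (A \<union> E)) (Pow B)"
proof -
  show "inj_on (\<lambda>E. cell ` (A \<union> E)) (Pow B)"
  proof (rule inj_onI)
    fix E E' assume E: "E \<in> Pow B" "E' \<in> Pow B" and eq: "cell ` (A \<union> E) = cell ` (A \<union> E')"
    have "A \<union> E = A \<union> E'"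
      using inj_on_image_eq_iff[OF inj, of "A \<union> E" "A \<union> E'"] E eq by auto
    then show "E = E'" using E disj by blast
  qed
  have skel: "skeleton (n - 1) (cell ` (A \<union> E)) = cell ` A" if "E \<subseteq> B" for E
  proof
    show "skeleton (n - 1) (cell ` (A \<union> E)) \<subseteq> cell ` A"
    proof
      fix z assume "z \<in> skeleton (n - 1) (cell ` (A \<union> E))"
      then have "z \<in> cell ` (A \<union> E)" "fst z \<le> n - 1" by (simp_all add: skeleton_def case_prod_unfold)
      then obtain a where a: "a \<in> A \<union> E" "z = cell a" "fst z \<le> n - 1" by blast
      have "a \<notin> E"
      proof
        assume "a \<in> E"
        then have "fst (cell a) = n" using B that by blast
        then show False using a n by simp
      qed
      then show "z \<in> cell ` A" using a by blast
    qed
    show "cell ` A \<subseteq> skeleton (n - 1) (cell ` (A \<union> E))"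
    proof
      fix z assume "z \<in> cell ` A"
      then obtain a where a: "a \<in> A" "z = cell a" by blast
      then have "fst z \<le> n - 1" using A[of a] by simp
      then show "z \<in> skeleton (n - 1) (cell ` (A \<union> E))" using a by (simp add: skeleton_def case_prod_unfold)
    qed
  qed
  show "{L. spanning_subcomplex n (cell ` (A \<union> B)) L} = (\<lambda>E. cell ` (A \<union> E)) ` Pow B"
  proof (intro subset_antisym subsetI)
    fix L assume "L \<in> {L. spanning_subcomplex n (cell ` (A \<union> B)) L}"
    then have L: "L \<subseteq> cell ` (A \<union> B)" "skeleton (n - 1) L = cell ` A"
      using skel[of B] by (simp_all add: spanning_subcomplex_def subcomplex_def)
    then have AL: "cell ` A \<subseteq> L" by (auto simp: skeleton_def)
    define E where "E = {b \<in> B. cell b \<in> L}"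
    have "L = cell ` (A \<union> E)" using L(1) AL by (auto simp: E_def)
    moreover have "E \<in> Pow B" by (auto simp: E_def)
    ultimately show "L \<in> (\<lambda>E. cell ` (A \<union> E)) ` Pow B" by blast
  next
    fix L assume "L \<in> (\<lambda>E. cell ` (A \<union> E)) ` Pow B"
    then obtain E where E: "E \<subseteq> B" "L = cell ` (A \<union> E)" by blast
    have "w \<in> L" if zw: "z \<in> L" "w \<in> cell ` (A \<union> B)" "snd w \<subseteq> snd z" for z w
    proof -
      obtain a where a: "a \<in> A \<union> E" "z = cell a" using zw(1) E(2) by blast
      obtain b where b: "b \<in> A \<union> B" "w = cell b" using zw(2) by blast
      have "b = a \<or> b \<in> A" by (rule sub) (use a b E zw(3) in auto)
      then show ?thesis using a b E(2) by blast
    qed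
    moreover have "L \<subseteq> cell ` (A \<union> B)" using E by blast
    ultimately have "subcomplex L (cell ` (A \<union> B))" unfolding subcomplex_def by fastforce
    moreover have "fst z \<le> n" if z: "z \<in> L" for z
    proof -
      obtain a where a: "a \<in> A \<union> E" "z = cell a" using z E(2) by blast
      show ?thesis using a(1)
      proof
        assume "a \<in> A" then show ?thesis using A[of a] a(2) by simp
      next
        assume "a \<in> E" then show ?thesis using B[of a] a(2) E(1) by auto
      qed
    qed
    then have "\<forall>(k, e)\<in>L. k \<le> n" by fastforce
    moreover have "skeleton (n - 1) L = skeleton (n - 1) (cell ` (A \<union> B))"
      using skel[OF E(1)] skel[of B] E(2) by simp
    ultimately show "L \<in> {L. spanning_subcomplex n (cell ` (A \<union> B)) L}"
      by (simp add: spanning_subcomplex_def)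
  qed
qed

lemma T_poly_eq_sum:
  fixes cell :: "'i \<Rightarrow> nat \<times> 'a::topological_space set" and X Y :: "'r::comm_ring_1"
  assumes "inj_on cell (A \<union> B)" "A \<inter> B = {}" "n \<ge> 1"
    and "\<And>a. a \<in> A \<Longrightarrow> fst (cell a) < n" "\<And>b. b \<in> B \<Longrightarrow> fst (cell b) = n"
    and "\<And>a b. a \<in> A \<union> B \<Longrightarrow> b \<in> A \<union> B \<Longrightarrow> snd (cell a) \<subseteq> snd (cell b) \<Longrightarrow> a = b \<or> a \<in> A"
  shows "T_poly n (cell ` (A \<union> B)) X Y =
    (\<Sum>E\<in>Pow B. X ^ (betti (n - 1) (top_of_set (\<Union>a\<in>A \<union> E. snd (cell a))) - betti (n - 1) (top_of_set (\<Union>a\<in>A \<union> B. snd (cell a)))) *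
      Y ^ betti n (top_of_set (\<Union>a\<in>A \<union> E. snd (cell a))))"
proof -
  have sp: "space_of (cell ` (A \<union> E)) = top_of_set (\<Union>a\<in>A \<union> E. snd (cell a))" for E
    by (simp add: space_of_def case_prod_unfold)
  have S: "{L. spanning_subcomplex n (cell ` (A \<union> B)) L} = (\<lambda>E. cell ` (A \<union> E)) ` Pow B"
    by (rule spanning_subcomplexes(1)[OF assms(1-3)]) (fact assms)+
  have I: "inj_on (\<lambda>E. cell ` (A \<union> E)) (Pow B)"
    by (rule spanning_subcomplexes(2)[OF assms(1-3)]) (fact assms)+
  have "sum f {L. spanning_subcomplex n (cell ` (A \<union> B)) L} = (\<Sum>E\<in>Pow B. f (cell ` (A \<union> E)))" for f :: "(nat \<times> 'a set) set \<Rightarrow> 'r"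
    unfolding S sum.reindex[OF I] by (simp add: o_def)
  then show ?thesis unfolding T_poly_def by (simp only: sp)
qed

subsection \<open>Triangulated spheres of even dimension\<close>

locale sphere_triangulation =
  fixes K :: "'a::euclidean_space set set" and n :: nat
  assumes n: "n \<ge> 1" and tri: "triangulates K (nsphere (2 * n))"
begin

abbreviation VS where "VS \<equiv> vertex_sets K"

lemma cplx: "simplicial_complex K"
  using tri by (simp add: triangulates_def)

lemma Union_vertex_sets: "\<Union>K = (\<Union>V\<in>VS. convex hull V)"
proof
  show "\<Union>K \<subseteq> (\<Union>V\<in>VS. convex hull V)"
  proof
    fix x assume "x \<in> \<Union>K"
    then obtain \<sigma> where \<sigma>: "\<sigma> \<in> K" "x \<in> \<sigma>" by blast
    then have "\<sigma> \<noteq> {}" by blast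
    then obtain V where "V \<in> VS" "\<sigma> = convex hull V" by (rule nonempty_simplex[OF cplx \<sigma>(1)])
    then show "x \<in> (\<Union>V\<in>VS. convex hull V)" using \<sigma>(2) by blast
  qed
  show "(\<Union>V\<in>VS. convex hull V) \<subseteq> \<Union>K" by (auto simp: vertex_sets_def)
qed

end

sublocale sphere_triangulation \<subseteq> triangulated_sphere "vertex_sets K" "2 * n"
proof -
  interpret gc: geometric_complex VS by (rule geometric_complex_vertex_sets[OF cplx])
  have X: "gc.poly VS = \<Union>K" unfolding gc.poly_def Union_vertex_sets ..
  have hom: "top_of_set (\<Union>K) homeomorphic_space nsphere (2 * n)" using tri by (simp add: triangulates_def)
  show "triangulated_sphere VS (2 * n)"
  proof
    show "top_of_set (gc.poly VS) homeomorphic_space nsphere (2 * n)" using hom X by simp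
    show "1 \<le> 2 * n" using n by simp
    show "card V \<le> Suc (2 * n)" if "V \<in> VS" for V
      by (rule card_affine_independent_in_sphere[OF hom]) (use that in \<open>auto simp: vertex_sets_def\<close>)
  qed
qed

context sphere_triangulation
begin

lemma barycenter_hull:
  assumes "V \<in> VS"
  shows "barycenter (convex hull V) = bc V"
proof -
  have "{v. v extreme_point_of (convex hull V)} = V"
    using extreme_point_of_convex_hull_affine_independent[OF aff_ind[OF assms]] by simp
  then show ?thesis by (simp add: barycenter_def bc_def)
qed

text \<open>Translates the description by flags of the barycentric subdivision into a condition on
  coordinates, the form in which duality is proved.\<close>

lemma dual_cell_hull:
  assumes V: "V \<in> VS"
  shows "dual_cell K (convex hull V) = dcell V"
proof
  show "dual_cell K (convex hull V) \<subseteq> dcell V"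
  proof
    fix x assume "x \<in> dual_cell K (convex hull V)"
    then obtain F where F: "F \<subseteq> K - {{}}" "\<forall>\<rho>\<in>F. \<forall>\<tau>\<in>F. \<rho> \<subseteq> \<tau> \<or> \<tau> \<subseteq> \<rho>" and x: "x \<in> convex hull (barycenter ` F)"
      and ext: "bc V extreme_point_of convex hull (barycenter ` F)"
      and int: "convex hull (barycenter ` F) \<inter> convex hull V = {bc V}"
      unfolding dual_cell_def barycentric_subdivision_def barycenter_hull[OF V] by blast
    define G where "G = {W \<in> VS. convex hull W \<in> F}"
    have FG: "F = (\<lambda>W. convex hull W) ` G"
    proof
      show "F \<subseteq> (\<lambda>W. convex hull W) ` G"
      proof
        fix \<sigma> assume \<sigma>: "\<sigma> \<in> F"
        then have "\<sigma> \<in> K" "\<sigma> \<noteq> {}" using F(1) by auto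
        then obtain W where "W \<in> VS" "\<sigma> = convex hull W" by (rule nonempty_simplex[OF cplx])
        then show "\<sigma> \<in> (\<lambda>W. convex hull W) ` G" using \<sigma> by (auto simp: G_def)
      qed
    qed (auto simp: G_def)
    have GVS: "G \<subseteq> VS" by (auto simp: G_def)
    have bG: "barycenter ` F = bc ` G"
      unfolding FG image_image by (rule image_cong) (use GVS barycenter_hull in auto)
    have chain: "\<rho> \<subseteq> \<tau> \<or> \<tau> \<subseteq> \<rho>" if "\<rho> \<in> G" "\<tau> \<in> G" for \<rho> \<tau>
      using F(2) that hull_subset_iff[of \<rho> \<tau>] hull_subset_iff[of \<tau> \<rho>] by (auto simp: G_def)
    have "bc V \<in> bc ` G" using extreme_point_of_convex_hull[OF ext] bG by simp
    then have VG: "V \<in> G" using bc_inj[OF V] GVS by blast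
    \<comment> \<open>A member of the flag strictly below \<open>V\<close> would have its barycentre
      in the simplex of \<open>V\<close> and in the flag hull, against transversality.\<close>
    have least: "V \<subseteq> W" if W: "W \<in> G" for W
    proof (cases "V \<subseteq> W")
      case False
      then have "W \<subseteq> V" using chain[OF VG W] by blast
      then have "bc W \<in> convex hull V" using bc_in_hull[of W] hull_mono[of W V convex] GVS W by blast
      moreover have "bc W \<in> convex hull (barycenter ` F)" unfolding bG using W by (intro hull_inc) blast
      ultimately have "bc W = bc V" using int by blast
      then have "W = V" using bc_inj[of W V] GVS W V by blast
      then show ?thesis by simp
    qed simp
    show "x \<in> dcell V"
      using flag_hull_subset_dcell[OF GVS chain VG least] x bG by auto
  qed
  show "dcell V \<subseteq> dual_cell K (convex hull V)"
  proof
    fix x assume "x \<in> dcell V"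
    then have x: "x \<in> X" "V \<subseteq> am x" by (auto simp: dcell_def)
    obtain G where G: "G \<subseteq> VS" "V \<in> G" "\<And>\<rho>. \<rho> \<in> G \<Longrightarrow> V \<subseteq> \<rho>" "\<And>\<rho>. \<rho> \<in> G \<Longrightarrow> \<rho> \<subseteq> supp x"
      "\<And>\<rho> \<tau>. \<rho> \<in> G \<Longrightarrow> \<tau> \<in> G \<Longrightarrow> \<rho> \<subseteq> \<tau> \<or> \<tau> \<subseteq> \<rho>" "x \<in> convex hull (bc ` G)"
      using dcell_flag[OF x(1) V x(2)] by (elim exE conjE) (rule that, auto)
    define F where "F = (\<lambda>W. convex hull W) ` G"
    have bG: "barycenter ` F = bc ` G"
      unfolding F_def image_image by (rule image_cong) (use G(1) barycenter_hull in auto)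
    have FK: "F \<subseteq> K - {{}}" using G(1) by (auto simp: F_def vertex_sets_def)
    have "\<rho> \<subseteq> \<tau> \<or> \<tau> \<subseteq> \<rho>" if \<rho>\<tau>: "\<rho> \<in> F" "\<tau> \<in> F" for \<rho> \<tau>
    proof -
      obtain R T where "R \<in> G" "T \<in> G" "\<rho> = convex hull R" "\<tau> = convex hull T" using \<rho>\<tau> by (auto simp: F_def)
      then show ?thesis using G(5)[of R T] hull_mono[of R T convex] hull_mono[of T R convex] by auto
    qed
    then have mem: "convex hull (bc ` G) \<in> barycentric_subdivision K"
      unfolding barycentric_subdivision_def using FK by (intro CollectI exI[of _ F]) (simp add: bG)
    \<comment> \<open>\<open>supp x\<close> is the simplex that contains the whole flag.\<close>
    note tr = flag_hull_transverse[OF G(1) G(5) G(2) G(3) supp_VS[OF x(1)] G(4)]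
    show "x \<in> dual_cell K (convex hull V)"
      unfolding dual_cell_def barycenter_hull[OF V] using mem tr G(6) by blast
  qed
qed

lemma simplicial_cells_eq: "simplicial_cells K = (\<lambda>V. (card V - 1, convex hull V)) ` VS"
proof (intro subset_antisym subsetI)
  fix z assume "z \<in> simplicial_cells K"
  then obtain k \<sigma> where z: "z = (k, \<sigma>)" "\<sigma> \<in> K" "int k simplex \<sigma>" by (auto simp: simplicial_cells_def)
  obtain V where "V \<in> VS" "card V = Suc k" "\<sigma> = convex hull V" by (rule simplex_vertex_set[OF z(2,3)])
  then show "z \<in> (\<lambda>V. (card V - 1, convex hull V)) ` VS" using z(1) by (intro image_eqI[of _ _ V]) auto
next
  fix z assume "z \<in> (\<lambda>V. (card V - 1, convex hull V)) ` VS"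
  then obtain V where "V \<in> VS" "z = (card V - 1, convex hull V)" by blast
  then show "z \<in> simplicial_cells K" using vertex_set_simplex[of V K] by (simp add: simplicial_cells_def)
qed

lemma dual_complex_eq: "dual_complex (2 * n) K = (\<lambda>V. (Suc (2 * n) - card V, dcell V)) ` VS"
proof (intro subset_antisym subsetI)
  fix z assume "z \<in> dual_complex (2 * n) K"
  then obtain j k \<sigma> where z: "z = (j, dual_cell K \<sigma>)" "\<sigma> \<in> K" "int k simplex \<sigma>" "j + k = 2 * n"
    unfolding dual_complex_def by blast
  obtain V where V: "V \<in> VS" "card V = Suc k" "\<sigma> = convex hull V" by (rule simplex_vertex_set[OF z(2,3)])
  then have "z = (Suc (2 * n) - card V, dcell V)" using z(1,4) dual_cell_hull[OF V(1)] by auto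
  then show "z \<in> (\<lambda>V. (Suc (2 * n) - card V, dcell V)) ` VS" using V(1) by blast
next
  fix z assume "z \<in> (\<lambda>V. (Suc (2 * n) - card V, dcell V)) ` VS"
  then obtain V where V: "V \<in> VS" "z = (Suc (2 * n) - card V, dcell V)" by blast
  have "Suc (2 * n) - card V + (card V - 1) = 2 * n" using dim_le[OF V(1)] vertex_set_simplex(3)[OF V(1)] by simp
  then show "z \<in> dual_complex (2 * n) K"
    unfolding dual_complex_def using V(2) dual_cell_hull[OF V(1)] vertex_set_simplex(1,2)[OF V(1)]
    by (intro CollectI exI[of _ "Suc (2 * n) - card V"] exI[of _ "card V - 1"] exI[of _ "convex hull V"]) simp
qed

text \<open>\<open>low\<close>, \<open>mid\<close> and \<open>high\<close> are the simplices of
  dimension below, equal to and above \<open>n\<close>; passing to dual cells in dimension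
  \<open>2 * n\<close> reverses this order and fixes \<open>mid\<close>.\<close>

definition "low = {V \<in> VS. card V \<le> n}"
definition "mid = {V \<in> VS. card V = Suc n}"
definition "high = {V \<in> VS. card V > Suc n}"

lemma down_closed_low: "down_closed (low \<union> E)" if "E \<subseteq> mid"
  unfolding down_closed_def
proof (intro conjI ballI allI impI)
  show "low \<union> E \<subseteq> VS" using that by (auto simp: low_def mid_def)
  fix V W assume V: "V \<in> low \<union> E" and W: "W \<subseteq> V \<and> W \<noteq> {}"
  have VVS: "V \<in> VS" "card V \<le> Suc n" using V that by (auto simp: low_def mid_def)
  have WVS: "W \<in> VS" using face[OF VVS(1)] W by blast
  show "W \<in> low \<union> E"
  proof (cases "W = V")
    case False
    then have "card W < card V" using W finV[OF VVS(1)] by (intro psubset_card_mono) auto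
    then show ?thesis using VVS(2) WVS by (simp add: low_def)
  qed (use V in simp)
qed

lemma low_nonempty: "low \<noteq> {}"
proof -
  obtain V where V: "V \<in> VS" "card V = Suc (2 * n)" using exists_top_simplex by blast
  then obtain v where "v \<in> V" using nonempty by blast
  then have "{v} \<in> low" using face[OF V(1), of "{v}"] n by (simp add: low_def)
  then show ?thesis by blast
qed

lemma dual_poly_nonempty: "dual_poly (low \<union> E) \<noteq> {}" if "E \<subseteq> mid"
proof -
  obtain V where V: "V \<in> VS" "card V = Suc (2 * n)" using exists_top_simplex by blast
  then have "V \<notin> low \<union> E" using that n by (auto simp: low_def mid_def)
  then have "bc V \<in> dual_poly (low \<union> E)" using lam_bc(2)[OF V(1)] am_bc[OF V(1)] by (simp add: dual_poly_def)
  then show ?thesis by blast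
qed

text \<open>The subtracted terms belong to the full \<open>n\<close>-skeleta
  \<open>dual_poly low\<close> and \<open>poly (low \<union> mid)\<close>. Both have trivial reduced
  homology in degree \<open>n - 1\<close>, so they equal 1 for \<open>n = 1\<close> and 0
  otherwise.\<close>

lemma betti_poly_dual:
  assumes E: "E \<subseteq> mid"
  shows "betti n (top_of_set (poly (low \<union> E))) =
      betti (n - 1) (top_of_set (dual_poly (low \<union> E))) - betti (n - 1) (top_of_set (dual_poly low))"
    and "betti n (top_of_set (dual_poly (low \<union> E))) =
      betti (n - 1) (top_of_set (poly (low \<union> E))) - betti (n - 1) (top_of_set (poly (low \<union> mid)))"
proof -
  let ?e = "if n - 1 = 0 then 1 else 0 :: nat"
  have ne: "low \<union> E' \<noteq> {}" for E' using low_nonempty by blast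
  have arith: "n < 2 * n" "n - 1 < 2 * n" "2 * n - Suc n = n - 1" "2 * n - Suc (n - 1) = n" "n \<noteq> 0" "Suc (n - 1) = n" using n by auto
  have upper: "betti n (top_of_set (poly (low \<union> E'))) = card S \<and>
      betti (n - 1) (top_of_set (dual_poly (low \<union> E'))) = card S + ?e"
    if E': "E' \<subseteq> mid" and S: "quotient_basis (simplicial_cycles (low \<union> E') n) (simplicial_boundaries (low \<union> E') n) S" for E' S
    using Alexander_betti[OF down_closed_low[OF E'] arith(1) ne dual_poly_nonempty[OF E'] S] arith by simp
  have lower: "betti n (top_of_set (dual_poly (low \<union> E'))) = card S \<and>
      betti (n - 1) (top_of_set (poly (low \<union> E'))) = card S + ?e"
    if E': "E' \<subseteq> mid" and S: "quotient_basis (simplicial_cycles (low \<union> E') (n - 1)) (simplicial_boundaries (low \<union> E') (n - 1)) S" for E' S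
    using Alexander_betti[OF down_closed_low[OF E'] arith(2) ne dual_poly_nonempty[OF E'] S] arith by simp
  have sub: "low \<union> E \<subseteq> VS" by (rule down_closed_subset[OF down_closed_low[OF E]])
  have triv: "quotient_basis U U {}" if "subspace U" for U :: "('a set \<Rightarrow> real) set"
    using that by (simp add: quotient_basis_def)
  \<comment> \<open>Without \<open>n\<close>-simplices there are no \<open>n\<close>-cycles; duality
    turns this into vanishing for the dual skeleton.\<close>
  have "simplicial_cycles low n = {0}"
  proof -
    have "x = 0" if "x \<in> SC low (Suc n)" for x
      using that by (auto simp: SC_def low_def fun_eq_iff)
    then show ?thesis using subspace_0[OF subspace_simplicial_cycles] by (auto simp: simplicial_cycles_def)
  qed
  then have "quotient_basis (simplicial_cycles low n) (simplicial_boundaries low n) {}"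
    using subspace_0[OF subspace_simplicial_boundaries] by (simp add: quotient_basis_def)
  then have low: "betti (n - 1) (top_of_set (dual_poly low)) = ?e" using upper[of "{}" "{}"] by simp
  \<comment> \<open>Cycles and boundaries in degree \<open>n - 1\<close> involve at most
    \<open>n + 1\<close> vertices, so the skeleton shares them with the whole sphere.\<close>
  have SC: "SC (low \<union> mid) j = SC VS j" if "j \<le> Suc n" for j
    using that by (fastforce simp: SC_def low_def mid_def)
  have "simplicial_cycles (low \<union> mid) (n - 1) = simplicial_cycles VS (n - 1)"
    "simplicial_boundaries (low \<union> mid) (n - 1) = simplicial_boundaries VS (n - 1)"
    using SC arith by (simp_all add: simplicial_cycles_def simplicial_boundaries_def)
  then have "quotient_basis (simplicial_cycles (low \<union> mid) (n - 1)) (simplicial_boundaries (low \<union> mid) (n - 1)) {}"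
    using simplicial_cycles_bound[OF arith(2)] triv[OF subspace_simplicial_boundaries] by simp
  then have mid: "betti (n - 1) (top_of_set (poly (low \<union> mid))) = ?e" using lower[of mid "{}"] by simp
  obtain S where "quotient_basis (simplicial_cycles (low \<union> E) n) (simplicial_boundaries (low \<union> E) n) S"
    by (rule simplicial_quotient_basis_exists[OF sub])
  from upper[OF E this] show "betti n (top_of_set (poly (low \<union> E))) =
      betti (n - 1) (top_of_set (dual_poly (low \<union> E))) - betti (n - 1) (top_of_set (dual_poly low))"
    using low by simp
  obtain S' where "quotient_basis (simplicial_cycles (low \<union> E) (n - 1)) (simplicial_boundaries (low \<union> E) (n - 1)) S'"
    by (rule simplicial_quotient_basis_exists[OF sub])
  from lower[OF E this] show "betti n (top_of_set (dual_poly (low \<union> E))) =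
      betti (n - 1) (top_of_set (poly (low \<union> E))) - betti (n - 1) (top_of_set (poly (low \<union> mid)))"
    using mid by simp
qed

lemma T_poly_primal:
  fixes x y :: "'r::comm_ring_1"
  shows "T_poly n (skeleton n (simplicial_cells K)) x y =
    (\<Sum>E\<in>Pow mid. x ^ betti n (top_of_set (dual_poly (low \<union> E))) * y ^ betti n (top_of_set (poly (low \<union> E))))"
proof -
  let ?cell = "\<lambda>V::'a set. (card V - 1, convex hull V)"
  have VS: "low \<union> mid \<subseteq> VS" by (auto simp: low_def mid_def)
  have "skeleton n (simplicial_cells K) = ?cell ` (low \<union> mid)"
    unfolding simplicial_cells_eq by (auto simp: skeleton_def low_def mid_def)
  moreover have "T_poly n (?cell ` (low \<union> mid)) x y =
    (\<Sum>E\<in>Pow mid. x ^ (betti (n - 1) (top_of_set (\<Union>a\<in>low \<union> E. snd (?cell a))) - betti (n - 1) (top_of_set (\<Union>a\<in>low \<union> mid. snd (?cell a)))) *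
      y ^ betti n (top_of_set (\<Union>a\<in>low \<union> E. snd (?cell a))))"
  proof (rule T_poly_eq_sum)
    show "inj_on ?cell (low \<union> mid)"
    proof (rule inj_onI)
      fix V W assume "V \<in> low \<union> mid" "W \<in> low \<union> mid" "?cell V = ?cell W"
      then show "V = W" using hull_subset_iff[of V W] hull_subset_iff[of W V] VS by auto
    qed
    show "low \<inter> mid = {}" by (auto simp: low_def mid_def)
    show "fst (?cell V) < n" if "V \<in> low" for V using that n by (auto simp: low_def)
    show "fst (?cell V) = n" if "V \<in> mid" for V using that by (auto simp: mid_def)
    show "V = W \<or> V \<in> low" if V: "V \<in> low \<union> mid" and W: "W \<in> low \<union> mid" and s: "snd (?cell V) \<subseteq> snd (?cell W)" for V W
    proof (cases "V = W")
      case False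
      have VW: "V \<in> VS" "W \<in> VS" "card W \<le> Suc n" using V W by (auto simp: low_def mid_def)
      then have "V \<subseteq> W" using s hull_subset_iff by simp
      then have "card V < card W" using False finV[OF VW(2)] by (intro psubset_card_mono) auto
      then show ?thesis using VW by (simp add: low_def)
    qed simp
  qed (rule n)
  moreover have "(\<Union>a\<in>low \<union> E. snd (?cell a)) = poly (low \<union> E)" for E by (simp add: poly_def)
  ultimately show ?thesis
    using betti_poly_dual(2) by (simp only: Pow_iff cong: sum.cong) simp
qed

lemma T_poly_dual:
  fixes x y :: "'r::comm_ring_1"
  shows "T_poly n (skeleton n (dual_complex (2 * n) K)) x y =
    (\<Sum>E\<in>Pow mid. x ^ betti n (top_of_set (poly (low \<union> E))) * y ^ betti n (top_of_set (dual_poly (low \<union> E))))"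
proof -
  let ?cell = "\<lambda>V::'a set. (Suc (2 * n) - card V, dcell V)"
  have VS: "high \<union> mid \<subseteq> VS" by (auto simp: high_def mid_def)
  have skel: "skeleton n (dual_complex (2 * n) K) = ?cell ` (high \<union> mid)"
    unfolding dual_complex_eq using n by (auto simp: skeleton_def high_def mid_def)
  have T: "T_poly n (?cell ` (high \<union> mid)) x y =
    (\<Sum>E\<in>Pow mid. x ^ (betti (n - 1) (top_of_set (\<Union>a\<in>high \<union> E. snd (?cell a))) - betti (n - 1) (top_of_set (\<Union>a\<in>high \<union> mid. snd (?cell a)))) *
      y ^ betti n (top_of_set (\<Union>a\<in>high \<union> E. snd (?cell a))))"
  proof (rule T_poly_eq_sum)
    show "inj_on ?cell (high \<union> mid)"
    proof (rule inj_onI)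
      fix V W assume "V \<in> high \<union> mid" "W \<in> high \<union> mid" "?cell V = ?cell W"
      then show "V = W" using dcell_subset_iff[of V W] dcell_subset_iff[of W V] VS by auto
    qed
    show "high \<inter> mid = {}" by (auto simp: high_def mid_def)
    show "fst (?cell V) < n" if "V \<in> high" for V using that n by (auto simp: high_def)
    show "fst (?cell V) = n" if "V \<in> mid" for V using that by (auto simp: mid_def)
    show "V = W \<or> V \<in> high" if V: "V \<in> high \<union> mid" and W: "W \<in> high \<union> mid" and s: "snd (?cell V) \<subseteq> snd (?cell W)" for V W
    proof (cases "V = W")
      case False
      have VW: "V \<in> VS" "W \<in> VS" "card W \<ge> Suc n" using V W by (auto simp: high_def mid_def)
      then have "W \<subseteq> V" using s dcell_subset_iff by simp
      then have "card W < card V" using False finV[OF VW(1)] by (intro psubset_card_mono) auto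
      then show ?thesis using VW by (simp add: high_def)
    qed simp
  qed (rule n)
  \<comment> \<open>Choosing the dual cells of \<open>E\<close> leaves the complementary set of
    \<open>n\<close>-simplices on the primal side.\<close>
  have un: "(\<Union>a\<in>high \<union> E. snd (?cell a)) = dual_poly (low \<union> (mid - E))" if "E \<subseteq> mid" for E
  proof -
    have "VS = low \<union> mid \<union> high" "low \<inter> mid = {}" "low \<inter> high = {}" "mid \<inter> high = {}"
      by (auto simp: low_def mid_def high_def)
    then have "VS - (low \<union> (mid - E)) = high \<union> E" using that by blast
    then show ?thesis using dual_poly_eq_Union[OF down_closed_low, of "mid - E"] by simp
  qed
  have "T_poly n (skeleton n (dual_complex (2 * n) K)) x y =
      (\<Sum>E\<in>Pow mid. x ^ betti n (top_of_set (poly (low \<union> (mid - E)))) * y ^ betti n (top_of_set (dual_poly (low \<union> (mid - E)))))"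
    unfolding skel T
  proof (rule sum.cong[OF refl])
    fix E assume "E \<in> Pow mid"
    then have E: "E \<subseteq> mid" by simp
    have m: "(\<Union>a\<in>high \<union> mid. snd (?cell a)) = dual_poly low" using un[of mid] by simp
    have "mid - E \<subseteq> mid" by blast
    from betti_poly_dual(1)[OF this] show
      "x ^ (betti (n - 1) (top_of_set (\<Union>a\<in>high \<union> E. snd (?cell a))) - betti (n - 1) (top_of_set (\<Union>a\<in>high \<union> mid. snd (?cell a)))) *
        y ^ betti n (top_of_set (\<Union>a\<in>high \<union> E. snd (?cell a))) =
      x ^ betti n (top_of_set (poly (low \<union> (mid - E)))) * y ^ betti n (top_of_set (dual_poly (low \<union> (mid - E))))"
      unfolding un[OF E] m by simp
  qed
  \<comment> \<open>Complementation permutes the subsets of \<open>mid\<close>.\<close>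
  also have "\<dots> = (\<Sum>E\<in>Pow mid. x ^ betti n (top_of_set (poly (low \<union> E))) * y ^ betti n (top_of_set (dual_poly (low \<union> E))))"
    by (rule sum.reindex_bij_witness[of _ "\<lambda>E. mid - E" "\<lambda>E. mid - E"]) (auto simp: double_diff)
  finally show ?thesis .
qed

end

theorem theorem1:
  fixes n :: nat and K :: "'a::euclidean_space set set" and X Y :: "'r::comm_ring_1"
  assumes "n \<ge> 1"
    and "triangulates K (nsphere (2 * n))"
  shows "T_poly n (skeleton n (simplicial_cells K)) X Y =
         T_poly n (skeleton n (dual_complex (2 * n) K)) Y X"
proof -
  interpret sphere_triangulation K n using assms by unfold_locales
  show ?thesis unfolding T_poly_primal T_poly_dual by (simp add: mult.commute)
qed

end
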